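(* Let $\Omega$ be a polyhedral domain where the inner angle is strictly less than $2\pi$, and let $f\in L^{p'}(\Omega)$ with $\frac1p+\frac1{p'}=1$. Then there is a constant $C>0$, independent of $\varepsilon$, such that for every $\varepsilon=[\varepsilon_-,\varepsilon_+]$ with $0<\varepsilon_-\le\varepsilon_+<\infty$ $$\mathcal J_\varepsilon(u_\varepsilon)-\mathcal J(u)\le C\Big(\varepsilon_-^p+\varepsilon_+^{-\frac p{d-1}}\Big).$$
   Context: Standing setting: $\Omega\subset\mathbb R^d$ is open and bounded, $1<p<2$, $f\in (W_0^{1,p}(\Omega))^*$. The energy is $\mathcal J(v):=\frac1p\int_\Omega|\nabla v|^p\,dx-\langle f,v\rangle$ on $W_0^{1,p}(\Omega)$ and $u$ is its unique minimizer. For $\varepsilon=[\varepsilon_-,\varepsilon_+]$ with $0<\varepsilon_-\le\varepsilon_+<\infty$ define $$\kappa_\varepsilon(t):=\begin{cases}\frac12\varepsilon_-^{p-2}t^2+(\frac1p-\frac12)\varepsilon_-^p & t\le\varepsilon_-,\\ \frac1p t^p & \varepsilon_-\le t\le\varepsilon_+,\\ \frac12\varepsilon_+^{p-2}t^2+(\frac1p-\frac12)\varepsilon_+^p & t\ge\varepsilon_+,\end{cases}$$ and $\mathcal J_\varepsilon(v):=\int_\Omega\kappa_\varepsilon(|\nabla v|)\,dx-\langle f,v\rangle$, as a functional $W_0^{1,p}(\Omega)\to\mathbb R\cup\{\infty\}$ (finite exactly on $W_0^{1,2}(\Omega)$); $u_\varepsilon$ is its unique minimizer. (Under the stated hypotheses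 it is known, from a regularity result of Ebmeyer type combined with an embedding of Nikolskii spaces, that $\nabla u$ lies in the weak Lebesgue space $L^{\frac{pd}{d-1},\infty}(\Omega)$.) *)

theory Defs
  imports "HOL-Analysis.Analysis"
begin

section \<open>Lebesgue and Sobolev spaces on an open set\<close>

text \<open>Functions stand for their classes modulo null sets; only the values on \<open>\<Omega>\<close> matter.\<close>

definition Lp_space :: "real \<Rightarrow> 'a::euclidean_space set \<Rightarrow> ('a \<Rightarrow> 'b::euclidean_space) set" where
  "Lp_space p \<Omega> = {u. u \<in> borel_measurable (lebesgue_on \<Omega>) \<and>
                      integrable (lebesgue_on \<Omega>) (\<lambda>x. norm (u x) powr p)}"

definition locally_integrable_on :: "'a::euclidean_space set \<Rightarrow> ('a \<Rightarrow> 'b::euclidean_space) \<Rightarrow> bool" where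
  "locally_integrable_on \<Omega> u \<longleftrightarrow> (\<forall>K. compact K \<longrightarrow> K \<subseteq> \<Omega> \<longrightarrow> integrable (lebesgue_on K) u)"

primrec C_k :: "nat \<Rightarrow> ('a::euclidean_space \<Rightarrow> real) \<Rightarrow> bool" where
  "C_k 0 \<phi> \<longleftrightarrow> continuous_on UNIV \<phi>"
| "C_k (Suc k) \<phi> \<longleftrightarrow> \<phi> differentiable_on UNIV \<and>
     (\<forall>b\<in>Basis. C_k k (\<lambda>x. frechet_derivative \<phi> (at x) b))"

definition test_functions :: "'a::euclidean_space set \<Rightarrow> ('a \<Rightarrow> real) set" where
  "test_functions \<Omega> = {\<phi>. (\<forall>k. C_k k \<phi>) \<and>
     (\<exists>K. compact K \<and> K \<subseteq> \<Omega> \<and> (\<forall>x. x \<notin> K \<longrightarrow> \<phi> x = 0))}"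

definition is_weak_gradient ::
  "'a::euclidean_space set \<Rightarrow> ('a \<Rightarrow> real) \<Rightarrow> ('a \<Rightarrow> 'a) \<Rightarrow> bool" where
  "is_weak_gradient \<Omega> u G \<longleftrightarrow> locally_integrable_on \<Omega> u \<and> locally_integrable_on \<Omega> G \<and>
     (\<forall>\<phi>\<in>test_functions \<Omega>. \<forall>b\<in>Basis.
        (LINT x|lebesgue_on \<Omega>. u x * frechet_derivative \<phi> (at x) b) =
        - (LINT x|lebesgue_on \<Omega>. (G x \<bullet> b) * \<phi> x))"

text \<open>A weak gradient is unique up to a null subset of \<open>\<Omega>\<close>, so every quantity below is
  independent of the choice.\<close>

definition weak_gradient :: "'a::euclidean_space set \<Rightarrow> ('a \<Rightarrow> real) \<Rightarrow> 'a \<Rightarrow> 'a" where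
  "weak_gradient \<Omega> u = (SOME G. is_weak_gradient \<Omega> u G)"

definition W1p :: "real \<Rightarrow> 'a::euclidean_space set \<Rightarrow> ('a \<Rightarrow> real) set" where
  "W1p p \<Omega> = {u. u \<in> Lp_space p \<Omega> \<and> (\<exists>G. is_weak_gradient \<Omega> u G) \<and>
                 weak_gradient \<Omega> u \<in> Lp_space p \<Omega>}"

definition W1p_norm :: "real \<Rightarrow> 'a::euclidean_space set \<Rightarrow> ('a \<Rightarrow> real) \<Rightarrow> real" where
  "W1p_norm p \<Omega> u =
     ((LINT x|lebesgue_on \<Omega>. \<bar>u x\<bar> powr p) +
      (LINT x|lebesgue_on \<Omega>. norm (weak_gradient \<Omega> u x) powr p)) powr (1 / p)"

definition W1p_0 :: "real \<Rightarrow> 'a::euclidean_space set \<Rightarrow> ('a \<Rightarrow> real) set" where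
  "W1p_0 p \<Omega> = {u \<in> W1p p \<Omega>. \<exists>\<phi>. (\<forall>n. \<phi> n \<in> test_functions \<Omega>) \<and>
     (\<lambda>n::nat. W1p_norm p \<Omega> (\<lambda>x. u x - \<phi> n x)) \<longlonglongrightarrow> 0}"


section \<open>The energy and the relaxed energy\<close>

definition pairing :: "'a::euclidean_space set \<Rightarrow> ('a \<Rightarrow> real) \<Rightarrow> ('a \<Rightarrow> real) \<Rightarrow> real" where
  "pairing \<Omega> f v = (LINT x|lebesgue_on \<Omega>. f x * v x)"

definition energy ::
  "real \<Rightarrow> 'a::euclidean_space set \<Rightarrow> ('a \<Rightarrow> real) \<Rightarrow> ('a \<Rightarrow> real) \<Rightarrow> real" where
  "energy p \<Omega> f v =
     1 / p * (LINT x|lebesgue_on \<Omega>. norm (weak_gradient \<Omega> v x) powr p) - pairing \<Omega> f v"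

definition kappa :: "real \<Rightarrow> real \<Rightarrow> real \<Rightarrow> real \<Rightarrow> real" where
  "kappa p em ep t =
     (if t \<le> em then 1 / 2 * em powr (p - 2) * t\<^sup>2 + (1 / p - 1 / 2) * em powr p
      else if t \<le> ep then 1 / p * t powr p
      else 1 / 2 * ep powr (p - 2) * t\<^sup>2 + (1 / p - 1 / 2) * ep powr p)"

text \<open>For \<open>0 < p \<le> 2\<close> the integrand is nonnegative, so its integral is a well-defined
  element of \<open>[0, \<infinity>]\<close>.\<close>

definition relaxed_energy ::
  "real \<Rightarrow> 'a::euclidean_space set \<Rightarrow> ('a \<Rightarrow> real) \<Rightarrow> real \<Rightarrow> real \<Rightarrow> ('a \<Rightarrow> real) \<Rightarrow> ereal" where
  "relaxed_energy p \<Omega> f em ep v =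
     enn2ereal (\<integral>\<^sup>+ x. ennreal (kappa p em ep (norm (weak_gradient \<Omega> v x))) \<partial>lebesgue_on \<Omega>)
     - ereal (pairing \<Omega> f v)"

definition is_minimizer_on :: "'v set \<Rightarrow> ('v \<Rightarrow> 'r::linorder) \<Rightarrow> 'v \<Rightarrow> bool" where
  "is_minimizer_on V F u \<longleftrightarrow> u \<in> V \<and> (\<forall>v\<in>V. F u \<le> F v)"


section \<open>Polyhedral domains and inner angles\<close>

definition polyhedral_domain :: "'a::euclidean_space set \<Rightarrow> bool" where
  "polyhedral_domain \<Omega> \<longleftrightarrow> open \<Omega> \<and> bounded \<Omega> \<and>
     (\<exists>\<F>. finite \<F> \<and> (\<forall>P\<in>\<F>. polytope P \<and> aff_dim P = int DIM('a) - 1) \<and>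
          frontier \<Omega> = \<Union>\<F>)"

text \<open>The open dihedron of opening \<open>\<theta>\<close> whose edge is the affine subspace of codimension two
  through \<open>x\<close> orthogonal to \<open>e\<close> and \<open>e'\<close> (in the plane: the sector with vertex \<open>x\<close>).\<close>

definition dihedron :: "'a::euclidean_space \<Rightarrow> 'a \<Rightarrow> 'a \<Rightarrow> real \<Rightarrow> 'a set" where
  "dihedron x e e' \<theta> = {y. \<exists>\<rho> \<phi>. 0 < \<rho> \<and> 0 < \<phi> \<and> \<phi> < \<theta> \<and>
     (y - x) \<bullet> e = \<rho> * cos \<phi> \<and> (y - x) \<bullet> e' = \<rho> * sin \<phi>}"

text \<open>\<open>\<theta>\<close> is the angle between two faces meeting in an edge through \<open>x\<close>, measured inside
  \<open>\<Omega>\<close>. Passing to connected components covers the case that several wedges of \<open>\<Omega>\<close> meet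
  along the same edge. The value \<open>2 * pi\<close> occurs at the tip of a crack; a point in the relative
  interior of a face has the angle \<open>pi\<close>. Any such \<open>x\<close> lies in the frontier of \<open>\<Omega>\<close>.\<close>

definition inner_angle_at :: "'a::euclidean_space set \<Rightarrow> 'a \<Rightarrow> real \<Rightarrow> bool" where
  "inner_angle_at \<Omega> x \<theta> \<longleftrightarrow> 0 < \<theta> \<and> \<theta> \<le> 2 * pi \<and>
     (\<exists>e e' r. norm e = 1 \<and> norm e' = 1 \<and> e \<bullet> e' = 0 \<and> 0 < r \<and>
        dihedron x e e' \<theta> \<inter> ball x r \<in> components (\<Omega> \<inter> ball x r))"

end

(* Let J be the energy and m its minimum.  It suffices to find, for 0 < h <= 1, a test function w with
J(w) <= m + C h and |grad w|^p <= C h^(1 - d): for h proportional to ep^(-p/(d - 1)) the gradient of w stays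
below ep, where kappa(t) exceeds t^p/p by at most (1/p - 1/2) em^p.

Such w is obtained by deforming smooth near minimisers v along vector fields of size t >= h, without any
regularity theory.  A polyhedral domain is determined by the signs of finitely many affine functions.
Stretching away from a flat of codimension at least 3 of this hyperplane arrangement lowers the energy, which
bounds the integral of |grad v|^p / dist.  Near the other flats the domain is a union of pieces that are
invariant under translation by an open cone of directions; this uses that no inner angle is 2 pi, the
exceptional planar cones being the punctured plane and the plane cut along a ray.  Comparing v with its
translates on a piece by strict convexity, and averaging over the directions, bounds the energy of v on a ball
of radius s >= h by C s.  Finally v is cut off near the flats of codimension at least 3 (at a cost O(h), by a
Hardy inequality), its support is pushed into the domain, and it is mollified at scale h. *)
theory Submission
 imports Defs
begin

text \<open>The obstacle: a deformation of size t must be localised near a flat, and its cut-off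
  varies on the scale of the distance to the deeper flats, so it changes the energy by up to t times
  the integral of |grad v|^p / dist, for which no bound is at hand. Hence the downward induction on
  the codimension: the cut-off used at one codimension only involves the weights of the deeper
  flats. There p < 2 enters: the Jacobian of a stretch gains at least two powers of its factor, the
  gradient loses p. Near minimisers replace the minimiser: with energy at most m + C h, testing with
  deformations of size t >= h gives the usual estimates up to O(t), and changes of variables are
  elementary for C1 functions with compact support. A deformed near minimiser is a near minimiser
  with a larger constant, so all constants are uniform in the function and the constructions can be
  composed. The exponent d - 1 arises because an energy of at most C h on balls of radius h makes a
  mollification w at scale h satisfy |grad w|^p <= C h / h^d.\<close>

notation scaleR (infixr "*R" 75)

abbreviation Epow :: "real => ('a::euclidean_space => 'b::euclidean_space) => real" where
  "Epow p g == (LBINT x. norm (g x) powr p)"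

abbreviation locE :: "real => ('a::euclidean_space => 'a) => 'a set => real" where
  "locE p g S == (LBINT y. indicator S y * norm (g y) powr p)"

section \<open>Change of variables in Euclidean spaces\<close>

text \<open>The library states the change of variables for \<open>real ^ 'n\<close> with a well-ordered index type.\<close>

typedef (overloaded) 'a bidx = "Basis :: 'a::euclidean_space set" using nonempty_Basis by blast

instance bidx :: (euclidean_space) finite
proof
 have "(UNIV :: 'a bidx set) = Abs_bidx ` Basis" using type_definition.Abs_image[OF type_definition_bidx] by auto
 then show "finite (UNIV :: 'a bidx set)" by (metis finite_Basis finite_imageI)
qed

definition bidx_nat :: "'a::euclidean_space bidx => nat" where "bidx_nat = (SOME f. inj f)"

lemma inj_bidx_nat: "inj (bidx_nat :: 'a::euclidean_space bidx => nat)"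
proof -
 have "EX f :: 'a bidx => nat. inj f" using finite_imp_inj_to_nat_seg[OF finite[of "UNIV :: 'a bidx set"]] by blast
 then show ?thesis unfolding bidx_nat_def by (rule someI_ex)
qed

instantiation bidx :: (euclidean_space) wellorder
begin

definition less_eq_bidx :: "'a bidx => 'a bidx => bool" where "less_eq_bidx x y \<longleftrightarrow> bidx_nat x <= bidx_nat y"

definition less_bidx :: "'a bidx => 'a bidx => bool" where "less_bidx x y \<longleftrightarrow> bidx_nat x < bidx_nat y"

instance
proof
 fix P :: "'a bidx => bool" and a
 assume *: "!!x. (!!y. y < x ==> P y) ==> P x"
 show "P a" by (induction "bidx_nat a" arbitrary: a rule: less_induct) (metis * less_bidx_def)
qed (auto simp: less_eq_bidx_def less_bidx_def dest: injD[OF inj_bidx_nat])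
end

definition to_cart :: "'a::euclidean_space => real ^ 'a bidx" where "to_cart x = (\<chi> i. x \<bullet> Rep_bidx i)"

definition of_cart :: "real ^ 'a bidx => 'a::euclidean_space" where "of_cart v = (SUM i:UNIV. v $ i *R Rep_bidx i)"

lemma sum_bidx: "(SUM i:UNIV. F (Rep_bidx i)) = (SUM b:Basis. F b)"
 for F :: "'a::euclidean_space => 'b::comm_monoid_add" by (rule sum.reindex_bij_witness[where i=Abs_bidx and j=Rep_bidx])
   (auto simp: Rep_bidx Rep_bidx_inverse Abs_bidx_inverse)

lemma prod_bidx: "(PROD i:UNIV. F (Rep_bidx i)) = (PROD b:Basis. F b)"
 for F :: "'a::euclidean_space => 'b::comm_monoid_mult" by (rule prod.reindex_bij_witness[where i=Abs_bidx and j=Rep_bidx])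
   (auto simp: Rep_bidx Rep_bidx_inverse Abs_bidx_inverse)

lemma of_cart_to_cart [simp]: "of_cart (to_cart x) = x"
 unfolding of_cart_def to_cart_def by (simp add: sum_bidx[of "%b. (x \<bullet> b) *R b"] euclidean_representation)

lemma to_cart_of_cart [simp]: "to_cart (of_cart v) = v"
proof -
 have "of_cart v \<bullet> Rep_bidx i = v $ i" for i unfolding of_cart_def inner_sum_left by (subst sum.remove[of _ i])
    (auto simp: Rep_bidx inner_Basis Rep_bidx_inject intro!: sum.neutral)
 then show ?thesis by (simp add: to_cart_def vec_eq_iff)
qed

lemma linear_to_cart: "linear to_cart"
 by (rule linearI) (auto simp: to_cart_def vec_eq_iff inner_left_distrib)

lemma linear_of_cart: "linear of_cart"
 by (rule linearI) (auto simp: of_cart_def scaleR_left_distrib sum.distrib scaleR_sum_right)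

lemma bounded_linear_to_cart: "bounded_linear to_cart"
 using linear_to_cart linear_conv_bounded_linear by blast

lemma bounded_linear_of_cart: "bounded_linear of_cart"
 using linear_of_cart linear_conv_bounded_linear by blast

lemma measurable_of_cart [measurable]: "of_cart : borel_measurable borel"
 by (intro borel_measurable_continuous_onI linear_continuous_on bounded_linear_of_cart)

text \<open>A box is pulled back to a box with the same side lengths, and Lebesgue measure is
  determined by its values on boxes. So integrals carry over between the two spaces without a
  constant.\<close>

lemma lborel_of_cart: "distr lborel borel of_cart = (lborel :: 'a::euclidean_space measure)"
proof (rule lborel_eqI[symmetric])
 fix l u :: 'a
 assume lu: "!!b. b : Basis ==> l \<bullet> b <= u \<bullet> b"
 have 1: "of_cart -` box l u = box (to_cart l) (to_cart u)"
 proof -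
  have "of_cart v : box l u \<longleftrightarrow> v : box (to_cart l) (to_cart u)" for v
  proof -
   have "of_cart v : box l u \<longleftrightarrow>
     (ALL i. l \<bullet> Rep_bidx i < of_cart v \<bullet> Rep_bidx i & of_cart v \<bullet> Rep_bidx i < u \<bullet> Rep_bidx i)"
    unfolding mem_box by (metis Rep_bidx Abs_bidx_inverse)
   moreover have "of_cart v \<bullet> Rep_bidx i = v $ i" for i using to_cart_of_cart[of v] by (metis to_cart_def vec_lambda_beta)
   ultimately show ?thesis by (auto simp: mem_box_cart to_cart_def)
  qed
  then show ?thesis by auto
 qed
 have 2: "(PROD b:Basis. (to_cart u - to_cart l) \<bullet> b) = (PROD b:Basis. (u - l) \<bullet> b)"
 proof -
  have "(PROD b:Basis. (to_cart u - to_cart l) \<bullet> b) = (PROD i:UNIV. (to_cart u - to_cart l) $ i)"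
   by (rule prod.reindex_bij_witness[where i="%i. axis i 1" and j="%b. SOME i. b = axis i 1"])
     (auto simp: Basis_vec_def cart_eq_inner_axis axis_eq_axis)
  also have "... = (PROD i:UNIV. (u - l) \<bullet> Rep_bidx i)" by (simp add: to_cart_def inner_diff_left)
  finally show ?thesis using prod_bidx[of "%b. (u - l) \<bullet> b"] by simp
 qed
 have "ALL b:Basis. to_cart l \<bullet> b <= to_cart u \<bullet> b"
  using lu by (auto simp: Basis_vec_def to_cart_def cart_eq_inner_axis[symmetric] Rep_bidx)
 then have "emeasure lborel (box (to_cart l) (to_cart u)) = (PROD b:Basis. (to_cart u - to_cart l) \<bullet> b)"
  by (subst emeasure_lborel_box) auto
 then show "emeasure (distr lborel borel of_cart) (box l u) = ennreal (PROD b:Basis. (u - l) \<bullet> b)"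
  by (subst emeasure_distr) (auto simp: 1 2)
qed simp

lemma integrable_of_cart:
 fixes G :: "'a::euclidean_space => real"
 assumes "G : borel_measurable borel"
 shows "integrable lborel G \<longleftrightarrow> integrable lborel (%v. G (of_cart v))" using integrable_distr_eq[of of_cart lborel borel G] assms
 by (simp add: lborel_of_cart)

lemma integral_of_cart:
 fixes G :: "'a::euclidean_space => real"
 assumes "G : borel_measurable borel"
 shows "(LBINT x. G x) = (LBINT v. G (of_cart v))" using integral_distr[of of_cart lborel borel G] assms by (simp add: lborel_of_cart)

text \<open>The determinant of an endomorphism, taken in the coordinates \<open>to_cart\<close>, so
  that \<open>det_mul\<close> and the change of variables for matrices apply to it.\<close>

definition ldet :: "('a::euclidean_space => 'a) => real" where "ldet L = det (matrix (%v. to_cart (L (of_cart v))))"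

lemma ldet_compose:
 assumes "linear L" "linear M"
 shows "ldet (%x. L (M x)) = ldet L * ldet M"
proof -
 have l: "linear (%v. to_cart (K (of_cart v)))" if "linear K" for K :: "'a => 'a"
  using that linear_compose[OF linear_compose[OF linear_of_cart that] linear_to_cart] by (simp add: o_def)
 have "matrix ((%v. to_cart (L (of_cart v))) \<circ> (%v. to_cart (M (of_cart v)))) =
    matrix (%v. to_cart (L (of_cart v))) ** matrix (%v. to_cart (M (of_cart v)))" by (rule matrix_compose) (use l assms in auto)
 then show ?thesis by (simp add: ldet_def det_mul o_def)
qed

text \<open>The matrix determinant lemma. With w_k nonzero, let M be the identity with row k
  replaced by w, and N the identity with column k replaced by e_k + M u. Then M (1 + u w^T) = N M,
  and Cramer's rule gives det M = w_k and det N = 1 + w . u.\<close>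

lemma det_rank_one: "det (mat 1 + (\<chi> i j. u $ i * w $ j) :: real^'n^'n) = 1 + u \<bullet> w"
proof (cases "w = 0")
 case True
 then have "(mat 1 + (\<chi> i j. u $ i * w $ j) :: real^'n^'n) = mat 1" by (simp add: vec_eq_iff)
 then show ?thesis using True by simp
next
 case False
 then obtain k where k: "w $ k ~= 0" by (auto simp: vec_eq_iff)
 define M :: "real^'n^'n" where "M = (\<chi> i. if i = k then w else row i (mat 1))"
 have detM: "det M = w $ k"
 proof -
  have *: "(SUM i:UNIV. w $ i *s row i (mat 1 :: real^'n^'n)) = w" by (auto simp: vec_eq_iff row_def mat_def sum.delta if_distrib cong: if_cong)
  show ?thesis using cramer_lemma_transpose[of k w "mat 1 :: real^'n^'n"] by (simp only: * M_def) simp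
 qed
 define z where "z = M *v u"
 define N :: "real^'n^'n" where "N = (\<chi> i j. if j = k then (mat 1 *v (axis k 1 + z)) $ i else (mat 1 :: real^'n^'n) $ i $ j)"
 have detN: "det N = 1 + z $ k" unfolding N_def by (subst cramer_lemma) simp
 have Mz: "z $ k = w \<bullet> u" by (simp add: z_def M_def matrix_vector_mult_def inner_vec_def)
 have N_eq: "N $ i $ l = (if i = l then 1 else 0) + z $ i * (if l = k then 1 else 0)" for i l
 proof -
  have "(mat 1 :: real^'n^'n) *v (axis k 1 + z) = axis k 1 + z" by simp
  then show ?thesis by (auto simp: N_def mat_def axis_def)
 qed
 have "M ** (mat 1 + (\<chi> i j. u $ i * w $ j)) = N ** M"
 proof -
  have "(M ** (mat 1 + (\<chi> i j. u $ i * w $ j))) $ i $ j = M $ i $ j + z $ i * w $ j" for i j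
  proof -
   have "(M ** (mat 1 + (\<chi> i j. u $ i * w $ j))) $ i $ j = (SUM l:UNIV. M $ i $ l * ((if l = j then 1 else 0) + u $ l * w $ j))"
    by (simp add: matrix_matrix_mult_def mat_def)
   also have "... = (SUM l:UNIV. (if l = j then M $ i $ l else 0) + M $ i $ l * u $ l * w $ j)" by (rule sum.cong) (auto simp: algebra_simps)
   also have "... = M $ i $ j + (SUM l:UNIV. M $ i $ l * u $ l) * w $ j" by (simp add: sum.distrib sum_distrib_right)
   finally show ?thesis by (simp add: z_def matrix_vector_mult_def)
  qed
  moreover have "(N ** M) $ i $ j = M $ i $ j + z $ i * w $ j" for i j
  proof -
   have "(N ** M) $ i $ j = (SUM l:UNIV. ((if i = l then 1 else 0) + z $ i * (if l = k then 1 else 0)) * M $ l $ j)"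
    by (simp add: matrix_matrix_mult_def N_eq)
   also have "... = (SUM l:UNIV. (if i = l then M $ l $ j else 0) + (if l = k then z $ i * M $ l $ j else 0))"
    by (rule sum.cong) (auto simp: algebra_simps)
   also have "... = M $ i $ j + z $ i * M $ k $ j" by (simp add: sum.distrib)
   finally show ?thesis by (simp add: M_def)
  qed
  ultimately show ?thesis by (simp add: vec_eq_iff)
 qed
 then have "det M * det (mat 1 + (\<chi> i j. u $ i * w $ j) :: real^'n^'n) = det N * det M" by (metis det_mul)
 then show ?thesis using k detM detN Mz by (simp add: inner_commute)
qed

lemma inner_to_cart: "to_cart x \<bullet> to_cart y = x \<bullet> y"
 unfolding inner_vec_def to_cart_def using sum_bidx[of "%b. (x \<bullet> b) * (y \<bullet> b)"] by (simp add: euclidean_inner[of x y])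

lemma ldet_rank_one: "ldet (%h. h + (w \<bullet> h) *R u) = 1 + u \<bullet> w"
proof -
 have "matrix (%v. to_cart (of_cart v + (w \<bullet> of_cart v) *R u)) =
    mat 1 + (\<chi> i j. to_cart u $ i * to_cart w $ j)"
 proof -
  have "w \<bullet> of_cart (axis j 1) = to_cart w $ j" for j using inner_to_cart[of w "of_cart (axis j 1)"] by (simp add: inner_axis)
  then show ?thesis by (simp add: vec_eq_iff matrix_def linear_add[OF linear_to_cart] linear_scale[OF linear_to_cart]) (auto simp: mat_def axis_def)
 qed
 then show ?thesis by (simp add: ldet_def det_rank_one inner_to_cart)
qed

text \<open>An inequality, because \<Phi> may fail to be onto: its image is open by invariance of
  domain, and leaving out the rest of the space can only decrease the integral of the nonnegative G.
  The detour through \<open>real ^ 1\<close> matches the vector-valued form of the change of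
  variables.\<close>

lemma change_of_variables_le:
 fixes G :: "'a::euclidean_space => real"
 assumes der: "!!x. (\<Phi> has_derivative D x) (at x)"
  and inj: "inj \<Phi>"
  and meas: "(%x. ldet (D x)) : borel_measurable borel"
  and G: "integrable lborel G" "!!x. 0 <= G x"
 shows "integrable lborel (%x. abs (ldet (D x)) * G (\<Phi> x))"
  and "(LBINT x. abs (ldet (D x)) * G (\<Phi> x)) <= (LBINT x. G x)"
proof -
 have cont: "continuous_on UNIV \<Phi>" using der has_derivative_continuous_on by (metis has_derivative_at_withinI)
 have Gm [measurable]: "G : borel_measurable borel" using G(1) by auto
 have \<Phi>m [measurable]: "\<Phi> : borel_measurable borel" by (rule borel_measurable_continuous_onI[OF cont])
 note meas [measurable]
 define g where "g v = to_cart (\<Phi> (of_cart v))" for v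
 define g' where "g' v h = to_cart (D (of_cart v) (of_cart h))" for v h
 define H where "H v = G (of_cart v)" for v
 define f :: "real ^ 'a bidx => real ^ 1" where "f v = vec (H v)" for v
 have H: "integrable lborel H" "!!v. 0 <= H v" using G integrable_of_cart[of G] by (auto simp: H_def[abs_def])
 have Hm [measurable]: "H : borel_measurable borel" using H by auto
 have Habs: "H absolutely_integrable_on UNIV" using H(1) by (simp add: set_integrable_def integrable_completion)
 have der_g: "(g has_derivative g' v) (at v)" for v
 proof -
  have "((%v. to_cart (\<Phi> (of_cart v))) has_derivative (%h. to_cart (D (of_cart v) (of_cart h)))) (at v)"
   by (rule bounded_linear.has_derivative[OF bounded_linear_to_cart])
     (rule has_derivative_compose[OF bounded_linear.has_derivative[OF bounded_linear_of_cart has_derivative_ident] der])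
  then show ?thesis by (simp add: g_def[abs_def] g'_def[abs_def])
 qed
 have inj_g: "inj_on g UNIV" using inj by (auto simp: g_def inj_on_def) (metis injD of_cart_to_cart to_cart_of_cart)
 have cont_g: "continuous_on UNIV g" using der_g has_derivative_continuous_on by (metis has_derivative_at_withinI)
 have open_range: "open (range g)" by (rule invariance_of_domain[OF cont_g open_UNIV inj_g])
 have Hr: "H absolutely_integrable_on (range g)" by (rule set_integrable_subset[OF Habs]) (use open_range in auto)
 then have fr: "f absolutely_integrable_on (range g)" by (simp add: absolutely_integrable_on_1_iff f_def)
 have *: "(%x. abs (det (matrix (g' x))) *R f (g x)) absolutely_integrable_on UNIV"
     "integral UNIV (%x. abs (det (matrix (g' x))) *R f (g x)) = integral (range g) f"
  using has_absolute_integral_change_of_variables[of UNIV g g' f "integral (range g) f"]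
   fr der_g inj_g by (auto intro: has_derivative_at_withinI)
 define F where "F x = abs (ldet (D x)) * G (\<Phi> x)" for x
 have Fm [measurable]: "F : borel_measurable borel" unfolding F_def[abs_def] by measurable
 have comp: "(abs (det (matrix (g' v))) *R f (g v)) $ 1 = F (of_cart v)" for v by (simp add: F_def f_def H_def g_def ldet_def g'_def[abs_def])
 have Fabs: "(%v. F (of_cart v)) absolutely_integrable_on UNIV" using *(1) unfolding absolutely_integrable_on_1_iff comp .
 then have "integrable lebesgue (%v. F (of_cart v))" by (simp add: set_integrable_def)
 then have Fint: "integrable lborel (%v. F (of_cart v))" by (subst (asm) integrable_completion) measurable
 then have "integrable lborel F" using integrable_of_cart[of F] by simp
 then show "integrable lborel (%x. abs (ldet (D x)) * G (\<Phi> x))" by (simp add: F_def[abs_def])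
 have "(LBINT x. F x) = (LBINT v. F (of_cart v))" by (rule integral_of_cart) measurable
 also have "... = integral UNIV (%v. F (of_cart v))" by (rule integral_lborel[symmetric, OF Fint])
 also have "... = integral UNIV (%x. abs (det (matrix (g' x))) *R f (g x)) $ 1" by (subst integral_on_1_eq) (simp add: comp[symmetric])
 also have "... = integral (range g) H" unfolding *(2) by (subst integral_on_1_eq) (simp add: f_def)
 also have "... <= integral UNIV H" by (rule integral_subset_le) (use Hr Habs H(2) in "auto simp: absolutely_integrable_on_def")
 also have "... = (LBINT v. H v)" by (rule integral_lborel[OF H(1)])
 also have "... = (LBINT x. G x)" unfolding H_def by (rule integral_of_cart[symmetric]) measurable
 finally show "(LBINT x. abs (ldet (D x)) * G (\<Phi> x)) <= (LBINT x. G x)" by (simp add: F_def[abs_def])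
qed

section \<open>Orthonormal systems and determinants\<close>

definition orthonormal :: "'a::euclidean_space set => bool" where
 "orthonormal B \<longleftrightarrow> finite B & (ALL b:B. norm b = 1) & pairwise orthogonal B"

definition proj :: "'a::euclidean_space set => 'a => 'a" where "proj B x = (SUM b:B. (x \<bullet> b) *R b)"

lemma linear_proj: "linear (proj B)"
 by (rule linearI) (auto simp: proj_def inner_left_distrib scaleR_left_distrib sum.distrib scaleR_sum_right)

lemma bounded_linear_proj: "bounded_linear (proj B)"
 using linear_proj linear_conv_bounded_linear by blast

lemma proj_zero [simp]: "proj B 0 = 0"
 by (simp add: proj_def)

lemma proj_empty [simp]: "proj {} x = 0"
 by (simp add: proj_def)

lemma proj_add: "proj B (x + y) = proj B x + proj B y"
 and proj_diff: "proj B (x - y) = proj B x - proj B y"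
 and proj_scaleR: "proj B (c *R x) = c *R proj B x"
 by (simp_all add: linear_add[OF linear_proj] linear_diff[OF linear_proj] linear_scale[OF linear_proj])

lemma inner_proj: "proj B x \<bullet> y = (SUM b:B. (x \<bullet> b) * (y \<bullet> b))"
 unfolding proj_def inner_sum_left by (rule sum.cong) (simp_all add: inner_commute)

lemma inner_proj_commute: "proj B x \<bullet> y = x \<bullet> proj B y"
 by (simp add: inner_proj inner_commute[of x "proj B y"]) (simp add: mult.commute)

lemma orthonormal_inner:
 assumes "orthonormal B" "b : B" "c : B"
 shows "b \<bullet> c = (if b = c then 1 else 0)" using assms by (auto simp: orthonormal_def pairwise_def orthogonal_def norm_eq_1)

lemma proj_basis:
 assumes "orthonormal B" "b : B"
 shows "proj B b = b"
proof -
 have "proj B b = (SUM c:B. (if b = c then c else 0))" unfolding proj_def using assms by (intro sum.cong) (auto simp: orthonormal_inner)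
 then show ?thesis using assms by (simp add: orthonormal_def)
qed

lemma proj_span:
 assumes "orthonormal B" "x : span B"
 shows "proj B x = x" using assms(2) by (induction rule: span_induct_alt) (auto simp: proj_add proj_scaleR proj_basis[OF assms(1)])

lemma proj_in_span: "proj B x : span B"
 unfolding proj_def by (intro span_sum span_scale span_base)

lemma proj_proj [simp]: "orthonormal B ==> proj B (proj B x) = proj B x"
 by (simp add: proj_span proj_in_span)

lemma norm_proj_sq: "orthonormal B ==> (norm (proj B x))^2 = (SUM b:B. (x \<bullet> b)^2)"
 by (metis (no_types, lifting) inner_proj inner_proj_commute power2_eq_square power2_norm_eq_inner
   proj_proj sum.cong)

lemma norm_proj_pythagoras:
 assumes "orthonormal B"
 shows "(norm x)^2 = (norm (proj B x))^2 + (norm (x - proj B x))^2"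
proof -
 have "proj B x \<bullet> (x - proj B x) = 0" using assms by (simp add: inner_proj_commute proj_diff)
 then have "(norm (proj B x + (x - proj B x)))^2 = (norm (proj B x))^2 + (norm (x - proj B x))^2"
  by (intro norm_add_Pythagorean) (simp add: orthogonal_def)
 then show ?thesis by simp
qed

lemma norm_proj_le: "orthonormal B ==> norm (proj B x) <= norm x"
 using norm_proj_pythagoras[of B x] by (intro power2_le_imp_le[OF _ norm_ge_zero]) simp

lemma linear_add_scale: "linear (%h. h + (w \<bullet> h) *R (Y::'a::euclidean_space))"
 by (rule linearI) (auto simp: algebra_simps inner_add_right)

lemma linear_add_proj: "linear (%h. h + beta *R proj B (h::'a::euclidean_space))"
 by (rule linearI) (auto simp: proj_add proj_scaleR algebra_simps)

lemma ldet_proj: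
 assumes "orthonormal B"
 shows "ldet (%h. h + beta *R proj B h) = (1 + beta) ^ card B"
proof -
 have "finite B" using assms by (simp add: orthonormal_def)
 then show ?thesis using assms
 proof (induction B)
  case empty
  show ?case using ldet_rank_one[of 0 0] by simp
 next
  case (insert b B)
  have onB: "orthonormal B" using insert by (auto simp: orthonormal_def pairwise_def)
  have bB: "proj B b = 0" unfolding proj_def using insert.prems insert.hyps by (intro sum.neutral) (auto simp: orthonormal_inner)
  have eq: "(%h. h + beta *R proj (insert b B) h) = (%h. (%h. h + beta *R proj B h) ((%h. h + ((beta *R b) \<bullet> h) *R b) h))"
   using insert.hyps by (auto simp: proj_add proj_scaleR bB proj_def[of "insert b B"] proj_def[of B, symmetric]
     algebra_simps inner_commute)
  have "ldet (%h. h + beta *R proj (insert b B) h) = (1 + beta) ^ card B * (1 + b \<bullet> (beta *R b))" unfolding eq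
   using ldet_compose[of "%h. h + beta *R proj B h" "%h. h + ((beta *R b) \<bullet> h) *R b"]
   by (simp only: insert.IH[OF onB] ldet_rank_one linear_add_scale linear_add_proj)
  moreover have "b \<bullet> b = 1" using insert.prems by (simp add: orthonormal_def norm_eq_1)
  ultimately show ?case using insert.hyps by simp
 qed
qed

text \<open>The map is h + beta P h composed with h + (w . h) Y', where P is the projection and Y'
  the preimage of Y under the outer factor.\<close>

lemma ldet_proj_rank_one:
 assumes "orthonormal B" and Y: "Y' + beta *R proj B Y' = Y"
 shows "ldet (%h. h + beta *R proj B h + (w \<bullet> h) *R Y) = (1 + beta) ^ card B * (1 + w \<bullet> Y')"
proof -
 have eq: "(%h. h + beta *R proj B h + (w \<bullet> h) *R Y) = (%h. (%h. h + beta *R proj B h) ((%h. h + (w \<bullet> h) *R Y') h))"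
  unfolding Y[symmetric] by (auto simp: proj_add proj_scaleR algebra_simps)
 show ?thesis unfolding eq inner_commute[of w Y'] using ldet_compose[of "%h. h + beta *R proj B h" "%h. h + (w \<bullet> h) *R Y'"]
  by (simp only: ldet_proj[OF assms(1)] ldet_rank_one linear_add_scale linear_add_proj)
qed

text \<open>Up to a cut-off term, this is the transposed derivative of a radial stretch. The
  component of k orthogonal to B is unchanged; on the span of B the map is (1 + a) - b Y Y^T, with
  eigenvalues 1 + a and 1 + a - b |Y|^2, and the second hypothesis on b keeps the latter above -(1 +
  a).\<close>

lemma norm_radial_adjoint_le:
 fixes k Y :: "'a::euclidean_space"
 assumes B: "orthonormal B" and Y: "proj B Y = Y" and a: "0 <= a" and b: "0 <= b" "b * (norm Y)^2 <= 2 * (1 + a)"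
 shows "norm (k + a *R proj B k - (b * (Y \<bullet> k)) *R Y) <= (1 + a) * norm k"
proof -
 define k2 where "k2 = proj B k"
 define k1 where "k1 = k - k2"
 define z where "z = (1 + a) *R k2 - (b * (Y \<bullet> k)) *R Y"
 have k1: "proj B k1 = 0" using B by (simp add: k1_def k2_def proj_diff)
 have "k1 \<bullet> z = k1 \<bullet> proj B z" using B Y by (simp add: z_def k2_def proj_diff proj_scaleR)
 then have orth: "k1 \<bullet> z = 0" by (simp add: inner_proj_commute[symmetric] k1)
 have Yk: "Y \<bullet> k = Y \<bullet> k2" by (metis Y inner_proj_commute k2_def)
 have "(norm z)^2 = (1 + a)^2 * (norm k2)^2 - (b * (Y \<bullet> k2)^2) * (2 * (1 + a) - b * (norm Y)^2)" unfolding z_def power2_norm_eq_inner Yk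
  by (simp add: inner_diff_left inner_diff_right inner_commute[of k2 Y] power2_eq_square algebra_simps)
 also have "... <= (1 + a)^2 * (norm k2)^2" using b by simp
 finally have z: "(norm z)^2 <= (1 + a)^2 * (norm k2)^2" .
 have "k + a *R proj B k - (b * (Y \<bullet> k)) *R Y = k1 + z" by (simp add: k1_def z_def k2_def algebra_simps)
 then have "(norm (k + a *R proj B k - (b * (Y \<bullet> k)) *R Y))^2 = (norm k1)^2 + (norm z)^2"
  using orth by (simp add: norm_add_Pythagorean orthogonal_def)
 also have "... <= (1 + a)^2 * (norm k1)^2 + (1 + a)^2 * (norm k2)^2"
  using z a by (intro add_mono mult_right_le_one_le) (auto simp: mult_le_cancel_right1 one_le_power)
 also have "... = ((1 + a) * norm k)^2" using norm_proj_pythagoras[OF B, of k]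
  by (simp only: k1_def k2_def power_mult_distrib) (simp add: distrib_left)
 finally show ?thesis using a by (intro power2_le_imp_le[OF _ mult_nonneg_nonneg]) auto
qed

section \<open>Inequalities for powers\<close>

text \<open>The tangent to z^p at c, multiplied out so that c = 0 needs no separate treatment.
  Convexity and the Jensen inequalities below result from averaging it.\<close>

lemma powr_tangent:
 fixes p z c :: real
 assumes "1 < p" "0 <= z" "0 <= c"
 shows "p * z * c powr (p - 1) <= z powr p + (p - 1) * c powr p"
proof -
 define q where "q = p / (p - 1)"
 have q: "1 < q" "1 / p + 1 / q = 1" using assms by (auto simp: q_def field_simps)
 have "z * c powr (p - 1) <= z powr p / p + (c powr (p - 1)) powr q / q" by (rule Youngs_inequality) (use assms q in auto)
 also have "(c powr (p - 1)) powr q = c powr p" using assms by (simp add: powr_powr q_def)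
 also have "c powr p / q = c powr p * ((p - 1) / p)" by (simp add: q_def)
 finally have "p * (z * c powr (p - 1)) <= p * (z powr p / p + c powr p * ((p - 1) / p))" using assms by (intro mult_left_mono) auto
 also have "... = z powr p + (p - 1) * c powr p" using assms by (simp add: field_simps)
 finally show ?thesis by (simp add: mult.assoc)
qed

lemma powr_mult_self: "0 <= c ==> 1 < p ==> c * c powr (p - 1) = c powr p" for c p :: real
 by (cases "c = 0") (auto simp: powr_diff)

lemma powr_convex_comb:
 fixes p x y theta :: real
 assumes "1 < p" "0 <= x" "0 <= y" "0 <= theta" "theta <= 1"
 shows "((1 - theta) * x + theta * y) powr p <= (1 - theta) * x powr p + theta * y powr p"
proof -
 define c where "c = (1 - theta) * x + theta * y"
 have c: "0 <= c" using assms by (simp add: c_def)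
 have "(1 - theta) * (p * x * c powr (p - 1)) + theta * (p * y * c powr (p - 1)) <=
   (1 - theta) * (x powr p + (p - 1) * c powr p) + theta * (y powr p + (p - 1) * c powr p)"
  using assms c by (intro add_mono mult_left_mono powr_tangent) auto
 moreover have "(1 - theta) * (p * x * c powr (p - 1)) + theta * (p * y * c powr (p - 1)) = p * (c * c powr (p - 1))"
  by (simp add: c_def algebra_simps)
 moreover have "(1 - theta) * (x powr p + (p - 1) * c powr p) + theta * (y powr p + (p - 1) * c powr p) =
   (1 - theta) * x powr p + theta * y powr p + p * c powr p - c powr p" by (simp add: algebra_simps)
 ultimately have "c powr p <= (1 - theta) * x powr p + theta * y powr p" using powr_mult_self[OF c assms(1)] by simp
 then show ?thesis by (simp only: c_def)
qed

text \<open>The factor of x^p tends to 1 as theta tends to 0, so a perturbation y whose p-th power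
  is small enough changes the energy by little.\<close>

lemma powr_add_split:
 fixes p x y theta :: real
 assumes "1 < p" "0 <= x" "0 <= y" "0 < theta" "theta < 1"
 shows "(x + y) powr p <= (1 - theta) powr (1 - p) * x powr p + theta powr (1 - p) * y powr p"
proof -
 have "((1 - theta) * (x / (1 - theta)) + theta * (y / theta)) powr p
   <= (1 - theta) * (x / (1 - theta)) powr p + theta * (y / theta) powr p" using assms by (intro powr_convex_comb) auto
 then show ?thesis using assms by (simp add: powr_divide powr_diff)
qed

lemma powr_add_le:
 fixes p x y :: real
 assumes "1 < p" "0 <= x" "0 <= y"
 shows "(x + y) powr p <= 2 powr p * (x powr p + y powr p)"
proof -
 have "(x + y) powr p <= (1/2) powr (1 - p) * x powr p + (1/2) powr (1 - p) * y powr p" using powr_add_split[of p x y "1/2"] assms by simp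
 also have "(1/2::real) powr (1 - p) <= 2 powr p" using assms by (simp add: powr_divide powr_minus_divide[symmetric] powr_le_cancel_iff)
 finally show ?thesis by (simp add: distrib_left[symmetric] mult_right_mono)
qed

lemma norm_midpoint_powr:
 fixes a b :: "'a::real_normed_vector"
 assumes "1 < p"
 shows "norm ((1/2) *R (a + b)) powr p <= (norm a powr p + norm b powr p) / 2"
proof -
 have "norm ((1/2) *R (a + b)) <= (1 - 1/2) * norm a + 1/2 * norm b" using norm_triangle_ineq[of a b] by simp
 then have "norm ((1/2) *R (a + b)) powr p <= ((1 - 1/2) * norm a + 1/2 * norm b) powr p" using assms by (intro powr_mono2) auto
 also have "... <= (1 - 1/2) * norm a powr p + 1/2 * norm b powr p" using assms by (intro powr_convex_comb) auto
 finally show ?thesis by simp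
qed

text \<open>A crude form of uniform convexity. If |b| <= eta |a|, the midpoint has norm at most (1 +
  eta)/2 |a|, and ((1 + eta)/2)^p < 1/2 for small eta because p > 1, so the convexity defect bounds
  a multiple of |a|^p. Otherwise |a| <= |b| / eta.\<close>

lemma norm_powr_defect:
 assumes "1 < (p::real)"
 obtains C where "0 < C" "!!a b :: 'a::real_normed_vector. norm a powr p <= C * norm b powr p +
    C * ((norm a powr p + norm b powr p) / 2 - norm ((1/2) *R (a + b)) powr p)"
proof -
 have lt: "2 powr (-p) < (1/2 :: real)" using powr_less_mono[of "-p" "-1" "2::real"] assms by (simp add: powr_minus_divide)
 have "((%eta::real. ((1 + eta) / 2) powr p) \<longlongrightarrow> ((1 + 0) / 2) powr p) (at_right 0)" by (intro tendsto_intros) auto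
 moreover have "((1 + 0) / 2) powr p = 2 powr (- p)" by (simp add: powr_divide powr_minus_divide)
 ultimately have "\<forall>\<^sub>F eta in at_right 0. ((1 + eta) / 2) powr p < (1/2 :: real)" using lt by (metis order_tendstoD(2))
 moreover have "\<forall>\<^sub>F eta in at_right (0::real). 0 < eta" by (simp add: eventually_at_right_less)
 ultimately obtain eta :: real where eta: "0 < eta" "((1 + eta) / 2) powr p < 1/2"
  using eventually_happens[OF eventually_conj] trivial_limit_at_right_real by blast
 define kap where "kap = 1/2 - ((1 + eta) / 2) powr p"
 have kap: "0 < kap" using eta by (simp add: kap_def)
 define C where "C = max (1 / kap) (eta powr (-p))"
 have C: "0 < C" using kap by (simp add: C_def less_max_iff_disj)
 show ?thesis
 proof (rule that[OF C])
  fix a b :: 'a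
  define D where "D = (norm a powr p + norm b powr p) / 2 - norm ((1/2) *R (a + b)) powr p"
  have D: "0 <= D" using norm_midpoint_powr[OF assms, of a b] by (simp add: D_def)
  show "norm a powr p <= C * norm b powr p +
    C * ((norm a powr p + norm b powr p) / 2 - norm ((1/2) *R (a + b)) powr p)"
  proof (cases "norm b <= eta * norm a")
   case True
   have "norm ((1/2) *R (a + b)) <= ((1 + eta) / 2) * norm a" using norm_triangle_ineq[of a b] True by (simp add: distrib_right)
   then have "norm ((1/2) *R (a + b)) powr p <= (((1 + eta) / 2) * norm a) powr p" using assms by (intro powr_mono2) auto
   also have "... = ((1 + eta) / 2) powr p * norm a powr p" by (subst powr_mult) (use eta in auto)
   finally have "kap * norm a powr p <= D"
   proof -
    have "M <= E * A ==> 0 <= B ==> (1 / 2 - E) * A <= (A + B) / 2 - M" for A B E M :: real by (simp add: field_simps)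
    then show "norm ((1/2) *R (a + b)) powr p <= ((1 + eta) / 2) powr p * norm a powr p ==> ?thesis"
     unfolding D_def kap_def using powr_ge_zero by blast
   qed
   then have "norm a powr p <= (1 / kap) * D" using kap by (simp add: field_simps)
   also have "... <= C * D" using D by (intro mult_right_mono) (auto simp: C_def)
   finally show ?thesis unfolding D_def[symmetric] using C by (simp add: add_increasing)
  next
   case False
   then have "norm a <= norm b / eta" using eta by (simp add: field_simps)
   then have "norm a powr p <= (norm b / eta) powr p" using assms by (intro powr_mono2) auto
   also have "... = eta powr (-p) * norm b powr p" using eta by (simp add: powr_divide powr_minus_divide)
   also have "... <= C * norm b powr p" by (intro mult_right_mono) (auto simp: C_def)
   finally show ?thesis unfolding D_def[symmetric] using C D by (simp add: add_increasing2)
  qed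
 qed
qed

text \<open>The tangent inequality at c, the absolute value of the mean, integrated over the
  interval.\<close>

lemma jensen_powr_unit:
 fixes F :: "real => real"
 assumes p: "1 < p" and F: "continuous_on {0..1} F"
 shows "abs (integral {0..1} F) powr p <= integral {0..1} (%t. abs (F t) powr p)"
proof -
 define c where "c = abs (integral {0..1} F)"
 have c: "0 <= c" by (simp add: c_def)
 have i1: "(%t. abs (F t)) integrable_on {0..1}" by (intro integrable_continuous_real continuous_intros F)
 have i2: "(%t. abs (F t) powr p) integrable_on {0..1}"
  by (intro integrable_continuous_real continuous_on_powr' continuous_intros F) (use p in auto)
 have cF: "c <= integral {0..1} (%t. abs (F t))" unfolding c_def
  using integral_norm_bound_integral[of F "{0..1}" "%t. abs (F t)"] i1 integrable_continuous_real[OF F] by simp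
 have "p * c powr (p - 1) * c <= p * c powr (p - 1) * integral {0..1} (%t. abs (F t))" using p cF by (intro mult_left_mono) auto
 also have "... = integral {0..1} (%t. p * c powr (p - 1) * abs (F t))" by simp
 also have "... <= integral {0..1} (%t. abs (F t) powr p + (p - 1) * c powr p)"
 proof (rule integral_le)
  show "(%t. p * c powr (p - 1) * abs (F t)) integrable_on {0..1}" using integrable_on_cmult_left[OF i1, of "p * c powr (p - 1)"] by simp
  show "(%t. abs (F t) powr p + (p - 1) * c powr p) integrable_on {0..1}" by (intro integrable_add i2) auto
  show "p * c powr (p - 1) * abs (F t) <= abs (F t) powr p + (p - 1) * c powr p" for t
   using powr_tangent[OF p, of "abs (F t)" c] c by (simp add: mult.assoc mult.left_commute mult.commute)
 qed
 also have "... = integral {0..1} (%t. abs (F t) powr p) + (p - 1) * c powr p" by (subst integral_add) (use i2 in auto)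
 also have "p * c powr (p - 1) * c = p * c powr p" using powr_mult_self[OF c p] by (simp add: mult.commute mult.left_commute)
 finally show ?thesis by (simp add: c_def[symmetric] algebra_simps)
qed

section \<open>Continuously differentiable functions\<close>

text \<open>The gradient is carried along as an explicit continuous field, so that energies are
  integrals of given functions.\<close>

definition C1 :: "('a::euclidean_space => real) => ('a => 'a) => bool" where
 "C1 v g \<longleftrightarrow> (ALL x. (v has_derivative (%h. g x \<bullet> h)) (at x)) & continuous_on UNIV g"

lemma C1D: "C1 v g ==> (v has_derivative (%h. g x \<bullet> h)) (at x)"
 by (simp add: C1_def)

lemma C1_grad_cont: "C1 v g ==> continuous_on UNIV g"
 by (simp add: C1_def)

lemma C1_cont: "C1 v g ==> continuous_on UNIV v"
 by (rule has_derivative_continuous_on[OF has_derivative_at_withinI[OF C1D]])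

lemma C1_const [simp]: "C1 (%x. c) (%x. 0)"
 by (simp add: C1_def)

lemma C1_add: "C1 u gu ==> C1 v gv ==> C1 (%x. u x + v x) (%x. gu x + gv x)"
 unfolding C1_def by (auto intro!: continuous_intros has_derivative_eq_rhs[OF has_derivative_add] simp: inner_add_left)

lemma C1_diff: "C1 u gu ==> C1 v gv ==> C1 (%x. u x - v x) (%x. gu x - gv x)"
 unfolding C1_def by (auto intro!: continuous_intros has_derivative_eq_rhs[OF has_derivative_diff] simp: inner_diff_left)

lemma C1_mult:
 assumes "C1 u gu" "C1 v gv"
 shows "C1 (%x. u x * v x) (%x. u x *R gv x + v x *R gu x)"
proof -
 have "((%x. u x * v x) has_derivative (%h. (u x *R gv x + v x *R gu x) \<bullet> h)) (at x)" for x
  by (rule has_derivative_eq_rhs[OF has_derivative_mult[OF C1D[OF assms(1)] C1D[OF assms(2)]]]) (auto simp: inner_add_left algebra_simps)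
 moreover have "continuous_on UNIV (%x. u x *R gv x + v x *R gu x)" by (intro continuous_intros assms[THEN C1_cont] assms[THEN C1_grad_cont])
 ultimately show ?thesis unfolding C1_def by blast
qed

lemma C1_cmult:
 assumes "C1 v g"
 shows "C1 (%x. c * v x) (%x. c *R g x)" using C1_mult[OF C1_const[of c] assms] by simp

lemma C1_sum:
 assumes "!!i. i : I ==> C1 (v i) (g i)"
 shows "C1 (%x. SUM i:I. v i x) (%x. SUM i:I. g i x)" using assms by (induction I rule: infinite_finite_induct) (auto intro: C1_add)

lemma C1_compose_real:
 assumes "C1 v g" "!!x. (phi has_field_derivative phi' (v x)) (at (v x))"
  and "continuous_on (range v) phi'"
 shows "C1 (%x. phi (v x)) (%x. phi' (v x) *R g x)"
proof -
 have "((%x. phi (v x)) has_derivative (%h. (phi' (v x) *R g x) \<bullet> h)) (at x)" for x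
  by (rule has_derivative_eq_rhs[OF has_derivative_compose[OF C1D[OF assms(1)]
     assms(2)[of x, unfolded has_field_derivative_def]]]) simp
 moreover have "continuous_on UNIV (%x. phi' (v x))" using continuous_on_compose2[OF assms(3) C1_cont[OF assms(1)]] by auto
 then have "continuous_on UNIV (%x. phi' (v x) *R g x)" by (intro continuous_intros C1_grad_cont[OF assms(1)])
 ultimately show ?thesis unfolding C1_def by blast
qed

lemma gradient_unique:
 assumes "(v has_derivative (%h. g \<bullet> h)) (at x)" "(v has_derivative (%h. g' \<bullet> h)) (at x)"
 shows "g = g'"
proof -
 have "(%h. g \<bullet> h) = (%h. g' \<bullet> h)" by (rule has_derivative_unique[OF assms])
 then have "g \<bullet> h = g' \<bullet> h" for h by meson
 then show ?thesis by (metis inner_diff_left eq_iff_diff_eq_0 inner_eq_zero_iff)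
qed

lemma gradient_zero_off:
 assumes "C1 v g" "closed K" "!!x. x ~: K ==> v x = 0" "x ~: K"
 shows "g x = 0"
proof -
 have "(v has_derivative (%h. 0 \<bullet> h)) (at x)" by (rule has_derivative_transform_within_open[of "%x. 0" _ _ UNIV "- K"]) (use assms in auto)
 with C1D[OF assms(1)] show ?thesis by (rule gradient_unique)
qed

definition C1c :: "'a::euclidean_space set => ('a => real) => ('a => 'a) => bool" where
 "C1c Om v g \<longleftrightarrow> C1 v g & (EX K. compact K & K <= Om & (ALL x. x ~: K --> v x = 0 & g x = 0))"

lemma C1cI:
 assumes "C1 v g" "compact K" "K <= Om" "!!x. x ~: K ==> v x = 0"
 shows "C1c Om v g" unfolding C1c_def using assms gradient_zero_off[OF assms(1) compact_imp_closed[OF assms(2)]] by blast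

lemma C1cE:
 assumes "C1c Om v g"
 obtains K where "C1 v g" "compact K" "K <= Om" "!!x. x ~: K ==> v x = 0" "!!x. x ~: K ==> g x = 0" using assms unfolding C1c_def by blast

lemma C1c_C1: "C1c Om v g ==> C1 v g" by (simp add: C1c_def)

lemma C1c_zero [simp]: "C1c Om (%x. 0) (%x. 0)"
 unfolding C1c_def by (auto intro: exI[of _ "{}"])

lemma C1c_mono: "C1c S v g ==> S <= T ==> C1c T v g"
 unfolding C1c_def by blast

lemma integrable_compact_support:
 fixes F :: "'a::euclidean_space => real"
 assumes "continuous_on UNIV F" "compact K" "!!x. x ~: K ==> F x = 0"
 shows "integrable lborel F"
proof -
 have "integrable lborel (%x. indicator K x *R F x)" by (rule borel_integrable_compact) (use assms in "auto intro: continuous_on_subset")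
 moreover have "(%x. indicator K x *R F x) = F" using assms(3) by (auto simp: fun_eq_iff indicator_def)
 ultimately show ?thesis by simp
qed

lemma continuous_norm_powr:
 assumes "continuous_on UNIV g" "0 < (p::real)"
 shows "continuous_on UNIV (%x. norm (g x) powr p)" by (intro continuous_on_powr' continuous_intros assms) (use assms in auto)

lemma C1c_powr_weight:
 assumes "C1c Om v g" "0 < (p::real)" "continuous_on UNIV omega"
 shows "continuous_on UNIV (%x. norm (g x) powr p * omega x)"
  and "integrable lborel (%x. norm (g x) powr p * omega x)"
  and "continuous_on UNIV (%x. abs (v x) powr p * omega x)"
  and "integrable lborel (%x. abs (v x) powr p * omega x)"
proof -
 obtain K where K: "C1 v g" "compact K" "!!x. x ~: K ==> v x = 0" "!!x. x ~: K ==> g x = 0" using C1cE[OF assms(1)] by metis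
 show 1: "continuous_on UNIV (%x. norm (g x) powr p * omega x)" by (intro continuous_intros continuous_norm_powr C1_grad_cont[OF K(1)] assms)
 show 2: "continuous_on UNIV (%x. abs (v x) powr p * omega x)"
  using continuous_norm_powr[OF C1_cont[OF K(1)] assms(2)] by (auto intro!: continuous_intros assms)
 show "integrable lborel (%x. norm (g x) powr p * omega x)" by (rule integrable_compact_support[OF 1 K(2)]) (use K assms in auto)
 show "integrable lborel (%x. abs (v x) powr p * omega x)" by (rule integrable_compact_support[OF 2 K(2)]) (use K assms in auto)
qed

lemma C1c_powr:
 assumes "C1c Om v g" "0 < (p::real)"
 shows "integrable lborel (%x. norm (g x) powr p)" "integrable lborel (%x. abs (v x) powr p)"
 using C1c_powr_weight[OF assms, of "%x. 1"] by auto

section \<open>Displacements by small vector fields\<close>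

text \<open>The bound 3/4 makes x + tau X injective; the lower bound 1/2 on the determinants makes
  composition with these maps cost at most a factor 2 in integrals. All tau in [0, 1] are included
  because differences of a function are integrated along the whole segment from x to x + X
  x.\<close>

definition small_field :: "('a::euclidean_space => 'a) => ('a => 'a => 'a) => bool" where "small_field X DX \<longleftrightarrow>
   (ALL x. (X has_derivative DX x) (at x)) & (ALL x h. norm (DX x h) <= (3/4) * norm h) &
   (ALL tau:{0..1}. (%x. ldet (%h. h + tau *R DX x h)) : borel_measurable borel & (ALL x. 1/2 <= ldet (%h. h + tau *R DX x h)))"

lemma small_field_inj:
 assumes "small_field X DX" "0 <= tau" "tau <= 1"
 shows "inj (%x. x + tau *R X x)"
proof (rule injI)
 fix x y assume eq: "x + tau *R X x = y + tau *R X y"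
 have bl: "bounded_linear (DX z)" for z using assms(1) has_derivative_bounded_linear unfolding small_field_def by blast
 have "onorm (DX z) <= 3/4" for z by (rule onorm_le) (use assms(1) in "auto simp only: small_field_def")
 then have "norm (X x - X y) <= (3/4) * norm (x - y)" by (intro differentiable_bound[OF convex_UNIV, of X DX])
    (use assms(1) in "auto simp only: small_field_def intro: has_derivative_at_withinI")
 moreover have "x - y = tau *R (X y - X x)" using eq by (simp add: algebra_simps)
 then have "norm (x - y) = tau * norm (X x - X y)" using assms by (simp add: norm_minus_commute)
 moreover have "tau * norm (X x - X y) <= norm (X x - X y)" using assms by (simp add: mult_left_le_one_le)
 ultimately have "norm (x - y) <= 0" by linarith
 then show "x = y" by simp
qed

lemma small_field_has_derivative:
 assumes "small_field X DX"
 shows "((%x. x + tau *R X x) has_derivative (%h. h + tau *R DX x h)) (at x)" using assms by (auto simp: small_field_def intro!: derivative_eq_intros)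

lemma small_field_cont: "small_field X DX ==> continuous_on UNIV X"
 by (rule has_derivative_continuous_on[of _ _ DX]) (auto simp: small_field_def intro: has_derivative_at_withinI)

lemma small_field_integral_le:
 fixes G :: "'a::euclidean_space => real"
 assumes X: "small_field X DX" and tau: "0 <= tau" "tau <= 1"
  and G: "integrable lborel G" "!!x. 0 <= G x"
 shows "integrable lborel (%x. G (x + tau *R X x))"
  and "(LBINT x. G (x + tau *R X x)) <= 2 * (LBINT x. G x)"
proof -
 let ?d = "%x. ldet (%h. h + tau *R DX x h)"
 have d: "?d : borel_measurable borel" "!!x. 1/2 <= ?d x" using X tau by (auto simp: small_field_def)
 note cv = change_of_variables_le[OF small_field_has_derivative[OF X] small_field_inj[OF X tau] d(1) G]
 have [measurable]: "G : borel_measurable borel" "X : borel_measurable borel"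
  using G(1) borel_measurable_continuous_onI[OF small_field_cont[OF X]] by auto
 have le: "G (x + tau *R X x) <= 2 * (abs (?d x) * G (x + tau *R X x))" for x
  using mult_right_mono[OF _ G(2)[of "x + tau *R X x"], of 1 "2 * abs (?d x)"] d(2)[of x] by simp
 show i: "integrable lborel (%x. G (x + tau *R X x))" by (rule Bochner_Integration.integrable_bound[OF integrable_mult_right[OF cv(1), of 2]])
    (use le G(2) in "auto intro!: AE_I2 simp: abs_mult")
 have "(LBINT x. G (x + tau *R X x)) <= (LBINT x. 2 * (abs (?d x) * G (x + tau *R X x)))"
  by (rule integral_mono[OF i integrable_mult_right[OF cv(1)]]) (use le in auto)
 also have "... <= 2 * (LBINT x. G x)" using cv(2) by simp
 finally show "(LBINT x. G (x + tau *R X x)) <= 2 * (LBINT x. G x)" .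
qed

text \<open>The difference is taken along a part of the segment, but the bound uses all of it, so
  that one estimate serves every stopping parameter s.\<close>

lemma segment_powr_le:
 fixes v :: "'a::euclidean_space => real"
 assumes "C1 v g" "1 < p" and s: "0 <= s" "s <= 1"
 shows "abs (v (x + s *R y) - v x) powr p <= norm y powr p * integral {0..1} (%tau. norm (g (x + tau *R y)) powr p)"
proof -
 define F where "F tau = g (x + tau *R y) \<bullet> y" for tau
 have cg: "continuous_on {0..1} (%tau. g (x + tau *R y))"
  by (rule continuous_on_compose2[OF C1_grad_cont[OF assms(1)]]) (auto intro!: continuous_intros)
 have F: "continuous_on {0..1} F" unfolding F_def by (intro continuous_intros cg)
 have "((%tau. v (x + tau *R y)) has_vector_derivative F tau) (at tau within {0..s})" for tau unfolding has_vector_derivative_def F_def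
  by (rule has_derivative_eq_rhs[OF has_derivative_compose[OF _ C1D[OF assms(1)]]]) (auto intro!: derivative_eq_intros)
 then have "(F has_integral (v (x + s *R y) - v (x + 0 *R y))) {0..s}" using s by (intro fundamental_theorem_of_calculus) auto
 then have "v (x + s *R y) - v x = integral {0..s} F" by (simp add: has_integral_iff)
 moreover have "abs (integral {0..s} F) <= integral {0..s} (%tau. abs (F tau))"
  using integral_norm_bound_integral[of F "{0..s}" "%tau. abs (F tau)"] s continuous_on_subset[OF F, of "{0..s}"]
  by (auto intro!: integrable_continuous_real continuous_intros)
 moreover have "integral {0..s} (%tau. abs (F tau)) <= integral {0..1} (%tau. abs (F tau))"
  using s continuous_on_subset[OF F, of "{0..s}"] by (intro integral_subset_le integrable_continuous_real continuous_intros F) auto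
 ultimately have "abs (v (x + s *R y) - v x) powr p <= \<bar>integral {0..1} (%tau. \<bar>F tau\<bar>)\<bar> powr p"
  using assms by (intro powr_mono2) auto
 also have "... <= integral {0..1} (%tau. abs (F tau) powr p)"
  using jensen_powr_unit[OF assms(2), of "%tau. abs (F tau)"] F by (simp add: continuous_on_rabs)
 also have "... <= integral {0..1} (%tau. norm y powr p * norm (g (x + tau *R y)) powr p)"
 proof (rule integral_le)
  show "(%tau. abs (F tau) powr p) integrable_on {0..1}"
   by (intro integrable_continuous_real continuous_on_powr' continuous_intros F) (use assms in auto)
  show "(%tau. norm y powr p * norm (g (x + tau *R y)) powr p) integrable_on {0..1}"
   by (intro integrable_continuous_real continuous_on_powr' continuous_intros cg) (use assms in auto)
  fix tau :: real
  have "abs (F tau) <= norm y * norm (g (x + tau *R y))"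
   unfolding F_def using Cauchy_Schwarz_ineq2[of "g (x + tau *R y)" y] by (simp add: mult.commute)
  then have "abs (F tau) powr p <= (norm y * norm (g (x + tau *R y))) powr p" using assms by (intro powr_mono2) auto
  then show "abs (F tau) powr p <= norm y powr p * norm (g (x + tau *R y)) powr p" by (simp add: powr_mult)
 qed
 finally show ?thesis by simp
qed

text \<open>The bound is stated for any \<open>D\<close> dominated by a difference along part of the segment:
 at a point that leaves the domain before reaching \<open>x + X x\<close>, the competitors below vanish.\<close>

lemma displacement_powr_le:
 fixes v :: "'a::euclidean_space => real"
 assumes v: "C1c Om v g" and p: "1 < p" and X: "small_field X DX"
  and omega: "continuous_on UNIV omega" "!!x. 0 <= omega x"
  and omega': "continuous_on UNIV omega'" "!!x. 0 <= omega' x"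
  and le: "!!x tau. 0 <= tau ==> tau <= 1 ==> g (x + tau *R X x) ~= 0 ==>
    norm (X x) powr p * omega x <= C * omega' (x + tau *R X x)"
  and C: "0 <= C"
  and D: "continuous_on UNIV D" "!!x. EX s. 0 <= s & s <= 1 & abs (D x) <= abs (v (x + s *R X x) - v x)"
 shows "integrable lborel (%x. abs (D x) powr p * omega x)" (is "integrable _ ?L")
  and "(LBINT x. abs (D x) powr p * omega x)
   <= 2 * C * (LBINT x. norm (g x) powr p * omega' x)"
proof -
 define G where "G x = norm (g x) powr p * omega' x" for x
 have Gc: "continuous_on UNIV G" and Gi: "integrable lborel G" unfolding G_def[abs_def] using C1c_powr_weight[OF v _ omega'(1), of p] p by auto
 have G0: "0 <= G x" for x using omega' by (simp add: G_def)
 have Xc: "continuous_on UNIV X" by (rule small_field_cont[OF X])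
 have Lc: "continuous_on UNIV ?L" by (intro continuous_intros continuous_on_powr' D omega) (use p in auto)
 then have [measurable]: "?L : borel_measurable borel" by (rule borel_measurable_continuous_onI)
 have L0: "0 <= ?L x" for x using omega by simp
 define H where "H = (%(x, tau). C * G (x + tau *R X x))"
 have Hc: "continuous_on UNIV H" unfolding H_def split_beta
  by (intro continuous_intros continuous_on_compose2[OF Gc] continuous_on_compose2[OF Xc]) auto
 then have Hm: "H : borel_measurable borel" by (rule borel_measurable_continuous_onI)
 have [measurable]: "H : borel_measurable (lborel \<Otimes>\<^sub>M lborel)" using Hm by (simp add: lborel_prod)
 have H0: "0 <= H z" for z using G0 C by (simp add: H_def split_beta)
 have pt: "ennreal (?L x) <= (\<integral>\<^sup>+tau. ennreal (H (x, tau)) * indicator {0..1} tau \<partial>lborel)" for x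
 proof -
  have cg: "continuous_on {0..1} (%tau. g (x + tau *R X x))"
   by (rule continuous_on_compose2[OF C1_grad_cont[OF C1c_C1[OF v]]]) (auto intro!: continuous_intros)
  have cG: "continuous_on {0..1} (%tau. H (x, tau))" unfolding H_def by (auto intro!: continuous_intros continuous_on_compose2[OF Gc])
  obtain s where s: "0 <= s" "s <= 1" "abs (D x) <= abs (v (x + s *R X x) - v x)" using D(2) by blast
  have "abs (D x) powr p <= abs (v (x + s *R X x) - v x) powr p" using s p by (intro powr_mono2) auto
  also have "... <= norm (X x) powr p * integral {0..1} (%tau. norm (g (x + tau *R X x)) powr p)" by (rule segment_powr_le[OF C1c_C1[OF v] p s(1,2)])
  finally have "?L x <= norm (X x) powr p * integral {0..1} (%tau. norm (g (x + tau *R X x)) powr p) * omega x" by (intro mult_right_mono omega)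
  also have "... = integral {0..1} (%tau. norm (X x) powr p * omega x * norm (g (x + tau *R X x)) powr p)" by (simp add: mult_ac)
  also have "... <= integral {0..1} (%tau. H (x, tau))"
  proof (rule integral_le)
   show "(%tau. norm (X x) powr p * omega x * norm (g (x + tau *R X x)) powr p) integrable_on {0..1}"
    by (intro integrable_continuous_real continuous_on_powr' continuous_intros cg) (use p in auto)
   show "(%tau. H (x, tau)) integrable_on {0..1}" by (intro integrable_continuous_real cG)
   fix tau :: real assume "tau : {0..1}"
   then show "norm (X x) powr p * omega x * norm (g (x + tau *R X x)) powr p <= H (x, tau)"
    using mult_right_mono[OF le[of tau x], of "norm (g (x + tau *R X x)) powr p"] p
    by (cases "g (x + tau *R X x) = 0") (auto simp: H_def G_def mult_ac)
  qed
  finally have "ennreal (?L x) <= ennreal (integral {0..1} (%tau. H (x, tau)))" by (rule ennreal_leI)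
  also have "... = (\<integral>\<^sup>+tau. ennreal (H (x, tau)) * indicator {0..1} tau \<partial>lborel)"
  proof -
   have si: "set_integrable lborel {0..1} (%tau. H (x, tau))" by (rule borel_integrable_atLeastAtMost') (rule cG)
   then have "integral {0..1} (%tau. H (x, tau)) = (LINT tau:{0..1}|lborel. H (x, tau))" by (rule set_borel_integral_eq_integral(2)[symmetric])
   then have "ennreal (integral {0..1} (%tau. H (x, tau))) =
     (\<integral>\<^sup>+tau. ennreal (indicat_real {0..1} tau *R H (x, tau)) \<partial>lborel)"
    using si H0 unfolding set_integrable_def set_lebesgue_integral_def by (subst nn_integral_eq_integral) auto
   also have "... = (\<integral>\<^sup>+tau. ennreal (H (x, tau)) * indicator {0..1} tau \<partial>lborel)"
    by (auto intro!: nn_integral_cong simp: indicator_def)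
   finally show ?thesis .
  qed
  finally show ?thesis .
 qed
 have "(\<integral>\<^sup>+x. ennreal (?L x) \<partial>lborel) <= (\<integral>\<^sup>+x. (\<integral>\<^sup>+tau. ennreal (H (x, tau)) * indicator {0..1} tau \<partial>lborel) \<partial>lborel)"
  by (rule nn_integral_mono) (rule pt)
 also have "... = (\<integral>\<^sup>+tau. (\<integral>\<^sup>+x. ennreal (H (x, tau)) * indicator {0..1} tau \<partial>lborel) \<partial>lborel)"
  by (rule lborel_pair.Fubini'[symmetric]) measurable
 also have "... <= (\<integral>\<^sup>+tau. ennreal (2 * C * (LBINT x. G x)) * indicator {0..1} (tau::real) \<partial>lborel)"
 proof (rule nn_integral_mono)
  fix tau :: real
  show "(\<integral>\<^sup>+x. ennreal (H (x, tau)) * indicator {0..1} tau \<partial>lborel)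
   <= ennreal (2 * C * (LBINT x. G x)) * indicator {0..1} tau"
  proof (cases "tau : {0..1}")
   case True
   then have t: "0 <= tau" "tau <= 1" by auto
   \<comment> \<open>The integrals have been exchanged by Tonelli's theorem; for fixed tau,
     composition with x + tau X costs a factor 2.\<close>
   note sf = small_field_integral_le[OF X t Gi G0]
   have "(\<integral>\<^sup>+x. ennreal (H (x, tau)) \<partial>lborel) = ennreal (LBINT x. H (x, tau))"
    by (rule nn_integral_eq_integral) (use sf H0 in "auto simp: H_def")
   also have "... <= ennreal (2 * C * (LBINT x. G x))" using mult_left_mono[OF sf(2) C] by (intro ennreal_leI) (auto simp: H_def mult_ac)
   finally show ?thesis using True by simp
  qed auto
 qed
 also have "... = ennreal (2 * C * (LBINT x. G x))" by (simp add: nn_integral_cmult_indicator)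
 finally have *: "(\<integral>\<^sup>+x. ennreal (?L x) \<partial>lborel) <= ennreal (2 * C * (LBINT x. G x))" .
 show i: "integrable lborel ?L" by (rule integrableI_bounded) (use L0 * in "auto simp: le_less_trans")
 have "ennreal (LBINT x. ?L x) = (\<integral>\<^sup>+x. ennreal (?L x) \<partial>lborel)"
  by (rule nn_integral_eq_integral[symmetric, OF i]) (use L0 in auto)
 then have "ennreal (LBINT x. ?L x) <= ennreal (2 * C * (LBINT x. G x))" using * by simp
 then show "(LBINT x. ?L x) <= 2 * C * (LBINT x. norm (g x) powr p * omega' x)"
  using C G0 by (subst (asm) ennreal_le_iff) (auto simp: G_def[abs_def] intro!: mult_nonneg_nonneg Bochner_Integration.integral_nonneg)
qed

section \<open>Deformations of a function on a piece of its domain\<close>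

text \<open>The common form of two deformations. For empty B the field Y is constant and x + beta Y
  is a cut-off translation; for B a basis of the normal space of a flat, Y is the normal component
  and the map is a cut-off stretch. In both cases Y has the derivative
  \<open>proj B\<close>.\<close>

locale deformation =
 fixes B :: "'a::euclidean_space set" and beta :: "'a => real" and gbeta :: "'a => 'a" and Y :: "'a => 'a"
 assumes orthonormal_B: "orthonormal B"
  and C1_beta: "C1 beta gbeta"
  and Y_derivative: "!!x. (Y has_derivative proj B) (at x)"
  and small: "small_field (%x. beta x *R Y x) (%x h. beta x *R proj B h + (gbeta x \<bullet> h) *R Y x)"
begin

definition Phi :: "'a => 'a" where "Phi x = x + beta x *R Y x"

text \<open>The transpose of the derivative of \<open>Phi\<close>: it maps the gradient of a
  function at \<open>Phi x\<close> to the gradient of its composition with \<open>Phi\<close> at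
  x.\<close>

definition Adj :: "'a => 'a => 'a" where "Adj x k = k + beta x *R proj B k + (Y x \<bullet> k) *R gbeta x"

definition jac :: "'a => real" where "jac x = ldet (%h. h + (beta x *R proj B h + (gbeta x \<bullet> h) *R Y x))"

lemma Phi_derivative:
 "(Phi has_derivative (%h. h + (beta x *R proj B h + (gbeta x \<bullet> h) *R Y x))) (at x)"
proof -
 have "((%x. x + 1 *R (beta x *R Y x)) has_derivative (%h. h + 1 *R (beta x *R proj B h + (gbeta x \<bullet> h) *R Y x))) (at x)"
  by (rule small_field_has_derivative[OF small])
 then show ?thesis unfolding Phi_def[abs_def] scaleR_one .
qed

lemma continuous_Phi: "continuous_on UNIV Phi"
 by (rule has_derivative_continuous_on[OF has_derivative_at_withinI[OF Phi_derivative]])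

lemma continuous_Y: "continuous_on UNIV Y"
 by (rule has_derivative_continuous_on[OF has_derivative_at_withinI[OF Y_derivative]])

lemma inj_Phi: "inj Phi"
 using small_field_inj[OF small, of 1] by (simp add: Phi_def[abs_def])

lemma jac_measurable: "jac : borel_measurable borel"
 using bspec[of "{0..1}" _ "1::real", OF conjunct2[OF conjunct2[OF small[unfolded small_field_def]]]] by (simp add: jac_def[abs_def])

lemma jac_ge: "1/2 <= jac x"
 using bspec[of "{0..1}" _ "1::real", OF conjunct2[OF conjunct2[OF small[unfolded small_field_def]]]] by (simp add: jac_def)

lemma Adj_zero [simp]: "Adj x 0 = 0" by (simp add: Adj_def)

lemma has_derivative_comp_Phi:
 assumes "(psi has_derivative (%h. k \<bullet> h)) (at (Phi x))"
 shows "((%x. psi (Phi x)) has_derivative (%h. Adj x k \<bullet> h)) (at x)"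
 by (rule has_derivative_eq_rhs[OF has_derivative_compose[OF Phi_derivative assms]])
   (simp add: Adj_def inner_add_left inner_add_right inner_proj_commute fun_eq_iff inner_commute[of "Y x" k])

lemma isCont_Adj:
 assumes "isCont k x"
 shows "isCont (%x. Adj x (k x)) x"
proof -
 have "isCont beta x" "isCont gbeta x" "isCont Y x" using C1_cont[OF C1_beta] C1_grad_cont[OF C1_beta] continuous_Y
  by (auto simp: continuous_on_eq_continuous_at)
 then show ?thesis unfolding Adj_def by (intro continuous_intros assms bounded_linear.isCont[OF bounded_linear_proj])
qed

lemma integral_comp_Phi_le:
 assumes "integrable lborel G" "!!x. 0 <= G x"
 shows "integrable lborel (%x. jac x * G (Phi x))"
  and "(LBINT x. jac x * G (Phi x)) <= (LBINT x. G x)"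
proof -
 have j: "abs (jac x) = jac x" for x using jac_ge[of x] by simp
 show "integrable lborel (%x. jac x * G (Phi x))" "(LBINT x. jac x * G (Phi x)) <= (LBINT x. G x)"
  using change_of_variables_le[OF Phi_derivative inj_Phi _ assms] jac_measurable by (simp_all add: jac_def[symmetric, abs_def] jac_def[symmetric] j)
qed

text \<open>Only the piece S is deformed, and values are pulled back only from S to S. In W the
  piece and the rest of Om are separated by open sets, so v cut down to S is still C1 there; the
  deformation happens on T, along paths inside W. By \<open>push\<close> a value of S is never
  pulled back to a point outside S, so the new support stays in Om. A path that ends outside S has
  left Om on the way, where v is 0.\<close>

lemma piece_competitor:
 assumes v: "C1c Om v g"
  and Om: "open Om" and p: "1 < p"
  and T: "closed T" "!!x. x ~: T ==> beta x = 0"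
  and W: "open W" "!!x s. x : T ==> 0 <= s ==> s <= 1 ==> x + s *R (beta x *R Y x) : W"
  and S: "S <= Om" "open (W Int S)" "open (W Int Om - S)"
  and push: "!!x. x : T ==> Phi x : S ==> x : S"
  and t: "!!x. norm (beta x *R Y x) <= t"
 obtains w gw where "C1c Om w gw" "!!x. w x = (if x : S then (if Phi x : S then v (Phi x) else 0) else v x)"
  "!!x. gw x = (if x : S then (if Phi x : S then Adj x (g (Phi x)) else 0) else g x)"
  "(LBINT x. abs (w x - v x) powr p) <= 2 * t powr p * Epow p g"
proof -
 obtain K where K: "C1 v g" "compact K" "K <= Om" "!!x. x ~: K ==> v x = 0" "!!x. x ~: K ==> g x = 0" using C1cE[OF v] by metis
 define psi where "psi z = (if z : S then v z else 0)" for z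
 define gpsi where "gpsi z = (if z : S then g z else 0)" for z
 have gbeta0: "gbeta x = 0" if "x ~: T" for x by (rule gradient_zero_off[OF C1_beta T that])
 have Phi_off: "Phi x = x" and Adj_off: "Adj x k = k" if "x ~: T" for x k using that T(2) gbeta0 by (auto simp: Phi_def Adj_def)
 have TW: "x : W" "Phi x : W" if "x : T" for x using W(2)[OF that, of 0] W(2)[OF that, of 1] by (auto simp: Phi_def)
 have opK: "open (- K)" using K(2) by (simp add: compact_imp_closed open_Compl)
 have loc: "(psi has_derivative (%h. gpsi z \<bullet> h)) (at z) & isCont gpsi z" if z: "z : W" for z
 proof -
  consider (ins) "z : S" | (out) "z : Om - S" | (off) "z ~: Om" by blast
  then show ?thesis
  proof cases
   case ins
   have "(psi has_derivative (%h. g z \<bullet> h)) (at z)" by (rule has_derivative_transform_within_open[OF C1D[OF K(1)] S(2)])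
      (use ins z in "auto simp: psi_def")
   then have "(psi has_derivative (%h. gpsi z \<bullet> h)) (at z)" using ins by (simp add: gpsi_def)
   moreover have "continuous_on (W Int S) gpsi" using continuous_on_subset[OF C1_grad_cont[OF K(1)], of "W Int S"]
    by (rule continuous_on_eq) (auto simp: gpsi_def)
   then have "isCont gpsi z" using S(2) ins z by (simp add: continuous_on_eq_continuous_at)
   ultimately show ?thesis by blast
  next
   case out
   have "(psi has_derivative (%h. 0)) (at z)" by (rule has_derivative_transform_within_open[OF has_derivative_const[of 0] S(3)])
      (use out z in "auto simp: psi_def")
   then have "(psi has_derivative (%h. gpsi z \<bullet> h)) (at z)" using out by (simp add: gpsi_def)
   moreover have "continuous_on (W Int Om - S) gpsi" by (rule continuous_on_eq[OF continuous_on_const[of _ 0]]) (auto simp: gpsi_def)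
   then have "isCont gpsi z" using S(3) out z by (simp add: continuous_on_eq_continuous_at)
   ultimately show ?thesis by blast
  next
   case off
   then have zK: "z ~: K" using K(3) by blast
   have "(psi has_derivative (%h. 0)) (at z)" by (rule has_derivative_transform_within_open[OF has_derivative_const[of 0] opK])
      (use zK K in "auto simp: psi_def")
   then have "(psi has_derivative (%h. gpsi z \<bullet> h)) (at z)" using zK K(5) by (simp add: gpsi_def)
   moreover have "continuous_on (- K) gpsi" by (rule continuous_on_eq[OF continuous_on_const[of _ 0]]) (use K in "auto simp: gpsi_def")
   then have "isCont gpsi z" using opK zK by (simp add: continuous_on_eq_continuous_at)
   ultimately show ?thesis by blast
  qed
 qed
 \<comment> \<open>With psi equal to v on S and to 0 elsewhere, differentiability on T is inherited
   from psi; the case distinction of the statement then follows from \<open>push\<close>.\<close>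
 define w where "w x = v x + psi (Phi x) - psi x" for x
 define gw where "gw x = g x + Adj x (gpsi (Phi x)) - gpsi x" for x
 have w_off: "w x = v x" and gw_off: "gw x = g x" if "x ~: T" for x using that by (auto simp: w_def gw_def Phi_off Adj_off)
 have w_eq: "w x = (if x : S then (if Phi x : S then v (Phi x) else 0) else v x)" for x
  using push[of x] Phi_off[of x] by (cases "x : T") (auto simp: w_def psi_def)
 have gw_eq: "gw x = (if x : S then (if Phi x : S then Adj x (g (Phi x)) else 0) else g x)" for x
  using push[of x] Phi_off[of x] Adj_off[of x] by (cases "x : T") (auto simp: gw_def gpsi_def)
 have opT: "open (- T)" using T by (simp add: open_Compl)
 have isg: "isCont g x" for x using C1_grad_cont[OF K(1)] by (simp add: continuous_on_eq_continuous_at)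
 have "(w has_derivative (%h. gw x \<bullet> h)) (at x) & isCont gw x" for x
 proof (cases "x : T")
  case True
  have "(w has_derivative (%h. g x \<bullet> h + Adj x (gpsi (Phi x)) \<bullet> h - gpsi x \<bullet> h)) (at x)" unfolding w_def[abs_def]
   by (intro has_derivative_add has_derivative_diff C1D[OF K(1)] has_derivative_comp_Phi
     conjunct1[OF loc] TW[OF True])
  moreover have "isCont gw x"
  proof -
   have "isCont (%x. gpsi (Phi x)) x" using conjunct2[OF loc[OF TW(2)[OF True]]] continuous_Phi
    by (intro isCont_o2[of x Phi gpsi]) (auto simp: continuous_on_eq_continuous_at)
   then show ?thesis unfolding gw_def[abs_def] by (intro continuous_intros isg isCont_Adj conjunct2[OF loc[OF TW(1)[OF True]]])
  qed
  ultimately show ?thesis by (simp add: gw_def inner_add_left inner_diff_left)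
 next
  case False
  have "(w has_derivative (%h. g x \<bullet> h)) (at x)" by (rule has_derivative_transform_within_open[OF C1D[OF K(1)] opT]) (use False w_off in auto)
  then have "(w has_derivative (%h. gw x \<bullet> h)) (at x)" by (simp add: gw_off[OF False])
  moreover have "continuous_on (- T) gw" using continuous_on_subset[OF C1_grad_cont[OF K(1)], of "- T"]
   by (rule continuous_on_eq) (use gw_off in auto)
  then have "isCont gw x" using opT False by (simp add: continuous_on_eq_continuous_at)
  ultimately show ?thesis by blast
 qed
 then have C1w: "C1 w gw" unfolding C1_def by (simp add: continuous_on_eq_continuous_at)
 \<comment> \<open>For x in T the point \<open>Phi x\<close> lies in W, and K lies in Om. So
   removing the open preimage leaves exactly those x in T with \<open>Phi x\<close> in K and in S,
   and in this form Q is visibly closed.\<close>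
 define Q where "Q = T Int Phi -` K - Phi -` (W Int Om - S)"
 have Qc: "closed Q" unfolding Q_def by (intro closed_Diff closed_Int T(1) closed_vimage[OF compact_imp_closed[OF K(2)] continuous_Phi]
    open_vimage[OF S(3) continuous_Phi])
 obtain R where R: "!!x. x : K ==> norm x <= R" using compact_imp_bounded[OF K(2)] bounded_iff by metis
 have "norm x <= R + t" if "x : Q" for x
 proof -
  have "norm (Phi x) <= R" using that R by (auto simp: Q_def)
  moreover have "norm x <= norm (Phi x) + norm (beta x *R Y x)" using norm_triangle_ineq4[of "Phi x" "beta x *R Y x"] by (simp add: Phi_def)
  ultimately show ?thesis using t[of x] by linarith
 qed
 then have Qcomp: "compact Q" using Qc by (auto simp: compact_eq_bounded_closed bounded_iff)
 have QOm: "Q <= Om"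
 proof
  fix x assume x: "x : Q"
  then have "Phi x : S" using TW(2)[of x] K(3) by (auto simp: Q_def)
  then show "x : Om" using push x S(1) by (auto simp: Q_def)
 qed
 have Cw: "C1c Om w gw"
 proof (rule C1cI[OF C1w, of "K Un Q"])
  show "compact (K Un Q)" using K(2) Qcomp by (rule compact_Un)
  show "K Un Q <= Om" using K(3) QOm by blast
  fix x assume x: "x ~: K Un Q"
  then have vx: "v x = 0" using K(4) by blast
  show "w x = 0"
  proof (cases "x : T")
   case True
   then have "Phi x ~: K \<or> Phi x ~: S" using x by (auto simp: Q_def)
   then show ?thesis using vx K(4) by (auto simp: w_eq)
  qed (use vx w_off in auto)
 qed
 have path: "EX s. 0 <= s & s <= 1 & abs (w x - v x) <= abs (v (x + s *R (beta x *R Y x)) - v x)" for x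
 proof (cases "x : T & x : S")
  case False
  then have "w x = v x" using w_off[of x] w_eq[of x] by auto
  then show ?thesis by (intro exI[of _ 0]) auto
 next
  case True
  show ?thesis
  proof (cases "Phi x : S")
   case True
   then show ?thesis using \<open>x : T & x : S\<close> by (intro exI[of _ 1]) (auto simp: w_eq Phi_def)
  next
   case False
   \<comment> \<open>The segment from x to \<open>Phi x\<close> runs inside W, starts in S and ends
     outside S. Inside Om it would be disconnected by S and Om - S; so it contains a point outside
     Om, where v vanishes, and this point serves as the witness.\<close>
   define A where "A = (%s. x + s *R (beta x *R Y x)) ` {0..1}"
   have conn: "connected A" unfolding A_def by (intro connected_continuous_image continuous_intros) auto
   have AW: "A <= W" using W(2) True by (auto simp: A_def)
   have xA: "x : A" unfolding A_def by (rule image_eqI[of _ _ 0]) auto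
   have PA: "Phi x : A" unfolding A_def Phi_def by (rule image_eqI[of _ _ 1]) auto
   have "\<not> A <= Om"
   proof
    assume AOm: "A <= Om"
    have "A <= (W Int S) Un (W Int Om - S)" "(W Int S) Int (W Int Om - S) Int A = {}" using AW AOm by auto
    then have "(W Int S) Int A = {} \<or> (W Int Om - S) Int A = {}" using connectedD[OF conn S(2,3)] by blast
    then show False using xA PA AW AOm True False by blast
   qed
   then obtain s where s: "0 <= s" "s <= 1" "x + s *R (beta x *R Y x) ~: Om" unfolding A_def image_subset_iff by fastforce
   then have "v (x + s *R (beta x *R Y x)) = 0" using K(3,4) by blast
   moreover have "w x = 0" using True False by (simp add: w_eq)
   ultimately show ?thesis using s by (intro exI[of _ s]) simp
  qed
 qed
 have t0: "0 <= t" using t[of undefined] norm_ge_zero order_trans by blast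
 have "(LBINT x. abs (w x - v x) powr p * 1) <= 2 * t powr p * (LBINT x. norm (g x) powr p * 1)"
 proof (rule displacement_powr_le[OF v p small])
  show "continuous_on UNIV (%x. w x - v x)" by (intro continuous_intros C1_cont[OF C1w] C1_cont[OF K(1)])
  show "norm (beta x *R Y x) powr p * 1 <= t powr p * 1" for x using t[of x] p by (auto intro!: powr_mono2 simp del: norm_scaleR)
 qed (use path in auto)
 then show ?thesis using that[OF Cw w_eq gw_eq] by simp
qed
end

context deformation
begin

text \<open>The Jacobian is used up by the change of variables, and omega bounds what is left of the
  derivative. It is evaluated at the image point, so that after the substitution it stands at the
  same point as the gradient.\<close>

lemma piece_energy_le:
 assumes v: "C1c Om v g" and w: "C1c Om w gw" and p: "1 < p"
  and gw: "!!x. gw x = (if x : S then (if Phi x : S then Adj x (g (Phi x)) else 0) else g x)"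
  and S: "S : sets borel"
  and omega: "continuous_on UNIV omega" "!!x. 0 <= omega x"
  and le: "!!x. x : S ==> Phi x : S ==>
   norm (Adj x (g (Phi x))) powr p <= jac x * (norm (g (Phi x)) powr p * omega (Phi x))"
 shows "Epow p gw <= (LBINT x. norm (g x) powr p * (if x : S then omega x else 1))"
proof -
 define G where "G x = indicator S x * (norm (g x) powr p * omega x)" for x
 have iw: "integrable lborel (%x. norm (gw x) powr p)" using C1c_powr[OF w] p by auto
 have ig: "integrable lborel (%x. norm (g x) powr p)" using C1c_powr[OF v] p by auto
 have igomega: "integrable lborel (%x. norm (g x) powr p * omega x)" using C1c_powr_weight[OF v _ omega(1)] p by auto
 note S[measurable]
 have iG: "integrable lborel G" unfolding G_def[abs_def] using integrable_mult_indicator[OF _ igomega, of S] S by simp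
 have iN: "integrable lborel (%x. indicator (- S) x * norm (g x) powr p)" using integrable_mult_indicator[OF _ ig, of "- S"] S by simp
 have G0: "0 <= G x" for x using omega by (simp add: G_def)
 note cv = integral_comp_Phi_le[OF iG G0]
 have pt: "norm (gw x) powr p <= jac x * G (Phi x) + indicator (- S) x * norm (g x) powr p" for x
 proof -
  have "0 <= jac x * G (Phi x)" using jac_ge[of x] G0[of "Phi x"] by (intro mult_nonneg_nonneg) auto
  then show ?thesis using le[of x] by (auto simp: gw G_def indicator_def)
 qed
 have "Epow p gw <= (LBINT x. jac x * G (Phi x) + indicator (- S) x * norm (g x) powr p)" by (rule integral_mono) (use iw cv(1) iN pt in auto)
 also have "... <= (LBINT x. G x) + (LBINT x. indicator (- S) x * norm (g x) powr p)" using cv iN by simp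
 also have "... = (LBINT x. G x + indicator (- S) x * norm (g x) powr p)" using iG iN by simp
 also have "... = (LBINT x. norm (g x) powr p * (if x : S then omega x else 1))"
  by (rule Bochner_Integration.integral_cong) (auto simp: G_def indicator_def)
 finally show ?thesis .
qed
end

section \<open>Cut-off translations\<close>

lemma translation_deformation:
 fixes y :: "'a::euclidean_space"
 assumes "C1 eta geta" "!!x. norm y * norm (geta x) <= 1/2"
 shows "deformation {} eta geta (%x. y)"
proof
 show "orthonormal {}" by (simp add: orthonormal_def)
 show "C1 eta geta" by fact
 show "((%x. y) has_derivative proj {}) (at x)" for x by (rule has_derivative_eq_rhs[OF has_derivative_const]) auto
 have i: "abs (geta x \<bullet> y) <= 1/2" for x using Cauchy_Schwarz_ineq2[of "geta x" y] assms(2)[of x] by (simp add: mult.commute)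
 have d: "ldet (%h. h + (tau * (geta x \<bullet> h)) *R y) = 1 + tau * (geta x \<bullet> y)" for tau x
  using ldet_rank_one[of "tau *R geta x" y] by (simp add: inner_commute)
 show "small_field (%x. eta x *R y) (%x h. eta x *R proj {} h + (geta x \<bullet> h) *R y)" unfolding small_field_def
 proof (intro conjI allI ballI)
  fix x h :: 'a
  show "((%x. eta x *R y) has_derivative (%h. eta x *R proj {} h + (geta x \<bullet> h) *R y)) (at x)"
   by (rule has_derivative_eq_rhs[OF has_derivative_scaleR_left[OF C1D[OF assms(1)]]]) auto
  have "norm (eta x *R proj {} h + (geta x \<bullet> h) *R y) <= norm (geta x) * norm h * norm y"
   using Cauchy_Schwarz_ineq2[of "geta x" h] by (simp add: mult_right_mono)
  also have "... = norm y * norm (geta x) * norm h" by simp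
  also have "... <= 3/4 * norm h" using assms(2)[of x] by (intro mult_right_mono) auto
  finally show "norm (eta x *R proj {} h + (geta x \<bullet> h) *R y) <= 3/4 * norm h" .
 next
  fix tau :: real assume tau: "tau : {0..1}"
  show "(%x. ldet (%h. h + tau *R (eta x *R proj {} h + (geta x \<bullet> h) *R y))) : borel_measurable borel"
   using C1_grad_cont[OF assms(1)] by (auto simp: d intro!: borel_measurable_continuous_onI continuous_intros)
  fix x
  have "abs (tau * (geta x \<bullet> y)) <= 1 * (1/2)" unfolding abs_mult using tau i[of x] by (intro mult_mono) auto
  then show "1/2 <= ldet (%h. h + tau *R (eta x *R proj {} h + (geta x \<bullet> h) *R y))" by (simp add: d)
 qed
qed

text \<open>The gradient grows by at most 1 + a and the Jacobian is at least 1 - a, so the energy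
  density grows by at most 1 + 8 a. For p <= 2 this reduces to a (5 - 9 a) >= 0.\<close>

lemma one_plus_powr_le:
 fixes a p :: real
 assumes "0 <= a" "a <= 1/2" "1 < p" "p <= 2"
 shows "(1 + a) powr p <= (1 - a) * (1 + 8 * a)"
proof -
 have "(1 + a) powr p <= (1 + a) powr 2" using assms by (intro powr_mono) auto
 also have "... = (1 + a)^2" using assms by simp
 also have "... <= (1 - a) * (1 + 8 * a)"
 proof -
  have "0 <= a * (5 - 9 * a)" using assms by (intro mult_nonneg_nonneg) auto
  then show ?thesis by (simp add: power2_eq_square algebra_simps)
 qed
 finally show ?thesis .
qed

lemma translation_Adj_le:
 fixes y :: "'a::euclidean_space"
 assumes D: "deformation {} eta geta (%x. y)" and y: "norm y * norm (geta x) <= 1/2"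
  and p: "1 < p" "p <= 2"
 shows "norm (deformation.Adj {} eta geta (%x. y) x k) powr p <=
  deformation.jac {} eta geta (%x. y) x * (norm k powr p * (1 + 8 * (norm y * norm (geta x))))"
proof -
 interpret deformation "{}" eta geta "%x. y" by fact
 define a where "a = norm y * norm (geta x)"
 have a: "0 <= a" "a <= 1/2" using y by (auto simp: a_def)
 have "norm (Adj x k) <= norm k + norm ((y \<bullet> k) *R geta x)"
  unfolding Adj_def using norm_triangle_ineq[of k "(y \<bullet> k) *R geta x"] by simp
 also have "norm ((y \<bullet> k) *R geta x) <= norm y * norm k * norm (geta x)" using Cauchy_Schwarz_ineq2[of y k] by (simp add: mult_right_mono)
 finally have "norm (Adj x k) <= (1 + a) * norm k" by (simp add: a_def algebra_simps)
 then have "norm (Adj x k) powr p <= ((1 + a) * norm k) powr p" using p by (intro powr_mono2) auto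
 also have "... = (1 + a) powr p * norm k powr p" using a by (intro powr_mult)
 also have "... <= ((1 - a) * (1 + 8 * a)) * norm k powr p" by (intro mult_right_mono one_plus_powr_le a p) auto
 also have "... = (1 - a) * (norm k powr p * (1 + 8 * a))" by simp
 also have "... <= jac x * (norm k powr p * (1 + 8 * a))"
 proof (rule mult_right_mono)
  have "jac x = 1 + geta x \<bullet> y" unfolding jac_def using ldet_rank_one[of "geta x" y] by (simp add: inner_commute)
  then show "1 - a <= jac x" using Cauchy_Schwarz_ineq2[of "geta x" y] by (simp add: a_def mult.commute abs_le_iff)
 qed (use a in auto)
 finally show ?thesis by (simp add: a_def)
qed

section \<open>Stretching away from a flat of codimension at least three\<close>

lemma C1_norm_proj:
 assumes "orthonormal B"
 shows "C1 (%x. (norm (proj B (x - a0)))^2 + c) (%x. 2 *R proj B (x - a0))"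
proof -
 have e: "(norm (proj B (x - a0)))^2 = (x - a0) \<bullet> proj B (x - a0)" for x using assms by (simp add: power2_norm_eq_inner inner_proj_commute)
 have d: "((%x. proj B (x - a0)) has_derivative proj B) (at x)" for x
  by (rule has_derivative_eq_rhs[OF bounded_linear.has_derivative[OF bounded_linear_proj]]) (auto intro!: derivative_eq_intros)
 have "((%x. (x - a0) \<bullet> proj B (x - a0) + c) has_derivative (%h. (2 *R proj B (x - a0)) \<bullet> h)) (at x)" for x
 proof -
  have 1: "((%x. x - a0) has_derivative (%h. h)) (at x)" by (auto intro!: derivative_eq_intros)
  have 2: "(x - a0) \<bullet> proj B h + h \<bullet> proj B (x - a0) = (2 *R proj B (x - a0)) \<bullet> h" for h
   using inner_proj_commute[of B "x - a0" h] inner_commute[of h "proj B (x - a0)"] by simp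
  show ?thesis using has_derivative_add_const[OF has_derivative_inner[OF 1 d], of c] unfolding 2 .
 qed
 moreover have "continuous_on UNIV (%x. 2 *R proj B (x - a0))" by (intro continuous_intros bounded_linear.continuous_on[OF bounded_linear_proj])
 ultimately show ?thesis unfolding C1_def e by blast
qed

text \<open>The gain of a stretch by 1 + beta, linear in beta with a positive coefficient because p
  < 2. Weighted arithmetic and geometric means bound the power by (2 - p)/(1 + beta) + (p - 1), and
  1/(1 + beta) <= 1 - beta/2.\<close>

lemma powr_two_minus_le:
 fixes beta p :: real
 assumes "0 <= beta" "beta <= 1/2" "1 < p" "p < 2"
 shows "(1 + beta) powr (p - 2) <= 1 - (2 - p) / 2 * beta"
proof -
 have "(1 / (1 + beta)) powr (2 - p) * 1 powr (p - 1) <= (2 - p) * (1 / (1 + beta)) + (p - 1) * 1" by (rule Youngs_inequality_0) (use assms in auto)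
 moreover have "(1 / (1 + beta)) powr (2 - p) = (1 + beta) powr (p - 2)" using assms by (simp add: powr_divide powr_minus_divide[symmetric])
 moreover have "(2 - p) * (1 / (1 + beta)) <= (2 - p) * (1 - beta / 2)"
 proof (rule mult_left_mono)
  have "1 <= (1 - beta / 2) * (1 + beta)"
  proof -
   have "0 <= beta * (1 - beta) / 2" using assms by simp
   then show ?thesis by (simp add: algebra_simps)
  qed
  then show "1 / (1 + beta) <= 1 - beta / 2" using assms by (simp add: divide_le_eq)
 qed (use assms in auto)
 ultimately show ?thesis by (simp add: algebra_simps)
qed

text \<open>\<open>Phi\<close> will multiply the component normal to the flat by 1 + beta, with beta
  about t/(2 dist) where eta = 1 and dist exceeds t. The displacement stays below t/2 everywhere,
  while the stretching factor carries the weight 1/dist that is to be controlled. Regularising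
  dist^2 by t^2 keeps beta <= 1/2.\<close>

locale radial_push =
 fixes B :: "'a::euclidean_space set" and a0 :: 'a and t :: real and eta :: "'a => real" and geta :: "'a => 'a"
 assumes on: "orthonormal B" and card_B: "3 <= card B" and t: "0 < t"
  and eta: "C1 eta geta" "!!x. 0 <= eta x" "!!x. eta x <= 1" "!!x. t * norm (geta x) <= 1/2"
begin

definition nrm :: "'a => 'a" where "nrm x = proj B (x - a0)"
definition R2 :: "'a => real" where "R2 x = (norm (nrm x))^2 + t^2"
definition alpha :: "'a => real" where "alpha x = t / 2 * R2 x powr (-1/2)"
definition beta :: "'a => real" where "beta x = eta x * alpha x"
text \<open>The gradient of \<open>alpha\<close> is -b times the normal component.\<close>

definition b :: "'a => real" where "b x = t / 2 * R2 x powr (-3/2)"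
definition gbeta :: "'a => 'a" where "gbeta x = alpha x *R geta x - (eta x * b x) *R nrm x"

lemma R2_ge: "t^2 <= R2 x" "(norm (nrm x))^2 <= R2 x" "0 < R2 x"
 using t by (auto simp: R2_def add_nonneg_pos)

lemma C1_alpha: "C1 alpha (%x. - b x *R nrm x)"
proof -
 have "C1 R2 (%x. 2 *R nrm x)" unfolding R2_def[abs_def] nrm_def by (rule C1_norm_proj[OF on])
 then have C: "C1 (%x. (%s. t / 2 * s powr (-1/2)) (R2 x)) (%x. (t / 2 * ((-1/2) * R2 x powr (-1/2 - 1))) *R (2 *R nrm x))"
 proof (rule C1_compose_real)
  show "((%s. t / 2 * s powr (-1/2)) has_field_derivative t / 2 * ((-1/2) * R2 x powr (-1/2 - 1))) (at (R2 x))" for x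
   using R2_ge(3)[of x] by (auto intro!: derivative_eq_intros)
  show "continuous_on (range R2) (%s. t / 2 * ((-1/2) * s powr (-1/2 - 1)))"
   using R2_ge(3) by (auto intro!: continuous_intros simp: less_imp_neq[symmetric])
 qed
 have e: "(t / 2 * ((-1/2) * R2 x powr (-1/2 - 1))) *R (2 *R nrm x) = - b x *R nrm x" for x by (simp add: b_def)
 show ?thesis using C unfolding e by (simp only: alpha_def[abs_def])
qed

lemma alpha_bounds: "0 < alpha x" "alpha x <= 1/2" "alpha x * norm (nrm x) <= t / 2" "0 <= b x" "b x * (norm (nrm x))^2 <= alpha x"
proof -
 have s: "R2 x powr (-1/2) = 1 / sqrt (R2 x)" using R2_ge(3)[of x] by (simp add: powr_minus_divide powr_half_sqrt)
 have s1: "t <= sqrt (R2 x)" "norm (nrm x) <= sqrt (R2 x)" using R2_ge[of x] t by (auto intro!: real_le_rsqrt)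
 show "0 < alpha x" using R2_ge(3)[of x] t by (simp add: alpha_def)
 show "alpha x <= 1/2" using s1 t R2_ge(3)[of x] unfolding alpha_def s by (simp add: divide_le_eq)
 show "alpha x * norm (nrm x) <= t / 2" using s1 t R2_ge(3)[of x] unfolding alpha_def s by (simp add: divide_le_eq mult_left_mono)
 show "0 <= b x" using t by (simp add: b_def)
 have "R2 x powr (-3/2) * (norm (nrm x))^2 <= R2 x powr (-3/2) * R2 x powr 1" using R2_ge[of x] by (intro mult_left_mono) auto
 also have "... = R2 x powr (-1/2)" by (subst powr_add[symmetric]) simp
 finally show "b x * (norm (nrm x))^2 <= alpha x" using t by (simp add: b_def alpha_def)
qed

lemma C1_beta: "C1 beta gbeta"
proof -
 have "C1 (%x. eta x * alpha x) (%x. eta x *R (- b x *R nrm x) + alpha x *R geta x)" by (rule C1_mult[OF eta(1) C1_alpha])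
 then show ?thesis by (simp add: beta_def[abs_def] gbeta_def[abs_def] algebra_simps)
qed

lemma proj_nrm: "proj B (nrm x) = nrm x" using on by (simp add: nrm_def)

lemma beta_bounds: "0 <= beta x" "beta x <= alpha x" "beta x <= 1/2" "norm (beta x *R nrm x) <= t / 2"
proof -
 show 1: "0 <= beta x" using eta(2) alpha_bounds(1)[of x] by (simp add: beta_def)
 show 2: "beta x <= alpha x" using eta(2,3)[of x] alpha_bounds(1)[of x] by (simp add: beta_def mult_left_le_one_le)
 then show "beta x <= 1/2" using alpha_bounds(2)[of x] by linarith
 have "beta x * norm (nrm x) <= alpha x * norm (nrm x)" using 2 by (intro mult_right_mono) auto
 then show "norm (beta x *R nrm x) <= t / 2" using 1 alpha_bounds(3)[of x] by simp
qed

lemma error_small: "alpha x * norm (nrm x) * norm (geta x) <= 1/4"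
proof -
 have "alpha x * norm (nrm x) * norm (geta x) <= t / 2 * norm (geta x)" by (intro mult_right_mono alpha_bounds) auto
 then show ?thesis using eta(4)[of x] by simp
qed

text \<open>Of the directions in B, all but the radial one are stretched by 1 + tau beta; the last
  factor belongs to the radial one. There the decrease of \<open>alpha\<close> costs no more than
  beta gains, since b |nrm|^2 <= alpha, and only the gradient of the cut-off remains.\<close>

lemma jac_radial:
 assumes tau: "0 <= tau" "tau <= 1"
 shows "ldet (%h. h + tau *R (beta x *R proj B h + (gbeta x \<bullet> h) *R nrm x)) =
   (1 + tau * beta x) ^ (card B - 1) * (1 + tau * beta x + tau * (gbeta x \<bullet> nrm x))" (is ?eq)
  and "1 - alpha x * norm (nrm x) * norm (geta x) <= 1 + tau * beta x + tau * (gbeta x \<bullet> nrm x)" (is ?ge)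
proof -
 have pos: "0 < 1 + tau * beta x" using tau beta_bounds(1)[of x] by (simp add: add_pos_nonneg)
 have "ldet (%h. h + (tau * beta x) *R proj B h + ((tau *R gbeta x) \<bullet> h) *R nrm x) =
   (1 + tau * beta x) ^ card B * (1 + (tau *R gbeta x) \<bullet> ((1 / (1 + tau * beta x)) *R nrm x))"
 proof (rule ldet_proj_rank_one[OF on])
  have "(1 / (1 + tau * beta x)) *R nrm x + (tau * beta x) *R proj B ((1 / (1 + tau * beta x)) *R nrm x) =
    ((1 + tau * beta x) * (1 / (1 + tau * beta x))) *R nrm x"
   by (simp only: proj_scaleR proj_nrm scaleR_scaleR distrib_right mult_1_left scaleR_left_distrib)
  then show "(1 / (1 + tau * beta x)) *R nrm x + (tau * beta x) *R proj B ((1 / (1 + tau * beta x)) *R nrm x) = nrm x" using pos by simp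
 qed
 also have "... = (1 + tau * beta x) ^ (card B - 1) * ((1 + tau * beta x) * (1 + (tau *R gbeta x) \<bullet> ((1 / (1 + tau * beta x)) *R nrm x)))"
  using power_minus_mult[of "card B" "1 + tau * beta x"] card_B by simp
 also have "(1 + tau * beta x) * (1 + (tau *R gbeta x) \<bullet> ((1 / (1 + tau * beta x)) *R nrm x)) = 1 + tau * beta x + tau * (gbeta x \<bullet> nrm x)"
  using pos by (simp add: field_simps)
 finally show ?eq by (simp add: scaleR_right_distrib add.assoc)
 have "gbeta x \<bullet> nrm x = alpha x * (geta x \<bullet> nrm x) - eta x * (b x * (norm (nrm x))^2)"
  by (simp add: gbeta_def inner_diff_left power2_norm_eq_inner)
 moreover have "eta x * (b x * (norm (nrm x))^2) <= beta x" unfolding beta_def by (intro mult_left_mono alpha_bounds eta)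
 moreover have "abs (alpha x * (geta x \<bullet> nrm x)) <= alpha x * (norm (geta x) * norm (nrm x))"
  unfolding abs_mult using alpha_bounds(1)[of x] Cauchy_Schwarz_ineq2[of "geta x" "nrm x"] by (intro mult_mono) auto
 ultimately have "- (alpha x * norm (nrm x) * norm (geta x)) <= beta x + gbeta x \<bullet> nrm x" by (simp add: mult_ac abs_le_iff)
 then have "tau * (- (alpha x * norm (nrm x) * norm (geta x))) <= tau * (beta x + gbeta x \<bullet> nrm x)" using tau by (intro mult_left_mono) auto
 moreover have "tau * (alpha x * norm (nrm x) * norm (geta x)) <= alpha x * norm (nrm x) * norm (geta x)"
  using tau alpha_bounds(1)[of x] by (intro mult_left_le_one_le) auto
 ultimately show ?ge by (simp add: algebra_simps)
qed

lemma deformation_radial: "deformation B beta gbeta nrm"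
proof
 show "orthonormal B" by (rule on)
 show "C1 beta gbeta" by (rule C1_beta)
 show nd: "(nrm has_derivative proj B) (at x)" for x unfolding nrm_def[abs_def]
  by (rule has_derivative_eq_rhs[OF bounded_linear.has_derivative[OF bounded_linear_proj]]) (auto intro!: derivative_eq_intros)
 show "small_field (%x. beta x *R nrm x) (%x h. beta x *R proj B h + (gbeta x \<bullet> h) *R nrm x)" unfolding small_field_def
 proof (intro conjI allI ballI)
  fix x h :: 'a
  show "((%x. beta x *R nrm x) has_derivative (%h. beta x *R proj B h + (gbeta x \<bullet> h) *R nrm x)) (at x)"
   by (rule has_derivative_scaleR[OF C1D[OF C1_beta] nd])
  define z where "z = beta x *R proj B h - (eta x * b x * (nrm x \<bullet> proj B h)) *R nrm x"
  have ni: "nrm x \<bullet> proj B h = nrm x \<bullet> h" by (simp add: inner_proj_commute[symmetric] proj_nrm)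
  have "(norm z)^2 = (beta x)^2 * (norm (proj B h))^2 -
    (eta x * b x) * (nrm x \<bullet> proj B h)^2 * (2 * beta x - eta x * (b x * (norm (nrm x))^2))" unfolding z_def power2_norm_eq_inner
   by (simp add: inner_diff_left inner_diff_right inner_commute[of "proj B h" "nrm x"] power2_eq_square algebra_simps)
  also have "... <= (beta x)^2 * (norm (proj B h))^2"
  proof -
   have "eta x * (b x * (norm (nrm x))^2) <= beta x" unfolding beta_def by (intro mult_left_mono alpha_bounds eta)
   then show ?thesis using eta(2) alpha_bounds(4)[of x] beta_bounds(1)[of x] by simp
  qed
  also have "... <= (beta x)^2 * (norm h)^2" by (intro mult_left_mono power_mono norm_proj_le[OF on]) auto
  finally have "(norm z)^2 <= (beta x * norm h)^2" by (simp add: power_mult_distrib)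
  then have z: "norm z <= beta x * norm h" using beta_bounds(1)[of x] by (intro power2_le_imp_le[OF _ mult_nonneg_nonneg]) auto
  have "beta x *R proj B h + (gbeta x \<bullet> h) *R nrm x = z + (alpha x * (geta x \<bullet> h)) *R nrm x"
   by (simp add: z_def gbeta_def inner_diff_left ni algebra_simps)
  then have "norm (beta x *R proj B h + (gbeta x \<bullet> h) *R nrm x) <= norm z + norm ((alpha x * (geta x \<bullet> h)) *R nrm x)"
   using norm_triangle_ineq by metis
  also have "norm ((alpha x * (geta x \<bullet> h)) *R nrm x) = alpha x * norm (nrm x) * abs (geta x \<bullet> h)"
   using alpha_bounds(1)[of x] by (simp add: abs_mult)
  also have "... <= alpha x * norm (nrm x) * (norm (geta x) * norm h)" using alpha_bounds(1)[of x] by (intro mult_left_mono Cauchy_Schwarz_ineq2) auto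
  also have "... <= 1/4 * norm h" using mult_right_mono[OF error_small, of "norm h" x] by (simp add: mult.assoc)
  also have "norm z <= 1/2 * norm h" using z beta_bounds(3)[of x] mult_right_mono[of "beta x" "1/2" "norm h"] by simp
  finally show "norm (beta x *R proj B h + (gbeta x \<bullet> h) *R nrm x) <= 3/4 * norm h" by simp
 next
  fix tau :: real assume "tau : {0..1}"
  then have tau: "0 <= tau" "tau <= 1" by auto
  have cn: "continuous_on UNIV nrm" by (rule has_derivative_continuous_on[OF has_derivative_at_withinI[OF nd]])
  show "(%x. ldet (%h. h + tau *R (beta x *R proj B h + (gbeta x \<bullet> h) *R nrm x))) : borel_measurable borel" unfolding jac_radial(1)[OF tau]
   by (intro borel_measurable_continuous_onI continuous_intros C1_cont[OF C1_beta] C1_grad_cont[OF C1_beta] cn)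
  fix x
  have "1 * (1/2) <= (1 + tau * beta x) ^ (card B - 1) * (1 + tau * beta x + tau * (gbeta x \<bullet> nrm x))"
   using jac_radial(2)[OF tau, of x] error_small[of x] tau beta_bounds(1)[of x] by (intro mult_mono one_le_power) auto
  then show "1/2 <= ldet (%h. h + tau *R (beta x *R proj B h + (gbeta x \<bullet> h) *R nrm x))" unfolding jac_radial(1)[OF tau] by simp
 qed
qed

sublocale deformation B beta gbeta nrm by (rule deformation_radial)

text \<open>The gradient grows by at most (1 + beta)(1 + a), with a coming from the cut-off; the
  Jacobian is at least (1 + beta)^2 (1 - a), because B has at least two directions besides the
  radial one. The quotient is (1 + beta)^(p - 2) up to terms in a.\<close>

lemma radial_Adj_le:
 assumes p: "1 < p" "p < 2"
 shows "norm (Adj x k) powr p <=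
  jac x * (norm k powr p * (1 - (2 - p) / 2 * beta x + 4 * (t * norm (geta x))))"
proof -
 define a where "a = alpha x * norm (nrm x) * norm (geta x)"
 have a: "0 <= a" "a <= 1/2" "a <= t / 2 * norm (geta x)"
  using error_small[of x] alpha_bounds(1)[of x] mult_right_mono[OF alpha_bounds(3), of "norm (geta x)" x] by (auto simp: a_def)
 have beta: "0 <= beta x" "beta x <= 1/2" using beta_bounds by auto
 \<comment> \<open>The transposed derivative without the gradient of the cut-off; what is missing is
   at most a |k|.\<close>
 define xi where "xi = k + beta x *R proj B k - (eta x * b x * (nrm x \<bullet> k)) *R nrm x"
 have "norm xi <= (1 + beta x) * norm k" unfolding xi_def
 proof (rule norm_radial_adjoint_le[OF on proj_nrm beta(1)])
  show "0 <= eta x * b x" using eta(2) alpha_bounds(4)[of x] by simp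
  have "eta x * (b x * (norm (nrm x))^2) <= beta x" unfolding beta_def by (intro mult_left_mono alpha_bounds eta)
  then show "eta x * b x * (norm (nrm x))^2 <= 2 * (1 + beta x)" using beta by (simp add: mult.assoc)
 qed
 have eq: "Adj x k = xi + ((nrm x \<bullet> k) * alpha x) *R geta x" by (simp add: Adj_def xi_def gbeta_def algebra_simps)
 have "norm (((nrm x \<bullet> k) * alpha x) *R geta x) <= a * norm k"
 proof -
  have "norm (((nrm x \<bullet> k) * alpha x) *R geta x) = abs (nrm x \<bullet> k) * (alpha x * norm (geta x))"
   using alpha_bounds(1)[of x] by (simp add: abs_mult)
  also have "... <= (norm (nrm x) * norm k) * (alpha x * norm (geta x))"
   using alpha_bounds(1)[of x] by (intro mult_right_mono Cauchy_Schwarz_ineq2) auto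
  finally show ?thesis by (simp add: a_def mult_ac)
 qed
 then have "norm (Adj x k) <= (1 + beta x) * norm k + a * norm k"
  unfolding eq using \<open>norm xi <= _\<close> by (rule norm_triangle_le[OF add_mono, rotated])
 also have "... <= ((1 + beta x) * (1 + a)) * norm k"
  using mult_nonneg_nonneg[OF mult_nonneg_nonneg[OF beta(1) a(1)] norm_ge_zero[of k]] by (simp add: algebra_simps)
 finally have "norm (Adj x k) powr p <= (((1 + beta x) * (1 + a)) * norm k) powr p" using p by (intro powr_mono2) auto
 also have "... = (1 + beta x) powr p * (1 + a) powr p * norm k powr p" using beta a by (simp add: powr_mult)
 also have "(1 + beta x) powr p = (1 + beta x) powr (p - 2) * (1 + beta x)^2" using beta by (simp add: powr_diff power2_eq_square)
 finally have 1: "norm (Adj x k) powr p <= (1 + beta x) powr (p - 2) * (1 + beta x)^2 * (1 + a) powr p * norm k powr p" .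
 have J: "(1 + beta x)^2 * (1 - a) <= jac x"
 proof -
  have "(1 + beta x)^2 * (1 - a) <= (1 + beta x) ^ (card B - 1) * (1 + 1 * beta x + 1 * (gbeta x \<bullet> nrm x))"
   using jac_radial(2)[of 1 x] card_B a beta by (intro mult_mono power_increasing) (auto simp: a_def)
  then show ?thesis unfolding jac_def using jac_radial(1)[of 1 x] by simp
 qed
 have "(1 + beta x) powr (p - 2) * (1 + beta x)^2 * (1 + a) powr p * norm k powr p
   <= (1 + beta x) powr (p - 2) * (1 + beta x)^2 * ((1 - a) * (1 + 8 * a)) * norm k powr p"
  using a p by (intro mult_right_mono mult_left_mono one_plus_powr_le) auto
 also have "... = ((1 + beta x)^2 * (1 - a)) * ((1 + beta x) powr (p - 2) * (1 + 8 * a) * norm k powr p)" by (simp add: mult_ac)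
 also have "... <= jac x * ((1 + beta x) powr (p - 2) * (1 + 8 * a) * norm k powr p)" using a by (intro mult_right_mono J) auto
 also have "... <= jac x * ((1 - (2 - p) / 2 * beta x + 4 * (t * norm (geta x))) * norm k powr p)"
 proof (intro mult_left_mono mult_right_mono)
  have le1: "(1 + beta x) powr (p - 2) <= 1" using powr_mono[of "p - 2" 0 "1 + beta x"] p beta by simp
  have "(1 + beta x) powr (p - 2) * (1 + 8 * a) = (1 + beta x) powr (p - 2) + (1 + beta x) powr (p - 2) * (8 * a)" by (simp add: algebra_simps)
  also have "... <= (1 - (2 - p) / 2 * beta x) + 1 * (8 * a)" using le1 a by (intro add_mono powr_two_minus_le beta p mult_right_mono) auto
  finally show "(1 + beta x) powr (p - 2) * (1 + 8 * a) <= 1 - (2 - p) / 2 * beta x + 4 * (t * norm (geta x))" using a(3) by simp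
 qed (use jac_ge[of x] in auto)
 finally show ?thesis using 1 by (simp add: mult_ac)
qed
end

section \<open>Hyperplane arrangements\<close>

definition lv :: "'a::euclidean_space \<times> real => 'a => real" where "lv H x = fst H \<bullet> x - snd H"

lemma continuous_on_lv [continuous_intros]:
 "continuous_on S f ==> continuous_on S (%x. lv H (f x))" unfolding lv_def by (intro continuous_intros)

lemma lv_diff_le: "abs (lv H x - lv H y) <= norm (fst H) * norm (x - y)"
 using Cauchy_Schwarz_ineq2[of "fst H" "x - y"] by (simp add: lv_def inner_diff_right)

definition same_signs :: "('a::euclidean_space \<times> real) set => 'a => 'a => bool" where
 "same_signs HH x y \<longleftrightarrow> (ALL H:HH. sgn (lv H x) = sgn (lv H y))"

lemma same_signs_segment:
 assumes "same_signs HH x y" "z : closed_segment x y"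
 shows "same_signs HH x z" unfolding same_signs_def
proof
 fix H assume "H : HH"
 then have s: "sgn (lv H x) = sgn (lv H y)" using assms(1) by (simp add: same_signs_def)
 obtain u where u: "0 <= u" "u <= 1" "z = (1 - u) *R x + u *R y" using assms(2) by (auto simp: in_segment)
 have l: "lv H z = (1 - u) * lv H x + u * lv H y" unfolding u lv_def by (simp add: inner_add_right algebra_simps)
 consider "lv H x = 0" "lv H y = 0" | "0 < lv H x" "0 < lv H y" | "lv H x < 0" "lv H y < 0"
  using s by (metis sgn_0_0 sgn_greater sgn_less linorder_neqE_linordered_idom)
 then show "sgn (lv H x) = sgn (lv H z)"
 proof cases
  case 2
  then have "0 < lv H z" unfolding l using u by (cases "u = 0") (auto intro!: add_nonneg_pos)
  then show ?thesis using 2 by simp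
 next
  case 3
  have "(1 - u) * lv H x <= 0" "u * lv H y <= 0" using u 3 by (auto simp: mult_le_0_iff)
  moreover have "(1 - u) * lv H x ~= 0 \<or> u * lv H y ~= 0" using 3 by auto
  ultimately have "lv H z < 0" unfolding l by linarith
  then show ?thesis using 3 by simp
 qed (simp add: l)
qed

text \<open>The affine functions are those of the half-spaces cutting out the polytopes of the
  frontier. A segment between points of equal signs keeps the signs. If it met the frontier in a
  polytope P, then its endpoint in Om would satisfy the inequalities of P too and lie in the
  frontier, although Om is open.\<close>

lemma polyhedral_domain_signs:
 fixes Om :: "'a::euclidean_space set"
 assumes "polyhedral_domain Om"
 obtains HH where "finite HH" "!!x y. same_signs HH x y ==> x : Om ==> y : Om"
proof -
 obtain \<F> where F: "open Om" "finite \<F>" "!!P. P : \<F> ==> polytope P" "frontier Om = \<Union>\<F>"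
  using assms unfolding polyhedral_domain_def by blast
 have "ALL P:\<F>. EX A. finite A & (ALL x. x : P \<longleftrightarrow> (ALL H:A. lv H x <= 0))"
 proof
  fix P assume "P : \<F>"
  then have "polyhedron P" using F(3) polytope_imp_polyhedron by blast
  then obtain G where G: "finite G" "P = \<Inter>G" "ALL h:G. EX a b. a ~= 0 & h = {x. a \<bullet> x <= b}" unfolding polyhedron_def by blast
  have "ALL h:G. EX H. h = {x. lv H x <= 0}"
  proof
   fix h assume "h : G"
   then obtain a b where "h = {x. a \<bullet> x <= b}" using G(3) by blast
   then have "h = {x. lv (a, b) x <= 0}" by (simp add: lv_def)
   then show "EX H. h = {x. lv H x <= 0}" by blast
  qed
  then obtain c where c: "!!h. h : G ==> h = {x. lv (c h) x <= 0}" by metis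
  have "x : P \<longleftrightarrow> (ALL H:c ` G. lv H x <= 0)" for x unfolding G(2) using c by blast
  then show "EX A. finite A & (ALL x. x : P \<longleftrightarrow> (ALL H:A. lv H x <= 0))" using G(1) by (intro exI[of _ "c ` G"]) auto
 qed
 then obtain A where A: "!!P. P : \<F> ==> finite (A P)" "!!P x. P : \<F> ==> x : P \<longleftrightarrow> (ALL H:A P. lv H x <= 0)" by metis
 define HH where "HH = (\<Union>P\<in>\<F>. A P)"
 show ?thesis
 proof (rule that)
  show "finite HH" using A(1) F(2) by (auto simp: HH_def)
  fix x y assume xy: "same_signs HH x y" "x : Om"
  show "y : Om"
  proof (rule ccontr)
   assume "y ~: Om"
   then have "closed_segment x y Int frontier Om ~= {}" using xy(2) by (intro connected_Int_frontier) auto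
   then obtain z P where z: "z : closed_segment x y" "P : \<F>" "z : P" using F(4) by auto
   have "same_signs HH x z" by (rule same_signs_segment[OF xy(1) z(1)])
   then have "lv H x <= 0 \<longleftrightarrow> lv H z <= 0" if "H : A P" for H using that z(2) unfolding same_signs_def HH_def
    by (metis UN_I sgn_greater linorder_not_le)
   then have "x : P" using A(2)[OF z(2)] z(3) by blast
   then have "x : frontier Om" using F(4) z(2) by blast
   then show False using xy(2) F(1) by (simp add: frontier_def interior_open)
  qed
 qed
qed

section \<open>Flats of the arrangement and the distances to them\<close>

locale arrangement =
 fixes HH :: "('a::euclidean_space \<times> real) set"
 assumes finite_HH: "finite HH"
begin

text \<open>A flat is represented by a set of hyperplanes with a common point, so one affine
  subspace may occur several times; the empty set stands for the whole space, of codimension 0.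
  Below, \<open>base\<close> is a point of the flat, \<open>nbasis\<close> an orthonormal basis of
  its normal space, \<open>rad\<close> the distance to it, and \<open>near\<close> consists of the
  hyperplanes containing it.\<close>

definition flats :: "('a \<times> real) set set" where "flats = {I. I <= HH & (EX x. ALL H:I. lv H x = 0)}"

definition base :: "('a \<times> real) set => 'a" where "base I = (SOME x. ALL H:I. lv H x = 0)"

definition nbasis :: "('a \<times> real) set => 'a set" where "nbasis I = (SOME B. orthonormal B & span B = span (fst ` I) & card B = dim (fst ` I))"

definition codim :: "('a \<times> real) set => nat" where "codim I = dim (fst ` I)"

definition nrm :: "('a \<times> real) set => 'a => 'a" where "nrm I x = proj (nbasis I) (x - base I)"

abbreviation rad where "rad I x == norm (nrm I x)"

definition near :: "('a \<times> real) set => ('a \<times> real) set" where "near I = {H : HH. fst H : span (fst ` I) & lv H (base I) = 0}"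

definition far :: "('a \<times> real) set => ('a \<times> real) set" where "far I = HH - near I"

lemma finite_flats: "finite flats"
 unfolding flats_def using finite_HH by simp

lemma base: "I : flats ==> H : I ==> lv H (base I) = 0"
 unfolding flats_def base_def by (metis (mono_tags, lifting) mem_Collect_eq someI_ex)

lemma nbasis: "orthonormal (nbasis I)" "span (nbasis I) = span (fst ` I)" "card (nbasis I) = codim I"
proof -
 obtain B where B: "B <= span (fst ` I)" "pairwise orthogonal B" "!!x. x : B ==> norm x = 1"
  "independent B" "card B = dim (span (fst ` I))" "span B = span (fst ` I)" using orthonormal_basis_subspace[OF subspace_span[of "fst ` I"]] by blast
 have "EX B. orthonormal B & span B = span (fst ` I) & card B = dim (fst ` I)"
  using B by (intro exI[of _ B]) (auto simp: orthonormal_def independent_imp_finite dim_span)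
 from someI_ex[OF this]
 show "orthonormal (nbasis I)" "span (nbasis I) = span (fst ` I)" "card (nbasis I) = codim I" by (simp_all add: nbasis_def codim_def)
qed

lemma inner_nrm: "a : span (fst ` I) ==> a \<bullet> nrm I x = a \<bullet> (x - base I)"
 using proj_span[OF nbasis(1)[of I], of a] nbasis(2)[of I] unfolding nrm_def by (simp add: inner_proj_commute[symmetric])

lemma lv_near: "H : near I ==> lv H x = fst H \<bullet> nrm I x"
 by (simp add: near_def inner_nrm lv_def inner_diff_right)

lemma near_superset: "I : flats ==> I <= near I"
 using base[of I] by (auto simp: near_def flats_def intro: span_base)

lemma empty_flat: "{} : flats" by (simp add: flats_def)

lemma codim_empty: "codim {} = 0" by (simp add: codim_def)

lemma codim_le: "codim I <= DIM('a)" by (simp add: codim_def dim_subset_UNIV)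

text \<open>Each normal coordinate is a linear combination of the affine functions in I, by
  induction over the span of their normals.\<close>

lemma nrm_le_lv:
 assumes "I : flats"
 obtains C where "0 < C" "!!x. rad I x <= C * (SUM H:I. abs (lv H x))"
proof -
 have fI: "finite I" using assms finite_HH by (auto simp: flats_def intro: finite_subset)
 have S: "EX C>=0. ALL x. abs (b \<bullet> (x - base I)) <= C * (SUM H:I. abs (lv H x))" if "b : span (fst ` I)" for b using that
 proof (induction rule: span_induct_alt)
  case base
  show ?case by (intro exI[of _ 0]) auto
 next
  case (step c a z)
  then obtain C where C: "0 <= C" "!!x. abs (z \<bullet> (x - base I)) <= C * (SUM H:I. abs (lv H x))" by blast
  obtain H where H: "H : I" "a = fst H" using step.hyps(1) by auto
  have "abs ((c *R a + z) \<bullet> (x - base I)) <= (abs c + C) * (SUM H:I. abs (lv H x))" for x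
  proof -
   have "a \<bullet> (x - base I) = lv H x" using base[OF assms H(1)] by (simp add: lv_def H inner_diff_right)
   then have "abs ((c *R a + z) \<bullet> (x - base I)) <= abs c * abs (lv H x) + abs (z \<bullet> (x - base I))"
    by (simp add: inner_add_left abs_mult[symmetric])
   also have "... <= abs c * (SUM H:I. abs (lv H x)) + C * (SUM H:I. abs (lv H x))"
    by (intro add_mono mult_left_mono C member_le_sum H fI) auto
   finally show ?thesis by (simp add: distrib_right)
  qed
  then show ?case using C(1) by (intro exI[of _ "abs c + C"]) auto
 qed
 have "ALL b:nbasis I. EX C>=0. ALL x. abs (b \<bullet> (x - base I)) <= C * (SUM H:I. abs (lv H x))"
  using S nbasis(2) span_base by blast
 then obtain c where c: "!!b. b : nbasis I ==> 0 <= c b"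
  "!!b x. b : nbasis I ==> \<bar>b \<bullet> (x - base I)\<bar> <= c b * (SUM H:I. abs (lv H x))" by metis
 show ?thesis
 proof (rule that[of "1 + (SUM b:nbasis I. c b)"])
  show "0 < 1 + (SUM b:nbasis I. c b)" using c(1) by (simp add: sum_nonneg add_pos_nonneg)
  fix x
  have "rad I x <= (SUM b:nbasis I. norm (((x - base I) \<bullet> b) *R b))" unfolding nrm_def proj_def by (rule norm_sum)
  also have "... <= (SUM b:nbasis I. c b * (SUM H:I. abs (lv H x)))"
   using nbasis(1)[of I] c(2) by (intro sum_mono) (auto simp: orthonormal_def inner_commute)
  also have "... <= (1 + (SUM b:nbasis I. c b)) * (SUM H:I. abs (lv H x))" by (simp add: sum_distrib_right distrib_right sum_nonneg)
  finally show "rad I x <= (1 + (SUM b:nbasis I. c b)) * (SUM H:I. abs (lv H x))" .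
 qed
qed

lemma lv_base_diff:
 "fst H : span (fst ` I) ==> lv H x = lv H (base I) + fst H \<bullet> nrm I x" using inner_nrm[of "fst H" I x] by (simp add: lv_def inner_diff_right)

text \<open>From \<open>base I\<close>, the component of the normal of H orthogonal to the normals
  in I leads to H without leaving the flat.\<close>

lemma far_transversal:
 assumes I: "I : flats" and H: "H : HH" "fst H ~: span (fst ` I)"
 shows "insert H I : flats" "codim (insert H I) = codim I + 1"
proof -
 define u where "u = fst H - proj (nbasis I) (fst H)"
 have u0: "u ~= 0" using H(2) proj_in_span[of "nbasis I" "fst H"] nbasis(2)[of I] by (auto simp: u_def)
 have uI: "a \<bullet> u = 0" if "a : span (fst ` I)" for a using proj_span[OF nbasis(1)[of I], of a] that nbasis(2)[of I]
  by (simp add: u_def inner_diff_right inner_proj_commute[symmetric])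
 have "fst H \<bullet> u = u \<bullet> u" using uI[of "proj (nbasis I) (fst H)"] proj_in_span[of "nbasis I" "fst H"] nbasis(2)[of I]
  by (simp add: u_def inner_diff_left)
 then have Hu: "fst H \<bullet> u ~= 0" using u0 by simp
 define x where "x = base I - (lv H (base I) / (fst H \<bullet> u)) *R u"
 have "lv H x = 0" using Hu by (simp add: x_def lv_def inner_diff_right)
 moreover have "lv H' x = 0" if "H' : I" for H' using base[OF I that] uI[of "fst H'"] that by (simp add: x_def lv_def inner_diff_right span_base)
 ultimately show "insert H I : flats" using I H(1) by (auto simp: flats_def)
 show "codim (insert H I) = codim I + 1" using H(2) by (simp add: codim_def dim_insert)
qed

text \<open>The weight \<open>q t k\<close> is comparable to the inverse square of the distance to the flats of
 codimension greater than \<open>k\<close>, regularised at scale \<open>t\<close>.\<close>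

definition deeper :: "nat => ('a \<times> real) set set" where "deeper k = {J : flats. k < codim J}"

definition q :: "real => nat => 'a => real" where "q t k x = 1 + (SUM J:deeper k. inverse ((rad J x)^2 + t^2))"


abbreviation sq where "sq t k x == sqrt (q t k x)"

abbreviation cutoff where
 "cutoff C t k eta geta == C1 eta geta & (ALL x. 0 <= eta x & eta x <= 1) & (ALL x. norm (geta x) <= C * sq t k x)"
lemma finite_deeper: "finite (deeper k)"
 using finite_flats by (simp add: deeper_def)

lemma q_ge_1: "1 <= q t k x"
 unfolding q_def by (simp add: sum_nonneg)

lemma q_ge: "J : deeper k ==> inverse ((rad J x)^2 + t^2) <= q t k x"
 unfolding q_def using member_le_sum[of J "deeper k" "%J. inverse ((rad J x)^2 + t^2)"] finite_deeper[of k] by force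

text \<open>1 / \<open>sq\<close> plays the role of the distance to the deeper flats, as long as it
  is at least 2 t.\<close>

lemma nrm_ge:
 assumes J: "J : deeper k" and t: "0 < t" "2 * t * sq t k x <= 1"
 shows "1 / (2 * sq t k x) <= rad J x"
proof -
 have s: "1 <= sq t k x" using q_ge_1[of t k x] by simp
 have "1 <= q t k x * ((rad J x)^2 + t^2)"
 proof -
  have a: "0 < (rad J x)^2 + t^2" using t by (simp add: add_nonneg_pos)
  show ?thesis using mult_right_mono[OF q_ge[OF J, of x t] less_imp_le[OF a]] left_inverse[of "(rad J x)^2 + t^2"] a by linarith
 qed
 also have "... <= q t k x * (rad J x + t)^2" using q_ge_1[of t k x] t by (intro mult_left_mono) (auto simp: power2_sum)
 also have "... = (sq t k x * (rad J x + t))^2" using q_ge_1[of t k x] by (simp add: power_mult_distrib)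
 finally have "1 <= sq t k x * (rad J x + t)" using s t by (simp add: power2_nonneg_ge_1_iff)
 then have "1 <= 2 * sq t k x * rad J x" using t by (simp add: algebra_simps)
 then show ?thesis using s by (simp add: divide_le_eq mult.commute mult.left_commute)
qed

text \<open>Close to a flat, in relation to the deeper flats, a hyperplane not containing it stays
  away by a multiple of 1 / \<open>sq\<close>. If H is parallel to the flat, its affine function is
  a nonzero constant on it. Otherwise H cuts the flat in a deeper one, whose distance is at least 1
  / (2 \<open>sq\<close>) and at most a multiple of |lv H x| + rad I x.\<close>

lemma far_lower:
 assumes I: "I : flats" and H: "H : far I"
 obtains m c where "0 < m" "0 < c" "!!t x. 0 < t ==> 2 * t * sq t (codim I) x <= 1 ==>
    m * rad I x * sq t (codim I) x <= 1 ==>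
    c <= abs (lv H x) * sq t (codim I) x"
proof (cases "fst H : span (fst ` I)")
 case True
 define kap where "kap = abs (lv H (base I))"
 have kap: "0 < kap" using H True by (auto simp: kap_def far_def near_def)
 define m where "m = 2 * (norm (fst H) + 1) / kap"
 have m: "0 < m" using kap by (auto simp: m_def intro!: divide_pos_pos add_nonneg_pos)
 show ?thesis
 proof (rule that[OF m, of "kap / 2"])
  fix t x assume t: "0 < (t::real)"
  let ?s = "sq t (codim I) x"
  assume "2 * t * ?s <= 1" and *: "m * rad I x * ?s <= 1"
  have s: "1 <= ?s" using q_ge_1[of t "codim I" x] by simp
  have "norm (fst H) * rad I x <= (m * kap / 2) * rad I x" using kap by (intro mult_right_mono) (auto simp: m_def)
  then have "abs (fst H \<bullet> nrm I x) <= (m * kap / 2) * rad I x" using Cauchy_Schwarz_ineq2[of "fst H" "nrm I x"] by linarith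
  then have "kap - (m * kap / 2) * rad I x <= abs (lv H x)" using lv_base_diff[OF True, of x] by (simp add: kap_def)
  then have "(kap - (m * kap / 2) * rad I x) * ?s <= abs (lv H x) * ?s" using s by (intro mult_right_mono) auto
  moreover have "kap / 2 * (m * rad I x * ?s) <= kap / 2 * 1" using * kap by (intro mult_left_mono) auto
  moreover have "kap * 1 <= kap * ?s" using s kap by (intro mult_left_mono) auto
  ultimately show "kap / 2 <= abs (lv H x) * ?s" by (simp add: algebra_simps)
 qed (use kap in auto)
next
 case False
 have HH: "H : HH" using H by (simp add: far_def)
 define J where "J = insert H I"
 note J = far_transversal[OF I HH False, folded J_def]
 obtain C where C: "0 < C" "!!x. rad J x <= C * (SUM H:J. abs (lv H x))" using nrm_le_lv[OF J(1)] by blast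
 define N where "N = (SUM H:I. norm (fst H)) + 1"
 have N: "0 < N" by (simp add: N_def add_nonneg_pos sum_nonneg)
 have fI: "finite I" using I finite_HH by (auto simp: flats_def intro: finite_subset)
 have bound: "rad J x <= C * (abs (lv H x) + N * rad I x)" for x
 proof -
  have "(SUM H:J. abs (lv H x)) <= abs (lv H x) + (SUM H:I. abs (lv H x))"
   unfolding J_def using fI by (simp add: sum.insert_if)
  also have "(SUM H:I. abs (lv H x)) <= (SUM H:I. norm (fst H) * rad I x)"
  proof (rule sum_mono)
   fix H' assume "H' : I"
   then show "abs (lv H' x) <= norm (fst H') * rad I x"
    using Cauchy_Schwarz_ineq2[of "fst H'" "nrm I x"] lv_near[OF subsetD[OF near_superset[OF I]], of H' x] by simp
  qed
  also have "... <= N * rad I x" by (simp add: N_def sum_distrib_right[symmetric] distrib_right)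
  finally have "(SUM H:J. abs (lv H x)) <= abs (lv H x) + N * rad I x" by simp
  then show ?thesis using C by (intro order_trans[OF C(2) mult_left_mono]) auto
 qed
 define m where "m = 4 * C * N"
 show ?thesis
 proof (rule that[of m "1 / (4 * C)"])
  show "0 < m" "0 < 1 / (4 * C)" using C N by (auto simp: m_def)
  fix t x assume t: "0 < (t::real)"
  let ?s = "sq t (codim I) x"
  assume t2: "2 * t * ?s <= 1" and *: "m * rad I x * ?s <= 1"
  have s: "1 <= ?s" using q_ge_1[of t "codim I" x] by simp
  have "J : deeper (codim I)" using J by (simp add: deeper_def)
  from nrm_ge[OF this t t2] have "1 / 2 <= rad J x * ?s" using s by (simp add: field_simps)
  also have "... <= C * (abs (lv H x) + N * rad I x) * ?s" using s by (intro mult_right_mono bound) auto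
  also have "... = C * (abs (lv H x) * ?s) + m * rad I x * ?s / 4" by (simp add: m_def algebra_simps)
  finally have "1 / 4 <= C * (abs (lv H x) * ?s)" using * by simp
  then show "1 / (4 * C) <= abs (lv H x) * ?s" using C(1) by (simp add: field_simps)
 qed
qed

lemma far_lower_uniform:
 assumes I: "I : flats"
 obtains m c where "1 <= m" "0 < c" "!!t x H. 0 < t ==> 2 * t * sq t (codim I) x <= 1 ==>
    m * rad I x * sq t (codim I) x <= 1 ==> H : far I ==>
    c <= abs (lv H x) * sq t (codim I) x"
proof -
 have "ALL H:far I. EX m c. 0 < m & 0 < c & (ALL t x. 0 < t --> 2 * t * sq t (codim I) x <= 1 -->
    m * rad I x * sq t (codim I) x <= 1 --> c <= abs (lv H x) * sq t (codim I) x)" using far_lower[OF I] by metis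
 then obtain m c where mc: "!!H. H : far I ==> 0 < m H" "!!H. H : far I ==> 0 < c H"
  "!!H t x. H : far I ==> 0 < t ==> 2 * t * sq t (codim I) x <= 1 ==>
    m H * rad I x * sq t (codim I) x <= 1 ==> c H <= abs (lv H x) * sq t (codim I) x" by metis
 have fin: "finite (far I)" using finite_HH by (simp add: far_def)
 define M where "M = Max (insert 1 (m ` far I))"
 define c0 where "c0 = Min (insert 1 (c ` far I))"
 have c0: "0 < c0" "!!H. H : far I ==> c0 <= c H" using fin mc(2) by (auto simp: c0_def)
 have M: "1 <= M" "!!H. H : far I ==> m H <= M" using fin by (auto simp: M_def)
 show ?thesis
 proof (rule that[OF M(1) c0(1)])
  fix t x H assume a: "0 < t" "2 * t * sq t (codim I) x <= 1" "M * rad I x * sq t (codim I) x <= 1" "H : far I"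
  have "m H * (rad I x * sq t (codim I) x) <= M * (rad I x * sq t (codim I) x)"
   using M(2)[OF a(4)] q_ge_1[of t "codim I" x] by (intro mult_right_mono) auto
  then have "m H * rad I x * sq t (codim I) x <= 1" using a(3) by (simp add: mult.assoc)
  from mc(3)[OF a(4,1,2) this] c0(2)[OF a(4)]
  show "c0 <= abs (lv H x) * sq t (codim I) x" by simp
 qed
qed

text \<open>A gradient of order q^(3/2) means that q^(-1/2), a regularised distance, is Lipschitz
  with a constant depending neither on t nor on k.\<close>

lemma C1_q:
 assumes "0 < t"
 obtains gq where "C1 (q t k) gq" "!!x. norm (gq x) <= 2 * card flats * (q t k x * sq t k x)"
proof -
 define s where "s J x = (rad J x)^2 + t^2" for J x
 define gs where "gs J x = (- inverse ((s J x)^2)) *R (2 *R nrm J x)" for J x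
 have s: "0 < s J x" for J x using assms by (simp add: s_def add_nonneg_pos)
 have C: "C1 (%x. inverse (s J x)) (gs J)" for J unfolding gs_def
 proof (rule C1_compose_real[of _ _ inverse "%y. - inverse (y^2)"])
  show "C1 (s J) (%x. 2 *R nrm J x)" unfolding s_def[abs_def] nrm_def by (rule C1_norm_proj[OF nbasis(1)])
  show "(inverse has_field_derivative - inverse ((s J x)^2)) (at (s J x))" for x
   using s[of J x] DERIV_inverse[of "s J x"] by (simp add: power2_eq_square numeral_2_eq_2)
  show "continuous_on (range (s J)) (%y. - inverse (y^2))" using s by (auto intro!: continuous_intros simp: less_imp_neq[symmetric])
 qed
 define gq where "gq x = (SUM J:deeper k. gs J x)" for x
 have C': "C1 (%x. 1 + (SUM J:deeper k. inverse (s J x))) (%x. 0 + gq x)" unfolding gq_def by (intro C1_add C1_const C1_sum C)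
 have q_eq: "q t k x = 1 + (SUM J:deeper k. inverse (s J x))" for x by (simp add: q_def s_def)
 show ?thesis
 proof (rule that[of gq])
  show "C1 (q t k) gq" using C' unfolding q_eq[symmetric] by simp
  fix x
  have g: "norm (gs J x) <= 2 * (q t k x * sq t k x)" if J: "J : deeper k" for J
  proof -
   have i: "inverse (s J x) <= q t k x" using q_ge[OF J, of x t] by (simp add: s_def)
   have n: "rad J x <= sqrt (s J x)" by (rule real_le_rsqrt) (simp add: s_def)
   have "norm (gs J x) = 2 * (inverse (s J x) * inverse (s J x)) * rad J x" using s[of J x] by (simp add: gs_def power2_eq_square)
   also have "... <= 2 * (inverse (s J x) * inverse (s J x)) * sqrt (s J x)" using n s[of J x] by (intro mult_left_mono) auto
   also have "... = 2 * (inverse (s J x) * sqrt (inverse (s J x)))"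
   proof -
    define r where "r = sqrt (s J x)"
    have r: "0 < r" "s J x = r * r" "inverse r = sqrt (inverse (s J x))" using s[of J x] by (auto simp: r_def real_sqrt_inverse)
    then show ?thesis by (simp add: r(3)[symmetric] r_def[symmetric] r(2) field_simps)
   qed
   also have "... <= 2 * (q t k x * sq t k x)" using i s[of J x] q_ge_1[of t k x] by (intro mult_left_mono mult_mono) auto
   finally show ?thesis .
  qed
  have "norm (gq x) <= (SUM J:deeper k. norm (gs J x))" unfolding gq_def by (rule norm_sum)
  also have "... <= (SUM J:deeper k. 2 * (q t k x * sq t k x))" by (intro sum_mono g)
  also have "... = card (deeper k) * (2 * (q t k x * sq t k x))" by simp
  also have "... <= card flats * (2 * (q t k x * sq t k x))" using q_ge_1[of t k x] finite_flats
   by (intro mult_right_mono) (auto intro!: card_mono simp: deeper_def)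
  finally show "norm (gq x) <= 2 * card flats * (q t k x * sq t k x)" by (simp add: mult_ac)
 qed
qed
end

section \<open>Cut-off functions\<close>

lemma smooth_step:
 obtains phi phi' :: "real => real" and C where "!!s. (phi has_field_derivative phi' s) (at s)" "continuous_on UNIV phi'"
  "!!s. 0 <= phi s" "!!s. phi s <= 1" "!!s. s <= 0 ==> phi s = 0" "!!s. 1 <= s ==> phi s = 1"
  "!!s. s <= 0 ==> phi' s = 0" "!!s. 1 <= s ==> phi' s = 0" "0 <= C" "!!s. abs (phi' s) <= C"
proof -
 define M where "M s = (max 0 s)^2" for s :: real
 have dM: "(M has_field_derivative 2 * max 0 s) (at s)" for s
 proof -
  consider "s < 0" | "s = 0" | "0 < s" by linarith
  then show ?thesis
  proof cases
   case 1
   have "(M has_field_derivative 0) (at s)" by (rule has_field_derivative_transform_within_open[OF DERIV_const[of 0], of "{..<0}"])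
      (use 1 in "auto simp: M_def")
   then show ?thesis using 1 by simp
  next
   case 2
   have l: "((%h::real. max 0 h) \<longlongrightarrow> max 0 0) (at 0)" by (intro tendsto_intros)
   have "((%h. (M (0 + h) - M 0) / h) \<longlongrightarrow> max 0 0) (at 0)" by (rule Lim_transform_eventually[OF l])
      (auto simp: eventually_at_filter M_def power2_eq_square max_def)
   then show ?thesis using 2 by (simp add: DERIV_def)
  next
   case 3
   have "(M has_field_derivative 2 * s) (at s)" by (rule has_field_derivative_transform_within_open[of "%s. s^2" _ _ "{0<..}"])
      (use 3 in "auto simp: M_def intro!: derivative_eq_intros")
   then show ?thesis using 3 by simp
  qed
 qed
 define D where "D s = M s + M (1 - s)" for s
 have D: "0 < D s" for s unfolding D_def M_def by (cases "0 < s") (auto intro: add_pos_nonneg add_nonneg_pos)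
 define phi where "phi s = M s / D s" for s
 define phi' where "phi' s = (2 * max 0 s * D s - M s * (2 * max 0 s - 2 * max 0 (1 - s))) / (D s * D s)" for s
 have dD: "(D has_field_derivative 2 * max 0 s - 2 * max 0 (1 - s)) (at s)" for s
 proof -
  have "((%s. M (1 - s)) has_field_derivative (2 * max 0 (1 - s)) * (- 1)) (at s)" by (rule DERIV_chain2[OF dM]) (auto intro!: derivative_eq_intros)
  from DERIV_add[OF dM[of s] this] show ?thesis unfolding D_def[abs_def] by simp
 qed
 have c: "continuous_on UNIV M" unfolding M_def[abs_def] by (intro continuous_intros)
 have cD: "continuous_on UNIV D" unfolding D_def[abs_def] by (intro continuous_intros continuous_on_compose2[OF c]) auto
 have c': "continuous_on UNIV phi'" unfolding phi'_def[abs_def] using D by (intro continuous_intros c cD) (auto simp: less_imp_neq[symmetric])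
 have z: "phi' s = 0" if "s <= 0 \<or> 1 <= s" for s using that by (auto simp: phi'_def D_def M_def max_def power2_eq_square)
 have "bounded (phi' ` {0..1})" by (intro compact_imp_bounded compact_continuous_image continuous_on_subset[OF c']) auto
 then obtain C where C: "!!s. s : {0..1} ==> \<bar>phi' s\<bar> <= C" unfolding bounded_iff by fastforce
 show ?thesis
 proof (rule that[of phi phi' C])
  show "(phi has_field_derivative phi' s) (at s)" for s unfolding phi_def[abs_def] phi'_def using D[of s] by (intro DERIV_divide dM dD) auto
  show "0 <= phi s" "phi s <= 1" for s using D[of s] by (auto simp: phi_def D_def M_def divide_le_eq)
  show "phi s = 0" if "s <= 0" for s using that by (simp add: phi_def M_def)
  show "phi s = 1" if "1 <= s" for s using that by (simp add: phi_def M_def D_def)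
  show "0 <= C" using C[of 0] by force
  show "abs (phi' s) <= C" for s using C[of s] z[of s] C[of 0] by (cases "s : {0..1}") force+
 qed (use c' z in auto)
qed

context arrangement
begin

text \<open>A product of three cut-offs: the flat I is close in relation to the flats of codimension
  above k; these are not much closer than those of codimension above l; and 1 /
  \<open>sq t l\<close> exceeds a multiple of t. Where the product does not vanish, every factor has
  a gradient of order \<open>sq t l\<close>. The constant is independent of K, since the third
  factor only varies where K^2 t^2 q lies between 1 and 2; so K can be chosen afterwards in terms of
  C.\<close>

lemma cutoff_exists:
 assumes m: "1 <= m" and M: "1 <= M"
 obtains C where "0 <= C" "!!t K. 0 < t ==> EX eta geta. C1 eta geta & (ALL x. 0 <= eta x & eta x <= 1) &
   (ALL x. norm (geta x) <= C * sq t l x) &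
   (ALL x. m^2 * (rad I x)^2 * q t k x <= 1 --> q t k x <= M * q t l x --> K^2 * t^2 * q t l x <= 1 --> eta x = 1) &
   (ALL x. \<not> (m^2 * (rad I x)^2 * q t k x <= 2 & q t k x <= 2 * M * q t l x & K^2 * t^2 * q t l x <= 2) --> eta x = 0)"
proof -
 obtain phi phi' :: "real => real" and C0 where phi: "!!s. (phi has_field_derivative phi' s) (at s)" "continuous_on UNIV phi'"
  "!!s. 0 <= phi s" "!!s. phi s <= 1" "!!s. s <= 0 ==> phi s = 0" "!!s. 1 <= s ==> phi s = 1"
  "!!s. s <= 0 ==> phi' s = 0" "!!s. 1 <= s ==> phi' s = 0" "0 <= C0" "!!s. abs (phi' s) <= C0" by (rule smooth_step) (rule that; assumption)
 define N where "N = real (2 * card flats)"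
 have N: "0 <= N" by (simp add: N_def)
 define c1 where "c1 = (4 * m + 2 * N) * sqrt (2 * M)"
 define c2 where "c2 = 2 * N * (sqrt (2 * M) + 1)"
 define c3 where "c3 = 2 * N"
 have c: "0 <= c1" "0 <= c2" "0 <= c3" using N m M by (auto simp: c1_def c2_def c3_def)
 show ?thesis
 proof (rule that[of "C0 * (c1 + c2 + c3)"])
  show "0 <= C0 * (c1 + c2 + c3)" using phi(9) c by simp
  fix t K :: real assume t: "0 < t"
  obtain gk where gk: "C1 (q t k) gk" "!!x. norm (gk x) <= N * (q t k x * sq t k x)" unfolding N_def using C1_q[OF t, of k] by blast
  obtain gl where gl: "C1 (q t l) gl" "!!x. norm (gl x) <= N * (q t l x * sq t l x)" unfolding N_def using C1_q[OF t, of l] by blast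
  have q1: "1 <= q t k x" "1 <= q t l x" for x by (rule q_ge_1)+
  define rho where "rho x = rad I x" for x
  have rho: "0 <= rho x" for x by (simp add: rho_def)
  define F1 where "F1 x = 2 - m^2 * ((rho x)^2 * q t k x)" for x
  define G1 where "G1 x = 0 - m^2 *R ((rho x)^2 *R gk x + q t k x *R (2 *R nrm I x))" for x
  define F2 where "F2 x = 2 - (1 / M) * (q t k x * inverse (q t l x))" for x
  define G2 where "G2 x = 0 - (1 / M) *R (q t k x *R (- inverse ((q t l x)^2) *R gl x) + inverse (q t l x) *R gk x)" for x
  define F3 where "F3 x = 2 - K^2 * t^2 * q t l x" for x
  define G3 where "G3 x = 0 - (K^2 * t^2) *R gl x" for x
  have CF1: "C1 F1 G1" unfolding F1_def[abs_def] G1_def[abs_def]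
  proof (intro C1_diff C1_const C1_cmult C1_mult gk(1))
   show "C1 (%x. (rho x)^2) (%x. 2 *R nrm I x)" using C1_norm_proj[OF nbasis(1), of I "base I" 0] by (simp add: rho_def nrm_def)
  qed
  have Ci: "C1 (%x. inverse (q t l x)) (%x. - inverse ((q t l x)^2) *R gl x)"
  proof (rule C1_compose_real[OF gl(1), of inverse "%y. - inverse (y^2)"])
   show "(inverse has_field_derivative - inverse ((q t l x)^2)) (at (q t l x))" for x
    using q1(2)[of x] DERIV_inverse[of "q t l x"] by (simp add: power2_eq_square numeral_2_eq_2)
   have "y ~= 0" if y: "y : range (q t l)" for y
   proof -
    obtain x where "y = q t l x" using y by blast
    then show ?thesis using q1(2)[of x] by auto
   qed
   then show "continuous_on (range (q t l)) (%y. - inverse (y^2))" by (intro continuous_intros) auto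
  qed
  have CF2: "C1 F2 G2" unfolding F2_def[abs_def] G2_def[abs_def] by (intro C1_diff C1_const C1_cmult C1_mult gk(1) Ci)
  have CF3: "C1 F3 G3" unfolding F3_def[abs_def] G3_def[abs_def] by (intro C1_diff C1_const C1_cmult gl(1))
  have comp: "C1 (%x. phi (F x)) (%x. phi' (F x) *R G x)" if "C1 F G" for F :: "'a => real" and G
   by (rule C1_compose_real[OF that phi(1)]) (rule continuous_on_subset[OF phi(2)], simp)
  define eta where "eta x = phi (F1 x) * (phi (F2 x) * phi (F3 x))" for x
  define geta where "geta x = phi (F1 x) *R (phi (F2 x) *R (phi' (F3 x) *R G3 x) + phi (F3 x) *R (phi' (F2 x) *R G2 x))
    + (phi (F2 x) * phi (F3 x)) *R (phi' (F1 x) *R G1 x)" for x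
  have Ceta: "C1 eta geta" unfolding eta_def[abs_def] geta_def[abs_def] by (intro C1_mult comp CF1 CF2 CF3)
  have le: "q t k x <= 2 * M * q t l x" if "0 < F2 x" for x
  proof -
   have "(1 / M) * (q t k x * inverse (q t l x)) <= 2" using that by (simp add: F2_def)
   then show ?thesis using M q1(2)[of x] by (simp add: field_simps)
  qed
  have le_s: "sq t k x <= sqrt (2 * M) * sq t l x" if "0 < F2 x" for x using le[OF that] by (simp add: real_sqrt_mult[symmetric])
  have G1: "norm (G1 x) <= c1 * sq t l x" if "0 < F1 x" "0 < F2 x" for x
  proof -
   let ?Q = "q t k x" and ?s = "sq t k x"
   have s1: "0 <= ?s" "?s * ?s = ?Q" using q1(1)[of x] by auto
   have a: "m^2 * ((rho x)^2 * ?Q) <= 2" using that by (simp add: F1_def)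
   have "(m * rho x * ?s)^2 = m^2 * ((rho x)^2 * ?Q)" using q1(1)[of x] by (simp add: power_mult_distrib)
   then have "(m * rho x * ?s)^2 <= 2^2" using a by simp
   then have b: "m * rho x * ?s <= 2" by (rule power2_le_imp_le) simp
   have "norm (G1 x) <= m^2 * ((rho x)^2 * norm (gk x) + ?Q * (2 * rho x))" unfolding G1_def using q1(1)[of x]
    by (auto simp: rho_def abs_mult intro!: mult_left_mono norm_triangle_le)
   also have "... <= m^2 * ((rho x)^2 * (N * (?Q * ?s)) + ?Q * (2 * rho x))" using q1(1)[of x] by (intro mult_left_mono add_mono gk) auto
   also have "... = (m^2 * ((rho x)^2 * ?Q)) * (N * ?s) + (m * rho x * ?s) * (2 * m * ?s)"
   proof -
    have "m^2 * (R^2 * (N * (S * S * S)) + S * S * (2 * R)) = (m^2 * (R^2 * (S * S))) * (N * S) + (m * R * S) * (2 * m * S)"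
     for R S :: real by (simp add: power2_eq_square algebra_simps)
    from this[of "rho x" ?s] show ?thesis unfolding s1(2) .
   qed
   also have "... <= 2 * (N * ?s) + 2 * (2 * m * ?s)" using a b N m s1 by (intro add_mono mult_right_mono) auto
   also have "... = (4 * m + 2 * N) * ?s" by (simp add: algebra_simps)
   also have "... <= (4 * m + 2 * N) * (sqrt (2 * M) * sq t l x)" using m N by (intro mult_left_mono le_s that) auto
   finally show ?thesis by (simp add: c1_def mult.assoc)
  qed
  have G2: "norm (G2 x) <= c2 * sq t l x" if "0 < F2 x" for x
  proof -
   let ?Q = "q t k x" and ?L = "q t l x"
   have p: "0 < ?Q" "0 < ?L" using q1[of x] by auto
   have "norm (G2 x) <= (1 / M) * (?Q * (inverse (?L^2) * norm (gl x)) + inverse ?L * norm (gk x))"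
    unfolding G2_def using p M by (auto intro!: divide_right_mono order_trans[OF norm_triangle_ineq4])
   also have "... <= (1 / M) * (?Q * (inverse (?L^2) * (N * (?L * sqrt ?L))) + inverse ?L * (N * (?Q * sqrt ?Q)))"
    using p M by (intro mult_left_mono add_mono gk gl) auto
   also have "... = (?Q / (M * ?L)) * (N * (sqrt ?L + sqrt ?Q))" using p M by (simp add: field_simps power2_eq_square)
   also have "... <= 2 * (N * (sqrt ?L + sqrt (2 * M) * sqrt ?L))"
    using p M N le[OF that] le_s[OF that] by (intro mult_mono mult_left_mono add_left_mono) (auto simp: field_simps)
   finally show ?thesis by (simp add: c2_def algebra_simps)
  qed
  have G3: "norm (G3 x) <= c3 * sq t l x" if "0 < F3 x" for x
  proof -
   have "norm (G3 x) = K^2 * t^2 * norm (gl x)" by (simp add: G3_def)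
   also have "... <= K^2 * t^2 * (N * (q t l x * sq t l x))" by (intro mult_left_mono gl) auto
   also have "... = (K^2 * t^2 * q t l x) * (N * sq t l x)" by simp
   also have "... <= 2 * (N * sq t l x)" using that N q1(2)[of x] by (intro mult_right_mono) (auto simp: F3_def)
   finally show ?thesis by (simp add: c3_def)
  qed
  have prod: "norm ((a * b * d) *R v) <= C0 * B" if "abs a <= 1" "abs b <= 1" "abs d <= C0" "norm v <= B" for a b d B :: real and v :: 'a
  proof -
   have "abs (a * b) <= 1" using that mult_le_one[of "abs a" "abs b"] by (simp add: abs_mult)
   then have "abs (a * b) * abs d * norm v <= 1 * C0 * B" using that phi(9) by (intro mult_mono) auto
   then show ?thesis by (simp add: abs_mult)
  qed
  have ab: "abs (phi s) <= 1" for s using phi(3,4)[of s] by simp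
  have geta_le: "norm (geta x) <= C0 * (c1 + c2 + c3) * sq t l x" for x
  proof -
   have s: "0 <= sq t l x" using q1(2)[of x] by simp
   have "norm ((phi (F1 x) * phi (F2 x) * phi' (F3 x)) *R G3 x) <= C0 * (c3 * sq t l x)"
   proof (cases "0 < F3 x")
    case True then show ?thesis by (intro prod ab phi G3)
   qed (use phi(7,9) c s in auto)
   moreover have "norm ((phi (F1 x) * phi (F3 x) * phi' (F2 x)) *R G2 x) <= C0 * (c2 * sq t l x)"
   proof (cases "0 < F2 x")
    case True then show ?thesis by (intro prod ab phi G2)
   qed (use phi(7,9) c s in auto)
   moreover have "norm ((phi (F2 x) * phi (F3 x) * phi' (F1 x)) *R G1 x) <= C0 * (c1 * sq t l x)"
   proof (cases "0 < F1 x & 0 < F2 x")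
    case True then show ?thesis by (intro prod ab phi G1) auto
   next
    case False
    then have "phi' (F1 x) = 0 \<or> phi (F2 x) = 0" using phi(5,7) by (meson not_le)
    then show ?thesis using phi(9) c s by auto
   qed
   moreover have "geta x = (phi (F1 x) * phi (F2 x) * phi' (F3 x)) *R G3 x + (phi (F1 x) * phi (F3 x) * phi' (F2 x)) *R G2 x
     + (phi (F2 x) * phi (F3 x) * phi' (F1 x)) *R G1 x" by (simp add: geta_def scaleR_right_distrib mult.assoc)
   ultimately have "norm (geta x) <= C0 * (c3 * sq t l x) + C0 * (c2 * sq t l x) + C0 * (c1 * sq t l x)"
    by (metis norm_triangle_mono)
   then show ?thesis by (simp add: algebra_simps)
  qed
  show "EX eta geta. C1 eta geta & (ALL x. 0 <= eta x & eta x <= 1) & (ALL x. norm (geta x) <= C0 * (c1 + c2 + c3) * sq t l x) &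
   (ALL x. m^2 * (rad I x)^2 * q t k x <= 1 --> q t k x <= M * q t l x --> K^2 * t^2 * q t l x <= 1 --> eta x = 1) &
   (ALL x. \<not> (m^2 * (rad I x)^2 * q t k x <= 2 & q t k x <= 2 * M * q t l x & K^2 * t^2 * q t l x <= 2) --> eta x = 0)"
  proof (intro exI[of _ eta] exI[of _ geta] conjI allI impI Ceta geta_le)
   fix x
   show "0 <= eta x" using phi(3) by (simp add: eta_def)
   show "eta x <= 1" unfolding eta_def by (intro mult_le_one phi mult_nonneg_nonneg)
  next
   fix x assume a: "m^2 * (rad I x)^2 * q t k x <= 1" "q t k x <= M * q t l x" "K^2 * t^2 * q t l x <= 1"
   have "1 <= F1 x" using a by (simp add: F1_def rho_def mult.assoc)
   moreover have "(1 / M) * (q t k x * inverse (q t l x)) <= 1" using a(2) M q1(2)[of x] by (simp add: field_simps)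
   then have "1 <= F2 x" by (simp add: F2_def)
   moreover have "1 <= F3 x" using a by (simp add: F3_def)
   ultimately show "eta x = 1" by (simp add: eta_def phi(6))
  next
   fix x assume a: "\<not> (m^2 * (rad I x)^2 * q t k x <= 2 & q t k x <= 2 * M * q t l x & K^2 * t^2 * q t l x <= 2)"
   have "\<not> (0 < F1 x & 0 < F2 x & 0 < F3 x)" using a le[of x] by (auto simp: F1_def F3_def rho_def mult.assoc)
   then show "eta x = 0" using phi(5) by (auto simp: eta_def not_less)
  qed
 qed
qed
end

lemma C1_lipschitz_segment:
 assumes "C1 v g" "!!z. z : closed_segment x y ==> norm (g z) <= B"
 shows "abs (v x - v y) <= B * norm (x - y)"
proof -
 have "norm (v x - v y) <= B * norm (x - y)"
 proof (rule differentiable_bound[of "closed_segment x y" v "%z h. g z \<bullet> h"])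
  fix z assume z: "z : closed_segment x y"
  show "(v has_derivative (%h. g z \<bullet> h)) (at z within closed_segment x y)" by (rule has_derivative_at_withinI[OF C1D[OF assms(1)]])
  show "onorm (%h. g z \<bullet> h) <= B"
  proof (rule onorm_le)
   fix h
   show "norm (g z \<bullet> h) <= B * norm h" using Cauchy_Schwarz_ineq2[of "g z" h] mult_right_mono[OF assms(2)[OF z], of "norm h"] by simp
  qed
 qed auto
 then show ?thesis by simp
qed

context arrangement
begin

lemma continuous_q:
 assumes "0 < t" shows "continuous_on UNIV (q t k)" using C1_q[OF assms, of k] C1_cont by blast

text \<open>q^(-1/2) is Lipschitz with constant \<open>card flats\<close>, so a move by a small
  fraction of 1 / \<open>sq\<close> changes \<open>sq\<close> by at most a factor 2.\<close>

lemma sqrt_q_near: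
 assumes t: "0 < t" and xz: "2 * card flats * norm (z - x) * sq t k x <= 1"
 shows "sq t k z <= 2 * sq t k x" "sq t k x <= 2 * sq t k z"
proof -
 obtain gq where gq: "C1 (q t k) gq" "!!x. norm (gq x) <= real (2 * card flats) * (q t k x * sq t k x)" using C1_q[OF t, of k] by blast
 have q: "0 < q t k x" for x using q_ge_1[of t k x] by linarith
 define r where "r x = q t k x powr (-1/2)" for x
 define gr where "gr x = (-1/2 * q t k x powr (-1/2 - 1)) *R gq x" for x
 have r: "r x = 1 / sq t k x" for x using q[of x] by (simp add: r_def powr_minus_divide powr_half_sqrt)
 have "C1 (%x. (%s. s powr (-1/2)) (q t k x)) (%x. (%s. -1/2 * s powr (-1/2 - 1)) (q t k x) *R gq x)"
 proof (rule C1_compose_real[OF gq(1)])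
  show "((%s. s powr (-1/2)) has_field_derivative -1/2 * q t k x powr (-1/2 - 1)) (at (q t k x))" for x
   using q[of x] by (auto intro!: derivative_eq_intros)
  have "y ~= 0" if y: "y : range (q t k)" for y
  proof -
   obtain x where "y = q t k x" using y by blast
   then show ?thesis using q[of x] by auto
  qed
  then show "continuous_on (range (q t k)) (%s. -1/2 * s powr (-1/2 - 1))" by (intro continuous_intros) auto
 qed
 then have C: "C1 r gr" by (simp only: r_def[abs_def] gr_def[abs_def])
 have g: "norm (gr x) <= card flats" for x
 proof -
  have e: "q t k x powr (-1/2 - 1) * (q t k x * sq t k x) = 1"
  proof -
   have "q t k x * sq t k x = q t k x powr (1 + 1/2)" unfolding powr_add using q[of x] by (simp add: powr_half_sqrt)
   then show ?thesis using q[of x] by (simp add: powr_add[symmetric])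
  qed
  have "norm (gr x) = 1/2 * q t k x powr (-1/2 - 1) * norm (gq x)" by (simp add: gr_def)
  also have "... <= 1/2 * q t k x powr (-1/2 - 1) * (real (2 * card flats) * (q t k x * sq t k x))" by (intro mult_left_mono gq) auto
  also have "... = card flats * (q t k x powr (-1/2 - 1) * (q t k x * sq t k x))" by simp
  finally show ?thesis unfolding e by simp
 qed
 have "abs (r z - r x) <= card flats * norm (z - x)" by (rule C1_lipschitz_segment[OF C g])
 also have "card flats * norm (z - x) * 2 * sq t k x <= 1" using xz by (simp add: mult_ac)
 then have "card flats * norm (z - x) <= r x / 2" using q[of x] by (simp add: r field_simps)
 finally have d: "abs (r z - r x) <= r x / 2" .
 have rx: "0 < r x" "0 < r z" using q by (auto simp: r)
 have "r x <= 2 * r z" "r z <= 2 * r x" using d rx by linarith+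
 then show "sq t k z <= 2 * sq t k x" "sq t k x <= 2 * sq t k z" using q by (auto simp: r field_simps)
qed

text \<open>The terms of codimension k are split off by subadditivity of the root. This drives the
  induction from the weight of index k to that of index k - 1.\<close>

lemma sqrt_q_step:
 assumes "1 <= k"
 shows "sqrt (q t (k - 1) x) <= sq t k x + (SUM J:{J : flats. codim J = k}. inverse (sqrt ((rad J x)^2 + t^2)))"
proof -
 let ?A = "{J : flats. codim J = k}" and ?a = "%J. inverse ((rad J x)^2 + t^2)"
 have fin: "finite ?A" using finite_flats by simp
 have "deeper (k - 1) = deeper k Un ?A" "deeper k Int ?A = {}" using assms by (auto simp: deeper_def)
 then have "q t (k - 1) x = q t k x + (SUM J:?A. ?a J)" unfolding q_def by (simp add: sum.union_disjoint finite_deeper fin)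
 moreover have s: "sqrt (a + (SUM J:A. ?a J)) <= sqrt a + (SUM J:A. inverse (sqrt ((rad J x)^2 + t^2)))"
  if "finite A" "0 <= a" for a A using that
 proof (induction A arbitrary: a)
  case (insert J A)
  have "sqrt (a + (SUM J:insert J A. ?a J)) = sqrt ((a + ?a J) + (SUM J:A. ?a J))" using insert by (simp add: add.assoc)
  also have "... <= sqrt (a + ?a J) + (SUM J:A. inverse (sqrt ((rad J x)^2 + t^2)))" using insert by (intro insert.IH) auto
  also have "sqrt (a + ?a J) <= sqrt a + sqrt (?a J)" using insert by (intro sqrt_add_le_add_sqrt) auto
  finally show ?case using insert by (simp add: real_sqrt_inverse)
 qed auto
 ultimately show ?thesis using s[OF fin, of "q t k x"] q_ge_1[of t k x] by simp
qed
end

section \<open>Near minimisers\<close>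

text \<open>The linear term enters through \<open>L_diff\<close>, Hoelder's inequality in a Young
  form with a free parameter t: if the p-th power integral of v - w is at most D t^p, then L changes
  by at most t (F0 + D). In place of a minimiser there is the lower bound m on C1 functions with
  compact support.\<close>

locale variational = arrangement HH
 for HH :: "('a::euclidean_space \<times> real) set" +
 fixes Om :: "'a set" and p :: real and L :: "('a => real) => real" and F0 m :: real
 assumes open_Om: "open Om" and bounded_Om: "bounded Om"
  and signs: "!!x y. same_signs HH x y ==> x : Om ==> y : Om"
  and p: "1 < p" "p < 2"
  and F0: "0 <= F0"
  and L_diff: "!!v gv w gw t. C1c Om v gv ==> C1c Om w gw ==> 0 < t ==>
   abs (L v - L w) <= t * (F0 + (LBINT x. abs (v x - w x) powr p) / t powr p)"
  and lower: "!!v g. C1c Om v g ==> m <= Epow p g / p - L v"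
begin

definition En :: "('a => 'a) => real" where "En g = Epow p g"

abbreviation Ewt :: "real => nat => ('a => 'a) => real" where
 "Ewt t k g == (LBINT x. norm (g x) powr p * sq t k x)"

definition near_min :: "real => ('a => real) => ('a => 'a) => bool" where "near_min c v g \<longleftrightarrow> C1c Om v g & En g / p - L v <= m + c"

lemma near_minD: "near_min c v g ==> C1c Om v g" "near_min c v g ==> En g / p - L v <= m + c"
 by (auto simp: near_min_def)

lemma near_min_mono: "near_min c v g ==> c <= c' ==> near_min c' v g"
 by (auto simp: near_min_def)

lemma En_nonneg: "0 <= En g"
 unfolding En_def by (rule Bochner_Integration.integral_nonneg) simp

text \<open>The second part is the source of the estimates: a competitor at distance O(t) stays
  above m, so deforming v cannot lower the energy by more than O(c + t).\<close>

lemma near_min_change: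
 assumes v: "near_min c v g" and w: "C1c Om w gw" and t: "0 < t"
  and d: "(LBINT x. abs (w x - v x) powr p) <= D * t powr p"
 shows "En gw / p - L w <= m + c + (En gw - En g) / p + t * (F0 + D)"
  and "0 <= c + (En gw - En g) / p + t * (F0 + D)"
proof -
 have "abs (L w - L v) <= t * (F0 + (LBINT x. abs (w x - v x) powr p) / t powr p)" by (rule L_diff[OF w near_minD(1)[OF v] t])
 also have "... <= t * (F0 + D)" using d t by (intro mult_left_mono add_left_mono) (auto simp: divide_le_eq)
 finally show 1: "En gw / p - L w <= m + c + (En gw - En g) / p + t * (F0 + D)" using near_minD(2)[OF v] by (simp add: diff_divide_distrib)
 show "0 <= c + (En gw - En g) / p + t * (F0 + D)" using 1 lower[OF w] by (simp add: En_def)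
qed

text \<open>Translation by a vector of length 3 R moves the domain off itself, so v vanishes at x or
  at x + y, and |v x| is at most |v (x + y) - v x|.\<close>

lemma poincare:
 obtains C where "0 < C" "!!v g. C1c Om v g ==> (LBINT x. abs (v x) powr p) <= C * En g"
proof -
 obtain R where R: "0 < R" "!!x. x : Om ==> norm x <= R" using bounded_Om unfolding bounded_pos by blast
 obtain e :: 'a where e: "norm e = 1" using nonempty_Basis norm_Basis by blast
 define y where "y = (3 * R) *R e"
 have ny: "norm y = 3 * R" using R e by (simp add: y_def)
 have D: "deformation {} (%x. 1) (%x. 0) (%x. y)" by (rule translation_deformation) auto
 show ?thesis
 proof (rule that[of "2 * (3 * R) powr p"])
  show "0 < 2 * (3 * R) powr p" using R by simp
  fix v g assume v: "C1c Om v g"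
  obtain K where K: "K <= Om" "!!x. x ~: K ==> v x = 0" using C1cE[OF v] by metis
  have vz: "v x = 0 \<or> v (x + y) = 0" for x
  proof (rule ccontr)
   assume "\<not> (v x = 0 \<or> v (x + y) = 0)"
   then have "x : Om" "x + y : Om" using K by blast+
   then have "norm x <= R" "norm (x + y) <= R" using R by auto
   then have "norm y <= 2 * R" using norm_triangle_ineq4[of "x + y" x] by simp
   then show False using ny R by simp
  qed
  have "(LBINT x. abs (v x) powr p * 1) <= 2 * (3 * R) powr p * (LBINT x. norm (g x) powr p * 1)"
  proof (rule displacement_powr_le[OF v p(1) deformation.small[OF D]])
   show "continuous_on UNIV v" by (rule C1_cont[OF C1c_C1[OF v]])
   show "EX s>=0. s <= 1 & abs (v x) <= abs (v (x + s *R 1 *R y) - v x)" for x using vz[of x] by (intro exI[of _ 1]) auto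
  qed (use ny in auto)
  then show "(LBINT x. abs (v x) powr p) <= 2 * (3 * R) powr p * En g" by (simp add: En_def)
 qed
qed

lemma energy_bound:
 obtains E where "0 < E" "!!v g. near_min c v g ==> En g <= E"
proof -
 obtain CP where CP: "0 < CP" "!!v g. C1c Om v g ==> (LBINT x. abs (v x) powr p) <= CP * En g" using poincare by blast
 \<comment> \<open>With this t the linear term contributes the energy with coefficient t CP / t^p =
   1/(2 p), which is half of the coefficient 1/p in the functional.\<close>
 define t where "t = (2 * p * CP) powr (1 / (p - 1))"
 have t: "0 < t" using CP p by (simp add: t_def)
 have tp: "t * CP / t powr p = 1 / (2 * p)"
 proof -
  have "t powr (p - 1) = 2 * p * CP" using CP p by (simp add: t_def powr_powr)
  then have "t powr p = t * (2 * p * CP)" using powr_mult_self[of t p] t p by simp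
  then show ?thesis using t CP p by simp
 qed
 define E where "E = max 1 (2 * p * (m + c + L (%x. 0) + t * F0))"
 show ?thesis
 proof (rule that[of E])
  show "0 < E" by (simp add: E_def)
  fix v g assume v: "near_min c v g"
  have "abs (L v - L (%x. 0)) <= t * (F0 + (LBINT x. abs (v x - 0) powr p) / t powr p)" by (rule L_diff[OF near_minD(1)[OF v] C1c_zero t])
  also have "... <= t * (F0 + (CP * En g) / t powr p)"
   using CP(2)[OF near_minD(1)[OF v]] t by (intro mult_left_mono add_left_mono divide_right_mono) auto
  also have "... = t * F0 + (t * CP / t powr p) * En g" by (simp add: algebra_simps)
  finally have "L v <= L (%x. 0) + t * F0 + 1 / (2 * p) * En g" unfolding tp by linarith
  then have "En g / p <= m + c + L (%x. 0) + t * F0 + En g / (2 * p)" using near_minD(2)[OF v] by simp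
  then have "En g / (2 * p) <= m + c + L (%x. 0) + t * F0" using p by (simp add: field_simps)
  then have "En g <= 2 * p * (m + c + L (%x. 0) + t * F0)" using p by (simp add: field_simps)
  then show "En g <= E" by (simp add: E_def)
 qed
qed
end

context arrangement
begin

lemma nrm_add: "nrm I (x + y) = nrm I x + proj (nbasis I) y"
 unfolding nrm_def by (simp add: proj_add[symmetric] algebra_simps)

lemma proj_nrm: "proj (nbasis I) (nrm I x) = nrm I x"
 by (simp add: nrm_def nbasis(1))

lemma continuous_nrm: "continuous_on UNIV (nrm I)"
 unfolding nrm_def[abs_def] by (intro bounded_linear.continuous_on[OF bounded_linear_proj] continuous_intros)

lemma same_signs_near_far:
 assumes "!!H. H : near I ==> sgn (lv H x) = sgn (lv H y)" "!!H. H : far I ==> sgn (lv H x) = sgn (lv H y)"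
 shows "same_signs HH x y" using assms by (auto simp: same_signs_def far_def)

lemma sgn_lv_near_point:
 assumes "norm (fst H) * norm (y - x) < abs (lv H x)"
 shows "sgn (lv H y) = sgn (lv H x)"
proof -
 have "abs (lv H y - lv H x) < abs (lv H x)" using assms lv_diff_le[of H y x] by linarith
 then show ?thesis by (auto simp: sgn_if abs_if split: if_splits)
qed

lemma normal_bound: "H : HH ==> norm (fst H) <= (SUM H:HH. norm (fst H))"
 by (rule member_le_sum) (use finite_HH in auto)
end

section \<open>Weighted energy bounds, by downward induction on the codimension\<close>

context variational
begin

text \<open>Quantified over all slacks \<open>Lam\<close>, because near minimisers are deformed
  before the bound is used, and each deformation enlarges the slack.\<close>

definition weight_bounded :: "nat => bool" where
 "weight_bounded k \<longleftrightarrow> (ALL Lam>=0. EX C>=0. ALL t v g. 0 < t --> t <= 1 --> near_min (Lam * t) v g -->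
   Ewt t k g <= C)"

lemma integrable_weight:
 assumes "C1c Om v g" "continuous_on UNIV omega"
 shows "integrable lborel (%x. norm (g x) powr p * omega x)" using C1c_powr_weight[OF assms(1) _ assms(2), of p] p by simp

lemma integrable_grad: "C1c Om v g ==> integrable lborel (%x. norm (g x) powr p)"
 using C1c_powr[of Om v g p] p by simp

text \<open>Pushing away from a flat of codimension at least three lowers the energy: the Jacobian
 gains two powers of the stretching factor, the gradient loses only \<open>p < 2\<close>.\<close>

lemma flat_weight:
 assumes I: "I : flats" and k: "codim I = k" "3 <= k" and W: "weight_bounded k" and Lam: "0 <= Lam"
 shows "EX C>=0. ALL t v g. 0 < t --> t <= 1 --> near_min (Lam * t) v g -->
   (LBINT x. norm (g x) powr p * inverse (sqrt ((rad I x)^2 + t^2))) <= C"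
proof -
 obtain mm c where mc: "1 <= mm" "0 < c" "!!t x H. 0 < t ==> 2 * t * sq t k x <= 1 ==>
    mm * rad I x * sq t k x <= 1 ==> H : far I ==> c <= abs (lv H x) * sq t k x"
  using far_lower_uniform[OF I] unfolding k(1) by blast
 define m2 where "m2 = 2 * mm"
 have m2: "1 <= m2" using mc(1) by (simp add: m2_def)
 obtain Ceta where Ceta: "0 <= Ceta" "!!t K. 0 < t ==> EX eta geta. C1 eta geta & (ALL x. 0 <= eta x & eta x <= 1) &
   (ALL x. norm (geta x) <= Ceta * sq t k x) &
   (ALL x. m2^2 * (rad I x)^2 * q t k x <= 1 --> q t k x <= 1 * q t k x --> K^2 * t^2 * q t k x <= 1 --> eta x = 1) &
   (ALL x. \<not> (m2^2 * (rad I x)^2 * q t k x <= 2 & q t k x <= 2 * 1 * q t k x & K^2 * t^2 * q t k x <= 2) --> eta x = 0)"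
  using cutoff_exists[OF m2 order_refl, of k I k] by blast
 define A where "A = (SUM H:HH. norm (fst H)) + 1"
 have A: "1 <= A" by (simp add: A_def sum_nonneg)
 define N where "N = real (card flats)"
 \<comment> \<open>On the support of the cut-off K t \<open>sq\<close> <= 2. The summands ensure
   there that the lower bound for far hyperplanes applies (4), that a move by t/2 changes
   \<open>sq\<close> by at most a factor 2 (2 N), that t |grad eta| <= 1/2 (4 Ceta), and that no far
   hyperplane is reached (2 A / c).\<close>
 define K where "K = 4 + 2 * N + 4 * Ceta + 2 * A / c"
 have K: "4 <= K" "2 * N <= K" "4 * Ceta <= K" "2 * A / c <= K" using Ceta(1) A mc(2) by (auto simp: K_def N_def add_nonneg_nonneg)
 have K0: "0 < K" using K(1) by simp
 obtain E where E: "0 < E" "!!v g. near_min Lam v g ==> En g <= E" using energy_bound[of Lam] by blast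
 obtain CW where CW: "0 <= CW" "!!t v g. 0 < t ==> t <= 1 ==> near_min (Lam * t) v g ==> Ewt t k g <= CW"
  using W Lam unfolding weight_bounded_def by blast
 define c2 where "c2 = (2 - p) / 2"
 have c2: "0 < c2" "c2 <= 1/2" using p by (auto simp: c2_def)
 define C' where "C' = 10 * Ceta"
 have C': "0 <= C'" using Ceta by (simp add: C'_def)
 define G where "G = (p * (Lam + F0 + 2 * E) + C' * CW) / c2"
 have G: "0 <= G" using p Lam F0 E C' CW(1) c2 by (simp add: G_def)
 show ?thesis
 proof (intro exI[of _ "2 * G + (m2 + K) * CW"] conjI allI impI)
  show "0 <= 2 * G + (m2 + K) * CW" using G m2 K0 CW by simp
  fix t :: real and v g
  assume t: "0 < t" "t <= 1" and v: "near_min (Lam * t) v g"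
  note vC = near_minD(1)[OF v]
  obtain eta geta where eta: "C1 eta geta" "!!x. 0 <= eta x" "!!x. eta x <= 1" "!!x. norm (geta x) <= Ceta * sq t k x"
   "!!x. m2^2 * (rad I x)^2 * q t k x <= 1 ==> K^2 * t^2 * q t k x <= 1 ==> eta x = 1"
   "!!x. \<not> (m2^2 * (rad I x)^2 * q t k x <= 2 & K^2 * t^2 * q t k x <= 2) ==> eta x = 0"
  proof -
   assume r: "!!eta geta. C1 eta geta ==> (!!x. 0 <= eta x) ==> (!!x. eta x <= 1) ==> (!!x. norm (geta x) <= Ceta * sq t k x) ==>
    (!!x. m2^2 * (rad I x)^2 * q t k x <= 1 ==> K^2 * t^2 * q t k x <= 1 ==> eta x = 1) ==>
    (!!x. \<not> (m2^2 * (rad I x)^2 * q t k x <= 2 & K^2 * t^2 * q t k x <= 2) ==> eta x = 0) ==> thesis"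
   obtain eta geta where "cutoff Ceta t k eta geta &
    (ALL x. m2^2 * (rad I x)^2 * q t k x <= 1 --> q t k x <= 1 * q t k x --> K^2 * t^2 * q t k x <= 1 --> eta x = 1) &
    (ALL x. \<not> (m2^2 * (rad I x)^2 * q t k x <= 2 & q t k x <= 2 * 1 * q t k x & K^2 * t^2 * q t k x <= 2) --> eta x = 0)"
    using Ceta(2)[OF t(1), of K] by blast
   note h = this
   have q2: "q t k x <= 2 * 1 * q t k x" for x using q_ge_1[of t k x] by simp
   show thesis by (rule r[of eta geta]) (use h q2 in simp_all)
  qed
  have q1: "1 <= sq t k x" for x using q_ge_1[of t k x] by simp
  define T where "T = {x. m2^2 * (rad I x)^2 * q t k x <= 2} Int {x. K^2 * t^2 * q t k x <= 2}"
  have T: "closed T" unfolding T_def by (intro closed_Int closed_Collect_le continuous_intros continuous_nrm continuous_q t)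
  have etaT: "eta x = 0" if "x ~: T" for x using that eta(6)[of x] by (auto simp: T_def)
  have getaT: "geta x = 0" if "x ~: T" for x by (rule gradient_zero_off[OF eta(1) T etaT that])
  have sq: "a * sq t k x <= 2" if "a^2 * q t k x <= 2" "0 <= a" for a x
  proof -
   have "(a * sq t k x)^2 <= 2^2" using that q_ge_1[of t k x] by (simp add: power_mult_distrib)
   then show ?thesis by (rule power2_le_imp_le) simp
  qed
  have Tt: "K * t * sq t k x <= 2" "m2 * rad I x * sq t k x <= 2" if "x : T" for x
   using that t K0 m2 by (auto simp: T_def intro!: sq simp: power_mult_distrib)
  have Kt: "a * t * sq t k x <= 2 * (a / K)" if "x : T" "0 <= a" for a x
   using mult_left_mono[OF Tt(1)[OF that(1)], of "a / K"] that K0 by (simp add: field_simps)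
  have small: "t * norm (geta x) <= 1/2" for x
  proof (cases "x : T")
   case True
   have "t * norm (geta x) <= Ceta * t * sq t k x" using mult_left_mono[OF eta(4)[of x], of t] t by (simp add: mult_ac)
   also have "... <= 2 * (Ceta / K)" by (rule Kt[OF True Ceta(1)])
   also have "... <= 1/2" using K(3) K0 by (simp add: divide_le_eq)
   finally show ?thesis .
  qed (simp add: getaT)
  interpret rp: radial_push "nbasis I" "base I" t eta geta by unfold_locales (use nbasis[of I] k t eta small in auto)
  have rn: "rp.nrm x = nrm I x" for x by (simp add: rp.nrm_def nrm_def)
  have Pn: "nrm I (rp.Phi x) = (1 + rp.beta x) *R nrm I x" for x by (simp add: rp.Phi_def rn nrm_add proj_scaleR proj_nrm scaleR_left_distrib)
  have disp: "norm (rp.Phi x - x) <= t / 2" for x using rp.beta_bounds(4)[of x] by (simp add: rp.Phi_def)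
  have off: "rp.Phi x = x" "rp.beta x = 0" if "x ~: T" for x using etaT[OF that] by (auto simp: rp.Phi_def rp.beta_def)
  \<comment> \<open>Near hyperplanes contain the flat, so the stretch multiplies their affine
    functions by 1 + beta; far ones are out of reach.\<close>
  have same: "same_signs HH x (rp.Phi x)" if x: "x : T" for x
  proof (rule same_signs_near_far[of I])
   fix H assume "H : near I"
   then have "lv H (rp.Phi x) = (1 + rp.beta x) * lv H x" by (simp add: lv_near Pn)
   then show "sgn (lv H x) = sgn (lv H (rp.Phi x))" using rp.beta_bounds(1)[of x] by (simp add: sgn_mult)
  next
   fix H assume H: "H : far I"
   have "2 * t * sq t k x <= 2 * (2 / K)" by (rule Kt[OF x]) simp
   also have "... <= 1" using K(1) by (simp add: divide_le_eq)
   finally have "c <= abs (lv H x) * sq t k x" using mc(3)[OF t(1) _ _ H, of x] Tt(2)[OF x] by (simp add: m2_def)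
   moreover have "A * t * sq t k x <= 2 * (A / K)" using A by (intro Kt[OF x]) simp
   moreover have "2 * (A / K) <= c" using K(4) K0 mc(2) by (simp add: divide_le_eq mult.commute)
   ultimately have "A * t <= abs (lv H x)" using q1[of x]
    by (metis (no_types, lifting) mult_le_cancel_right order_trans not_le less_le_trans zero_less_one)
   moreover have "norm (fst H) * norm (rp.Phi x - x) <= A * (t / 2)"
    using normal_bound[of H] H disp[of x] A by (intro mult_mono) (auto simp: A_def far_def)
   moreover have "A * (t / 2) < A * t" using A t by simp
   ultimately have "norm (fst H) * norm (rp.Phi x - x) < abs (lv H x)" by linarith
   then show "sgn (lv H x) = sgn (lv H (rp.Phi x))" using sgn_lv_near_point by metis
  qed
  have push: "x : Om" if "x : T" "rp.Phi x : Om" for x using signs[OF _ that(2), of x] same[OF that(1)] by (simp add: same_signs_def)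
  obtain w gw where w: "C1c Om w gw" "!!x. gw x = (if x : Om then (if rp.Phi x : Om then rp.Adj x (g (rp.Phi x)) else 0) else g x)"
   "(LBINT x. abs (w x - v x) powr p) <= 2 * (t / 2) powr p * Epow p g"
  proof (rule rp.piece_competitor[OF vC open_Om p(1) T, of UNIV Om "t / 2"])
   show "rp.beta x = 0" if "x ~: T" for x by (rule off(2)[OF that])
   show "norm (rp.beta x *R rp.nrm x) <= t / 2" for x by (rule rp.beta_bounds(4))
   show "x : Om" if "x : T" "rp.Phi x : Om" for x by (rule push[OF that])
  qed (use open_Om in auto)
  \<comment> \<open>The gain must be expressed at the image point. From x to \<open>Phi x\<close>
    the cut-off changes by O(t \<open>sq\<close>) and \<open>alpha\<close> does not increase; the
    error goes into the term with C'.\<close>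
  define omega where "omega y = 1 - c2 * (eta y * rp.alpha y) + C' * (t * sq t k y)" for y
  have omegac: "continuous_on UNIV omega" unfolding omega_def[abs_def]
   by (intro continuous_intros continuous_q t C1_cont[OF eta(1)] C1_cont[OF rp.C1_alpha])
  have etaalpha: "0 <= eta x * rp.alpha x" "eta x * rp.alpha x <= 1/2" for x using rp.beta_bounds[of x] by (auto simp: rp.beta_def)
  have omega0: "0 <= omega x" for x
  proof -
   have "c2 * (eta x * rp.alpha x) <= 1/2 * (1/2)" using c2 etaalpha by (intro mult_mono) auto
   then show ?thesis using C' t q1[of x] by (simp add: omega_def add_nonneg_nonneg)
  qed
  have omegale: "1 - c2 * rp.beta x + 4 * (t * norm (geta x)) <= omega (rp.Phi x)" for x
  proof (cases "x : T")
   case False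
   then have "1 - c2 * rp.beta x + 4 * (t * norm (geta x)) = 1" by (simp add: off(2) getaT)
   moreover have "0 <= C' * (t * sq t k x)" using C' t q1[of x] by (intro mult_nonneg_nonneg) auto
   ultimately show ?thesis using False etaT[OF False] by (simp add: off(1) omega_def)
  next
   case True
   let ?y = "rp.Phi x"
   have near: "sq t k z <= 2 * sq t k x" "sq t k x <= 2 * sq t k z"
    if "norm (z - x) <= t / 2" for z
   proof -
    have "2 * N * norm (z - x) * sq t k x <= 2 * N * (t / 2) * sq t k x"
     using that by (intro mult_right_mono mult_left_mono) (use q1[of x] in "auto simp: N_def")
    also have "... = N * t * sq t k x" by simp
    also have "... <= 2 * (N / K)" by (rule Kt[OF True]) (simp add: N_def)
    also have "... <= 1" using K(2) K0 by (simp add: divide_le_eq)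
    finally have "2 * card flats * norm (z - x) * sq t k x <= 1" by (simp add: N_def)
    then show "sq t k z <= 2 * sq t k x" "sq t k x <= 2 * sq t k z" by (rule sqrt_q_near[OF t(1)])+
   qed
   have xy: "sq t k x <= 2 * sqrt (q t k ?y)" by (rule near(2)[OF disp])
   have "abs (eta ?y - eta x) <= (Ceta * (4 * sqrt (q t k ?y))) * norm (?y - x)"
   proof (rule C1_lipschitz_segment[OF eta(1)])
    fix z assume "z : closed_segment ?y x"
    then have "norm (z - x) <= norm (?y - x)" using segment_bound(2)[of z ?y x] by (simp add: norm_minus_commute)
    then have "norm (z - x) <= t / 2" using disp[of x] by linarith
    then have "sq t k z <= 4 * sqrt (q t k ?y)" using near(1)[of z] xy by linarith
    then show "norm (geta z) <= Ceta * (4 * sqrt (q t k ?y))" using eta(4)[of z] Ceta(1) mult_left_mono order_trans by blast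
   qed
   also have "... <= (Ceta * (4 * sqrt (q t k ?y))) * (t / 2)" using Ceta(1) q1[of ?y] disp[of x] by (intro mult_left_mono mult_nonneg_nonneg) auto
   finally have deta: "eta ?y - eta x <= 2 * Ceta * (t * sqrt (q t k ?y))" by (simp add: mult_ac)
   have alpha: "rp.alpha ?y <= rp.alpha x"
   proof -
    have "rad I x <= norm (nrm I ?y)" unfolding Pn using rp.beta_bounds(1)[of x] by (simp add: mult_le_cancel_right1)
    then have "rp.R2 x <= rp.R2 ?y" by (simp add: rp.R2_def rn power_mono)
    then have "rp.R2 ?y powr (-1/2) <= rp.R2 x powr (-1/2)" using rp.R2_ge(3)[of x] by (intro powr_mono2') auto
    then show ?thesis using t by (simp add: rp.alpha_def)
   qed
   have "eta ?y * rp.alpha ?y <= eta ?y * rp.alpha x" by (intro mult_left_mono alpha eta)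
   also have "... = rp.beta x + (eta ?y - eta x) * rp.alpha x" by (simp add: rp.beta_def algebra_simps)
   also have "(eta ?y - eta x) * rp.alpha x <= (2 * Ceta * (t * sqrt (q t k ?y))) * 1"
   proof -
    have "(eta ?y - eta x) * rp.alpha x <= (2 * Ceta * (t * sqrt (q t k ?y))) * rp.alpha x"
     using rp.alpha_bounds(1)[of x] by (intro mult_right_mono deta) auto
    also have "... <= (2 * Ceta * (t * sqrt (q t k ?y))) * 1"
     using rp.alpha_bounds(2)[of x] Ceta(1) t q1[of ?y] by (intro mult_left_mono mult_nonneg_nonneg) auto
    finally show ?thesis .
   qed
   finally have "c2 * (eta ?y * rp.alpha ?y) <= c2 * (rp.beta x + 2 * Ceta * (t * sqrt (q t k ?y)))" using c2 by (intro mult_left_mono) auto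
   also have "... <= c2 * rp.beta x + 1 * (2 * Ceta * (t * sqrt (q t k ?y)))" unfolding distrib_left using c2 Ceta(1) t q1[of ?y]
    by (intro add_left_mono mult_right_mono mult_nonneg_nonneg) auto
   finally have 1: "c2 * (eta ?y * rp.alpha ?y) <= c2 * rp.beta x + 2 * Ceta * (t * sqrt (q t k ?y))" by simp
   have "t * norm (geta x) <= t * (Ceta * (2 * sqrt (q t k ?y)))" using eta(4)[of x] mult_left_mono[OF xy Ceta(1)] t by (intro mult_left_mono) auto
   then have 2: "4 * (t * norm (geta x)) <= 8 * Ceta * (t * sqrt (q t k ?y))" by (simp add: mult_ac)
   show ?thesis using 1 2 by (simp add: omega_def C'_def algebra_simps)
  qed
  have "En gw <= (LBINT x. norm (g x) powr p * (if x : Om then omega x else 1))" unfolding En_def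
  proof (rule rp.piece_energy_le[OF vC w(1) p(1) w(2) _ omegac omega0])
   show "Om : sets borel" using open_Om by simp
   fix x
   have "norm (rp.Adj x (g (rp.Phi x))) powr p <=
     rp.jac x * (norm (g (rp.Phi x)) powr p * (1 - c2 * rp.beta x + 4 * (t * norm (geta x))))" unfolding c2_def by (rule rp.radial_Adj_le[OF p])
   also have "... <= rp.jac x * (norm (g (rp.Phi x)) powr p * omega (rp.Phi x))" using rp.jac_ge[of x] omegale[of x] by (intro mult_left_mono) auto
   finally show "norm (rp.Adj x (g (rp.Phi x))) powr p <= rp.jac x * (norm (g (rp.Phi x)) powr p * omega (rp.Phi x))" .
  qed
  also have "... = (LBINT x. norm (g x) powr p * omega x)"
  proof (rule Bochner_Integration.integral_cong[OF refl])
   obtain K where "K <= Om" "!!x. x ~: K ==> g x = 0" using C1cE[OF vC] by metis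
   then have "g x = 0" if "x ~: Om" for x using that by blast
   then show "norm (g x) powr p * (if x : Om then omega x else 1) = norm (g x) powr p * omega x" for x using p by auto
  qed
  also have "... = En g - c2 * (LBINT x. norm (g x) powr p * (eta x * rp.alpha x))
    + C' * (t * Ewt t k g)"
  proof -
   have i1: "integrable lborel (%x. norm (g x) powr p * (eta x * rp.alpha x))"
    by (intro integrable_weight[OF vC] continuous_intros C1_cont[OF eta(1)] C1_cont[OF rp.C1_alpha])
   have i2: "integrable lborel (%x. norm (g x) powr p * sq t k x)" by (intro integrable_weight[OF vC] continuous_intros continuous_q t)
   have "(LBINT x. norm (g x) powr p * omega x) =
    (LBINT x. norm (g x) powr p - c2 * (norm (g x) powr p * (eta x * rp.alpha x)) + C' * (t * (norm (g x) powr p * sq t k x)))"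
    by (rule Bochner_Integration.integral_cong) (auto simp: omega_def algebra_simps)
   then show ?thesis using i1 i2 integrable_grad[OF vC] by (simp add: En_def)
  qed
  finally have EnW: "En gw - En g <= C' * (t * CW) - c2 * (LBINT x. norm (g x) powr p * (eta x * rp.alpha x))"
   using mult_left_mono[OF mult_left_mono[OF CW(2)[OF t v], of t] C'] t by simp
  have Eg: "En g <= E" by (rule E(2)[OF near_min_mono[OF v]]) (use Lam t in "simp add: mult_left_le")
  have d: "(LBINT x. abs (w x - v x) powr p) <= (2 * E) * t powr p"
  proof -
   have "2 * (t / 2) powr p * En g <= 2 * t powr p * E" using t p Eg En_nonneg[of g] by (intro mult_mono powr_mono2) auto
   then show ?thesis using w(3) by (simp add: En_def mult_ac)
  qed
  \<comment> \<open>The energy cannot drop by more than O(t), and the weight of index k controls the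
    errors. So the integrated gain is O(t), and as \<open>alpha\<close> is t/2 times the singular
    weight, division by t leaves a bound independent of t.\<close>
  have "0 <= Lam * t + (En gw - En g) / p + t * (F0 + 2 * E)" by (rule near_min_change(2)[OF v w(1) t(1) d])
  also have "... <= Lam * t + (C' * (t * CW) - c2 * (LBINT x. norm (g x) powr p * (eta x * rp.alpha x))) / p + t * (F0 + 2 * E)"
   using EnW p by (intro add_mono divide_right_mono) auto
  finally have "c2 * (LBINT x. norm (g x) powr p * (eta x * rp.alpha x)) <= t * (p * (Lam + F0 + 2 * E) + C' * CW)" using p by (simp add: field_simps)
  then have gain: "(LBINT x. norm (g x) powr p * (eta x * rp.alpha x)) <= t * G" using c2 by (simp add: G_def field_simps)
  \<comment> \<open>Either eta = 1 and the singular weight is the gain term itself, or a condition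
    of the cut-off fails and the singular weight is at most a multiple of \<open>sq\<close>.\<close>
  have pw: "inverse (sqrt ((rad I x)^2 + t^2)) <= (2 / t) * (eta x * rp.alpha x) + (m2 + K) * sq t k x" for x
  proof -
   define R where "R = sqrt ((rad I x)^2 + t^2)"
   have R: "t <= R" "rad I x <= R" unfolding R_def by (auto intro!: real_le_rsqrt)
   have R0: "0 < R" using R t by linarith
   have nn: "0 <= (2 / t) * (eta x * rp.alpha x)" using etaalpha(1)[of x] t by simp
   have le: "inverse R <= a * sq t k x" if a: "1 < a^2 * z^2 * q t k x" "0 <= a" "0 <= z" "z <= R" for a z
   proof -
    have "1^2 < (a * z * sq t k x)^2" using a q_ge_1[of t k x] by (simp add: power_mult_distrib)
    then have "1 < a * z * sq t k x" using a by (intro power2_less_imp_less[of 1]) (auto simp: q_ge_1 order_trans[OF zero_le_one])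
    also have "... = a * sq t k x * z" by simp
    also have "... <= a * sq t k x * R" using a q1[of x] by (intro mult_left_mono) auto
    finally show ?thesis using R0 by (simp add: field_simps)
   qed
   have s: "m2 * sq t k x <= (m2 + K) * sq t k x" "K * sq t k x <= (m2 + K) * sq t k x"
    using m2 K0 q1[of x] by (auto intro!: mult_right_mono)
   consider "eta x = 1" | "1 < m2^2 * (rad I x)^2 * q t k x" | "1 < K^2 * t^2 * q t k x" using eta(5)[of x] by force
   then have "inverse R <= (2 / t) * (eta x * rp.alpha x) + (m2 + K) * sq t k x"
   proof cases
    case 1
    have "rp.alpha x = t / 2 * inverse R" by (simp add: rp.alpha_def rp.R2_def rn R_def powr_minus powr_half_sqrt)
    moreover have "(2 / t) * (1 * (t / 2 * inverse R)) = inverse R" using t by simp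
    ultimately have "(2 / t) * (eta x * rp.alpha x) = inverse R" using 1 by (simp only:)
    then show ?thesis using m2 K0 q1[of x] by simp
   next
    case 2
    then have "inverse R <= m2 * sq t k x" using m2 R(2) le[of m2 "rad I x"] by simp
    then show ?thesis using s nn by linarith
   next
    case 3
    then have "inverse R <= K * sq t k x" using K0 t R(1) le[of K t] by simp
    then show ?thesis using s nn by linarith
   qed
   then show ?thesis by (simp add: R_def)
  qed
  have cR: "continuous_on UNIV (%x. inverse (sqrt ((rad I x)^2 + t^2)))"
  proof (intro continuous_intros continuous_nrm ballI)
   fix x
   show "sqrt ((rad I x)^2 + t^2) ~= 0" using t by simp
  qed
  have "(LBINT x. norm (g x) powr p * inverse (sqrt ((rad I x)^2 + t^2))) <=
   (LBINT x. (2 / t) * (norm (g x) powr p * (eta x * rp.alpha x)) + (m2 + K) * (norm (g x) powr p * sq t k x))"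
  proof (rule integral_mono)
   show "integrable lborel (%x. norm (g x) powr p * inverse (sqrt ((rad I x)^2 + t^2)))" by (rule integrable_weight[OF vC cR])
   show "integrable lborel (%x. (2 / t) * (norm (g x) powr p * (eta x * rp.alpha x)) + (m2 + K) * (norm (g x) powr p * sq t k x))"
    by (intro Bochner_Integration.integrable_add integrable_mult_right integrable_weight[OF vC] continuous_intros
      C1_cont[OF eta(1)] C1_cont[OF rp.C1_alpha] continuous_q t)
   show "norm (g x) powr p * inverse (sqrt ((rad I x)^2 + t^2)) <=
    (2 / t) * (norm (g x) powr p * (eta x * rp.alpha x)) + (m2 + K) * (norm (g x) powr p * sq t k x)" for x
    using mult_left_mono[OF pw[of x], of "norm (g x) powr p"] by (simp add: algebra_simps)
  qed
  also have "... = (2 / t) * (LBINT x. norm (g x) powr p * (eta x * rp.alpha x)) + (m2 + K) * Ewt t k g"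
   by (subst Bochner_Integration.integral_add) (auto intro!: integrable_mult_right integrable_weight[OF vC] continuous_intros
      C1_cont[OF eta(1)] C1_cont[OF rp.C1_alpha] continuous_q t)
  also have "... <= (2 / t) * (t * G) + (m2 + K) * CW" using t m2 K0 by (intro add_mono mult_left_mono gain CW(2)[OF t v]) auto
  also have "... = 2 * G + (m2 + K) * CW" using t by simp
  finally show "(LBINT x. norm (g x) powr p * inverse (sqrt ((rad I x)^2 + t^2))) <= 2 * G + (m2 + K) * CW" .
 qed
qed

text \<open>No flat has codimension above the dimension, so the weight is 1 and the energy bound
  applies.\<close>

lemma weight_bounded_top: "weight_bounded DIM('a)"
 unfolding weight_bounded_def
proof (intro allI impI)
 fix Lam :: real assume Lam: "0 <= Lam"
 obtain E where E: "0 < E" "!!v g. near_min Lam v g ==> En g <= E" using energy_bound[of Lam] by blast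
 have "deeper DIM('a) = {}" using codim_le by (auto simp: deeper_def not_less)
 then have q: "q t DIM('a) x = 1" for t x by (simp add: q_def)
 have "En g <= E" if "t <= 1" "near_min (Lam * t) v g" for t v g
  by (rule E(2)[OF near_min_mono[OF that(2)]]) (use that Lam in "simp add: mult_left_le")
 then show "EX C>=0. ALL t v g. 0 < t --> t <= 1 --> near_min (Lam * t) v g --> (LBINT x. norm (g x) powr p * sqrt (q t DIM('a) x)) <= C"
  using E(1) by (intro exI[of _ E]) (auto simp: q En_def)
qed

lemma weight_bounded_step:
 assumes k: "3 <= k" and W: "weight_bounded k"
 shows "weight_bounded (k - 1)" unfolding weight_bounded_def
proof (intro allI impI)
 fix Lam :: real assume Lam: "0 <= Lam"
 let ?A = "{J : flats. codim J = k}"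
 let ?R = "%J t x. inverse (sqrt ((rad J x)^2 + t^2))"
 have fin: "finite ?A" using finite_flats by simp
 obtain C0 where C0: "0 <= C0" "!!t v g. 0 < t ==> t <= 1 ==> near_min (Lam * t) v g ==> Ewt t k g <= C0"
  using W Lam unfolding weight_bounded_def by blast
 have "ALL J:?A. EX C>=0. ALL t v g. 0 < t --> t <= 1 --> near_min (Lam * t) v g --> (LBINT x. norm (g x) powr p * ?R J t x) <= C"
  using flat_weight[OF _ _ k W Lam] by blast
 from bchoice[OF this] obtain C where CA: "ALL J:?A. 0 <= C J & (ALL t v g. 0 < t --> t <= 1 --> near_min (Lam * t) v g -->
   (LBINT x. norm (g x) powr p * ?R J t x) <= C J)" by blast
 have C: "0 <= C J" "!!t v g. 0 < t ==> t <= 1 ==> near_min (Lam * t) v g ==> (LBINT x. norm (g x) powr p * ?R J t x) <= C J"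
  if "J : ?A" for J using bspec[OF CA that] by blast+
 show "EX C>=0. ALL t v g. 0 < t --> t <= 1 --> near_min (Lam * t) v g --> (LBINT x. norm (g x) powr p * sqrt (q t (k - 1) x)) <= C"
 proof (intro exI[of _ "C0 + (SUM J:?A. C J)"] conjI allI impI)
  show "0 <= C0 + (SUM J:?A. C J)" using C0 C(1) by (intro add_nonneg_nonneg sum_nonneg) auto
  fix t v g assume t: "0 < t" "t <= 1" and v: "near_min (Lam * t) v g"
  note vC = near_minD(1)[OF v]
  have cR: "continuous_on UNIV (%x. ?R J t x)" for J using t by (intro continuous_intros continuous_nrm ballI) auto
  have i1: "integrable lborel (%x. norm (g x) powr p * sq t j x)" for j by (intro integrable_weight[OF vC] continuous_intros continuous_q t)
  have i2: "integrable lborel (%x. norm (g x) powr p * ?R J t x)" for J by (rule integrable_weight[OF vC cR])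
  have "(LBINT x. norm (g x) powr p * sqrt (q t (k - 1) x)) <=
    (LBINT x. norm (g x) powr p * sq t k x + (SUM J:?A. norm (g x) powr p * ?R J t x))"
  proof (rule integral_mono)
   show "integrable lborel (%x. norm (g x) powr p * sq t k x + (SUM J:?A. norm (g x) powr p * ?R J t x))"
    by (intro Bochner_Integration.integrable_add i1 Bochner_Integration.integrable_sum i2)
   fix x
   have "norm (g x) powr p * sqrt (q t (k - 1) x) <= norm (g x) powr p * (sq t k x + (SUM J:?A. ?R J t x))"
    using k by (intro mult_left_mono sqrt_q_step) auto
   then show "norm (g x) powr p * sqrt (q t (k - 1) x) <=
     norm (g x) powr p * sq t k x + (SUM J:?A. norm (g x) powr p * ?R J t x)" by (simp only: distrib_left sum_distrib_left)
  qed (rule i1)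
  also have "... = Ewt t k g + (SUM J:?A. (LBINT x. norm (g x) powr p * ?R J t x))"
   by (subst Bochner_Integration.integral_add) (auto intro!: i1 i2 Bochner_Integration.integrable_sum Bochner_Integration.integral_sum)
  also have "... <= C0 + (SUM J:?A. C J)" by (intro add_mono sum_mono C0(2)[OF t v] C(2)[OF _ t v])
  finally show "(LBINT x. norm (g x) powr p * sqrt (q t (k - 1) x)) <= C0 + (SUM J:?A. C J)" .
 qed
qed

lemma weight_bounded_two:
 assumes "2 <= DIM('a)"
 shows "weight_bounded 2" using assms
proof (induction rule: inc_induct)
 case base
 show ?case by (rule weight_bounded_top)
next
 case (step n)
 then show ?case using weight_bounded_step[of "Suc n"] by simp
qed
end

section \<open>Components of planar cones\<close>

text \<open>The circular cone is not convex for c < 0, when its opening exceeds pi. It is still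
  invariant under directions w with |c| |w| <= w . e, and the radius r = (1 - |c|)/(1 + |c|) is the
  solution of 1 - r = |c| (1 + r).\<close>

lemma icecream_cone_push:
 fixes e :: "'a::real_inner"
 assumes e: "norm e = 1" and c: "-1 < c" "c < 1"
  and w: "norm (w - e) <= (1 - abs c) / (1 + abs c)" and s: "0 <= s"
  and z: "c * norm z < z \<bullet> e"
 shows "c * norm (z + s *R w) < (z + s *R w) \<bullet> e"
proof -
 define r where "r = (1 - abs c) / (1 + abs c)"
 have r: "1 - r = abs c * (1 + r)" by (simp add: r_def field_simps)
 have "w \<bullet> e = 1 + (w - e) \<bullet> e" using e by (simp add: inner_diff_left norm_eq_1)
 moreover have "abs ((w - e) \<bullet> e) <= r" using Cauchy_Schwarz_ineq2[of "w - e" e] w e by (simp add: r_def)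
 moreover have "norm w <= 1 + r" using norm_triangle_ineq[of "w - e" e] w e by (simp add: r_def)
 then have "abs c * norm w <= abs c * (1 + r)" by (intro mult_left_mono) auto
 ultimately have w': "abs c * norm w <= w \<bullet> e" using r by (simp add: abs_le_iff)
 then have sw: "s * (abs c * norm w) <= s * (w \<bullet> e)" using s by (rule mult_left_mono)
 show ?thesis
 proof (cases "0 <= c")
  case True
  have "c * norm (z + s *R w) <= c * (norm z + s * norm w)" using norm_triangle_ineq[of z "s *R w"] s True by (intro mult_left_mono) auto
  then show ?thesis using True sw z by (simp add: inner_add_left algebra_simps)
 next
  case False
  have "norm z <= norm (z + s *R w) + s * norm w" using norm_triangle_ineq4[of "z + s *R w" "s *R w"] s by simp
  then have "c * (norm (z + s *R w) + s * norm w) <= c * norm z" using False by (intro mult_left_mono_neg) auto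
  then show ?thesis using False sw z by (simp add: inner_add_left algebra_simps)
 qed
qed

lemma open_connected_real:
 fixes A :: "real set"
 assumes "open A" "connected A" "A ~= {}" "bounded A"
 obtains a b where "a < b" "A = {a<..<b}"
proof -
 have iv: "is_interval A" using assms(2) by (simp add: is_interval_connected_1)
 have bd: "bdd_below A" "bdd_above A" using assms(4) by (auto simp: bounded_imp_bdd_above bounded_imp_bdd_below)
 have "A = {Inf A<..<Sup A}"
 proof (intro equalityI subsetI)
  fix x assume x: "x : A"
  obtain d where d: "0 < d" "!!y. dist y x < d ==> y : A" using assms(1) x unfolding open_dist by blast
  have "x - d / 2 : A" "x + d / 2 : A" using d by (auto simp: dist_real_def)
  then have "Inf A <= x - d / 2" "x + d / 2 <= Sup A" using bd by (auto intro: cInf_lower cSup_upper)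
  then show "x : {Inf A<..<Sup A}" using d(1) by auto
 next
  fix x assume x: "x : {Inf A<..<Sup A}"
  obtain y where y: "y : A" "y < x" using x assms(3) bd cInf_less_iff[of A x] by auto
  obtain z where z: "z : A" "x < z" using x assms(3) bd less_cSup_iff[of A x] by auto
  show "x : A" using iv y z unfolding is_interval_1 by (meson less_imp_le)
 qed
 moreover from this have "Inf A < Sup A" using assms(3) by (metis greaterThanLessThan_empty_iff not_le)
 ultimately show ?thesis using that by blast
qed

text \<open>Measuring angles from the bisector turns a sector of any opening below 2 pi, convex or
  not, into a circular cone.\<close>

lemma cos_less_iff_sector:
 assumes "0 <= alpha" "alpha < beta" "beta <= 2 * pi" "beta - alpha < 2 * pi" "0 <= phi" "phi <= 2 * pi"
 shows "cos ((beta - alpha) / 2) < cos (phi - (alpha + beta) / 2) \<longleftrightarrow> alpha < phi & phi < beta"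
proof -
 define h where "h = (beta - alpha) / 2"
 define x where "x = abs (phi - (alpha + beta) / 2)"
 have c: "cos (phi - (alpha + beta) / 2) = cos x" by (simp add: x_def)
 have h: "0 < h" "h < pi" using assms by (auto simp: h_def)
 have x: "0 <= x" "x <= 2 * pi - h" using assms by (auto simp: x_def h_def abs_le_iff field_simps)
 have iff: "alpha < phi & phi < beta \<longleftrightarrow> x < h" unfolding x_def h_def abs_less_iff by (auto simp: field_simps)
 have "cos h < cos x" if "x < h" using cos_monotone_0_pi[of x h] that x h by simp
 moreover have "cos x <= cos h" if "h <= x"
 proof (cases "x <= pi")
  case True then show ?thesis using cos_monotone_0_pi_le[of h x] that h by simp
 next
  case False
  have "cos x = cos (2 * pi - x)" by (simp add: cos_diff)
  also have "... <= cos h" using cos_monotone_0_pi_le[of h "2 * pi - x"] x False h by simp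
  finally show ?thesis .
 qed
 ultimately show ?thesis unfolding c iff h_def[symmetric] by (meson not_le)
qed

text \<open>The segment from z to s z stays in C, so it lies in one component.\<close>

lemma component_cone:
 fixes C :: "'a::real_normed_vector set"
 assumes cone: "!!z s. z : C ==> 0 < s ==> s *R z : C" and S: "S : components C" and z: "z : S" "0 < s"
 shows "s *R z : S"
proof -
 have zC: "z : C" using S z in_components_subset by blast
 have "closed_segment z (s *R z) <= C"
 proof
  fix w assume "w : closed_segment z (s *R z)"
  then obtain u where u: "0 <= u" "u <= 1" "w = (1 - u) *R z + u *R (s *R z)" by (auto simp: in_segment)
  then have "w = ((1 - u) + u * s) *R z" by (simp add: algebra_simps)
  moreover have "0 < (1 - u) + u * s" using u z(2) by (cases "u = 0") (auto intro: add_nonneg_pos)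
  ultimately show "w : C" using cone zC by simp
 qed
 then have "closed_segment z (s *R z) <= S" using S z(1) by (intro components_maximal[OF S]) auto
 then show ?thesis by auto
qed

text \<open>If 0 lies in C, then C is the plane. Otherwise, C not being the punctured plane, a whole
  ray is missing. Arguments measured from this ray lie in (0, 2 pi) and are continuous on C, so a
  component is a sector over an open interval of arguments. Its opening is below 2 pi, since C is
  not the plane minus the ray, and directions close to the bisector keep it invariant.\<close>

lemma planar_component_push:
 fixes C :: "complex set"
 assumes op: "open C" and cone: "!!z s. z : C ==> 0 < s ==> s *R z : C"
  and S: "S : components C"
  and pt: "C ~= - {0}" and ray: "!!u. norm u = 1 ==> C ~= - {r *R u |r. 0 <= r}"
 obtains e r where "norm e = 1" "0 < r" "r <= 1" "!!z w s. z : S ==> 0 <= s ==> norm (w - e) <= r ==> z + s *R w : S"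
proof (cases "0 : C")
 case True
 then obtain d where d: "0 < d" "ball 0 d <= C" using op open_contains_ball by blast
 have "z : C" for z
 proof -
  define s where "s = d / (2 * (norm z + 1))"
  have s: "0 < s" using d by (simp add: s_def add_nonneg_pos)
  have "norm (s *R z) < d" using d(1) by (simp add: s_def field_simps add_nonneg_pos add_strict_increasing)
  then have "s *R z : C" using d(2) by (auto simp: subset_iff)
  then have "(1 / s) *R (s *R z) : C" by (rule cone) (use s in auto)
  then show ?thesis using s by simp
 qed
 then have "C = UNIV" by blast
 then have "S = UNIV" using S components_eq_sing_iff[of UNIV] by auto
 then show ?thesis by (intro that[of 1 1]) auto
next
 case False
 obtain z0 where z0: "z0 ~= 0" "z0 ~: C" using pt False by blast
 define u where "u = (1 / norm z0) *R z0"
 have u: "norm u = 1" using z0 by (simp add: u_def)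
 have u0: "u ~= 0" using u by auto
 have uu: "cnj u * u = 1" using u complex_norm_square[of u] by (simp add: mult.commute)
 have uC: "r *R u ~: C" if "0 <= r" for r
 proof (cases "r = 0")
  case False
  show ?thesis
  proof
   assume "r *R u : C"
   then have "(norm z0 / r) *R (r *R u) : C" by (rule cone) (use False that z0 in auto)
   then show False using False z0 by (simp add: u_def)
  qed
 qed (use \<open>0 ~: C\<close> in simp)
 have SC: "S <= C" using S in_components_subset by blast
 have Sop: "open S" using op S open_components by blast
 have Sne: "S ~= {}" using S in_components_nonempty by blast
 have Scon: "connected S" using S in_components_connected by blast
 have Scone: "s *R z : S" if "z : S" "0 < s" for s z by (rule component_cone[OF cone S that])
 define A where "A z = Arg2pi (cnj u * z)" for z
 have rep: "z = norm z *R (u * cis (A z))" for z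
 proof -
  have "cnj u * z = norm (cnj u * z) * cis (A z)" using Arg2pi(1)[of "cnj u * z"] by (simp add: A_def is_Arg_def cis_conv_exp)
  also have "norm (cnj u * z) = norm z" using u by (simp add: norm_mult)
  finally have e: "cnj u * z = norm z * cis (A z)" .
  have "z = u * (cnj u * z)" using uu by (metis mult.assoc mult.commute mult_1)
  also have "... = norm z *R (u * cis (A z))" unfolding e by (simp add: scaleR_conv_of_real mult_ac)
  finally show ?thesis .
 qed
 have Ab: "0 <= A z" "A z < 2 * pi" for z using Arg2pi[of "cnj u * z"] by (auto simp: A_def)
 have nn: "cnj u * z ~: \<real>\<^sub>\<ge>\<^sub>0" if "z : C" for z
 proof
  assume "cnj u * z : \<real>\<^sub>\<ge>\<^sub>0"
  then obtain r where r: "0 <= r" "cnj u * z = of_real r" by (auto simp: nonneg_Reals_def)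
  have "z = u * (cnj u * z)" using uu by (metis mult.assoc mult.commute mult_1)
  then have "z = r *R u" unfolding r(2) by (simp add: scaleR_conv_of_real mult.commute)
  then show False using uC[OF r(1)] that by simp
 qed
 have A0: "0 < A z" if "z : C" for z
 proof -
  have "A z ~= 0" using nn[OF that] by (auto simp: A_def Arg2pi_eq_0 complex_nonneg_Reals_iff complex_is_Real_iff)
  then show ?thesis using Ab(1)[of z] by simp
 qed
 have Acis: "A (u * cis theta) = theta" if "0 <= theta" "theta < 2 * pi" for theta
 proof -
  have e: "cnj u * (u * cis theta) = cis theta" using uu by (metis mult.assoc mult_1)
  show ?thesis unfolding A_def e by (rule Arg2pi_unique[of 1]) (use that in "auto simp: cis_conv_exp")
 qed
 define O' where "O' = A ` S"
 have memS: "z : S" if z: "z ~= 0" "A z : O'" for z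
 proof -
  obtain w where w: "w : S" "A z = A w" using z(2) by (auto simp: O'_def)
  have w0: "w ~= 0" using w SC False by blast
  have "(norm z / norm w) *R (norm w *R (u * cis (A w))) = norm z *R (u * cis (A w))" using w0 by simp
  then have "(norm z / norm w) *R w = z" using rep[of z] rep[of w] w(2) by metis
  then show ?thesis using Scone[OF w(1), of "norm z / norm w"] w0 z(1) by simp
 qed
 have O_eq: "O' = {0<..<2*pi} Int (%theta. u * cis theta) -` S"
 proof (intro equalityI subsetI)
  fix theta assume "theta : O'"
  then obtain w where w: "w : S" "theta = A w" by (auto simp: O'_def)
  have b: "0 < theta" "theta < 2 * pi" using A0[of w] Ab[of w] w SC by auto
  have "u * cis theta : S" by (rule memS) (use u0 b w in "auto simp: Acis O'_def")
  then show "theta : {0<..<2*pi} Int (%theta. u * cis theta) -` S" using b by auto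
 next
  fix theta assume "theta : {0<..<2*pi} Int (%theta. u * cis theta) -` S"
  then show "theta : O'" unfolding O'_def by (intro image_eqI[of _ _ "u * cis theta"]) (auto simp: Acis)
 qed
 have Oop: "open O'" unfolding O_eq by (intro open_Int open_vimage Sop continuous_intros open_greaterThanLessThan)
 have cA: "continuous_on S A" unfolding continuous_on_eq_continuous_within
 proof
  fix z assume "z : S"
  then have "isCont Arg2pi (cnj u * z)" using nn SC by (intro continuous_at_Arg2pi) auto
  moreover have "isCont (%z. cnj u * z) z" by (intro continuous_intros)
  ultimately have "isCont A z" unfolding A_def[abs_def] by (rule isCont_o2[rotated])
  then show "continuous (at z within S) A" by (rule continuous_at_imp_continuous_at_within)
 qed
 have Ocon: "connected O'" unfolding O'_def by (rule connected_continuous_image[OF cA Scon])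
 have Obd: "bounded O'" unfolding O_eq by (rule bounded_subset[of "{0<..<2*pi}"]) auto
 obtain alpha beta where ab: "alpha < beta" "O' = {alpha<..<beta}" using open_connected_real[OF Oop Ocon _ Obd] Sne by (auto simp: O'_def)
 have sub: "{alpha<..<beta} <= {0<..<2*pi}" using O_eq ab(2) by auto
 then have ab2: "0 <= alpha" "beta <= 2 * pi" using ab(1) by (auto simp: greaterThanLessThan_subseteq_greaterThanLessThan)
 have lt: "beta - alpha < 2 * pi"
 proof (rule ccontr)
  assume "\<not> beta - alpha < 2 * pi"
  then have full: "alpha = 0" "beta = 2 * pi" using ab2 by auto
  have "C = - {r *R u |r. 0 <= r}"
  proof (intro equalityI subsetI)
   fix z assume "z : C" then show "z : - {r *R u |r. 0 <= r}" using uC by auto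
  next
   fix z assume z: "z : - {r *R u |r. 0 <= r}"
   have "z ~= 0" using z by (auto intro: exI[of _ 0])
   moreover have "A z ~= 0"
   proof
    assume "A z = 0"
    then have "z = norm z *R u" using rep[of z] by simp
    then show False using z by (metis (mono_tags, lifting) ComplD mem_Collect_eq norm_ge_zero)
   qed
   then have "A z : O'" using Ab[of z] by (simp add: ab(2) full)
   ultimately show "z : C" using memS SC by blast
  qed
  then show False using ray[OF u] by blast
 qed
 define mid where "mid = (alpha + beta) / 2"
 define c where "c = cos ((beta - alpha) / 2)"
 define e where "e = u * cis mid"
 have e: "norm e = 1" using u by (simp add: e_def norm_mult)
 have hb: "0 < (beta - alpha) / 2" "(beta - alpha) / 2 < pi" using ab(1) lt by auto
 have c: "-1 < c" "c < 1" using cos_monotone_0_pi[of "(beta - alpha) / 2" pi] cos_monotone_0_pi[of 0 "(beta - alpha) / 2"] hb by (auto simp: c_def)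
 have inn: "z \<bullet> e = norm z * cos (A z - mid)" for z
 proof -
  have "z \<bullet> e = Re (z * cnj e)" by (simp add: inner_complex_def)
  also have "z * cnj e = norm z * ((cnj u * u) * (cis (A z) * cnj (cis mid)))" by (subst rep) (simp add: e_def scaleR_conv_of_real mult_ac)
  also have "... = norm z * cis (A z - mid)" unfolding uu by (simp add: cis_cnj cis_mult)
  finally show ?thesis by simp
 qed
 have Seq: "z : S \<longleftrightarrow> c * norm z < z \<bullet> e" for z
 proof (cases "z = 0")
  case True then show ?thesis using SC False by auto
 next
  case z: False
  have "z : S \<longleftrightarrow> A z : O'" using memS[OF z] by (auto simp: O'_def)
  also have "... \<longleftrightarrow> c < cos (A z - mid)"
   using cos_less_iff_sector[OF ab2(1) ab(1) ab2(2) lt, of "A z"] Ab[of z] by (simp add: ab(2) c_def mid_def)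
  also have "... \<longleftrightarrow> c * norm z < z \<bullet> e" unfolding inn using z by (simp add: mult.commute)
  finally show ?thesis .
 qed
 show ?thesis
 proof (rule that[OF e, of "(1 - abs c) / (1 + abs c)"])
  show "0 < (1 - abs c) / (1 + abs c)" "(1 - abs c) / (1 + abs c) <= 1" using c by (auto simp: divide_simps abs_if)
  fix z w s assume "z : S" "0 <= (s::real)" "norm (w - e) <= (1 - abs c) / (1 + abs c)"
  then show "z + s *R w : S" unfolding Seq using icecream_cone_push[OF e c] by blast
 qed
qed

section \<open>Pieces near flats of codimension at most two\<close>

lemma subspace_superset_dim:
 fixes V :: "'a::euclidean_space set"
 assumes "subspace V" "dim V <= n" "n <= DIM('a)"
 shows "EX W. subspace W & V <= W & dim W = n" using assms
proof (induction "n - dim V" arbitrary: V)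
 case 0
 then show ?case by (intro exI[of _ V]) auto
next
 case (Suc m)
 then have "dim V < DIM('a)" by simp
 then have "V ~= UNIV" by auto
 then obtain x where x: "x ~: V" by blast
 have "span V = V" using Suc.prems(1) by (simp add: span_eq_iff)
 then have xs: "x ~: span V" using x by metis
 have d: "dim (insert x V) = dim V + 1" by (simp add: dim_insert xs)
 have "EX W. subspace W & span (insert x V) <= W & dim W = n"
 proof (rule Suc.hyps(1))
  show "m = n - dim (span (insert x V))" "dim (span (insert x V)) <= n" using Suc.hyps(2) by (simp_all only: dim_span d)
 qed (use Suc.prems in "auto simp: subspace_span")
 then obtain W where "subspace W" "span (insert x V) <= W" "dim W = n" by blast
 then show ?case using span_superset[of "insert x V"] by (intro exI[of _ W]) auto
qed

text \<open>The normal space is enlarged to a plane, so that flats of codimension 0, 1 and 2 are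
  treated alike.\<close>

lemma orthonormal_pair_span:
 fixes V :: "'a::euclidean_space set"
 assumes "dim V <= 2" "2 <= DIM('a)"
 obtains b1 b2 where "norm b1 = 1" "norm b2 = 1" "b1 \<bullet> b2 = 0" "V <= span {b1, b2}"
proof -
 obtain W where W: "subspace W" "span V <= W" "dim W = 2" using subspace_superset_dim[OF subspace_span[of V], of 2] assms by (auto simp: dim_span)
 obtain B where B: "pairwise orthogonal B" "!!x. x : B ==> norm x = 1" "card B = dim W" "span B = W"
  using orthonormal_basis_subspace[OF W(1)] by metis
 obtain b1 b2 where b: "B = {b1, b2}" "b1 ~= b2" using B(3) W(3) by (auto simp: card_2_iff)
 show ?thesis by (rule that[of b1 b2]) (use B b W(2) span_superset[of V] in "auto simp: pairwise_def orthogonal_def")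
qed

text \<open>Complex coordinates in the plane of \<open>b1\<close> and \<open>b2\<close>, which make
  arguments available.\<close>

definition coord :: "'a::euclidean_space => 'a => 'a => complex" where "coord b1 b2 x = Complex (x \<bullet> b1) (x \<bullet> b2)"

definition emb :: "'a::euclidean_space => 'a => complex => 'a" where "emb b1 b2 z = Re z *R b1 + Im z *R b2"

locale orthonormal_pair =
 fixes b1 b2 :: "'a::euclidean_space"
 assumes b: "norm b1 = 1" "norm b2 = 1" "b1 \<bullet> b2 = 0"
begin

abbreviation zc where "zc \<equiv> coord b1 b2"
abbreviation em where "em \<equiv> emb b1 b2"

lemma bb: "b1 \<bullet> b1 = 1" "b2 \<bullet> b2 = 1" "b2 \<bullet> b1 = 0"
 using b by (auto simp: norm_eq_1 inner_commute)

lemma zc_em [simp]: "zc (em z) = z"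
 using b bb by (simp add: coord_def emb_def inner_add_left complex_eq_iff)

lemma zc_add: "zc (x + y) = zc x + zc y"
 and zc_diff: "zc (x - y) = zc x - zc y"
 and zc_scaleR: "zc (s *R x) = s *R zc x" by (auto simp: coord_def inner_add_left inner_diff_left complex_eq_iff)

lemma em_add: "em (z + w) = em z + em w"
 and em_scaleR: "em (s *R z) = s *R em z" by (auto simp: emb_def algebra_simps)

lemma norm_em: "norm (em z) = cmod z"
proof -
 have "(norm (em z))^2 = (cmod z)^2" unfolding cmod_power2 power2_norm_eq_inner using b bb
  by (simp add: emb_def inner_add_left inner_add_right power2_eq_square)
 then show ?thesis by simp
qed

lemma norm_zc_le: "cmod (zc x) <= norm x"
proof -
 have o: "orthonormal {b1, b2}" using b bb by (auto simp: orthonormal_def pairwise_def orthogonal_def)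
 have "b1 ~= b2" using b bb by auto
 then have "(cmod (zc x))^2 = (norm (proj {b1, b2} x))^2" unfolding norm_proj_sq[OF o] cmod_power2 by (simp add: coord_def)
 then have "cmod (zc x) = norm (proj {b1, b2} x)" by simp
 then show ?thesis using norm_proj_le[OF o, of x] by simp
qed

lemma continuous_zc [continuous_intros]: "continuous_on S f ==> continuous_on S (%x. zc (f x))"
 unfolding coord_def by (intro continuous_intros continuous_on_Complex)

lemma continuous_em [continuous_intros]: "continuous_on S f ==> continuous_on S (%x. em (f x))"
 unfolding emb_def by (intro continuous_intros)

lemma inner_span: "a : span {b1, b2} ==> a \<bullet> x = a \<bullet> em (zc x)"
proof (induction rule: span_induct_alt)
 case (step c a y)
 then have "a = b1 \<or> a = b2" by auto
 then have "a \<bullet> x = a \<bullet> em (zc x)" using b bb by (auto simp: emb_def coord_def inner_add_right inner_commute)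
 then show ?case using step.IH by (simp add: inner_add_left)
qed auto
end

context arrangement
begin

definition far_region :: "('a \<times> real) set => 'a set" where "far_region I = {x. ALL H:far I. lv H x ~= 0}"

lemma open_far_region: "open (far_region I)"
proof -
 have "far_region I = (\<Inter>H\<in>far I. - {x. lv H x = 0})" by (auto simp: far_region_def)
 moreover have "finite (far I)" using finite_HH by (simp add: far_def)
 ultimately show ?thesis by (auto intro!: open_INT closed_Collect_eq continuous_intros)
qed

definition sign_region :: "('a \<times> real) set => ('a \<times> real => real) => 'a set" where
 "sign_region I sig = {x. ALL H:far I. 0 < sig H * lv H x}"

lemma open_sign_region: "open (sign_region I sig)"
proof -
 have "sign_region I sig = (\<Inter>H\<in>far I. {x. 0 < sig H * lv H x})" by (auto simp: sign_region_def)
 moreover have "finite (far I)" using finite_HH by (simp add: far_def)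
 ultimately show ?thesis by (auto intro!: open_INT open_Collect_less continuous_intros)
qed
end

text \<open>The two planar cones whose components admit no open set of admissible directions are
  excluded in every plane and at every point. For the domain of the theorem the slit contradicts the
  angle condition, and the puncture contradicts a frontier made of polytopes of codimension
  one.\<close>

locale polyhedral = variational HH Om p L F0 m
 for HH :: "('a::euclidean_space \<times> real) set" and Om p L F0 m +
 assumes dim: "2 <= DIM('a)"
  and no_puncture: "!!b1 b2 q rho. orthonormal_pair b1 b2 ==> 0 < rho ==>
   Om Int ball q rho ~= {x : ball q rho. coord b1 b2 (x - q) ~= 0}"
  and no_slit: "!!b1 b2 q rho u. orthonormal_pair b1 b2 ==> 0 < rho ==> norm u = 1 ==>
   Om Int ball q rho ~= {x : ball q rho. coord b1 b2 (x - q) ~: {r *R u |r. 0 <= r}}"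
begin

text \<open>Off the far hyperplanes, S and the rest of Om are separated by open sets, and S absorbs
  translations in all directions near e until a far hyperplane is crossed. The ball of directions,
  rather than e alone, is what permits averaging over translates and leaves room for a
  mollifier.\<close>

definition push_piece :: "('a \<times> real) set => 'a set => 'a => real => bool" where
 "push_piece I S e r \<longleftrightarrow> S <= Om & open S & open (far_region I Int Om - S) & norm e = 1 & 0 < r & r <= 1 &
   (ALL x:S. ALL s w. 0 <= s --> norm (w - e) <= r --> (ALL H:far I. sgn (lv H (x + s *R w)) = sgn (lv H x)) --> x + s *R w : S)"

abbreviation shifted :: "real => 'a => 'a set => ('a => 'b::zero) => 'a => 'b" where
 "shifted t w S v x == (if x - (t / 2) *R w : S then v (x - (t / 2) *R w) else 0)"

abbreviation upstream :: "real => 'a => 'a set => ('a => real) => 'a => bool" where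
 "upstream t w S v x == (EX tau. 0 <= tau & tau <= t / 2 & x - tau *R w : S & v (x - tau *R w) ~= 0)"

text \<open>On a cell of the far hyperplanes the signs of the near ones decide membership in Om, and
  these depend only on the coordinates in a plane containing their normals. So Om is there a
  cylinder over a planar cone C, and the pieces are the cylinders over the components of C.\<close>

lemma pieces_sign_region:
 assumes I: "I : flats" "codim I <= 2" and y0: "y0 : sign_region I sig" "!!H. H : near I ==> lv H y0 = 0"
 obtains P where "finite P" "!!S e r. (S, e, r) : P ==> push_piece I S e r" "!!x. x : Om Int sign_region I sig ==> EX (S, e, r):P. x : S"
proof -
 obtain b1 b2 where b: "norm b1 = 1" "norm b2 = 1" "b1 \<bullet> b2 = 0" "fst ` I <= span {b1, b2}"
  using orthonormal_pair_span[of "fst ` I"] I(2) dim unfolding codim_def by blast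
 interpret op: orthonormal_pair b1 b2 using b by unfold_locales
 have near_span: "fst H : span {b1, b2}" if "H : near I" for H using that span_mono[OF b(4)] by (auto simp: near_def span_span)
 define W where "W = sign_region I sig"
 have Wop: "open W" unfolding W_def by (rule open_sign_region)
 have lvn: "lv H x = fst H \<bullet> op.em (op.zc (x - y0))" if "H : near I" for H x
  using y0(2)[OF that] op.inner_span[OF near_span[OF that], of "x - y0"] by (simp add: lv_def inner_diff_right)
 define C where "C = {z. EX x:Om Int W. ALL H:near I. sgn (lv H x) = sgn (fst H \<bullet> op.em z)}"
 have memC: "x : Om \<longleftrightarrow> op.zc (x - y0) : C" if x: "x : W" for x
 proof
  assume "x : Om"
  then show "op.zc (x - y0) : C" using x unfolding C_def by (auto simp: lvn)
 next
  assume "op.zc (x - y0) : C"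
  then obtain y where y: "y : Om" "y : W" "!!H. H : near I ==> sgn (lv H y) = sgn (fst H \<bullet> op.em (op.zc (x - y0)))" unfolding C_def by blast
  have "same_signs HH y x"
  proof (rule same_signs_near_far[of I])
   show "sgn (lv H y) = sgn (lv H x)" if "H : near I" for H using y(3)[OF that] lvn[OF that, of x] by simp
   show "sgn (lv H y) = sgn (lv H x)" if "H : far I" for H using y(2) x that by (auto simp: W_def sign_region_def zero_less_mult_iff)
     (metis mult_pos_pos mult_neg_neg sgn_neg sgn_pos less_asym)
  qed
  then show "x : Om" using signs y(1) by blast
 qed
 have coneC: "s *R z : C" if "z : C" "0 < s" for z s using that unfolding C_def by (auto simp: op.em_scaleR sgn_mult)
 obtain rho where rho: "0 < rho" "ball y0 rho <= W" using Wop y0(1) by (metis W_def open_contains_ball)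
 \<comment> \<open>C is swept out by rescaling the section of Om with a small planar disc around
   \<open>y0\<close>.\<close>
 have opC: "open C"
 proof -
  have "C = (\<Union>s\<in>{0<..}. (%z. s *R z) -` (ball 0 rho Int (%z. y0 + op.em z) -` Om))" (is "_ = ?U")
  proof (intro equalityI subsetI)
   fix z assume z: "z : C"
   define s where "s = rho / (2 * (cmod z + 1))"
   have s: "0 < s" using rho by (simp add: s_def add_nonneg_pos)
   have n: "norm (s *R z) < rho"
   proof -
    have "norm (s *R z) = rho * (cmod z / (2 * (cmod z + 1)))" using s rho(1) by (simp add: s_def)
    also have "... < rho * 1" using rho by (intro mult_strict_left_mono) (auto simp: divide_less_eq add_nonneg_pos)
    finally show ?thesis by simp
   qed
   then have "y0 + op.em (s *R z) : W" using rho(2) by (auto simp: dist_norm op.norm_em)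
   then have "y0 + op.em (s *R z) : Om" using memC coneC[OF z s] by simp
   then show "z : ?U" using s n by auto
  next
   fix z assume "z : ?U"
   then obtain s where s: "0 < s" "norm (s *R z) < rho" "y0 + op.em (s *R z) : Om" by auto
   have "y0 + op.em (s *R z) : W" using rho(2) s(2) by (auto simp: dist_norm op.norm_em)
   then have "s *R z : C" using memC s(3) by fastforce
   then show "z : C" using coneC[of "s *R z" "1 / s"] s(1) by simp
  qed
  moreover have "open ?U" by (intro open_UN ballI open_vimage open_Int open_ball open_Om continuous_intros)
  ultimately show ?thesis by simp
 qed
 have Omball: "Om Int ball y0 rho = {x : ball y0 rho. op.zc (x - y0) : C}" using memC rho(2) by blast
 have pt: "C ~= - {0}"
 proof
  assume "C = - {0}"
  then show False using Omball no_puncture[OF op.orthonormal_pair_axioms rho(1), of y0] by simp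
 qed
 have ray: "C ~= - {r *R u |r. 0 <= r}" if "norm u = 1" for u
 proof
  assume "C = - {r *R u |r. 0 <= r}"
  then show False using Omball no_slit[OF op.orthonormal_pair_axioms rho(1) that, of y0] by simp
 qed
 \<comment> \<open>Points of C with equal signs for all near hyperplanes are joined by a segment in
   C, and there are finitely many sign vectors.\<close>
 have finC: "finite (components C)"
 proof -
  define sv where "sv z = (\<lambda>H\<in>near I. sgn (fst H \<bullet> op.em z))" for z
  have fnear: "finite (near I)" using finite_HH by (simp add: near_def)
  have "sgn r : {-1, 0, 1}" for r :: real by (simp add: sgn_if)
  then have "sv z : (\<Pi>\<^sub>E H\<in>near I. {-1, 0, 1})" for z unfolding sv_def by (intro restrict_PiE_iff[THEN iffD2] ballI)
  then have "sv ` C <= (\<Pi>\<^sub>E H\<in>near I. {-1, 0, 1})" by blast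
  then have fin: "finite (sv ` C)" by (rule finite_subset) (intro finite_PiE fnear, auto)
  have same: "connected_component C z w" if z: "z : C" "w : C" "sv z = sv w" for z w
  proof -
   have s: "sgn (fst H \<bullet> op.em z) = sgn (fst H \<bullet> op.em w)" if "H : near I" for H
    using fun_cong[OF z(3), of H] that by (simp add: sv_def)
   have "closed_segment z w <= C"
   proof
    fix y assume "y : closed_segment z w"
    then obtain u where u: "0 <= u" "u <= 1" "y = (1 - u) *R z + u *R w" by (auto simp: in_segment)
    have ey: "op.em y : closed_segment (op.em z) (op.em w)" using u by (auto simp: in_segment op.em_add op.em_scaleR)
    have "same_signs ((%H. (fst H, 0)) ` near I) (op.em z) (op.em w)" using s by (auto simp: same_signs_def lv_def)
    from same_signs_segment[OF this ey]
    have "sgn (fst H \<bullet> op.em z) = sgn (fst H \<bullet> op.em y)" if "H : near I" for H using that by (auto simp: same_signs_def lv_def)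
    then show "y : C" using z(1) unfolding C_def by auto
   qed
   then show ?thesis unfolding connected_component_def by (intro exI[of _ "closed_segment z w"]) auto
  qed
  define f where "f s = connected_component_set C (SOME z. z : C & sv z = s)" for s
  have "components C <= f ` sv ` C"
  proof
   fix S assume "S : components C"
   then obtain z where z: "z : C" "S = connected_component_set C z" by (auto simp: components_def)
   define w where "w = (SOME w. w : C & sv w = sv z)"
   have w: "w : C" "sv w = sv z" using someI[of "%w. w : C & sv w = sv z" z] z(1) by (auto simp: w_def)
   have "S = connected_component_set C w" unfolding z(2) using same[OF w(1) z(1) w(2)] connected_component_eq[of z C w] by simp
   then show "S : f ` sv ` C" using z(1) by (auto simp: f_def w_def)
  qed
  then show ?thesis using fin finite_subset by blast
 qed
 have "ALL S:components C. EX er. norm (fst er) = 1 & 0 < snd er & snd er <= 1 &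
   (ALL z w s. z : S --> 0 <= s --> norm (w - fst er) <= snd er --> z + s *R w : S)"
 proof
  fix S assume S: "S : components C"
  obtain e r where "norm e = 1" "0 < r" "r <= 1" "!!z w s. z : S ==> 0 <= s ==> norm (w - e) <= r ==> z + s *R w : S"
   using planar_component_push[OF opC coneC S pt ray] by blast
  then show "EX er. norm (fst er) = 1 & 0 < snd er & snd er <= 1 & (ALL z w s. z : S --> 0 <= s --> norm (w - fst er) <= snd er --> z + s *R w : S)"
   by (intro exI[of _ "(e, r)"]) auto
 qed
 from bchoice[OF this] obtain er where er: "ALL S:components C. norm (fst (er S)) = 1 & 0 < snd (er S) & snd (er S) <= 1 &
   (ALL z w s. z : S --> 0 <= s --> norm (w - fst (er S)) <= snd (er S) --> z + s *R w : S)" by blast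
 define pc where "pc S = {x : W. op.zc (x - y0) : S}" for S
 have pcop: "open (pc S)" if "open S" for S
 proof -
  have "pc S = W Int (%x. op.zc (x - y0)) -` S" by (auto simp: pc_def)
  then show ?thesis using that by (auto intro!: open_Int Wop open_vimage continuous_intros)
 qed
 have Wpos: "sgn (lv H x) = sgn (sig H)" "sig H ~= 0" if "x : W" "H : far I" for x H
  using that by (auto simp: W_def sign_region_def zero_less_mult_iff dest!: bspec)
 have Wfar: "W <= far_region I" unfolding W_def sign_region_def far_region_def by fastforce
 have complW: "open (far_region I - W)"
 proof -
  have "far_region I - W = far_region I Int (\<Union>H\<in>far I. {x. sig H * lv H x < 0}) Un (if EX H:far I. sig H = 0 then far_region I else {})"
   by (auto simp: far_region_def W_def sign_region_def not_less mult_le_0_iff mult_less_0_iff zero_less_mult_iff le_less)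
  moreover have "open (\<Union>H\<in>far I. {x. sig H * lv H x < 0})" by (intro open_UN ballI open_Collect_less continuous_intros)
  ultimately show ?thesis using open_far_region[of I] by auto
 qed
 define P where "P = (%S. (pc S, op.em (fst (er S)), snd (er S))) ` components C"
 show ?thesis
 proof (rule that[of P])
  show "finite P" using finC by (simp add: P_def)
  show "EX (S, e, r):P. x : S" if "x : Om Int sign_region I sig" for x
  proof -
   have "op.zc (x - y0) : C" "x : W" using memC that by (auto simp: W_def)
   then obtain S where "S : components C" "op.zc (x - y0) : S" using Union_components[of C] by blast
   then show ?thesis using \<open>x : W\<close> by (auto simp: P_def pc_def)
  qed
  fix S' e r assume "(S', e, r) : P"
  then obtain S where S: "S : components C" "S' = pc S" "e = op.em (fst (er S))" "r = snd (er S)" by (auto simp: P_def)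
  note erS = bspec[OF er S(1), folded S(4)]
  have SC: "S <= C" using S(1) in_components_subset by blast
  show "push_piece I S' e r" unfolding push_piece_def
  proof (intro conjI ballI allI impI)
   show "S' <= Om" using memC SC by (auto simp: S(2) pc_def)
   show "open S'" unfolding S(2) by (rule pcop) (use opC S(1) open_components in blast)
   have "C - S = \<Union>(components C - {S})"
   proof -
    have U: "C = \<Union>(components C)" using Union_components[of C] by simp
    have "x ~: S" if "T : components C" "T ~= S" "x : T" for x T using components_nonoverlap[OF that(1) S(1)] that by blast
    then show ?thesis using U by blast
   qed
   then have "open (C - S)" using opC open_components by (auto intro!: open_Union)
   then have "open (pc (C - S))" by (rule pcop)
   moreover have "far_region I Int Om - S' = pc (C - S) Un (far_region I - W) Int Om" using memC Wfar by (auto simp: S(2) pc_def)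
   ultimately show "open (far_region I Int Om - S')" using complW open_Om by auto
   show "norm e = 1" "0 < r" "r <= 1" using erS by (auto simp: S(3) op.norm_em)
   fix x s w assume x: "x : S'" and s: "0 <= (s::real)" and w: "norm (w - e) <= r"
    and sg: "ALL H:far I. sgn (lv H (x + s *R w)) = sgn (lv H x)"
   have "cmod (op.zc w - fst (er S)) <= norm (w - e)" using op.norm_zc_le[of "w - e"] by (simp add: op.zc_diff S(3))
   then have "op.zc (x - y0) + s *R op.zc w : S" using erS x s w by (auto simp: S(2) pc_def)
   then have "op.zc (x + s *R w - y0) : S" by (simp add: op.zc_add op.zc_diff op.zc_scaleR algebra_simps)
   moreover have "x + s *R w : W" unfolding W_def sign_region_def
   proof (intro CollectI ballI)
    fix H assume H: "H : far I"
    have "x : W" using x by (simp add: S(2) pc_def)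
    then have "sgn (lv H (x + s *R w)) = sgn (sig H)" "sig H ~= 0" using Wpos[OF _ H] sg H by auto
    then show "0 < sig H * lv H (x + s *R w)" by (metis sgn_mult sgn_zero_iff sgn_greater mult_eq_0_iff not_real_square_gt_zero)
   qed
   ultimately show "x + s *R w : S'" by (simp add: S(2) pc_def)
  qed
 qed
qed

text \<open>The pieces of all cells of the far hyperplanes that meet the flat are collected. A point
  much closer to the flat than to the far hyperplanes lies in the same cell as its foot point
  \<open>x - nrm I x\<close>.\<close>

lemma pieces:
 assumes I: "I : flats" "codim I <= 2"
 obtains P where "finite P" "!!S e r. (S, e, r) : P ==> push_piece I S e r"
  "!!x. x : Om ==> (!!H. H : far I ==> norm (fst H) * rad I x < abs (lv H x)) ==> EX (S, e, r):P. x : S"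
proof -
 define \<Sigma> where "\<Sigma> = {sig : (\<Pi>\<^sub>E H\<in>far I. {-1, 0, 1}). EX y:sign_region I sig. ALL H:near I. lv H y = 0}"
 have ffar: "finite (far I)" using finite_HH by (simp add: far_def)
 have fin: "finite \<Sigma>" unfolding \<Sigma>_def by (rule finite_subset[OF _ finite_PiE[OF ffar, of "%_. {-1, 0, 1}"]]) auto
 have "ALL sig:\<Sigma>. EX P. finite P & (ALL S e r. (S, e, r) : P --> push_piece I S e r) & (ALL x:Om Int sign_region I sig. EX (S, e, r):P. x : S)"
 proof
  fix sig assume "sig : \<Sigma>"
  then obtain y where y: "y : sign_region I sig" "!!H. H : near I ==> lv H y = 0" by (auto simp: \<Sigma>_def)
  show "EX P. finite P & (ALL S e r. (S, e, r) : P --> push_piece I S e r) & (ALL x:Om Int sign_region I sig. EX (S, e, r):P. x : S)"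
  proof (rule pieces_sign_region[OF I y])
   fix P :: "('a set \<times> 'a \<times> real) set"
   assume a: "finite P" "!!S e r. (S, e, r) : P ==> push_piece I S e r" "!!x. x : Om Int sign_region I sig ==> EX (S, e, r):P. x : S"
   show ?thesis by (intro exI[of _ P] conjI allI impI ballI a)
  qed auto
 qed
 from bchoice[OF this] obtain P where P: "ALL sig:\<Sigma>. finite (P sig) & (ALL S e r. (S, e, r) : P sig --> push_piece I S e r) &
  (ALL x:Om Int sign_region I sig. EX (S, e, r):P sig. x : S)" by blast
 show ?thesis
 proof (rule that[of "\<Union>sig\<in>\<Sigma>. P sig"])
  show "finite (\<Union>sig\<in>\<Sigma>. P sig)" using fin P by auto
  show "push_piece I S e r" if "(S, e, r) : (\<Union>sig\<in>\<Sigma>. P sig)" for S e r using that P by blast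
  fix x assume x: "x : Om" and far: "!!H. H : far I ==> norm (fst H) * rad I x < abs (lv H x)"
  define sig where "sig = (\<lambda>H\<in>far I. sgn (lv H x))"
  define y where "y = x - nrm I x"
  have ny: "nrm I y = 0" using nrm_add[of I x "- nrm I x"] proj_scaleR[of "nbasis I" "-1" "nrm I x"] by (simp add: y_def proj_nrm)
  have sg: "sgn (lv H y) = sgn (lv H x)" if "H : far I" for H by (rule sgn_lv_near_point) (use far[OF that] in "simp add: y_def")
  have nz: "lv H x ~= 0" if "H : far I" for H
   using far[OF that] mult_nonneg_nonneg[OF norm_ge_zero[of "fst H"] norm_ge_zero[of "nrm I x"]] by linarith
  have pos: "0 < sgn a * b" if "a ~= 0" "sgn b = sgn a" for a b :: real using that by (auto simp: sgn_if split: if_splits)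
  have "y : sign_region I sig" "x : sign_region I sig" using nz sg pos by (auto simp: sign_region_def sig_def)
  moreover have "sig : (\<Pi>\<^sub>E H\<in>far I. {-1, 0, 1})"
  proof -
   have "sgn r : {-1, 0, 1}" for r :: real by (simp add: sgn_if)
   then show ?thesis unfolding sig_def by (intro restrict_PiE_iff[THEN iffD2] ballI)
  qed
  moreover have "ALL H:near I. lv H y = 0" by (simp add: lv_near ny)
  ultimately have "sig : \<Sigma>" "x : Om Int sign_region I sig" using x by (auto simp: \<Sigma>_def)
  note h = this
  have "ALL x:Om Int sign_region I sig. EX (S, e, r):P sig. x : S" using bspec[OF P h(1)] by (elim conjE)
  from bspec[OF this h(2)] have "EX z:P sig. case z of (S, e, r) => x : S" .
  then show "EX (S, e, r):(\<Union>sig\<in>\<Sigma>. P sig). x : S" using \<open>sig : \<Sigma>\<close> by (metis UN_I)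
 qed
qed
end

section \<open>Zones around the flats and their cut-off functions\<close>

context polyhedral
begin

text \<open>The cut-off at I is 1 on the inner zone and 0 off the outer one. The conditions say that
  I is close in relation to the deeper flats, that these are not much closer than the flats of
  codimension above 2, and that t is small against the distance to the latter.\<close>

definition inner_zone :: "real => real => real => ('a \<times> real) set => real => 'a set" where
 "inner_zone m1 M K I t = {x. m1^2 * (rad I x)^2 * q t (codim I) x <= 1 &
   q t (codim I) x <= M * q t 2 x & K^2 * t^2 * q t 2 x <= 1}"

definition outer_zone :: "real => real => real => ('a \<times> real) set => real => 'a set" where
 "outer_zone m1 M K I t = {x. m1^2 * (rad I x)^2 * q t (codim I) x <= 2 &
   q t (codim I) x <= 2 * M * q t 2 x & K^2 * t^2 * q t 2 x <= 2}"

lemma inner_outer_zone: "1 <= M ==> inner_zone m1 M K I t <= outer_zone m1 M K I t"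
proof
 fix x assume M: "1 <= M" and x: "x : inner_zone m1 M K I t"
 have "M * q t 2 x <= 2 * M * q t 2 x" using M q_ge_1[of t 2 x] by simp
 then show "x : outer_zone m1 M K I t" using x by (auto simp: inner_zone_def outer_zone_def)
qed

lemma closed_outer_zone: "0 < t ==> closed (outer_zone m1 M K I t)"
 unfolding outer_zone_def by (intro closed_Collect_conj closed_Collect_le continuous_intros continuous_nrm continuous_q)

lemma sqrt_q_le: "0 <= a ==> q t k x <= a^2 * q t l x ==> sq t k x <= a * sq t l x"
 by (metis real_sqrt_abs real_sqrt_le_iff real_sqrt_mult abs_of_nonneg)

lemma mult_sqrt_q_le:
 assumes "a^2 * q t k x <= b^2" "0 <= b"
 shows "a * sq t k x <= b"
proof (rule power2_le_imp_le[OF _ assms(2)])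
 show "(a * sq t k x)^2 <= b^2" using assms q_ge_1[of t k x] by (simp add: power_mult_distrib)
qed

lemma outer_zone_bounds:
 assumes x: "x : outer_zone m1 M K I t" and m: "1 <= m1" and M: "1 <= M" and K: "1 <= K" and t: "0 < t"
 shows "m1 * rad I x * sq t (codim I) x <= 2" "K * t * sq t 2 x <= 2"
  "sq t (codim I) x <= 2 * M * sq t 2 x" "K * t * sq t (codim I) x <= 4 * M"
proof -
 show "m1 * rad I x * sq t (codim I) x <= 2" using x by (intro mult_sqrt_q_le) (auto simp: outer_zone_def power_mult_distrib)
 show 1: "K * t * sq t 2 x <= 2" using x by (intro mult_sqrt_q_le) (auto simp: outer_zone_def power_mult_distrib)
 show 2: "sq t (codim I) x <= 2 * M * sq t 2 x"
 proof (rule sqrt_q_le)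
  have "2 * M * q t 2 x <= (2 * M)^2 * q t 2 x" using M q_ge_1[of t 2 x] by (intro mult_right_mono) (auto simp: power2_eq_square)
  then show "q t (codim I) x <= (2 * M)^2 * q t 2 x" using x by (auto simp: outer_zone_def)
 qed (use M in simp)
 have "K * t * sq t (codim I) x <= K * t * (2 * M * sq t 2 x)" using K t by (intro mult_left_mono 2) auto
 also have "... = 2 * M * (K * t * sq t 2 x)" by simp
 also have "... <= 2 * M * 2" using M by (intro mult_left_mono 1) auto
 finally show "K * t * sq t (codim I) x <= 4 * M" by simp
qed

text \<open>Descent through the codimensions 2, 1, 0: if no flat of codimension k is close in
  relation to the deeper ones, its terms in the weight are dominated, and \<open>q t (k - 1)\<close>
  is at most a multiple of \<open>q t k\<close>. The descent ends at the empty set, where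
  \<open>rad\<close> is 0.\<close>

lemma cover:
 fixes m1 t :: real
 assumes m: "1 <= m1"
 shows "EX I:flats. codim I <= 2 & m1^2 * (rad I x)^2 * q t (codim I) x <= 1 &
   q t (codim I) x <= (1 + card flats * m1^2)^2 * q t 2 x"
proof -
 define N where "N = 1 + card flats * m1^2"
 have N: "1 <= N" by (simp add: N_def)
 have step: "q t (k - 1) x <= N * q t k x"
  if k: "1 <= k" and no: "!!I. I : flats ==> codim I = k ==> 1 < m1^2 * (rad I x)^2 * q t k x" for k
 proof -
  let ?A = "{J : flats. codim J = k}"
  have fin: "finite ?A" using finite_flats by simp
  have "deeper (k - 1) = deeper k Un ?A" "deeper k Int ?A = {}" using k by (auto simp: deeper_def)
  then have "q t (k - 1) x = q t k x + (SUM J:?A. inverse ((rad J x)^2 + t^2))"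
   unfolding q_def by (simp add: sum.union_disjoint finite_deeper fin)
  also have "(SUM J:?A. inverse ((rad J x)^2 + t^2)) <= (SUM J:?A. m1^2 * q t k x)"
  proof (rule sum_mono)
   fix J assume "J : ?A"
   then have 1: "1 < m1^2 * (rad J x)^2 * q t k x" using no by blast
   then have "rad J x ~= 0" by auto
   then have p: "0 < (rad J x)^2" by simp
   have "inverse ((rad J x)^2 + t^2) <= inverse ((rad J x)^2)" using p by (intro le_imp_inverse_le) auto
   also have "... <= m1^2 * q t k x" using 1 p by (simp add: field_simps)
   finally show "inverse ((rad J x)^2 + t^2) <= m1^2 * q t k x" .
  qed
  also have "... <= card flats * (m1^2 * q t k x)" using q_ge_1[of t k x] finite_flats by (auto intro!: mult_right_mono card_mono)
  finally show ?thesis by (simp add: N_def algebra_simps)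
 qed
 show ?thesis
 proof (rule ccontr)
  assume "\<not> ?thesis"
  then have no: "1 < m1^2 * (rad I x)^2 * q t (codim I) x"
   if "I : flats" "codim I <= 2" "q t (codim I) x <= N^2 * q t 2 x" for I using that by (auto simp: N_def not_le)
  have q2: "0 < q t 2 x" using q_ge_1[of t 2 x] by simp
  have N2: "1 <= N^2" using N by simp
  have h2: "q t 2 x <= N^2 * q t 2 x" using mult_right_mono[OF N2, of "q t 2 x"] q2 by simp
  have "q t (2 - 1) x <= N * q t 2 x"
  proof (rule step)
   fix I assume I: "I : flats" "codim I = 2"
   show "1 < m1^2 * (rad I x)^2 * q t 2 x" using no[OF I(1)] I(2) h2 by simp
  qed simp
  then have s1: "q t 1 x <= N * q t 2 x" by simp
  have "N * q t 2 x <= N^2 * q t 2 x" using N q2 by (intro mult_right_mono) (auto simp: power2_eq_square)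
  then have h1: "q t 1 x <= N^2 * q t 2 x" using s1 by linarith
  have "q t (1 - 1) x <= N * q t 1 x"
  proof (rule step)
   fix I assume I: "I : flats" "codim I = 1"
   show "1 < m1^2 * (rad I x)^2 * q t 1 x" using no[OF I(1)] I(2) h1 by simp
  qed simp
  then have "q t 0 x <= N * q t 1 x" by simp
  also have "... <= N * (N * q t 2 x)" using s1 N by (intro mult_left_mono) auto
  finally have "q t 0 x <= N^2 * q t 2 x" by (simp add: power2_eq_square mult.assoc)
  then have "1 < m1^2 * (norm (nrm {} x))^2 * q t (codim {}) x" using no[OF empty_flat] codim_empty by simp
  moreover have "nbasis {} = {}" using nbasis(1,3)[of "{}"] codim_empty by (auto simp: orthonormal_def)
  ultimately show False by (simp add: nrm_def)
 qed
qed

lemma sqrt_q_near_cball: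
 fixes b t :: real
 assumes t: "0 < t" and z: "norm (z - x) <= b * t" and b: "0 <= b" and s: "2 * card flats * b * t * sq t k x <= 1"
 shows "sq t k z <= 2 * sq t k x" "sq t k x <= 2 * sq t k z"
proof -
 have "2 * card flats * norm (z - x) * sq t k x <= 2 * card flats * (b * t) * sq t k x"
  using z q_ge_1[of t k x] by (intro mult_right_mono mult_left_mono) auto
 then have "2 * card flats * norm (z - x) * sq t k x <= 1" using s by (simp add: mult.assoc)
 then show "sq t k z <= 2 * sq t k x" "sq t k x <= 2 * sq t k z" by (rule sqrt_q_near[OF t])+
qed

lemma nrm_dist_le: "rad I z <= rad I x + norm (z - x)"
proof -
 have "nrm I z = nrm I x + proj (nbasis I) (z - x)" using nrm_add[of I x "z - x"] by simp
 then show ?thesis using norm_triangle_ineq[of "nrm I x" "proj (nbasis I) (z - x)"] norm_proj_le[OF nbasis(1), of I "z - x"] by simp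
qed

text \<open>\<open>cover\<close> is used with 4 m1, because over the ball \<open>sq\<close> may
  double and \<open>rad\<close> may grow by b t, each taking one half of the margin. The 16 in M is
  a factor 4 for each of the two weights compared.\<close>

lemma cover_deep:
 fixes m1 K b :: real
 assumes m: "1 <= m1" and K: "1 <= K" and b: "0 <= b"
  and M: "M = 16 * (1 + card flats * (4 * m1)^2)^2"
 obtains K1 where "1 <= K1" "!!t x. 0 < t ==> K1 * t * sq t 2 x <= 1 ==>
   EX I:flats. codim I <= 2 & cball x (b * t) <= inner_zone m1 M K I t"
proof -
 define N where "N = 1 + card flats * (4 * m1)^2"
 have N: "1 <= N" by (simp add: N_def)
 define K1 where "K1 = 2 * K + 4 * m1 * b * N + 2 * card flats * b * N"
 have K1: "2 * K <= K1" "4 * m1 * b * N <= K1" "2 * card flats * b * N <= K1" using K m b N by (auto simp: K1_def)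
 show ?thesis
 proof (rule that[of K1])
  show "1 <= K1" using K K1 by linarith
  fix t x assume t: "0 < (t::real)" and a: "K1 * t * sq t 2 x <= 1"
  have s0: "0 <= t * sq t 2 x" using t q_ge_1[of t 2 x] by simp
  obtain I where I: "I : flats" "codim I <= 2" "(4 * m1)^2 * (rad I x)^2 * q t (codim I) x <= 1" "q t (codim I) x <= N^2 * q t 2 x"
   using cover[of "4 * m1" x t] m unfolding N_def by auto
  let ?k = "codim I"
  have kN: "sqrt (q t ?k x) <= N * sq t 2 x" by (rule sqrt_q_le) (use I N in auto)
  have ck: "c * t * sqrt (q t ?k x) <= 1" if "c * N <= K1" "0 <= c" for c
  proof -
   have "c * t * sqrt (q t ?k x) <= c * t * (N * sq t 2 x)" using that t by (intro mult_left_mono kN) auto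
   also have "... = (c * N) * (t * sq t 2 x)" by simp
   also have "... <= K1 * (t * sq t 2 x)" by (rule mult_right_mono[OF that(1) s0])
   also have "... <= 1" using a by (simp add: mult.assoc)
   finally show ?thesis .
  qed
  have c2: "c * t * sq t 2 x <= 1" if "c <= K1" for c using mult_right_mono[OF that s0] a by (simp add: mult.assoc)
  have "cball x (b * t) <= inner_zone m1 M K I t"
  proof
   fix z assume "z : cball x (b * t)"
   then have z: "norm (z - x) <= b * t" by (simp add: dist_norm norm_minus_commute)
   have nk: "sqrt (q t ?k z) <= 2 * sqrt (q t ?k x)"
    by (rule sqrt_q_near_cball[OF t z b]) (use ck[of "2 * card flats * b"] K1 b in "simp add: mult_ac")
   have bN: "2 * card flats * b <= K1" using K1(3) N mult_left_mono[of 1 N "2 * card flats * b"] b by simp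
   have n2: "sq t 2 z <= 2 * sq t 2 x" "sq t 2 x <= 2 * sq t 2 z" using sqrt_q_near_cball[OF t z b] c2[OF bN] by auto
   have sq: "a <= c^2 * a'" if "sqrt a <= c * sqrt a'" "0 <= a" "0 <= a'" for a a' c :: real
    using power_mono[OF that(1), of 2] that by (simp add: power_mult_distrib)
   have qpos: "0 <= q t j y" for j y using q_ge_1[of t j y] by simp
   have "m1 * rad I z * sqrt (q t ?k z) <= m1 * (rad I x + b * t) * (2 * sqrt (q t ?k x))"
    using nrm_dist_le[of I z x] z m qpos b t by (intro mult_mono nk mult_nonneg_nonneg add_nonneg_nonneg) auto
   also have "... = (4 * m1 * rad I x * sqrt (q t ?k x)) / 2 + (4 * m1 * b * t * sqrt (q t ?k x)) / 2" by (simp add: algebra_simps)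
   also have "4 * m1 * rad I x * sqrt (q t ?k x) <= 1" by (rule mult_sqrt_q_le) (use I(3) in "auto simp: power_mult_distrib")
   also have "4 * m1 * b * t * sqrt (q t ?k x) <= 1" by (rule ck) (use K1(2) m b in auto)
   finally have "m1 * rad I z * sqrt (q t ?k z) <= 1" by simp
   then have "(m1 * rad I z * sqrt (q t ?k z))^2 <= 1" using m qpos by (simp add: power_le_one)
   then have 1: "m1^2 * (rad I z)^2 * q t ?k z <= 1" using qpos by (simp add: power_mult_distrib)
   have "q t ?k z <= 2^2 * q t ?k x" by (rule sq[OF nk]) (use qpos in auto)
   moreover have "q t 2 x <= 2^2 * q t 2 z" by (rule sq[OF n2(2)]) (use qpos in auto)
   then have "N^2 * q t 2 x <= N^2 * (2^2 * q t 2 z)" by (rule mult_left_mono) simp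
   moreover have "M = 16 * N^2" by (simp only: M N_def)
   ultimately have 2: "q t ?k z <= M * q t 2 z" using I(4) by simp
   have "K * t * sq t 2 z <= K * t * (2 * sq t 2 x)" using K t by (intro mult_left_mono n2) auto
   also have "... = (2 * K) * t * sq t 2 x" by simp
   also have "... <= 1" by (rule c2[OF K1(1)])
   finally have "(K * t * sq t 2 z)^2 <= 1" using K t qpos by (simp add: power_le_one)
   then have 3: "K^2 * t^2 * q t 2 z <= 1" using qpos by (simp add: power_mult_distrib)
   show "z : inner_zone m1 M K I t" using 1 2 3 by (simp add: inner_zone_def)
  qed
  then show "EX I:flats. codim I <= 2 & cball x (b * t) <= inner_zone m1 M K I t" using I by blast
 qed
qed

text \<open>What a deformation of size t near I needs, with constants independent of t: a cut-off
  with gradient of order \<open>sq\<close>, weights comparable within distance t, and far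
  hyperplanes beyond this distance.\<close>

definition good_zone :: "real => real => real => real => ('a \<times> real) set => bool" where
 "good_zone m1 M K Ceta I \<longleftrightarrow> (ALL t>0.
   (EX eta geta. cutoff Ceta t 2 eta geta &
    (ALL x. t * norm (geta x) <= 1/2) & (ALL x:inner_zone m1 M K I t. eta x = 1) & (ALL x. x ~: outer_zone m1 M K I t --> eta x = 0)) &
   (ALL x:outer_zone m1 M K I t. (ALL H:far I. norm (fst H) * rad I x < abs (lv H x)) &
    (ALL z. norm (z - x) <= t --> sq t 2 x <= 2 * sq t 2 z & (ALL H:far I. lv H z ~= 0 & sgn (lv H z) = sgn (lv H x)))))"

text \<open>The order of choice matters: m1 from the lower bounds for far hyperplanes, then M, then
  \<open>Ceta\<close>, which does not depend on K, and finally K. Maxima and minima over the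
  finitely many flats make the constants uniform.\<close>

lemma good_zones:
 obtains m1 M K Ceta :: real where "1 <= m1" "M = 16 * (1 + card flats * (4 * m1)^2)^2" "1 <= K" "0 <= Ceta"
  "!!I. I : flats ==> codim I <= 2 ==> good_zone m1 M K Ceta I"
proof -
 have "ALL I:flats. EX mc. 1 <= fst mc & 0 < snd mc & (ALL t x H. 0 < t --> 2 * t * sq t (codim I) x <= 1 -->
    fst mc * rad I x * sq t (codim I) x <= 1 --> H : far I -->
    snd mc <= abs (lv H x) * sq t (codim I) x)"
 proof
  fix I assume "I : flats"
  then obtain m c where mc: "1 <= m" "0 < c" "!!t x H. 0 < t ==> 2 * t * sq t (codim I) x <= 1 ==>
    m * rad I x * sq t (codim I) x <= 1 ==> H : far I ==>
    c <= abs (lv H x) * sq t (codim I) x" by (rule far_lower_uniform) (rule that; assumption)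
  show "EX mc. 1 <= fst mc & 0 < snd mc & (ALL t x H. 0 < t --> 2 * t * sq t (codim I) x <= 1 -->
    fst mc * rad I x * sq t (codim I) x <= 1 --> H : far I -->
    snd mc <= abs (lv H x) * sq t (codim I) x)" by (intro exI[of _ "(m, c)"]) (use mc in simp)
 qed
 from bchoice[OF this] obtain mc where mc: "ALL I:flats. 1 <= fst (mc I) & 0 < snd (mc I) & (ALL t x H. 0 < t --> 2 * t * sq t (codim I) x <= 1 -->
    fst (mc I) * rad I x * sq t (codim I) x <= 1 --> H : far I -->
    snd (mc I) <= abs (lv H x) * sq t (codim I) x)" by (rule exE)
 define A where "A = (SUM H:HH. norm (fst H)) + 1"
 have A: "1 <= A" by (simp add: A_def sum_nonneg)
 define c0 where "c0 = Min (insert 1 ((%I. snd (mc I)) ` flats))"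
 have c0: "0 < c0" "!!I. I : flats ==> c0 <= snd (mc I)" using finite_flats mc by (auto simp: c0_def)
 define m0 where "m0 = Max (insert 1 ((%I. fst (mc I)) ` flats))"
 have m0: "1 <= m0" "!!I. I : flats ==> fst (mc I) <= m0" using finite_flats by (auto simp: m0_def)
 define m1 where "m1 = 2 * m0 + 4 * A / c0"
 have m1: "1 <= m1" "2 * m0 <= m1" "4 * A / c0 <= m1" using m0 A c0 by (auto simp: m1_def add_increasing2)
 define M where "M = 16 * (1 + card flats * (4 * m1)^2)^2"
 have M: "1 <= M"
 proof -
  have "1 <= (1 + card flats * (4 * m1)^2)^2" by (rule one_le_power) simp
  then show ?thesis unfolding M_def by linarith
 qed
 have "ALL I:flats. EX C. 0 <= C & (ALL t K. 0 < t --> (EX eta geta. C1 eta geta & (ALL x. 0 <= eta x & eta x <= 1) &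
   (ALL x. norm (geta x) <= C * sq t 2 x) & (ALL x:inner_zone m1 M K I t. eta x = 1) & (ALL x. x ~: outer_zone m1 M K I t --> eta x = 0)))"
 proof
  fix I
  show "EX C. 0 <= C & (ALL t K. 0 < t --> (EX eta geta. C1 eta geta & (ALL x. 0 <= eta x & eta x <= 1) &
   (ALL x. norm (geta x) <= C * sq t 2 x) & (ALL x:inner_zone m1 M K I t. eta x = 1) & (ALL x. x ~: outer_zone m1 M K I t --> eta x = 0)))"
   by (rule cutoff_exists[OF m1(1) M, of 2 I "codim I"]) (simp only: inner_zone_def outer_zone_def mem_Collect_eq Ball_def imp_conjL, blast)
 qed
 from bchoice[OF this] obtain C where C: "ALL I:flats. 0 <= C I & (ALL t K. 0 < t --> (EX eta geta. C1 eta geta & (ALL x. 0 <= eta x & eta x <= 1) &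
   (ALL x. norm (geta x) <= C I * sq t 2 x) &
   (ALL x:inner_zone m1 M K I t. eta x = 1) & (ALL x. x ~: outer_zone m1 M K I t --> eta x = 0)))" by (rule exE)
 define Ceta where "Ceta = Max (insert 0 (C ` flats))"
 have Ceta: "0 <= Ceta" "!!I. I : flats ==> C I <= Ceta" using finite_flats by (auto simp: Ceta_def)
 define N where "N = real (card flats)"
 \<comment> \<open>In the outer zone K t \<open>sq t 2\<close> <= 2 and K t
   \<open>sq t (codim I)\<close> <= 4 M. The summands give, in this order, the range of the lower
   bound for far hyperplanes, t |grad eta| <= 1/2, weights that change by at most a factor 2 within
   distance t, and far hyperplanes beyond distance t.\<close>
 define K where "K = 8 * M + 4 * Ceta + 4 * N + 8 * A * M / c0"
 have K: "8 * M <= K" "4 * Ceta <= K" "4 * N <= K" "8 * A * M / c0 <= K" using M Ceta(1) A c0 by (auto simp: K_def N_def add_nonneg_nonneg)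
 have K1: "1 <= K" using K(1) M by linarith
 show ?thesis
 proof (rule that[OF m1(1) M_def K1 Ceta(1)])
  fix I assume I: "I : flats" "codim I <= 2"
  show "good_zone m1 M K Ceta I" unfolding good_zone_def
  proof (intro allI impI conjI)
   fix t :: real assume t: "0 < t"
   have ob: "m1 * rad I x * sq t (codim I) x <= 2" "K * t * sq t 2 x <= 2"
    "K * t * sq t (codim I) x <= 4 * M" if "x : outer_zone m1 M K I t" for x using outer_zone_bounds[OF that m1(1) M K1 t] by auto
   have a2: "a * t * sq t 2 x <= 2 * (a / K)" if "x : outer_zone m1 M K I t" "0 <= a" for a x
    using mult_left_mono[OF ob(2)[OF that(1)], of "a / K"] that K1 by (simp add: field_simps)
   have ak: "a * t * sq t (codim I) x <= 4 * M * (a / K)" if "x : outer_zone m1 M K I t" "0 <= a" for a x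
    using mult_left_mono[OF ob(3)[OF that(1)], of "a / K"] that K1 by (simp add: field_simps)
   obtain eta geta where eta: "C1 eta geta" "ALL x. 0 <= eta x & eta x <= 1" "ALL x. norm (geta x) <= C I * sq t 2 x"
     "ALL x:inner_zone m1 M K I t. eta x = 1" "ALL x. x ~: outer_zone m1 M K I t --> eta x = 0"
    using conjunct2[OF bspec[OF C I(1)], rule_format, OF t, of K] by (elim exE conjE) (rule that; assumption)
   have g: "norm (geta x) <= Ceta * sq t 2 x" for x
    using eta(3) mult_right_mono[OF Ceta(2)[OF I(1)], of "sq t 2 x"] q_ge_1[of t 2 x] by (meson order_trans real_sqrt_ge_zero zero_le_one)
   have s: "t * norm (geta x) <= 1/2" for x
   proof (cases "x : outer_zone m1 M K I t")
    case True
    have "t * norm (geta x) <= Ceta * t * sq t 2 x" using mult_left_mono[OF g[of x], of t] t by (simp add: mult_ac)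
    also have "... <= 2 * (Ceta / K)" by (rule a2[OF True Ceta(1)])
    also have "... <= 1/2" using K(2) K1 by (simp add: divide_le_eq)
    finally show ?thesis .
   next
    case False
    have "geta x = 0" by (rule gradient_zero_off[OF eta(1) closed_outer_zone[OF t, of m1 M K I] _ False]) (use eta(5) in blast)
    then show ?thesis by simp
   qed
   show "EX eta geta. cutoff Ceta t 2 eta geta &
    (ALL x. t * norm (geta x) <= 1/2) & (ALL x:inner_zone m1 M K I t. eta x = 1) & (ALL x. x ~: outer_zone m1 M K I t --> eta x = 0)"
    by (intro exI[of _ eta] exI[of _ geta] conjI allI g s eta(1) eta(2)[rule_format, THEN conjunct1] eta(2)[rule_format, THEN conjunct2] eta(4,5))
   show "ALL x:outer_zone m1 M K I t. (ALL H:far I. norm (fst H) * rad I x < abs (lv H x)) &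
    (ALL z. norm (z - x) <= t --> sq t 2 x <= 2 * sq t 2 z & (ALL H:far I. lv H z ~= 0 & sgn (lv H z) = sgn (lv H x)))"
   proof (intro ballI conjI allI impI)
    fix x assume x: "x : outer_zone m1 M K I t"
    let ?s = "sq t (codim I) x"
    have s1: "1 <= ?s" using q_ge_1[of t "codim I" x] by simp
    have lower: "c0 <= abs (lv H x) * ?s" if H: "H : far I" for H
    proof -
     have "2 * t * ?s <= 4 * M * (2 / K)" by (rule ak[OF x]) simp
     also have "... <= 1" using K(1) K1 by (simp add: divide_le_eq)
     finally have 1: "2 * t * ?s <= 1" .
     have "2 * (fst (mc I) * rad I x * ?s) <= m1 * rad I x * ?s"
      using mult_right_mono[of "2 * fst (mc I)" m1 "rad I x * ?s"] m0(2)[OF I(1)] m1(2) s1 by (simp add: mult.assoc)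
     then have 2: "fst (mc I) * rad I x * ?s <= 1" using ob(1)[OF x] by linarith
     have "snd (mc I) <= abs (lv H x) * ?s" using bspec[OF mc I(1)] t 1 2 H by blast
     then show ?thesis using c0(2)[OF I(1)] by linarith
    qed
    fix H assume H: "H : far I"
    have nH: "norm (fst H) <= A - 1" using normal_bound[of H] H by (auto simp: A_def far_def)
    have "norm (fst H) * rad I x * ?s <= (A - 1) * rad I x * ?s" using nH s1 by (intro mult_right_mono) auto
    also have "... <= A * rad I x * ?s" using s1 by (intro mult_right_mono) auto
    also have "... <= (m1 * c0 / 4) * rad I x * ?s" using m1(3) c0(1) s1 by (intro mult_right_mono) (auto simp: field_simps)
    also have "... = c0 / 4 * (m1 * rad I x * ?s)" by simp
    also have "... <= c0 / 4 * 2" using c0(1) by (intro mult_left_mono ob(1)[OF x]) auto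
    also have "... < c0" using c0(1) by simp
    finally have "norm (fst H) * rad I x * ?s < abs (lv H x) * ?s" using lower[OF H] by linarith
    then show "norm (fst H) * rad I x < abs (lv H x)" using s1 by (simp add: mult_less_cancel_right)
    fix z assume z: "norm (z - x) <= t"
    have "norm (fst H) * norm (z - x) * ?s <= A * t * ?s" using nH z s1 A by (intro mult_right_mono mult_mono) auto
    also have "... <= 4 * M * (A / K)" using A by (intro ak[OF x]) simp
    also have "... <= c0 / 2" using K(4) K1 c0(1) by (simp add: field_simps)
    also have "... < c0" using c0(1) by simp
    finally have "norm (fst H) * norm (z - x) * ?s < abs (lv H x) * ?s" using lower[OF H] by linarith
    then have l: "norm (fst H) * norm (z - x) < abs (lv H x)" using s1 by (simp add: mult_less_cancel_right)
    show sg: "sgn (lv H z) = sgn (lv H x)" by (rule sgn_lv_near_point[OF l])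
    have "lv H x ~= 0" using l mult_nonneg_nonneg[OF norm_ge_zero[of "fst H"] norm_ge_zero[of "z - x"]] by linarith
    then show "lv H z ~= 0" using sg by (metis sgn_zero_iff)
   next
    fix x z assume x: "x : outer_zone m1 M K I t" and z: "norm (z - x) <= t"
    show "sq t 2 x <= 2 * sq t 2 z"
    proof (rule sqrt_q_near_cball[OF t, where z=z and x=x and b=1])
     have "(2 * card flats) * t * sq t 2 x <= 2 * (2 * N / K)" using a2[OF x, of "2 * N"] by (simp add: N_def)
     also have "... <= 1" using K(3) K1 by (simp add: divide_le_eq)
     finally show "real (2 * card flats) * 1 * t * sq t 2 x <= 1" by simp
    qed (use z in auto)
   qed
  qed
 qed
qed
end

section \<open>Translating the pieces\<close>

context variational
begin

definition defect :: "('a => 'a) => ('a => 'a) => 'a => real" where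
 "defect g h x = (norm (g x) powr p + norm (h x) powr p) / 2 - norm ((1/2) *R (g x + h x)) powr p"

lemma defect_nonneg: "0 <= defect g h x"
 using norm_midpoint_powr[OF p(1), of "g x" "h x"] by (simp add: defect_def)

lemma C1c_midpoint:
 assumes "C1c Om v g" "C1c Om w h"
 shows "C1c Om (%x. (1/2) * (v x + w x)) (%x. (1/2) *R (g x + h x))"
proof -
 obtain K where K: "compact K" "K <= Om" "!!x. x ~: K ==> v x = 0" using C1cE[OF assms(1)] by metis
 obtain K' where K': "compact K'" "K' <= Om" "!!x. x ~: K' ==> w x = 0" using C1cE[OF assms(2)] by metis
 show ?thesis by (rule C1cI[OF C1_cmult[OF C1_add[OF C1c_C1[OF assms(1)] C1c_C1[OF assms(2)]]], of "K Un K'"]) (use K K' in auto)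
qed

lemma integrable_defect:
 assumes "C1c Om v g" "C1c Om w h"
 shows "integrable lborel (defect g h)" using integrable_grad[OF assms(1)] integrable_grad[OF assms(2)] integrable_grad[OF C1c_midpoint[OF assms]]
 unfolding defect_def[abs_def] by simp

text \<open>Testing minimality with the midpoint bounds the integrated convexity defect.\<close>

lemma defect_le:
 assumes v: "near_min c v g" and w: "near_min c' w h" and t: "0 < t"
  and d: "(LBINT x. abs (w x - v x) powr p) <= D * t powr p"
 shows "(LBINT x. defect g h x) <= p * (abs c + abs c' + 2 * t * (F0 + D))"
proof -
 note vC = near_minD(1)[OF v] and wC = near_minD(1)[OF w]
 note mC = C1c_midpoint[OF vC wC]
 let ?mid = "%x. (1/2) * (v x + w x)" and ?gm = "%x. (1/2) *R (g x + h x)"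
 have iw: "integrable lborel (%x. abs (w x - v x) powr p)"
 proof -
  obtain K where K: "compact K" "!!x. x ~: K ==> v x = 0" using C1cE[OF vC] by metis
  obtain K' where K': "compact K'" "!!x. x ~: K' ==> w x = 0" using C1cE[OF wC] by metis
  have c: "continuous_on UNIV (%x. w x - v x)" by (intro continuous_intros C1_cont[OF C1c_C1[OF wC]] C1_cont[OF C1c_C1[OF vC]])
  show ?thesis by (rule integrable_compact_support[of _ "K Un K'"]) (use K K' p continuous_norm_powr[OF c, of p] in auto)
 qed
 have t1: "abs (L w - L v) <= t * (F0 + D)"
 proof -
  have "abs (L w - L v) <= t * (F0 + (LBINT x. abs (w x - v x) powr p) / t powr p)" by (rule L_diff[OF wC vC t])
  also have "... <= t * (F0 + D)" using d t by (intro mult_left_mono add_left_mono) (auto simp: divide_le_eq)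
  finally show ?thesis .
 qed
 have t2: "abs (L ?mid - L v) <= t * (F0 + D)"
 proof -
  have "abs (L ?mid - L v) <= t * (F0 + (LBINT x. abs (?mid x - v x) powr p) / t powr p)" by (rule L_diff[OF mC vC t])
  also have "(LBINT x. abs (?mid x - v x) powr p) <= (LBINT x. abs (w x - v x) powr p)"
  proof (rule integral_mono'[OF iw])
   show "abs (?mid x - v x) powr p <= abs (w x - v x) powr p" for x using p by (intro powr_mono2) (auto simp: field_simps abs_if)
  qed simp
  then have "t * (F0 + (LBINT x. abs (?mid x - v x) powr p) / t powr p) <= t * (F0 + D)"
   using d t by (intro mult_left_mono add_left_mono) (auto simp: divide_le_eq)
  finally show ?thesis .
 qed
 have i: "integrable lborel (%x. norm (g x) powr p)" "integrable lborel (%x. norm (h x) powr p)" "integrable lborel (%x. norm (?gm x) powr p)"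
  using integrable_grad[OF vC] integrable_grad[OF wC] integrable_grad[OF mC] by auto
 have "(LBINT x. defect g h x) = (En g + En h) / 2 - En ?gm" unfolding defect_def En_def using i by simp
 moreover have "m <= En ?gm / p - L ?mid" using lower[OF mC] by (simp add: En_def)
 moreover have "En g / p - L v <= m + abs c" "En h / p - L w <= m + abs c'" using near_minD(2)[OF v] near_minD(2)[OF w] by linarith+
 ultimately have *: "(LBINT x. defect g h x) = (En g + En h) / 2 - En ?gm"
  "m <= En ?gm / p - L ?mid" "En g / p - L v <= m + abs c" "En h / p - L w <= m + abs c'" by blast+
 have "(LBINT x. defect g h x) / p = (En g / p + En h / p) / 2 - En ?gm / p" unfolding *(1) using p by (simp add: field_simps)
 moreover have "a = (b + b') / 2 - b'' ==> m <= b'' - l ==> b - l' <= m + abs c ==> b' - l'' <= m + abs c' ==>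
   abs (l'' - l') <= X ==> \<bar>l - l'\<bar> <= X ==> a <= abs c + abs c' + 2 * X" for a b b' b'' l l' l'' X :: real by argo
 ultimately have "(LBINT x. defect g h x) / p <= abs c + abs c' + 2 * (t * (F0 + D))" using *(2-4) t1 t2 by blast
 then show ?thesis using p by (simp add: field_simps)
qed
end

context polyhedral
begin

text \<open>The translation raises the energy by at most a multiple of t times the integral of |g|^p
  \<open>sq\<close>, hence by O(t). So w is again a near minimiser, and testing the midpoint of v
  and w bounds the convexity defect. The constant is the same for all directions w0. The last clause
  keeps track of where the support may have moved.\<close>

lemma translate_piece:
 assumes gz: "good_zone m1 M K Ceta I" and Ceta: "0 <= Ceta"
  and S: "push_piece I S e r" and Lam: "0 <= Lam"
 shows "EX C>=0. ALL t v g w0. 0 < t --> t <= 1 --> near_min (Lam * t) v g --> norm (w0 - e) <= r -->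
  (EX w gw. near_min (C * t) w gw & (LBINT x. defect g gw x) <= C * t & (ALL x:S Int inner_zone m1 M K I t.
      w x = shifted t w0 S v x &
      gw x = shifted t w0 S g x) & (ALL x. w x ~= 0 --> v x ~= 0 \<or> x : S Int outer_zone m1 M K I t &
      upstream t w0 S v x))"
proof -
 obtain E where E: "0 < E" "!!v g. near_min Lam v g ==> En g <= E" using energy_bound[of Lam] by blast
 obtain CW where CW: "0 <= CW" "!!t v g. 0 < t ==> t <= 1 ==> near_min (Lam * t) v g ==> Ewt t 2 g <= CW"
  using weight_bounded_two[OF dim] Lam unfolding weight_bounded_def by blast
 define Ca where "Ca = Lam + 16 * Ceta * CW + (F0 + 2 * E)"
 have Ca: "0 <= Ca" using Lam Ceta CW(1) F0 E(1) by (simp add: Ca_def)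
 define C where "C = max Ca (p * (Lam + Ca + 2 * (F0 + 2 * E)))"
 have C: "0 <= C" "Ca <= C" "p * (Lam + Ca + 2 * (F0 + 2 * E)) <= C" using Ca by (auto simp: C_def)
 have SS: "S <= Om" "open S" "open (far_region I Int Om - S)" "norm e = 1" "0 < r" "r <= 1"
  and push: "!!x s w. x : S ==> 0 <= s ==> norm (w - e) <= r ==> (!!H. H : far I ==> sgn (lv H (x + s *R w)) = sgn (lv H x)) ==> x + s *R w : S"
  using S unfolding push_piece_def by blast+
 show ?thesis
 proof (intro exI[of _ C] conjI allI impI C(1))
  fix t v g w0 assume t: "0 < t" "t <= (1::real)" and v: "near_min (Lam * t) v g" and w0: "norm (w0 - e) <= r"
  note vC = near_minD(1)[OF v]
  \<comment> \<open>The minus sign moves the support in the direction w0, as w takes at x the value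
    of v at x - (t/2) w0 where the cut-off is 1.\<close>
  define y where "y = - (t / 2) *R w0"
  have "norm w0 <= 2" using norm_triangle_ineq[of "w0 - e" e] w0 SS(4,6) by simp
  then have y: "norm y <= t" using t by (simp add: y_def)
  obtain eta geta where eta: "C1 eta geta" "ALL x. 0 <= eta x & eta x <= 1" "ALL x. norm (geta x) <= Ceta * sq t 2 x"
    "ALL x. t * norm (geta x) <= 1/2" "ALL x:inner_zone m1 M K I t. eta x = 1" "ALL x. x ~: outer_zone m1 M K I t --> eta x = 0"
   using conjunct1[OF gz[unfolded good_zone_def, rule_format, OF t(1)]] by (elim exE conjE) (rule that; assumption)
  note zone = conjunct2[OF gz[unfolded good_zone_def, rule_format, OF t(1)]]
  have zq: "sq t 2 x <= 2 * sq t 2 z" and zs: "!!H. H : far I ==> lv H z ~= 0 & sgn (lv H z) = sgn (lv H x)"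
   if "x : outer_zone m1 M K I t" "norm (z - x) <= t" for x z using bspec[OF zone that(1)] that(2) by blast+
  have small: "norm y * norm (geta x) <= 1/2" for x using mult_right_mono[OF y, of "norm (geta x)"] eta(4)[rule_format, of x] by simp
  have D: "deformation {} eta geta (%x. y)" by (rule translation_deformation[OF eta(1) small])
  interpret df: deformation "{}" eta geta "%x. y" by (rule D)
  let ?T = "outer_zone m1 M K I t"
  have T: "closed ?T" by (rule closed_outer_zone[OF t(1)])
  have getaT: "geta x = 0" if "x ~: ?T" for x by (rule gradient_zero_off[OF eta(1) T _ that]) (use eta(6) in blast)
  have etay: "norm ((s * eta x) *R y) <= t" if "0 <= s" "s <= 1" for s x
  proof -
   have "s * eta x <= 1" using that eta(2) by (intro mult_le_one) auto
   then have "norm ((s * eta x) *R y) <= 1 * norm y" using that eta(2)[rule_format, of x] by (auto intro!: mult_left_le_one_le)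
   then show ?thesis using y by simp
  qed
  \<comment> \<open>Read backwards: x is reached from the point x + s y of S by a step in the
    direction w0, and S absorbs such steps.\<close>
  have pushT: "x : S" if x: "x : ?T" and P: "x + s *R y : S" and s: "0 <= s" "s <= 1" for x s
  proof -
   have e: "x + s *R y + (s * (t / 2)) *R w0 = x" by (simp add: y_def)
   have "s * norm y <= 1 * t" using s y by (intro mult_mono) auto
   then have "norm (s *R y) <= t" using s by simp
   then have f: "sgn (lv H (x + s *R y)) = sgn (lv H x)" if "H : far I" for H using zs[OF x _ that, of "x + s *R y"] by simp
   have "x + s *R y + (s * (t / 2)) *R w0 : S"
   proof (rule push[OF P _ w0])
    show "0 <= s * (t / 2)" using s t by simp
    show "sgn (lv H (x + s *R y + (s * (t / 2)) *R w0)) = sgn (lv H (x + s *R y))" if "H : far I" for H unfolding e using f[OF that] by simp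
   qed
   then show ?thesis unfolding e .
  qed
  obtain w gw where w: "C1c Om w gw" "!!x. w x = (if x : S then (if df.Phi x : S then v (df.Phi x) else 0) else v x)"
   "!!x. gw x = (if x : S then (if df.Phi x : S then df.Adj x (g (df.Phi x)) else 0) else g x)"
   "(LBINT x. abs (w x - v x) powr p) <= 2 * t powr p * Epow p g"
  proof (rule df.piece_competitor[OF vC open_Om p(1) T, of "far_region I" S t])
   show "eta x = 0" if "x ~: ?T" for x using eta(6) that by blast
   show "open (far_region I)" by (rule open_far_region)
   show "x + s *R eta x *R y : far_region I" if "x : ?T" "0 <= s" "s <= 1" for x s
    unfolding far_region_def using zs[OF that(1), of "x + (s * eta x) *R y"] etay[OF that(2,3), of x] by simp
   show "open (far_region I Int S)" by (intro open_Int open_far_region SS)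
   show "x : S" if "x : ?T" "df.Phi x : S" for x using pushT[OF that(1), of "eta x"] that(2) eta(2) by (simp add: df.Phi_def)
   show "norm (eta x *R y) <= t" for x using etay[of 1 x] by simp
  qed (use SS in auto)
  define omega where "omega z = 1 + 16 * Ceta * (t * sq t 2 z)" for z
  have omegac: "continuous_on UNIV omega" unfolding omega_def[abs_def] by (intro continuous_intros continuous_q t)
  have q0: "0 <= t * sq t 2 x" for x using t q_ge_1[of t 2 x] by simp
  have omega1: "1 <= omega x" for x using q0[of x] Ceta by (simp add: omega_def)
  have "En gw <= (LBINT x. norm (g x) powr p * (if x : S then omega x else 1))" unfolding En_def
  proof (rule df.piece_energy_le[OF vC w(1) p(1) w(3) _ omegac])
   show "S : sets borel" using SS(2) by simp
   show "0 <= omega x" for x using omega1[of x] by simp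
   fix x
   have "norm (df.Adj x (g (df.Phi x))) powr p <=
     df.jac x * (norm (g (df.Phi x)) powr p * (1 + 8 * (norm y * norm (geta x))))" by (rule translation_Adj_le[OF D small]) (use p in auto)
   also have "... <= df.jac x * (norm (g (df.Phi x)) powr p * omega (df.Phi x))"
   proof (intro mult_left_mono)
    show "1 + 8 * (norm y * norm (geta x)) <= omega (df.Phi x)"
    proof (cases "x : ?T")
     case True
     have "norm y * norm (geta x) <= t * (Ceta * sq t 2 x)" using y eta(3) t by (intro mult_mono) auto
     also have "... <= t * (Ceta * (2 * sq t 2 (df.Phi x)))"
      using zq[OF True, of "df.Phi x"] etay[of 1 x] t Ceta by (intro mult_left_mono) (auto simp: df.Phi_def)
     finally show ?thesis by (simp add: omega_def mult_ac)
    next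
     case False
     then show ?thesis using omega1[of "df.Phi x"] getaT by simp
    qed
   qed (use df.jac_ge[of x] in auto)
   finally show "norm (df.Adj x (g (df.Phi x))) powr p <= df.jac x * (norm (g (df.Phi x)) powr p * omega (df.Phi x))" .
  qed
  also have "... <= (LBINT x. norm (g x) powr p * omega x)"
  proof (rule integral_mono')
   show "integrable lborel (%x. norm (g x) powr p * omega x)" by (rule integrable_weight[OF vC omegac])
   show "norm (g x) powr p * (if x : S then omega x else 1) <= norm (g x) powr p * omega x" for x using omega1[of x] by (intro mult_left_mono) auto
   show "0 <= norm (g x) powr p * omega x" for x using omega1[of x] by (intro mult_nonneg_nonneg) auto
  qed
  also have "... = En g + 16 * Ceta * (t * Ewt t 2 g)"
  proof -
   have i2: "integrable lborel (%x. norm (g x) powr p * sq t 2 x)" by (intro integrable_weight[OF vC] continuous_intros continuous_q t)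
   have "(LBINT x. norm (g x) powr p * omega x) = (LBINT x. norm (g x) powr p + 16 * Ceta * (t * (norm (g x) powr p * sq t 2 x)))"
    by (rule Bochner_Integration.integral_cong) (auto simp: omega_def algebra_simps)
   then show ?thesis using i2 integrable_grad[OF vC] by (simp add: En_def)
  qed
  also have "... <= En g + 16 * Ceta * (t * CW)" using Ceta t by (intro add_left_mono mult_left_mono CW(2)[OF t v]) auto
  finally have Ew: "En gw - En g <= 16 * Ceta * CW * t" by (simp add: algebra_simps)
  have Eg: "En g <= E" by (rule E(2)[OF near_min_mono[OF v]]) (use Lam t in "simp add: mult_left_le")
  have d: "(LBINT x. abs (w x - v x) powr p) <= (2 * E) * t powr p"
  proof -
   have "2 * t powr p * En g <= 2 * t powr p * E" using Eg by (intro mult_left_mono) auto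
   then show ?thesis using w(4) by (simp add: En_def mult_ac)
  qed
  have nw: "near_min (Ca * t) w gw"
  proof -
   have "(En gw - En g) / p <= 16 * Ceta * CW * t / p" using Ew p by (intro divide_right_mono) auto
   also have "... <= 16 * Ceta * CW * t"
   proof -
    have "0 <= 16 * Ceta * CW * t" using Ceta CW(1) t by (intro mult_nonneg_nonneg) auto
    from mult_left_mono[OF _ this, of 1 p] show ?thesis using p by (simp add: divide_le_eq)
   qed
   finally have "En gw / p - L w <= m + Lam * t + 16 * Ceta * CW * t + t * (F0 + 2 * E)" using near_min_change(1)[OF v w(1) t(1) d] by linarith
   then show ?thesis unfolding near_min_def Ca_def using w(1) by (simp add: algebra_simps)
  qed
  have df1: "(LBINT x. defect g gw x) <= C * t"
  proof -
   have "(LBINT x. defect g gw x) <= p * (abs (Lam * t) + abs (Ca * t) + 2 * t * (F0 + 2 * E))" by (rule defect_le[OF v nw t(1) d])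
   also have "... = (p * (Lam + Ca + 2 * (F0 + 2 * E))) * t" using Lam Ca t by (simp add: algebra_simps)
   also have "... <= C * t" using C(3) t by (intro mult_right_mono) auto
   finally show ?thesis .
  qed
  have nC: "near_min (C * t) w gw" by (rule near_min_mono[OF nw]) (use C(2) t in simp)
  show "EX w gw. near_min (C * t) w gw & (LBINT x. defect g gw x) <= C * t & (ALL x:S Int inner_zone m1 M K I t.
      w x = shifted t w0 S v x &
      gw x = shifted t w0 S g x) & (ALL x. w x ~= 0 --> v x ~= 0 \<or> x : S Int outer_zone m1 M K I t &
      upstream t w0 S v x)"
  proof (intro exI[of _ w] exI[of _ gw] conjI nC df1 ballI allI impI)
   fix x assume x: "x : S Int inner_zone m1 M K I t"
   then have P: "df.Phi x = x - (t / 2) *R w0" using eta(5) unfolding df.Phi_def by (simp add: y_def)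
   show "w x = shifted t w0 S v x" using x by (simp add: w(2) P)
   have "geta x = 0"
   proof -
    \<comment> \<open>\<open>eta\<close> attains its maximum 1 at \<open>x\<close>.\<close>
    have "(%h. geta x \<bullet> h) = (%h. 0)" by (rule differential_zero_maxmin[of x UNIV eta]) (use C1D[OF eta(1)] eta(2,5) x in auto)
    then have "geta x \<bullet> geta x = 0" by meson
    then show ?thesis by simp
   qed
   then show "gw x = shifted t w0 S g x" using x by (simp add: w(3) P df.Adj_def)
  next
   fix x assume wx: "w x ~= 0"
   have Px: "df.Phi x = x - (eta x * (t / 2)) *R w0" unfolding df.Phi_def by (simp add: y_def)
   show "v x ~= 0 \<or> x : S Int outer_zone m1 M K I t & upstream t w0 S v x"
   proof (cases "x : S & x : ?T")
    case True
    then have "df.Phi x : S" "v (df.Phi x) ~= 0" using wx by (auto simp: w(2) split: if_splits)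
    moreover have "0 <= eta x * (t / 2)" "eta x * (t / 2) <= t / 2" using eta(2)[rule_format, of x] t by (auto simp: mult_left_le_one_le)
    ultimately show ?thesis using True unfolding Px by blast
   next
    case False
    have "df.Phi x = x" if "x ~: ?T" using eta(6) that by (simp add: df.Phi_def)
    then have "w x = v x" using False by (auto simp: w(2))
    then show ?thesis using wx by simp
   qed
  qed
 qed
qed
end

section \<open>A Hardy inequality\<close>

lemma C1c_bounded:
 assumes "C1c Om v g"
 obtains B where "0 <= B" "!!x. norm (g x) <= B"
proof -
 obtain K where K: "C1 v g" "compact K" "!!x. x ~: K ==> g x = 0" using C1cE[OF assms] by metis
 have "bounded (g ` K)" by (intro compact_imp_bounded compact_continuous_image K continuous_on_subset[OF C1_grad_cont[OF K(1)]]) auto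
 then obtain B where B: "0 < B" "!!x. x : K ==> norm (g x) <= B" unfolding bounded_pos by blast
 show ?thesis by (rule that[of B]) (use B K(3) in "auto, metis less_imp_le norm_zero")
qed

lemma
 fixes F :: "'a::euclidean_space => 'b::{banach, second_countable_topology}"
 assumes [measurable]: "F : borel_measurable borel"
 shows integral_translate: "(LBINT x. F (x + y)) = (LBINT x. F x)"
  and integrable_translate: "integrable lborel F ==> integrable lborel (%x. F (x + y))"
proof -
 have "(LBINT x. F x) = (LINT x|distr lborel borel ((+) y). F x)" by (simp only: lborel_distr_plus)
 also have "... = (LBINT x. F (y + x))" by (rule integral_distr) measurable
 finally show "(LBINT x. F (x + y)) = (LBINT x. F x)" by (simp add: add.commute)
 assume "integrable lborel F"
 then have "integrable (distr lborel borel ((+) y)) F" by (simp only: lborel_distr_plus)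
 then have "integrable lborel (%x. F (y + x))" by (subst (asm) integrable_distr_eq) auto
 then show "integrable lborel (%x. F (x + y))" by (simp add: add.commute)
qed

text \<open>Difference quotients have integral zero by translation invariance; they are uniformly
  bounded, live on a fixed ball and converge to the directional derivative.\<close>

lemma integral_gradient_zero:
 assumes v: "C1c Om v g"
 shows "(LBINT x. g x \<bullet> b) = 0"
proof -
 obtain K where K: "C1 v g" "compact K" "!!x. x ~: K ==> v x = 0" "!!x. x ~: K ==> g x = 0" using C1cE[OF v] by metis
 obtain B where B: "0 <= B" "!!x. norm (g x) <= B" using C1c_bounded[OF v] by metis
 obtain R where R: "!!x. x : K ==> norm x <= R" using compact_imp_bounded[OF K(2)] unfolding bounded_iff by blast
 define s where "s n = inverse (real (Suc n))" for n
 have s: "0 < s n" "s n <= 1" for n by (auto simp: s_def field_simps)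
 have s0: "s \<longlonglongrightarrow> 0" unfolding s_def by (rule LIMSEQ_inverse_real_of_nat)
 define F where "F n x = (v (x + s n *R b) - v x) / s n" for n x
 have vi: "integrable lborel v" by (rule integrable_compact_support[OF C1_cont[OF K(1)] K(2,3)])
 have [measurable]: "v : borel_measurable borel" by (rule borel_measurable_continuous_onI[OF C1_cont[OF K(1)]])
 have [measurable]: "g : borel_measurable borel" by (rule borel_measurable_continuous_onI[OF C1_grad_cont[OF K(1)]])
 have F0: "(LBINT x. F n x) = 0" for n unfolding F_def using vi integrable_translate[of v, OF _ vi] integral_translate[of v] by simp
 have F_le: "norm (F n x) <= B * norm b * indicator (cball 0 (R + norm b)) x" for n x
 proof -
  have "abs (v (x + s n *R b) - v x) <= B * norm (s n *R b)" using C1_lipschitz_segment[OF K(1), of x "x + s n *R b" B] B by simp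
  then have "abs (F n x) <= B * norm b" using s[of n] by (simp add: F_def field_simps)
  moreover have "F n x = 0" if "x ~: cball 0 (R + norm b)"
  proof -
   have "norm (s n *R b) <= norm b" using s[of n] by (auto intro!: mult_left_le_one_le)
   then have "R < norm x" "R < norm (x + s n *R b)" using that norm_ge_zero[of b] norm_diff_ineq[of x "s n *R b"] unfolding mem_cball_0 by linarith+
   then have "x ~: K" "x + s n *R b ~: K" using R by force+
   then show ?thesis by (simp add: F_def K)
  qed
  ultimately show ?thesis by (auto simp: indicator_def)
 qed
 have F_lim: "(%n. F n x) \<longlonglongrightarrow> g x \<bullet> b" for x
 proof -
  have "((%t. v (x + t *R b)) has_derivative (%t. g x \<bullet> (t *R b))) (at 0)"
   by (rule has_derivative_compose[of "%t. x + t *R b" _ _ _ v]) (auto intro!: derivative_eq_intros C1D[OF K(1)] simp: C1D[OF K(1)])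
  then have "((%t. v (x + t *R b)) has_field_derivative (g x \<bullet> b)) (at 0)"
   unfolding has_field_derivative_def by (rule has_derivative_eq_rhs) (auto simp: mult.commute)
  then have *: "((%t. (v (x + t *R b) - v x) / t) \<longlongrightarrow> g x \<bullet> b) (at 0)" by (simp add: DERIV_def)
  have "filterlim s (at 0) sequentially" unfolding filterlim_at using s0 s by (auto intro!: always_eventually simp: less_imp_neq[symmetric])
  from filterlim_compose[OF * this] show ?thesis by (simp add: F_def)
 qed
 have "(%n. LBINT x. F n x) \<longlonglongrightarrow> (LBINT x. g x \<bullet> b)"
 proof (rule integral_dominated_convergence[where w = "%x. B * norm b * indicator (cball 0 (R + norm b)) x"])
  show "integrable lborel (%x::'a. B * norm b * indicator (cball 0 (R + norm b)) x)" by (intro integrable_mult_right integrable_real_indicator)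
     (use emeasure_compact_finite[OF compact_cball] in "auto simp: less_top[symmetric]")
  show "(%x. F n x) : borel_measurable lborel" for n unfolding F_def by measurable
 qed (use F_le F_lim in auto)
 then show ?thesis unfolding F0 using LIMSEQ_unique tendsto_const by blast
qed

lemma abs_powr_deriv:
 fixes p :: real
 assumes p: "1 < p"
 defines "d \<equiv> %s. p * (max 0 s powr (p - 1) - max 0 (- s) powr (p - 1))"
 shows "((%s. abs s powr p) has_field_derivative d s) (at s)" "continuous_on UNIV d" "abs (d s) = p * abs s powr (p - 1)"
proof -
 define M where "M s = max 0 s powr p" for s :: real
 have dM: "(M has_field_derivative p * max 0 s powr (p - 1)) (at s)" for s
 proof -
  consider "s < 0" | "s = 0" | "0 < s" by linarith
  then show ?thesis
  proof cases
   case 1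
   have "(M has_field_derivative 0) (at s)" by (rule has_field_derivative_transform_within_open[OF DERIV_const[of 0], of "{..<0}"])
      (use 1 p in "auto simp: M_def")
   then show ?thesis using 1 p by simp
  next
   case 2
   have l: "((%h::real. max 0 h powr (p - 1)) \<longlongrightarrow> max 0 0 powr (p - 1)) (at 0)"
    by (intro tendsto_intros) (use p in "auto simp: eventually_at_filter")
   have "((%h. (M (0 + h) - M 0) / h) \<longlongrightarrow> max 0 0 powr (p - 1)) (at 0)" by (rule Lim_transform_eventually[OF l])
      (use p in "auto simp: eventually_at_filter M_def max_def powr_mult_self[symmetric]")
   then show ?thesis using 2 p by (simp add: DERIV_def)
  next
   case 3
   have "(M has_field_derivative p * s powr (p - 1)) (at s)" by (rule has_field_derivative_transform_within_open[of "%s. s powr p" _ _ "{0<..}"])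
      (use 3 in "auto simp: M_def intro!: derivative_eq_intros")
   then show ?thesis using 3 by simp
  qed
 qed
 have "((%s. M (- s)) has_field_derivative (p * max 0 (- s) powr (p - 1)) * (- 1)) (at s)"
  by (rule DERIV_chain2[OF dM]) (auto intro!: derivative_eq_intros)
 from DERIV_add[OF dM[of s] this]
 have "((%s. M s + M (- s)) has_field_derivative d s) (at s)" by (simp add: d_def algebra_simps)
 moreover have "(%s. M s + M (- s)) = (%s. abs s powr p)" using p by (auto simp: M_def max_def fun_eq_iff)
 ultimately show "((%s. abs s powr p) has_field_derivative d s) (at s)" by simp
 show "continuous_on UNIV d" unfolding d_def using p by (intro continuous_intros continuous_on_powr') auto
 show "abs (d s) = p * abs s powr (p - 1)" using p by (auto simp: d_def max_def abs_mult)
qed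

text \<open>A non-sharp Young inequality: if c <= delta a the first term suffices, otherwise the
  second.\<close>

lemma powr_young:
 fixes a c delta p :: real
 assumes "1 < p" "0 <= a" "0 <= c" "0 < delta"
 shows "a powr (p - 1) * c <= delta * a powr p + delta powr (1 - p) * c powr p"
proof (cases "c <= delta * a")
 case True
 have "a powr (p - 1) * c <= a powr (p - 1) * (delta * a)" using True by (intro mult_left_mono) auto
 also have "... = delta * a powr p" using powr_mult_self[of a p] assms by (simp add: mult_ac)
 finally show ?thesis using assms by (simp add: add_increasing2)
next
 case False
 have "a powr (p - 1) * c <= (c / delta) powr (p - 1) * c" using False assms by (intro mult_right_mono powr_mono2) (auto simp: field_simps)
 also have "... = delta powr (1 - p) * c powr p" using powr_mult_self[of c p] assms by (simp add: powr_divide powr_diff field_simps)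
 finally show ?thesis using assms by (simp add: add_increasing)
qed

context arrangement
begin

definition hardy_const :: "real => real" where "hardy_const p = 2 / (2 - p) * (p * ((2 - p) / (2 * p)) powr (1 - p))"

text \<open>The divergence of the normal field divided by the \<open>(p + 1)\<close>-st power of the distance to
 the flat is at least \<open>k - p - 1 > 0\<close> times that power.\<close>

lemma hardy:
 assumes v: "C1c Om v g" and p: "1 < p" "p < 2" and I: "3 <= codim I" and t: "0 < t"
 defines "R2 \<equiv> %x. (rad I x)^2 + t^2"
 shows "(LBINT x. abs (v x) powr p * R2 x powr (- (p + 1) / 2))
   <= hardy_const p * (LBINT x. norm (g x) powr p * R2 x powr (- 1 / 2))"
proof -
 note on = nbasis(1)[of I]
 define B where "B = nbasis I"
 have fB: "finite B" using on by (simp add: orthonormal_def B_def)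
 have R2: "0 < R2 x" for x unfolding R2_def using t by (simp add: add_nonneg_pos)
 have R2c: "C1 R2 (%x. 2 *R nrm I x)" unfolding R2_def nrm_def by (rule C1_norm_proj[OF on])
 define omega where "omega x = R2 x powr (- (p + 1) / 2)" for x
 define omega' where "omega' x = R2 x powr (- 1 / 2)" for x
 have omegaC: "C1 omega (%x. (- (p + 1) / 2 * R2 x powr (- (p + 1) / 2 - 1)) *R (2 *R nrm I x))" unfolding omega_def[abs_def]
 proof (rule C1_compose_real[OF R2c])
  show "((%a. a powr (- (p + 1) / 2)) has_field_derivative - (p + 1) / 2 * R2 x powr (- (p + 1) / 2 - 1)) (at (R2 x))" for x
   using R2[of x] by (rule has_real_derivative_powr)
  show "continuous_on (range R2) (%a. - (p + 1) / 2 * a powr (- (p + 1) / 2 - 1))"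
   using R2 by (intro continuous_intros) (auto simp: less_imp_neq[symmetric])
 qed
 define d where "d s = p * (max 0 s powr (p - 1) - max 0 (- s) powr (p - 1))" for s
 note d = abs_powr_deriv[OF p(1), folded d_def]
 have VC: "C1 (%x. abs (v x) powr p) (%x. d (v x) *R g x)"
  by (rule C1_compose_real[OF C1c_C1[OF v] d(1)]) (rule continuous_on_subset[OF d(2)], simp)
 have lin: "C1 (%x. (x - base I) \<bullet> b) (%x. b)" for b unfolding C1_def by (auto intro!: derivative_eq_intros simp: inner_commute)
 \<comment> \<open>The gradient of the b-th component of the field |v|^p omega times the normal
   vector. Summing its b-th entries over the normal basis gives the divergence D, whose integral is
   zero.\<close>
 define G where "G b x = abs (v x) powr p *R (omega x *R b + ((x - base I) \<bullet> b) *R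
   ((- (p + 1) / 2 * R2 x powr (- (p + 1) / 2 - 1)) *R (2 *R nrm I x))) + (omega x * ((x - base I) \<bullet> b)) *R (d (v x) *R g x)" for b x
 obtain K where K: "compact K" "K <= Om" "!!x. x ~: K ==> v x = 0" using C1cE[OF v] by metis
 have GC: "C1c Om (%x. abs (v x) powr p * (omega x * ((x - base I) \<bullet> b))) (G b)" for b
  unfolding G_def[abs_def] by (rule C1cI[OF C1_mult[OF VC C1_mult[OF omegaC lin]] K(1,2)]) (use K p in auto)
 have Gi: "integrable lborel (%x. G b x \<bullet> b)" for b
 proof -
  obtain K' where K': "compact K'" "!!x. x ~: K' ==> G b x = 0" using C1cE[OF GC[of b]] by metis
  show ?thesis by (rule integrable_compact_support[OF _ K'(1)]) (use K'(2) in "auto intro!: continuous_intros C1_grad_cont[OF C1c_C1[OF GC]]")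
 qed
 define D where "D x = (SUM b:B. G b x \<bullet> b)" for x
 have D0: "(LBINT x. D x) = 0" and Di: "integrable lborel D" unfolding D_def[abs_def] using Gi by (simp_all add: integral_gradient_zero[OF GC])
 \<comment> \<open>Chosen with p delta = (2 - p)/2, so that the term with the derivative of |v|^p
   absorbs only half of the (2 - p) |v|^p omega left by the divergence of the field.\<close>
 define delta where "delta = (2 - p) / (2 * p)"
 have delta: "0 < delta" using p by (simp add: delta_def)
 have "(2 - p) / 2 * (abs (v x) powr p * omega x) <= D x + p * delta powr (1 - p) * (norm (g x) powr p * omega' x)" for x
 proof -
  define n where "n = rad I x"
  have nx: "(SUM b:B. ((x - base I) \<bullet> b) * (y \<bullet> b)) = nrm I x \<bullet> y" for y unfolding nrm_def inner_proj B_def ..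
  have n2: "nrm I x \<bullet> nrm I x = n^2" by (simp add: n_def power2_norm_eq_inner)
  have b1: "(SUM b:B. b \<bullet> b) = real (codim I)" using on unfolding nbasis(3)[symmetric] B_def orthonormal_def by (simp add: norm_eq_1)
  define kap where "kap = R2 x powr (- (p + 1) / 2 - 1)"
  have kap: "R2 x * kap = omega x" "0 <= kap" unfolding kap_def omega_def using R2[of x] by (auto simp: powr_diff)
  have D: "D x = abs (v x) powr p * (real (codim I) * omega x - (p + 1) * kap * n^2) + omega x * (d (v x) * (nrm I x \<bullet> g x))"
  proof -
   have "G b x \<bullet> b = abs (v x) powr p * (omega x * (b \<bullet> b)) - abs (v x) powr p * ((p + 1) * kap) * (((x - base I) \<bullet> b) * (nrm I x \<bullet> b))
     + omega x * d (v x) * (((x - base I) \<bullet> b) * (g x \<bullet> b))" for b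
   proof -
    have e: "(- (p + 1) / 2 * kap) *R (2 *R nrm I x) = (- ((p + 1) * kap)) *R nrm I x"
     unfolding scaleR_scaleR by (rule arg_cong[where f = "%c. c *R nrm I x"]) (simp add: field_simps)
    show ?thesis unfolding G_def kap_def[symmetric] e by (simp add: inner_add_left algebra_simps)
   qed
   then have "D x = abs (v x) powr p * (omega x * (SUM b:B. b \<bullet> b))
     - abs (v x) powr p * ((p + 1) * kap) * (SUM b:B. ((x - base I) \<bullet> b) * (nrm I x \<bullet> b))
     + omega x * d (v x) * (SUM b:B. ((x - base I) \<bullet> b) * (g x \<bullet> b))"
    unfolding D_def by (simp add: sum.distrib sum_subtractf sum_distrib_left)
   then show ?thesis unfolding nx n2 b1 by (simp add: algebra_simps)
  qed
  have "kap * n^2 <= omega x" unfolding kap(1)[symmetric] using kap(2) by (simp add: R2_def n_def algebra_simps)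
  then have "(p + 1) * (kap * n^2) <= (p + 1) * omega x" using p by (intro mult_left_mono) auto
  moreover have "3 * omega x <= real (codim I) * omega x" using I by (intro mult_right_mono) (auto simp: omega_def)
  ultimately have "(2 - p) * omega x <= real (codim I) * omega x - (p + 1) * kap * n^2" by (simp add: algebra_simps)
  from mult_left_mono[OF this, of "abs (v x) powr p"]
  have 1: "(2 - p) * (abs (v x) powr p * omega x) <= abs (v x) powr p * (real (codim I) * omega x - (p + 1) * kap * n^2)"
   by (simp add: mult_ac)
  have 2: "abs (d (v x) * (nrm I x \<bullet> g x)) <= p * (delta * abs (v x) powr p + delta powr (1 - p) * (n * norm (g x)) powr p)"
  proof -
   have "abs (d (v x) * (nrm I x \<bullet> g x)) <= p * abs (v x) powr (p - 1) * (n * norm (g x))"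
    unfolding abs_mult d(3) n_def using p by (intro mult_left_mono Cauchy_Schwarz_ineq2) auto
   also have "... <= p * (delta * abs (v x) powr p + delta powr (1 - p) * (n * norm (g x)) powr p)"
    using powr_young[of p "abs (v x)" "n * norm (g x)" delta] p delta by (simp add: n_def)
   finally show ?thesis .
  qed
  have 3: "omega x * (n * norm (g x)) powr p <= norm (g x) powr p * omega' x"
  proof -
   have "n powr p <= (sqrt (R2 x)) powr p" using p by (intro powr_mono2) (auto simp: n_def R2_def intro!: real_le_rsqrt)
   then have "omega x * n powr p <= omega x * R2 x powr (p / 2)"
    using R2[of x] by (intro mult_left_mono) (auto simp: omega_def powr_half_sqrt[symmetric] powr_powr)
   also have "... = omega' x" unfolding omega_def omega'_def by (simp add: powr_add[symmetric] field_simps)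
   finally have "norm (g x) powr p * (omega x * n powr p) <= norm (g x) powr p * omega' x" by (intro mult_left_mono) auto
   then show ?thesis by (simp add: powr_mult n_def mult_ac)
  qed
  have "omega x * - (d (v x) * (nrm I x \<bullet> g x)) <= omega x * (p * (delta * abs (v x) powr p + delta powr (1 - p) * (n * norm (g x)) powr p))"
   using 2 by (intro mult_left_mono) (auto simp: omega_def)
  also have "... = p * delta * (abs (v x) powr p * omega x) + p * delta powr (1 - p) * (omega x * (n * norm (g x)) powr p)"
   by (simp add: algebra_simps)
  also have "... <= (2 - p) / 2 * (abs (v x) powr p * omega x) + p * delta powr (1 - p) * (norm (g x) powr p * omega' x)"
   using 3 p by (intro add_mono mult_left_mono) (auto simp: delta_def)
  finally have "- (omega x * (d (v x) * (nrm I x \<bullet> g x)))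
    <= (2 - p) * (abs (v x) powr p * omega x) / 2 + p * delta powr (1 - p) * (norm (g x) powr p * omega' x)" by simp
  with 1 show ?thesis unfolding D times_divide_eq_left by linarith
 qed
 note pt = this
 have i: "integrable lborel (%x. abs (v x) powr p * omega x)" "integrable lborel (%x. norm (g x) powr p * omega' x)"
  using p R2 by (auto intro!: C1c_powr_weight(2,4)[OF v] C1_cont[OF omegaC] continuous_intros C1_cont[OF R2c]
   simp: omega'_def less_imp_neq[symmetric])
 have "(2 - p) / 2 * (LBINT x. abs (v x) powr p * omega x) = (LBINT x. (2 - p) / 2 * (abs (v x) powr p * omega x))" by simp
 also have "... <= (LBINT x. D x + p * delta powr (1 - p) * (norm (g x) powr p * omega' x))" by (rule integral_mono[OF _ _ pt]) (use Di i in auto)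
 also have "... = p * delta powr (1 - p) * (LBINT x. norm (g x) powr p * omega' x)" using Di i by (simp add: D0)
 finally show ?thesis using p unfolding omega_def omega'_def hardy_const_def delta_def[symmetric] by (simp add: field_simps)
qed
end

section \<open>Cutting off near the flats of codimension at least three\<close>

lemma one_plus_sum_powr_le:
 fixes a :: "'i => real" and s :: real
 assumes A: "finite A" "!!i. i : A ==> 0 <= a i" and s: "0 <= s"
 shows "(1 + (SUM i:A. a i)) powr s <= (1 + real (card A)) powr s * (1 + (SUM i:A. a i powr s))"
proof -
 define M where "M = Max (insert 1 (a ` A))"
 have M: "1 <= M" "!!i. i : A ==> a i <= M" using A by (auto simp: M_def)
 have "M : insert 1 (a ` A)" unfolding M_def by (rule Max_in) (use A in auto)
 then have "M powr s <= 1 + (SUM i:A. a i powr s)"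
 proof
  assume "M : a ` A"
  then obtain i where "i : A" "M = a i" by blast
  then show ?thesis using member_le_sum[of i A "%i. a i powr s"] A by simp
 qed (simp add: sum_nonneg)
 moreover have "(SUM i:A. a i) <= real (card A) * M" by (rule sum_bounded_above) (rule M)
 then have "(1 + (SUM i:A. a i)) powr s <= ((1 + real (card A)) * M) powr s"
  using M A s by (intro powr_mono2) (auto simp: sum_nonneg add_nonneg_nonneg algebra_simps)
 then have "(1 + (SUM i:A. a i)) powr s <= (1 + real (card A)) powr s * M powr s" using M by (simp add: powr_mult)
 ultimately show ?thesis by (meson mult_left_mono order_trans powr_ge_zero)
qed

context variational
begin

lemma q_nonzero: "q t k x ~= 0"
 using q_ge_1[of t k x] by linarith

text \<open>The power (p + 1)/2 of q corresponds to the inverse distance to the power p + 1, one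
  more than in the usual Hardy inequality; in exchange the gradient carries the weight 1/dist, whose
  integral is already bounded. The additional power is what makes the cut-off cost only
  O(t).\<close>

lemma singular_weight_bounded:
 assumes dim: "2 <= DIM('a)" and Lam: "0 <= Lam"
 obtains C where "0 <= C" "!!t v g. 0 < t ==> t <= 1 ==> near_min (Lam * t) v g ==>
   (LBINT x. abs (v x) powr p * q t 2 x powr ((p + 1) / 2)) <= C"
proof -
 obtain E where E: "0 < E" "!!v g. near_min Lam v g ==> En g <= E" using energy_bound[of Lam] by blast
 obtain CP where CP: "0 < CP" "!!v g. C1c Om v g ==> (LBINT x. abs (v x) powr p) <= CP * En g" using poincare by blast
 obtain CW where CW: "0 <= CW" "!!t v g. 0 < t ==> t <= 1 ==> near_min (Lam * t) v g ==> Ewt t 2 g <= CW"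
  using weight_bounded_two[OF dim] Lam unfolding weight_bounded_def by blast
 let ?s = "(p + 1) / 2" and ?A = "deeper 2"
 have hc: "0 <= hardy_const p" using p by (simp add: hardy_const_def)
 define C where "C = (1 + real (card ?A)) powr ?s * (CP * E + real (card ?A) * (hardy_const p * CW))"
 show ?thesis
 proof (rule that[of C])
  show "0 <= C" unfolding C_def using CP(1) E(1) CW(1) hc by (intro mult_nonneg_nonneg add_nonneg_nonneg) auto
  fix t v g assume t: "0 < t" "t <= (1::real)" and v: "near_min (Lam * t) v g"
  note vC = near_minD(1)[OF v]
  define R2 where "R2 J x = (rad J x)^2 + t^2" for J x
  have R2: "0 < R2 J x" for J x unfolding R2_def using t by (simp add: add_nonneg_pos)
  have R2c: "continuous_on UNIV (%x. R2 J x powr r)" for J r unfolding R2_def[abs_def] using R2[of J, unfolded R2_def]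
   by (intro continuous_intros continuous_nrm) (auto simp: less_imp_neq[symmetric])
  have i: "integrable lborel (%x. abs (v x) powr p * R2 J x powr r)" "integrable lborel (%x. abs (v x) powr p)"
    "integrable lborel (%x. norm (g x) powr p * R2 J x powr r)" for J r
   using C1c_powr_weight(2,4)[OF vC _ R2c, of p J r] C1c_powr(2)[OF vC, of p] p by auto
  have h: "(LBINT x. abs (v x) powr p * R2 J x powr (- (p + 1) / 2)) <= hardy_const p * CW" if J: "J : ?A" for J
  proof -
   have "(LBINT x. abs (v x) powr p * R2 J x powr (- (p + 1) / 2)) <=
     hardy_const p * (LBINT x. norm (g x) powr p * R2 J x powr (- 1 / 2))"
    unfolding R2_def by (rule hardy[OF vC p _ t(1)]) (use J in "simp add: deeper_def")
   also have "(LBINT x. norm (g x) powr p * R2 J x powr (- 1 / 2)) <= Ewt t 2 g"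
   proof (rule integral_mono[OF i(3) integrable_weight[OF vC]])
    show "continuous_on UNIV (%x. sq t 2 x)" by (intro continuous_intros continuous_q t)
    fix x
    have "R2 J x powr (- 1 / 2) = sqrt (inverse (R2 J x))" using R2[of J x] by (simp add: powr_minus powr_half_sqrt real_sqrt_inverse)
    also have "... <= sq t 2 x" using q_ge[OF J, where t = t and x = x] by (simp add: R2_def)
    finally show "norm (g x) powr p * R2 J x powr (- 1 / 2) <= norm (g x) powr p * sq t 2 x" by (rule mult_left_mono) simp
   qed
   also have "... <= CW" by (rule CW(2)[OF t v])
   finally show ?thesis using hc by (simp add: mult_left_mono)
  qed
  have "(LBINT x. abs (v x) powr p * q t 2 x powr ?s) <= (LBINT x. (1 + real (card ?A)) powr ?s *
      (abs (v x) powr p + (SUM J:?A. abs (v x) powr p * R2 J x powr (- (p + 1) / 2))))"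
  proof (rule integral_mono[OF C1c_powr_weight(4)[OF vC]])
   show "continuous_on UNIV (%x. q t 2 x powr ?s)" by (intro continuous_intros continuous_q t) (use q_nonzero in auto)
   show "integrable lborel (%x. (1 + real (card ?A)) powr ?s *
      (abs (v x) powr p + (SUM J:?A. abs (v x) powr p * R2 J x powr (- (p + 1) / 2))))" using i by auto
   fix x
   have "q t 2 x powr ?s <= (1 + real (card ?A)) powr ?s * (1 + (SUM J:?A. inverse (R2 J x) powr ?s))"
    unfolding q_def R2_def by (rule one_plus_sum_powr_le[OF finite_deeper]) (use p in auto)
   also have "(SUM J:?A. inverse (R2 J x) powr ?s) = (SUM J:?A. R2 J x powr (- (p + 1) / 2))"
    by (rule sum.cong) (use R2 in "auto simp: powr_minus inverse_powr less_imp_le minus_divide_left[symmetric] simp del: minus_add_distrib")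
   finally show "abs (v x) powr p * q t 2 x powr ?s <= (1 + real (card ?A)) powr ?s *
      (abs (v x) powr p + (SUM J:?A. abs (v x) powr p * R2 J x powr (- (p + 1) / 2)))"
    using mult_left_mono[of _ _ "abs (v x) powr p"] by (fastforce simp: sum_distrib_left algebra_simps)
  qed (use p in simp)
  also have "... = (1 + real (card ?A)) powr ?s * ((LBINT x. abs (v x) powr p) +
    (SUM J:?A. (LBINT x. abs (v x) powr p * R2 J x powr (- (p + 1) / 2))))" using i by simp
  also have "... <= C" unfolding C_def
  proof (intro mult_left_mono add_mono sum_bounded_above h)
   have "En g <= E" by (rule E(2)[OF near_min_mono[OF v]]) (use Lam t in "simp add: mult_left_le")
   then show "(LBINT x. abs (v x) powr p) <= CP * E" using CP(2)[OF vC] CP(1) by (meson mult_left_mono less_imp_le order_trans)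
  qed auto
  finally show "(LBINT x. abs (v x) powr p * q t 2 x powr ?s) <= C" .
 qed
qed

text \<open>The cut-off differs from 1 only where 2 K t \<open>sq\<close> >= 1, so factors 2 K t
  \<open>sq\<close> can be inserted there. The energy then changes by O(t) times the integrals of
  |g|^p \<open>sq\<close> and |v|^p \<open>sq\<close>^(p + 1), and the p-th power distance from v is
  O(t^(p + 1)).\<close>

lemma cut_singular:
 fixes K :: real
 assumes dim: "2 <= DIM('a)" and Lam: "0 <= Lam" and K: "1 <= K"
 shows "EX C>=0. ALL t v g. 0 < t --> t <= 1 --> near_min (Lam * t) v g -->
  (EX w gw. near_min (C * t) w gw & (ALL x. w x ~= 0 --> K * t * sq t 2 x <= 1))"
proof -
 obtain CW where CW: "0 <= CW" "!!t v g. 0 < t ==> t <= 1 ==> near_min (Lam * t) v g ==> Ewt t 2 g <= CW"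
  using weight_bounded_two[OF dim] Lam unfolding weight_bounded_def by blast
 obtain CQ where CQ: "0 <= CQ" "!!t v g. 0 < t ==> t <= 1 ==> near_min (Lam * t) v g ==>
   (LBINT x. abs (v x) powr p * q t 2 x powr ((p + 1) / 2)) <= CQ" using singular_weight_bounded[OF dim Lam] by blast
 obtain phi phi' :: "real => real" and C0 where phi: "!!s. (phi has_field_derivative phi' s) (at s)" "continuous_on UNIV phi'"
  "!!s. 0 <= phi s" "!!s. phi s <= 1" "!!s. s <= 0 ==> phi s = 0" "!!s. 1 <= s ==> phi s = 1"
  "!!s. s <= 0 ==> phi' s = 0" "!!s. 1 <= s ==> phi' s = 0" "0 <= C0" "!!s. abs (phi' s) <= C0" by (rule smooth_step) (rule that; assumption)
 define Cz where "Cz = 4 * C0 * real (card flats)"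
 have Cz: "0 <= Cz" using phi(9) by (simp add: Cz_def)
 define Ce where "Ce = 2 powr p * (2 * K) * (CW + Cz powr p * CQ)"
 define Cd where "Cd = (2 * K) powr (p + 1) * CQ"
 have Ce: "0 <= Ce" unfolding Ce_def using K CW CQ by (intro mult_nonneg_nonneg add_nonneg_nonneg) auto
 have Cd: "0 <= Cd" unfolding Cd_def using CQ by simp
 define C where "C = Lam + Ce + (F0 + Cd)"
 show ?thesis
 proof (intro exI[of _ C] conjI allI impI)
  show "0 <= C" using Lam Ce Cd F0 by (simp add: C_def)
  fix t v g assume t: "0 < t" "t <= (1::real)" and v: "near_min (Lam * t) v g"
  note vC = near_minD(1)[OF v]
  obtain gq where gq: "C1 (q t 2) gq" "!!x. norm (gq x) <= 2 * card flats * (q t 2 x * sq t 2 x)" using C1_q[OF t(1)] by blast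
  define Z where "Z x = 2 * K^2 * t^2 * q t 2 x" for x
  define zeta where "zeta x = phi (2 - Z x)" for x
  define gzeta where "gzeta x = phi' (2 - Z x) *R (0 - (2 * K^2 * t^2) *R gq x)" for x
  have zetaC: "C1 zeta gzeta" unfolding zeta_def[abs_def] gzeta_def[abs_def] Z_def
   by (rule C1_compose_real[OF C1_diff[OF C1_const C1_cmult[OF gq(1)]] phi(1) continuous_on_subset[OF phi(2)]]) simp
  have q1: "1 <= sq t 2 x" for x using q_ge_1[of t 2 x] by simp
  have sq: "sq t 2 x ^ 2 = q t 2 x" for x using q_ge_1[of t 2 x] by simp
  have Z1: "1 <= 2 * K * t * sq t 2 x" if "1 <= Z x" for x
  proof -
   have "1 <= (2 * K * t * sq t 2 x)^2" using that sq[of x] by (simp add: Z_def power_mult_distrib)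
   then show ?thesis using K t q1[of x] by (smt (verit) mult_nonneg_nonneg power2_le_imp_le power_one)
  qed
  have gzeta: "norm (gzeta x) <= Cz * sq t 2 x" for x
  proof (cases "1 <= Z x & Z x <= 2")
   case True
   have "norm (gzeta x) = abs (phi' (2 - Z x)) * (2 * K^2 * t^2 * norm (gq x))" unfolding gzeta_def by (simp add: abs_mult)
   also have "... <= C0 * (2 * K^2 * t^2 * (2 * card flats * (q t 2 x * sq t 2 x)))"
    using phi(9,10) gq(2) by (intro mult_mono mult_left_mono) auto
   also have "... = Z x * (2 * C0 * card flats * sq t 2 x)" by (simp add: Z_def)
   also have "... <= 2 * (2 * C0 * card flats * sq t 2 x)" using True phi(9) q1[of x] by (intro mult_right_mono mult_nonneg_nonneg) auto
   finally show ?thesis by (simp add: Cz_def)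
  next
   case False
   then have "gzeta x = 0" using phi(7,8)[of "2 - Z x"] by (auto simp: gzeta_def)
   then show ?thesis using Cz q1[of x] by simp
  qed
  define w where "w x = zeta x * v x" for x
  define gw where "gw x = zeta x *R g x + v x *R gzeta x" for x
  obtain K' where K': "compact K'" "K' <= Om" "!!x. x ~: K' ==> v x = 0" using C1cE[OF vC] by metis
  have wC: "C1c Om w gw" unfolding w_def[abs_def] gw_def[abs_def] by (rule C1cI[OF C1_mult[OF zetaC C1c_C1[OF vC]] K'(1,2)]) (use K'(3) in simp)
  define Q where "Q x = q t 2 x powr ((p + 1) / 2)" for x
  have Qs: "Q x = sq t 2 x powr (p + 1)" for x using q_ge_1[of t 2 x] by (simp add: Q_def powr_half_sqrt[symmetric] powr_powr)
  have iQ: "integrable lborel (%x. abs (v x) powr p * Q x)"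
   unfolding Q_def by (intro C1c_powr_weight(4)[OF vC] continuous_intros continuous_q t) (use q_nonzero p in auto)
  have iW: "integrable lborel (%x. norm (g x) powr p * sq t 2 x)" by (intro integrable_weight[OF vC] continuous_intros continuous_q t)
  have gw_le: "norm (gw x) powr p <= norm (g x) powr p +
    2 powr p * (2 * K * t) * (norm (g x) powr p * sq t 2 x + Cz powr p * (abs (v x) powr p * Q x))" for x
  proof (cases "Z x <= 1")
   case True
   then have "gw x = g x" using phi(6,8)[of "2 - Z x"] by (simp add: gw_def zeta_def gzeta_def)
   moreover have "0 <= 2 powr p * (2 * K * t) * (norm (g x) powr p * sq t 2 x + Cz powr p * (abs (v x) powr p * Q x))"
    using K t q1[of x] by (intro mult_nonneg_nonneg add_nonneg_nonneg) (auto simp: Q_def)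
   ultimately show ?thesis by simp
  next
   case False
   note z = Z1[of x]
   have "norm (gw x) <= norm (g x) + abs (v x) * (Cz * sq t 2 x)"
    unfolding gw_def using phi(3,4)[of "2 - Z x"] mult_left_mono[OF gzeta[of x], of "abs (v x)"]
    by (intro order_trans[OF norm_triangle_ineq] add_mono) (auto simp: zeta_def intro: mult_left_le_one_le)
   then have "norm (gw x) powr p <= (norm (g x) + abs (v x) * (Cz * sq t 2 x)) powr p" using p by (intro powr_mono2) auto
   also have "... <= 2 powr p * (norm (g x) powr p + (abs (v x) * (Cz * sq t 2 x)) powr p)"
    by (rule powr_add_le) (use p Cz q1[of x] in auto)
   also have "... = 2 powr p * (1 * norm (g x) powr p + 1 * (Cz powr p * (abs (v x) powr p * sq t 2 x powr p)))"
    using Cz q1[of x] by (simp add: powr_mult mult_ac)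
   also have "... <= 2 powr p * ((2 * K * t * sq t 2 x) * norm (g x) powr p +
     (2 * K * t * sq t 2 x) * (Cz powr p * (abs (v x) powr p * sq t 2 x powr p)))"
    using False z by (intro mult_left_mono add_mono mult_right_mono) auto
   also have "... = 2 powr p * (2 * K * t) * (norm (g x) powr p * sq t 2 x + Cz powr p * (abs (v x) powr p * Q x))"
    using q1[of x] by (simp add: Qs powr_add algebra_simps)
   finally show ?thesis by (simp add: add_increasing)
  qed
  have "En gw <= (LBINT x. norm (g x) powr p +
    2 powr p * (2 * K * t) * (norm (g x) powr p * sq t 2 x + Cz powr p * (abs (v x) powr p * Q x)))"
   unfolding En_def by (rule integral_mono[OF integrable_grad[OF wC] _ gw_le]) (use iQ iW integrable_grad[OF vC] in auto)
  also have "... = En g + 2 powr p * (2 * K * t) * (Ewt t 2 g +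
     Cz powr p * (LBINT x. abs (v x) powr p * Q x))" using iQ iW integrable_grad[OF vC] by (simp add: En_def)
  also have "... <= En g + 2 powr p * (2 * K * t) * (CW + Cz powr p * CQ)"
   using K t CW(2)[OF t v] CQ(2)[OF t v] by (intro add_left_mono mult_left_mono add_mono) (auto simp: Q_def)
  finally have En: "En gw - En g <= Ce * t" by (simp add: Ce_def mult_ac)
  have d: "(LBINT x. abs (w x - v x) powr p) <= Cd * t powr p"
  proof -
   have "(LBINT x. abs (w x - v x) powr p) <= (LBINT x. (2 * K * t) powr (p + 1) * (abs (v x) powr p * Q x))"
   proof (rule integral_mono')
    fix x
    show "abs (w x - v x) powr p <= (2 * K * t) powr (p + 1) * (abs (v x) powr p * Q x)"
    proof (cases "Z x <= 1")
     case True
     then show ?thesis using phi(6)[of "2 - Z x"] by (simp add: w_def zeta_def Q_def)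
    next
     case False
     have "abs (w x - v x) = abs (1 - zeta x) * abs (v x)" unfolding w_def abs_mult[symmetric] by (simp add: algebra_simps abs_minus_commute)
     also have "... <= abs (v x)" using phi(3,4)[of "2 - Z x"] by (intro mult_left_le_one_le) (auto simp: zeta_def)
     finally have "abs (w x - v x) powr p <= abs (v x) powr p * 1" using p by (simp add: powr_mono2)
     also have "... <= abs (v x) powr p * (2 * K * t * sq t 2 x) powr (p + 1)"
      using Z1[of x] False p by (intro mult_left_mono ge_one_powr_ge_zero) auto
     finally show ?thesis using K t q1[of x] by (simp add: Qs powr_mult mult_ac)
    qed
   qed (use iQ in "auto simp: Q_def")
   also have "... = (2 * K * t) powr (p + 1) * (LBINT x. abs (v x) powr p * Q x)" by simp
   also have "... <= (2 * K * t) powr (p + 1) * CQ" using CQ(2)[OF t v] by (intro mult_left_mono) (auto simp: Q_def)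
   also have "... = Cd * t powr (p + 1)" using K t by (simp add: Cd_def powr_mult mult_ac)
   also have "... <= Cd * t powr p" using Cd t by (intro mult_left_mono powr_mono') auto
   finally show ?thesis .
  qed
  have "near_min (C * t) w gw"
  proof -
   have "(En gw - En g) / p <= Ce * t / p" using En p by (intro divide_right_mono) auto
   also have "... <= Ce * t" using p mult_left_mono[of 1 p "Ce * t"] Ce t by (simp add: divide_le_eq)
   finally have "En gw / p - L w <= m + Lam * t + Ce * t + t * (F0 + Cd)" using near_min_change(1)[OF v wC t(1) d] by linarith
   then show ?thesis unfolding near_min_def C_def using wC by (simp add: algebra_simps)
  qed
  moreover have "K * t * sq t 2 x <= 1" if "w x ~= 0" for x
  proof -
   have "Z x < 2" using that phi(5)[of "2 - Z x"] by (auto simp: w_def zeta_def not_le[symmetric])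
   then have "(K * t * sq t 2 x)^2 <= 1^2" using sq[of x] by (simp add: Z_def power_mult_distrib)
   then show ?thesis by (rule power2_le_imp_le) simp
  qed
  ultimately show "EX w gw. near_min (C * t) w gw & (ALL x. w x ~= 0 --> K * t * sq t 2 x <= 1)" by blast
 qed
qed
end

section \<open>Pushing the support into the domain\<close>

context polyhedral
begin

lemma zone_signs:
 assumes gz: "good_zone m1 M K Ceta I" and t: "0 < t" and x: "x : outer_zone m1 M K I t"
  and z: "norm (z - x) <= t" and H: "H : far I"
 shows "lv H z ~= 0" "sgn (lv H z) = sgn (lv H x)" using conjunct2[OF gz[unfolded good_zone_def, rule_format, OF t]] x z H by blast+

lemma piece_push:
 assumes gz: "good_zone m1 M K Ceta I" and t: "0 < t" and x: "x : outer_zone m1 M K I t"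
  and S: "push_piece I S e r" and z: "z : S" "norm (z - x) <= t" "norm (z + s *R w - x) <= t"
  and s: "0 <= s" "norm (w - e) <= r"
 shows "z + s *R w : S"
proof -
 have "sgn (lv H (z + s *R w)) = sgn (lv H z)" if "H : far I" for H
  using zone_signs(2)[OF gz t x z(2) that] zone_signs(2)[OF gz t x z(3) that] by simp
 then show ?thesis using S z(1) s unfolding push_piece_def by blast
qed

text \<open>Within distance t of a point of the zone there are no far hyperplanes, so S and the rest
  of Om are separated by open sets there.\<close>

lemma piece_connected:
 assumes gz: "good_zone m1 M K Ceta I" and t: "0 < t" and x: "x : outer_zone m1 M K I t"
  and S: "push_piece I S e r" and T: "connected T" "T <= Om" "T <= cball x t" and z: "z : T" "z : S"
 shows "T <= S"
proof (rule ccontr)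
 assume n: "\<not> T <= S"
 let ?R = "far_region I Int Om - S"
 have "T <= far_region I" unfolding far_region_def using T(3) zone_signs(1)[OF gz t x] by (fastforce simp: dist_norm norm_minus_commute)
 then have "T <= S Un ?R" using T by blast
 moreover have "S Int ?R Int T = {}" "S Int T ~= {}" "?R Int T ~= {}" using n z \<open>T <= far_region I\<close> T(2) by blast+
 moreover have "open S" "open ?R" using S by (simp_all add: push_piece_def)
 ultimately show False using T(1) unfolding connected_def by blast
qed

text \<open>Pushing by \<open>e\<close> leaves room for the directions near \<open>e\<close>. Later pushes keep this room,
 since a push maps a ball inside the domain into the domain.\<close>

lemma push_support_list:
 fixes ps :: "(('a \<times> real) set \<times> 'a set \<times> 'a \<times> real) list"
 assumes gz: "ALL (I, S, e, r):set ps. good_zone m1 M K Ceta I & push_piece I S e r & 2 * c <= r"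
  and Ceta: "0 <= Ceta" and M: "1 <= M" and c: "0 < c" "c <= 1/2" and Lam: "0 <= Lam"
 shows "EX C>=0. ALL t v g. 0 < t --> t <= 1 --> near_min (Lam * t) v g --> (EX w gw. near_min (C * t) w gw &
    (ALL x. w x ~= 0 --> (EX y. v y ~= 0 & norm (x - y) <= real (length ps) * t) &
     (ALL (I, S, e, r):set ps. x : S --> cball x (real (length ps) * t) <= inner_zone m1 M K I t -->
       ball x (c * t) <= Om)))" using gz
proof (induction ps)
 case Nil
 show ?case by (rule exI[of _ Lam]) (use Lam in fastforce)
next
 case (Cons P ps)
 obtain I S e r where P: "P = (I, S, e, r)" by (cases P)
 have gI: "good_zone m1 M K Ceta I" and SI: "push_piece I S e r" and r: "2 * c <= r" using Cons.prems P by auto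
 have e: "norm e = 1" "0 < r" and SOm: "S <= Om" using SI by (auto simp: push_piece_def)
 let ?n = "real (length ps)"
 obtain C1 where C1: "0 <= C1" and IH: "!!t v g. 0 < t ==> t <= 1 ==> near_min (Lam * t) v g ==> (EX w gw. near_min (C1 * t) w gw &
    (ALL x. w x ~= 0 --> (EX y. v y ~= 0 & norm (x - y) <= ?n * t) & (ALL (I, S, e, r):set ps. x : S --> cball x (?n * t) <= inner_zone m1 M K I t -->
       ball x (c * t) <= Om)))"
 proof -
  have "ALL (I, S, e, r):set ps. good_zone m1 M K Ceta I & push_piece I S e r & 2 * c <= r" using Cons.prems by simp
  from Cons.IH[OF this] show ?thesis by (elim exE conjE) (rule that; blast)
 qed
 obtain C2 where C2: "0 <= C2" and tp: "!!t v g w0. 0 < t ==> t <= 1 ==> near_min (C1 * t) v g ==> norm (w0 - e) <= r ==>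
  (EX w gw. near_min (C2 * t) w gw & (LBINT x. defect g gw x) <= C2 * t & (ALL x:S Int inner_zone m1 M K I t.
      w x = shifted t w0 S v x &
      gw x = shifted t w0 S g x) & (ALL x. w x ~= 0 --> v x ~= 0 \<or> x : S Int outer_zone m1 M K I t &
      upstream t w0 S v x))" using translate_piece[OF gI Ceta SI C1] by blast
 show ?case
 proof (intro exI[of _ C2] conjI allI impI C2)
  fix t v g assume t: "0 < t" "t <= (1::real)" and v: "near_min (Lam * t) v g"
  obtain w gw where w: "near_min (C1 * t) w gw"
   and wy: "!!x. w x ~= 0 ==> EX y. v y ~= 0 & norm (x - y) <= ?n * t"
   and wb: "!!x I S e r. w x ~= 0 ==> (I, S, e, r) : set ps ==> x : S ==>
    cball x (?n * t) <= inner_zone m1 M K I t ==> ball x (c * t) <= Om" using IH[OF t v] by fast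
  obtain u gu where u: "near_min (C2 * t) u gu"
   and uS: "!!x. x : S Int inner_zone m1 M K I t ==> u x = shifted t e S w x"
   and utau: "!!x. u x ~= 0 ==> w x ~= 0 \<or> x : S Int outer_zone m1 M K I t &
      upstream t e S w x"
  proof -
   have "norm (e - e) <= r" using e by simp
   from tp[OF t w this] show ?thesis by (elim exE conjE) (rule that, assumption, drule bspec, assumption, erule conjunct1, blast)
  qed
  have ct: "c * t <= t / 2" using c t by simp
  have cb: "cball z (?n * t) <= cball x ((?n + 1) * t)" if "norm (z - x) <= t" for x z
  proof
   fix y assume "y : cball z (?n * t)"
   then show "y : cball x ((?n + 1) * t)" using that dist_triangle[of x y z] by (simp add: dist_norm norm_minus_commute algebra_simps)
  qed
  show "EX w gw. near_min (C2 * t) w gw & (ALL x. w x ~= 0 --> (EX y. v y ~= 0 & norm (x - y) <= real (length (P # ps)) * t) &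
     (ALL (I, S, e, r):set (P # ps). x : S --> cball x (real (length (P # ps)) * t) <= inner_zone m1 M K I t -->
       ball x (c * t) <= Om))"
  proof (intro exI[of _ u] exI[of _ gu] conjI u allI impI)
   fix x assume ux: "u x ~= 0"
   \<comment> \<open>z is a point from which a nonzero value was carried to x: x itself, or a point
     of S upstream along e.\<close>
   obtain z where z: "w z ~= 0" "norm (z - x) <= t / 2" "z = x \<or> x : S Int outer_zone m1 M K I t &
     z : S & (EX tau. 0 <= tau & tau <= t / 2 & x = z + tau *R e)"
   proof (cases "w x ~= 0")
    case True
    then show ?thesis using t by (intro that[of x]) auto
   next
    case False
    then obtain tau where tau: "x : S Int outer_zone m1 M K I t" "0 <= tau" "tau <= t / 2" "x - tau *R e : S" "w (x - tau *R e) ~= 0"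
     using utau[OF ux] by blast
    show ?thesis by (rule that[of "x - tau *R e"]) (use tau e in auto)
   qed
   have n1: "real (length (P # ps)) = ?n + 1" by simp
   obtain y where y: "v y ~= 0" "norm (z - y) <= ?n * t" using wy[OF z(1)] by blast
   have "norm (x - y) <= norm (z - y) + norm (z - x)" using norm_triangle_ineq4[of "z - y" "z - x"] by simp
   then have "norm (x - y) <= real (length (P # ps)) * t" using y(2) z(2) t unfolding n1 by (simp add: algebra_simps)
   with y(1) show "EX y. v y ~= 0 & norm (x - y) <= real (length (P # ps)) * t" by blast
   show "ALL (I, S, e, r):set (P # ps). x : S --> cball x (real (length (P # ps)) * t) <= inner_zone m1 M K I t -->
       ball x (c * t) <= Om" unfolding n1
   proof (clarify)
    fix I' S' e' r' y
    assume l: "(I', S', e', r') : set (P # ps)" "x : S'" "cball x ((?n + 1) * t) <= inner_zone m1 M K I' t"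
     and "y : ball x (c * t)"
    then have y: "norm (y - x) < c * t" by (simp add: dist_norm norm_minus_commute)
    then have yt: "norm (y - x) <= t" using ct t by linarith
    have xin: "x : inner_zone m1 M K I' t" using l(3) t by (auto simp: subset_iff)
    then have xo: "x : outer_zone m1 M K I' t" using inner_outer_zone[OF M] by blast
    show "y : Om"
    proof (cases "(I', S', e', r') = P")
     case True
     then have eq: "I' = I" "S' = S" by (auto simp: P)
     \<comment> \<open>The value at x comes from z0 in S. Each y near x is reached from z0 by a step
       of the same length parameter in a direction near e, hence lies in S.\<close>
     define z0 where "z0 = x - (t / 2) *R e"
     have z0: "z0 : S" using uS[of x] ux xin l(2) by (auto simp: eq z0_def split: if_splits)
     define w0 where "w0 = e + (2 / t) *R (y - x)"
     have y': "z0 + (t / 2) *R w0 = y" unfolding w0_def z0_def using t by (simp add: algebra_simps)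
     have "norm (w0 - e) = 2 / t * norm (y - x)" using t by (simp add: w0_def)
     also have "... <= 2 / t * (c * t)" using y t by (intro mult_left_mono) auto
     finally have "norm (w0 - e) <= r" using r t by simp
     moreover have "norm (z0 - x) <= t" using e t by (simp add: z0_def)
     ultimately have "z0 + (t / 2) *R w0 : S" by (intro piece_push[OF gI t(1) xo[unfolded eq] SI z0]) (use y' yt t in auto)
     then show ?thesis using y' SOm by auto
    next
     case False
     then have l': "(I', S', e', r') : set ps" using l(1) by simp
     have g': "good_zone m1 M K Ceta I'" and SI': "push_piece I' S' e' r'" using Cons.prems l' by auto
     have zc: "cball z (?n * t) <= inner_zone m1 M K I' t" using cb[of z x] z(2) t l(3) by auto
     consider "z = x" | tau where "x : S" "x : outer_zone m1 M K I t" "z : S" "0 <= tau" "tau <= t / 2" "x = z + tau *R e" using z(3) by blast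
     then show ?thesis
     proof cases
      case 1
      then show ?thesis using wb[OF z(1) l' _ zc] l(2) y by (auto simp: dist_norm norm_minus_commute)
     next
      \<comment> \<open>The segment from z to x lies in S and, being connected, in S' as well. So
        the earlier pushes provide a ball around z inside Om; by connectedness it lies in S, and its
        translate along e, which contains y, stays in S.\<close>
      case (2 tau)
      let ?T = "closed_segment z x"
      have Tx: "norm (y - x) <= t" if "y : ?T" for y using segment_bound(2)[OF that] z(2) t(1) by (simp add: norm_minus_commute)
      have "?T <= S"
      proof
       fix y assume y: "y : ?T"
       then obtain theta where "0 <= theta" "theta <= 1" "y = z + (theta * tau) *R e" unfolding closed_segment_def 2(6) by (auto simp: algebra_simps)
       then show "y : S" using piece_push[OF gI t(1) 2(2) SI 2(3), of "theta * tau" e] z(2) Tx[OF y] 2(4) e t by auto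
      qed
      then have "?T <= S'" by (intro piece_connected[OF g' t(1) xo SI', of ?T x]) (use SOm Tx t l(2) in "auto simp: dist_norm norm_minus_commute")
      then have "z : S'" by auto
      then have b: "ball z (c * t) <= Om" by (rule wb[OF z(1) l' _ zc])
      have "ball z (c * t) <= S"
      proof (rule piece_connected[OF gI t(1) 2(2) SI connected_ball b])
       show "ball z (c * t) <= cball x t"
       proof
        fix y assume "y : ball z (c * t)"
        then have "norm (y - x) <= c * t + t / 2" using norm_triangle_ineq[of "y - z" "z - x"] z(2) by (simp add: dist_norm norm_minus_commute)
        then show "y : cball x t" using ct by (simp add: dist_norm norm_minus_commute)
       qed
       show "z : ball z (c * t)" using c t by simp
      qed (rule 2)
      then have "z + (y - x) : S" using y by (auto simp: subset_iff dist_norm norm_minus_commute)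
      then have "z + (y - x) + tau *R e : S" by (rule piece_push[OF gI t(1) 2(2) SI])
         (use y ct z(2) 2 e norm_triangle_ineq[of "z - x" "y - x"] in "auto simp: algebra_simps")
      then show ?thesis using SOm 2(6) by auto
     qed
    qed
   qed
  qed
 qed
qed

text \<open>One finite family for all flats of codimension at most 2. The radius b t stays free
  because successive pushes move points by several t.\<close>

lemma all_pieces:
 obtains m1 M K Ceta :: real and A where "0 <= Ceta" "1 <= M" "finite A"
  "!!I S e r. (I, S, e, r) : A ==> good_zone m1 M K Ceta I & push_piece I S e r"
  "!!b. 0 <= b ==> EX K1>=1. ALL t x. 0 < t --> x : Om --> K1 * t * sq t 2 x <= 1 -->
    (EX (I, S, e, r):A. x : S & cball x (b * t) <= inner_zone m1 M K I t)"
proof -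
 obtain m1 M K Ceta :: real where z: "1 <= m1" "M = 16 * (1 + card flats * (4 * m1)^2)^2" "1 <= K" "0 <= Ceta"
  "!!I. I : flats ==> codim I <= 2 ==> good_zone m1 M K Ceta I" by (rule good_zones) (rule that; assumption)
 have "1 <= (1 + card flats * (4 * m1)^2)^2" by (rule one_le_power) simp
 then have M: "1 <= M" unfolding z(2) by linarith
 define F where "F = {I : flats. codim I <= 2}"
 have ex: "ALL I:F. EX P. finite P & (ALL (S, e, r):P. push_piece I S e r) &
   (ALL x:Om. (ALL H:far I. norm (fst H) * rad I x < abs (lv H x)) --> (EX (S, e, r):P. x : S))"
 proof
  fix I assume I: "I : F"
  have I': "I : flats" "codim I <= 2" using I by (auto simp: F_def)
  show "EX P. finite P & (ALL (S, e, r):P. push_piece I S e r) &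
   (ALL x:Om. (ALL H:far I. norm (fst H) * rad I x < abs (lv H x)) --> (EX (S, e, r):P. x : S))" (is ?thesis)
  proof (rule pieces[OF I'])
   fix P assume P: "finite P" "!!S e r. (S, e, r) : P ==> push_piece I S e r"
    "!!x. x : Om ==> (!!H. H : far I ==> norm (fst H) * rad I x < abs (lv H x)) ==> EX (S, e, r):P. x : S"
   show ?thesis by (rule exI[of _ P]) (use P in "simp add: split_beta")
  qed
 qed
 obtain P where P0: "ALL I:F. finite (P I) & (ALL (S, e, r):P I. push_piece I S e r) &
   (ALL x:Om. (ALL H:far I. norm (fst H) * rad I x < abs (lv H x)) --> (EX (S, e, r):P I. x : S))" using bchoice[OF ex] by (elim exE)
 have P: "finite (P I)" "(S, e, r) : P I ==> push_piece I S e r"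
  "x : Om ==> (!!H. H : far I ==> norm (fst H) * rad I x < abs (lv H x)) ==> EX (S, e, r):P I. x : S"
  if "I : F" for I S e r x using bspec[OF P0 that] by auto
 have F: "finite F" using finite_flats by (simp add: F_def)
 show ?thesis
 proof (rule that[of Ceta M "Sigma F P" m1 K, OF z(4) M])
  show "finite (Sigma F P)" using F P(1) by blast
  show "good_zone m1 M K Ceta I & push_piece I S e r" if "(I, S, e, r) : Sigma F P" for I S e r using that z(5) P(2) by (auto simp: F_def)
  fix b :: real assume b: "0 <= b"
  obtain K1 where K1: "1 <= K1" "!!t x. 0 < t ==> K1 * t * sq t 2 x <= 1 ==>
    EX I:flats. codim I <= 2 & cball x (b * t) <= inner_zone m1 M K I t" using cover_deep[OF z(1,3) b z(2)] by blast
  show "EX K1>=1. ALL t x. 0 < t --> x : Om --> K1 * t * sq t 2 x <= 1 -->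
    (EX (I, S, e, r):Sigma F P. x : S & cball x (b * t) <= inner_zone m1 M K I t)"
  proof (intro exI[of _ K1] conjI K1(1) allI impI)
   fix t :: real and x assume t: "0 < t" and x: "x : Om" "K1 * t * sq t 2 x <= 1"
   obtain I where I: "I : F" "cball x (b * t) <= inner_zone m1 M K I t" using K1(2)[OF t x(2)] by (auto simp: F_def)
   have "x : cball x (b * t)" using b t by simp
   then have "x : outer_zone m1 M K I t" using I(2) inner_outer_zone[OF M] by blast
   then have "norm (fst H) * rad I x < abs (lv H x)" if "H : far I" for H
    using z(5)[of I] I(1) t that unfolding good_zone_def F_def by blast
   from P(3)[OF I(1) x(1) this] obtain S e r where "(S, e, r) : P I" "x : S" by auto
   then show "EX (I, S, e, r):Sigma F P. x : S & cball x (b * t) <= inner_zone m1 M K I t" using I by (intro bexI[of _ "(I, S, e, r)"]) auto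
  qed
 qed
qed

lemma support_push:
 assumes Lam: "0 <= Lam"
 obtains C c where "0 <= C" "0 < c" "c <= 1" "!!t v g. 0 < t ==> t <= 1 ==> near_min (Lam * t) v g ==>
  EX w gw. near_min (C * t) w gw & (ALL x. w x ~= 0 --> ball x (c * t) <= Om)"
proof -
 obtain m1 M K Ceta :: real and A where z: "0 <= Ceta" "1 <= M" "finite A"
  "!!I S e r. (I, S, e, r) : A ==> good_zone m1 M K Ceta I & push_piece I S e r"
  "!!b. 0 <= b ==> EX K1>=1. ALL t x. 0 < t --> x : Om --> K1 * t * sq t 2 x <= 1 -->
    (EX (I, S, e, r):A. x : S & cball x (b * t) <= inner_zone m1 M K I t)" by (rule all_pieces) (rule that; assumption)
 obtain ps where ps: "set ps = A" using finite_list[OF z(3)] by blast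
 let ?n = "real (length ps)"
 obtain K1 where K1: "1 <= K1" "!!t x. 0 < t ==> x : Om ==> K1 * t * sq t 2 x <= 1 ==>
    EX (I, S, e, r):A. x : S & cball x (?n * t) <= inner_zone m1 M K I t" using z(5)[of ?n] by auto
 define c where "c = Min (insert 1 ((%(I, S, e, r). r) ` A)) / 2"
 have c1: "c <= 1/2" using z(3) by (simp add: c_def)
 have c2: "2 * c <= r" if "(I, S, e, r) : A" for I S e r
 proof -
  have "r : (%(I, S, e, r). r) ` A" using that by force
  then show "2 * c <= r" using z(3) by (simp add: c_def)
 qed
 have c0: "0 < c" unfolding c_def using z(3,4) by (auto simp: push_piece_def)
 \<comment> \<open>The covering needs K1 at the final position of a point; doubling K1 and adding
   the second term allow for a drift of at most n t, during which \<open>sq\<close> at most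
   doubles.\<close>
 define K2 where "K2 = 2 * K1 + 2 * card flats * ?n"
 have K2: "1 <= K2" unfolding K2_def using K1(1) by (intro add_increasing2) auto
 obtain Ca where Ca: "0 <= Ca" "!!t v g. 0 < t ==> t <= 1 ==> near_min (Lam * t) v g ==>
  EX w gw. near_min (Ca * t) w gw & (ALL x. w x ~= 0 --> K2 * t * sq t 2 x <= 1)" using cut_singular[OF dim Lam K2] by blast
 have "ALL (I, S, e, r):set ps. good_zone m1 M K Ceta I & push_piece I S e r & 2 * c <= r" using z(4) c2 ps by auto
 from push_support_list[OF this z(1,2) c0 c1 Ca(1)]
 obtain C where C: "0 <= C" "!!t v g. 0 < t ==> t <= 1 ==> near_min (Ca * t) v g ==>
  EX w gw. near_min (C * t) w gw & (ALL x. w x ~= 0 --> (EX y. v y ~= 0 & norm (x - y) <= ?n * t) &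
     (ALL (I, S, e, r):A. x : S --> cball x (?n * t) <= inner_zone m1 M K I t --> ball x (c * t) <= Om))" unfolding ps by blast
 show ?thesis
 proof (rule that[OF C(1) c0])
  show "c <= 1" using c1 by simp
  fix t v g assume t: "0 < t" "t <= (1::real)" and v: "near_min (Lam * t) v g"
  obtain v1 g1 where v1: "near_min (Ca * t) v1 g1" "!!x. v1 x ~= 0 ==> K2 * t * sq t 2 x <= 1" using Ca(2)[OF t v] by blast
  from C(2)[OF t v1(1)] obtain w gw where w: "near_min (C * t) w gw"
   and wx: "!!x. w x ~= 0 ==> (EX y. v1 y ~= 0 & norm (x - y) <= ?n * t)"
    "!!x. w x ~= 0 ==> ALL (I, S, e, r):A. x : S --> cball x (?n * t) <= inner_zone m1 M K I t --> ball x (c * t) <= Om" by blast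
  have "ball x (c * t) <= Om" if x: "w x ~= 0" for x
  proof -
   obtain y where y: "v1 y ~= 0" "norm (x - y) <= ?n * t" using wx(1)[OF x] by blast
   have s: "0 <= t * sq t 2 y" using t q_ge_1[of t 2 y] by simp
   have "(2 * K1) * (t * sq t 2 y) + 2 * card flats * ?n * (t * sq t 2 y) <= 1"
    using v1(2)[OF y(1)] unfolding K2_def by (simp add: algebra_simps)
   moreover have "0 <= (2 * K1) * (t * sq t 2 y)" "0 <= 2 * card flats * ?n * (t * sq t 2 y)" using s K1(1) by auto
   ultimately have a: "(2 * K1) * (t * sq t 2 y) <= 1" "2 * card flats * ?n * (t * sq t 2 y) <= 1" by linarith+
   have "sq t 2 x <= 2 * sq t 2 y" by (rule sqrt_q_near_cball(1)[OF t(1) y(2)]) (use a(2) in "simp_all add: mult_ac")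
   then have "K1 * t * sq t 2 x <= K1 * t * (2 * sq t 2 y)" using K1(1) t by (intro mult_left_mono) auto
   then have q: "K1 * t * sq t 2 x <= 1" using a(1) by (simp add: mult_ac)
   have "x : Om" by (rule C1cE[OF near_minD(1)[OF w]]) (use x in blast)
   from K1(2)[OF t(1) this q] obtain I S e r
    where P: "(I, S, e, r) : A" "x : S" "cball x (?n * t) <= inner_zone m1 M K I t" by clarify (rule that, assumption, assumption, assumption)
   from bspec[OF wx(2)[OF x] P(1)] P(2,3) show ?thesis by simp
  qed
  with w show "EX w gw. near_min (C * t) w gw & (ALL x. w x ~= 0 --> ball x (c * t) <= Om)" by blast
 qed
qed
end

section \<open>The Morrey bound\<close>

lemma nn_integral_reflect:
 fixes F :: "'a::euclidean_space => ennreal"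
 assumes [measurable]: "F : borel_measurable borel"
 shows "(\<integral>\<^sup>+z. F (y - z) \<partial>lborel) = (\<integral>\<^sup>+z. F z \<partial>lborel)"
proof -
 have "distr lborel borel ((-) y) = lborel" using lborel_affine[of "-1" y] by (simp add: density_1 one_ereal_def)
 then have "(\<integral>\<^sup>+z. F z \<partial>lborel) = (\<integral>\<^sup>+z. F z \<partial>(distr lborel borel ((-) y)))" by simp
 also have "... = (\<integral>\<^sup>+z. F (y - z) \<partial>lborel)" by (rule nn_integral_distr) measurable
 finally show ?thesis by simp
qed

text \<open>The translates of a small ball are averaged over all translations in a larger ball.\<close>

lemma average_translates:
 fixes G :: "'a::euclidean_space => real"
 assumes G: "continuous_on UNIV G" "!!x. 0 <= G x" "integrable lborel G"
  and s: "0 < s" "0 < rho" and sub: "!!y z. y : ball x s ==> z : cball z0 rho ==> y - z : ball x R"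
  and kap: "(LBINT y. indicator (ball x R) y * G y) <= kap"
  and l: "!!z. z : cball z0 rho ==> l <= (LBINT y. indicator (ball x s) y * G (y - z))"
 shows "l <= (s / rho) ^ DIM('a) * kap"
proof -
 have [measurable]: "G : borel_measurable borel" by (rule borel_measurable_continuous_onI[OF G(1)])
 have [measurable]: "ball a b : sets borel" "cball a b : sets borel" for a :: 'a and b by auto
 define H where "H y = ennreal (indicator (ball x R) y * G y)" for y
 have [measurable]: "H : borel_measurable borel" unfolding H_def by measurable
 have iB: "integrable lborel (%y. indicator B y * G (y - z))" if "B : sets borel" for B z
  using integrable_real_mult_indicator[OF _ integrable_translate[OF _ G(3), of "- z"]] that by (simp add: mult.commute)
 have kap0: "0 <= kap" using kap G(2) by (intro order_trans[OF Bochner_Integration.integral_nonneg kap]) simp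
 have "ennreal l * emeasure lborel (cball z0 rho) = (\<integral>\<^sup>+z. ennreal l * indicator (cball z0 rho) z \<partial>lborel)"
  by (simp add: nn_integral_cmult_indicator)
 also have "... <= (\<integral>\<^sup>+z. (\<integral>\<^sup>+y. indicator (cball z0 rho) z * (indicator (ball x s) y * ennreal (G (y - z))) \<partial>lborel) \<partial>lborel)"
 proof (rule nn_integral_mono)
  fix z
  have "(\<integral>\<^sup>+y. indicator (ball x s) y * ennreal (G (y - z)) \<partial>lborel) = ennreal (LBINT y. indicator (ball x s) y * G (y - z))"
   by (subst nn_integral_eq_integral[symmetric, OF iB]) (auto simp: G intro!: nn_integral_cong simp: indicator_def)
  then show "ennreal l * indicator (cball z0 rho) z <=
    (\<integral>\<^sup>+y. indicator (cball z0 rho) z * (indicator (ball x s) y * ennreal (G (y - z))) \<partial>lborel)"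
   using l[of z] by (auto simp: indicator_def[of "cball z0 rho"] intro!: ennreal_leI)
 qed
 also have "... = (\<integral>\<^sup>+y. (\<integral>\<^sup>+z. indicator (cball z0 rho) z * (indicator (ball x s) y * ennreal (G (y - z))) \<partial>lborel) \<partial>lborel)"
  by (rule lborel_pair.Fubini'[symmetric]) measurable
 also have "... <= (\<integral>\<^sup>+y. indicator (ball x s) y * ennreal kap \<partial>lborel)"
 proof (rule nn_integral_mono)
  fix y
  have "(\<integral>\<^sup>+z. indicator (cball z0 rho) z * (indicator (ball x s) y * ennreal (G (y - z))) \<partial>lborel)
    <= (\<integral>\<^sup>+z. indicator (ball x s) y * H (y - z) \<partial>lborel)"
   by (rule nn_integral_mono) (use sub[of y] in "auto simp: indicator_def H_def")
  also have "... = indicator (ball x s) y * (\<integral>\<^sup>+z. H z \<partial>lborel)" by (simp add: nn_integral_cmult nn_integral_reflect[of H y])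
  also have "(\<integral>\<^sup>+z. H z \<partial>lborel) = ennreal (LBINT y. indicator (ball x R) y * G y)"
   unfolding H_def using iB[of "ball x R" 0] by (intro nn_integral_eq_integral) (auto simp: G)
  also have "indicator (ball x s) y * ... <= indicator (ball x s) y * ennreal kap" using kap by (intro mult_left_mono ennreal_leI) auto
  finally show "(\<integral>\<^sup>+z. indicator (cball z0 rho) z * (indicator (ball x s) y * ennreal (G (y - z))) \<partial>lborel)
    <= indicator (ball x s) y * ennreal kap" .
 qed
 also have "... = ennreal kap * emeasure lborel (ball x s)" by (simp add: nn_integral_cmult_indicator mult.commute[of _ "ennreal kap"])
 \<comment> \<open>l may be negative, and then the left side is 0 in \<open>ennreal\<close>.\<close>
 finally have "ennreal (l * (unit_ball_vol DIM('a) * rho ^ DIM('a))) <= ennreal (kap * (unit_ball_vol DIM('a) * s ^ DIM('a)))"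
  using s kap0 by (cases "0 <= l") (simp_all add: emeasure_ball emeasure_cball ennreal_mult' ennreal_neg mult_nonpos_nonneg)
 then have "l * (unit_ball_vol DIM('a) * rho ^ DIM('a)) <= kap * (unit_ball_vol DIM('a) * s ^ DIM('a))"
  using s kap0 by (subst (asm) ennreal_le_iff) auto
 then have "(l * rho ^ DIM('a)) * unit_ball_vol DIM('a) <= (kap * s ^ DIM('a)) * unit_ball_vol DIM('a)" by (simp add: mult_ac)
 then have "l * rho ^ DIM('a) <= kap * s ^ DIM('a)" by (rule mult_right_le_imp_le) simp
 then show ?thesis using s by (simp add: power_divide field_simps)
qed

context polyhedral
begin

text \<open>On the piece v is compared with its translates by all z in a ball of radius comparable
  to t. Strict convexity bounds |g y|^p by a multiple of |g (y - z)|^p plus a defect with integral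
  O(t). The left side does not depend on z, and averaging the right side over z produces the volume
  ratio (s/t)^d.\<close>

lemma piece_morrey:
 assumes gz: "good_zone m1 M K Ceta I" and Ceta: "0 <= Ceta" and S: "push_piece I S e r" and Lam: "0 <= Lam"
 shows "EX C>=0. ALL t v g s x kap. 0 < t --> t <= 1 --> near_min (Lam * t) v g --> 0 < s --> s <= t --> locE p g (ball x (3 * t)) <= kap -->
   locE p g (ball x s Int (S Int inner_zone m1 M K I t))
    <= C * ((s / t) ^ DIM('a) * kap + t)"
proof -
 obtain CP where CP: "0 <= CP" "!!t v g w0. 0 < t ==> t <= 1 ==> near_min (Lam * t) v g ==> norm (w0 - e) <= r ==>
  (EX w gw. near_min (CP * t) w gw & (LBINT x. defect g gw x) <= CP * t & (ALL x:S Int inner_zone m1 M K I t.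
      w x = shifted t w0 S v x &
      gw x = shifted t w0 S g x) & (ALL x. w x ~= 0 --> v x ~= 0 \<or> x : S Int outer_zone m1 M K I t &
      upstream t w0 S v x))" using translate_piece[OF gz Ceta S Lam] by blast
 obtain Cd where Cd: "0 < Cd" "!!a b :: 'a. norm a powr p <= Cd * norm b powr p +
    Cd * ((norm a powr p + norm b powr p) / 2 - norm ((1/2) *R (a + b)) powr p)" using norm_powr_defect[OF p(1)] by metis
 have e: "norm e = 1" "0 < r" "r <= 1" "open S" using S by (auto simp: push_piece_def)
 define C where "C = Cd * (2 / r) ^ DIM('a) + Cd * CP"
 show ?thesis
 proof (intro exI[of _ C] conjI allI impI)
  show "0 <= C" unfolding C_def using Cd(1) CP(1) e by (intro add_nonneg_nonneg mult_nonneg_nonneg) auto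
  fix t v g s x kap assume t: "0 < t" "t <= (1::real)" and v: "near_min (Lam * t) v g" and s: "0 < s" "s <= t"
   and kap: "locE p g (ball x (3 * t)) <= kap"
  note vC = near_minD(1)[OF v]
  let ?U = "inner_zone m1 M K I t" and ?G = "%y. norm (g y) powr p"
  have U: "closed ?U" unfolding inner_zone_def by (intro closed_Collect_conj closed_Collect_le continuous_intros continuous_nrm continuous_q t)
  have Gc: "continuous_on UNIV ?G" by (rule continuous_norm_powr[OF C1_grad_cont[OF C1c_C1[OF vC]]]) (use p in simp)
  have [measurable]: "?G : borel_measurable borel" by (rule borel_measurable_continuous_onI[OF Gc])
  have GI: "integrable lborel ?G" by (rule integrable_grad[OF vC])
  define l where "l = locE p g (ball x s Int (S Int ?U))"
  have ineq: "(l - Cd * CP * t) / Cd <= (LBINT y. indicator (ball x s) y * ?G (y - z))"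
   if z: "z : cball ((t / 2) *R e) (t / 2 * r)" for z
  proof -
   define w0 where "w0 = (2 / t) *R z"
   have zw: "(t / 2) *R w0 = z" using t by (simp add: w0_def)
   have "w0 - e = (2 / t) *R (z - (t / 2) *R e)" using t by (simp add: w0_def algebra_simps)
   then have "norm (w0 - e) = 2 / t * norm (z - (t / 2) *R e)" using t by simp
   also have "... <= r" using z t by (simp add: dist_norm norm_minus_commute field_simps)
   finally have "norm (w0 - e) <= r" .
   from CP(2)[OF t v this] obtain w gw where w: "near_min (CP * t) w gw" "(LBINT x. defect g gw x) <= CP * t"
    "!!y. y : S Int ?U ==> gw y = (if y - z : S then g (y - z) else 0)"
    unfolding zw by (elim exE conjE) (rule that, assumption, assumption, drule bspec, assumption, erule conjunct2)
   have iz: "integrable lborel (%y. indicator (ball x s) y * ?G (y - z))"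
    using integrable_real_mult_indicator[OF _ integrable_translate[OF _ GI, of "- z"], of "ball x s"] by (simp add: mult.commute)
   have id: "integrable lborel (defect g gw)" by (rule integrable_defect[OF vC near_minD(1)[OF w(1)]])
   have "l <= (LBINT y. Cd * (indicator (ball x s) y * ?G (y - z)) + Cd * defect g gw y)" unfolding l_def
   proof (rule integral_mono)
    show "integrable lborel (%y. indicator (ball x s Int (S Int ?U)) y * norm (g y) powr p)"
     using integrable_real_mult_indicator[OF _ GI, of "ball x s Int (S Int ?U)"] U e(4) by (simp add: mult.commute)
    show "integrable lborel (%y. Cd * (indicator (ball x s) y * ?G (y - z)) + Cd * defect g gw y)" using iz id by auto
    fix y
    show "indicator (ball x s Int (S Int ?U)) y * norm (g y) powr p <=
      Cd * (indicator (ball x s) y * ?G (y - z)) + Cd * defect g gw y"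
    proof (cases "y : ball x s Int (S Int ?U)")
     case True
     have "norm (g y) powr p <= Cd * norm (gw y) powr p + Cd * defect g gw y" unfolding defect_def by (rule Cd(2))
     moreover have "norm (gw y) powr p <= ?G (y - z)" using w(3)[of y] True by auto
     then have "Cd * norm (gw y) powr p <= Cd * ?G (y - z)" using Cd(1) by simp
     ultimately show ?thesis using True by auto
    next
     case False
     then show ?thesis using Cd(1) defect_nonneg[of g gw y] by (auto intro!: add_nonneg_nonneg mult_nonneg_nonneg)
    qed
   qed
   also have "... = Cd * (LBINT y. indicator (ball x s) y * ?G (y - z)) + Cd * (LBINT y. defect g gw y)" using iz id by simp
   also have "... <= Cd * (LBINT y. indicator (ball x s) y * ?G (y - z)) + Cd * (CP * t)"
    using Cd(1) w(2) by (intro add_left_mono mult_left_mono) auto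
   finally show ?thesis using Cd(1) by (simp add: field_simps)
  qed
  have "(l - Cd * CP * t) / Cd <= (s / (t / 2 * r)) ^ DIM('a) * kap"
  proof (rule average_translates[OF Gc _ GI s(1) _ _ kap ineq])
   show "0 < t / 2 * r" using t e by simp
   fix y z assume y: "y : ball x s" and z: "z : cball ((t / 2) *R e) (t / 2 * r)"
   have "norm z <= norm ((t / 2) *R e) + t / 2 * r" using norm_triangle_ineq2[of z "(t / 2) *R e"] z by (simp add: dist_norm norm_minus_commute)
   also have "... <= t / 2 + t / 2 * 1" using e t by (intro add_mono mult_left_mono) auto
   finally have "norm z <= t" by simp
   then show "y - z : ball x (3 * t)" using y s norm_triangle_ineq[of "x - y" z] by (simp add: dist_norm algebra_simps)
  qed auto
  also have "(s / (t / 2 * r)) ^ DIM('a) = (2 / r) ^ DIM('a) * (s / t) ^ DIM('a)"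
   unfolding power_mult_distrib[symmetric] using t e by (simp add: field_simps)
  finally have "l <= Cd * ((2 / r) ^ DIM('a) * (s / t) ^ DIM('a) * kap) + Cd * CP * t" using Cd(1) by (simp add: field_simps)
  also have "... <= C * ((s / t) ^ DIM('a) * kap + t)"
  proof -
   have "0 <= kap" by (rule order_trans[OF Bochner_Integration.integral_nonneg kap]) simp
   then have "0 <= Cd * CP * ((s / t) ^ DIM('a) * kap)" "0 <= Cd * (2 / r) ^ DIM('a) * t" using Cd(1) CP(1) s t e by simp_all
   then show ?thesis unfolding C_def by (simp add: algebra_simps)
  qed
  finally show "locE p g (ball x s Int (S Int ?U)) <= C * ((s / t) ^ DIM('a) * kap + t)" unfolding l_def .
 qed
qed

text \<open>At points of Om in no piece K1 t \<open>sq\<close> > 1, so |g|^p is at most K1 t |g|^p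
  \<open>sq\<close>, and the weighted bound makes their contribution O(t).\<close>

lemma morrey_step:
 assumes Lam: "0 <= Lam"
 obtains C where "1 <= C" "!!t v g s x kap. 0 < t ==> t <= 1 ==> near_min (Lam * t) v g ==> 0 < s ==> s <= t ==> locE p g (ball x (3 * t)) <= kap ==>
   locE p g (ball x s) <= C * ((s / t) ^ DIM('a) * kap + t)"
proof -
 obtain m1 M K Ceta :: real and A where z: "0 <= Ceta" "1 <= M" "finite A"
  "!!I S e r. (I, S, e, r) : A ==> good_zone m1 M K Ceta I & push_piece I S e r"
  "!!b. 0 <= b ==> EX K1>=1. ALL t x. 0 < t --> x : Om --> K1 * t * sq t 2 x <= 1 -->
    (EX (I, S, e, r):A. x : S & cball x (b * t) <= inner_zone m1 M K I t)" by (rule all_pieces) (rule that; assumption)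
 obtain K1 where K1: "1 <= K1" "!!t x. 0 < t ==> x : Om ==> K1 * t * sq t 2 x <= 1 ==>
    EX (I, S, e, r):A. x : S & cball x (0 * t) <= inner_zone m1 M K I t" using z(5)[of 0] by auto
 obtain CW where CW: "0 <= CW" "!!t v g. 0 < t ==> t <= 1 ==> near_min (Lam * t) v g ==> Ewt t 2 g <= CW"
  using weight_bounded_two[OF dim] Lam unfolding weight_bounded_def by blast
 define V where "V P t = fst (snd P) Int inner_zone m1 M K (fst P) t" for P :: "('a \<times> real) set \<times> 'a set \<times> 'a \<times> real" and t
 have "ALL P:A. EX C>=0. ALL t v g s x kap. 0 < t --> t <= 1 --> near_min (Lam * t) v g --> 0 < s --> s <= t --> locE p g (ball x (3 * t)) <= kap -->
   locE p g (ball x s Int V P t) <= C * ((s / t) ^ DIM('a) * kap + t)"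
 proof
  fix P assume "P : A"
  then obtain I S e r where "P = (I, S, e, r)" "good_zone m1 M K Ceta I" "push_piece I S e r" using z(4) by (cases P) metis
  then show "EX C>=0. ALL t v g s x kap. 0 < t --> t <= 1 --> near_min (Lam * t) v g --> 0 < s --> s <= t --> locE p g (ball x (3 * t)) <= kap -->
   locE p g (ball x s Int V P t) <= C * ((s / t) ^ DIM('a) * kap + t)"
   using piece_morrey[OF _ z(1) _ Lam, of m1 M K I S e r] unfolding V_def by (simp only: fst_conv snd_conv)
 qed
 from bchoice[OF this] obtain CP where CP0: "ALL P:A. 0 <= CP P & (ALL t v g s x kap. 0 < t --> t <= 1 --> near_min (Lam * t) v g --> 0 < s --> s <= t -->
   locE p g (ball x (3 * t)) <= kap --> locE p g (ball x s Int V P t) <= CP P * ((s / t) ^ DIM('a) * kap + t))" by (rule exE)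
 note CP = conjunct1[OF bspec[OF CP0]] conjunct2[OF bspec[OF CP0], rule_format]
 define C where "C = 1 + K1 * CW + (SUM P:A. CP P)"
 have sC: "0 <= (SUM P:A. CP P)" using CP(1) by (rule sum_nonneg)
 have KC: "0 <= K1 * CW" using K1(1) CW(1) by simp
 show ?thesis
 proof (rule that[of C])
  show "1 <= C" using sC KC by (simp add: C_def)
  fix t v g s x kap assume t: "0 < t" "t <= (1::real)" and v: "near_min (Lam * t) v g" and s: "0 < s" "s <= t"
   and kap: "locE p g (ball x (3 * t)) <= kap"
  note vC = near_minD(1)[OF v]
  have GI: "integrable lborel (%y. norm (g y) powr p)" by (rule integrable_grad[OF vC])
  have V: "V P t : sets borel" if "P : A" for P
  proof -
   have "closed (inner_zone m1 M K (fst P) t)" unfolding inner_zone_def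
    by (intro closed_Collect_conj closed_Collect_le continuous_intros continuous_nrm continuous_q t)
   moreover have "open (fst (snd P))" using z(4) that by (cases P) (auto simp: push_piece_def)
   ultimately show ?thesis unfolding V_def by auto
  qed
  have iG: "integrable lborel (%y. indicator B y * norm (g y) powr p)" if "B : sets borel" for B
   using integrable_real_mult_indicator[OF _ GI, of B] that by (simp add: mult.commute)
  have iW: "integrable lborel (%x. norm (g x) powr p * sq t 2 x)" by (intro integrable_weight[OF vC] continuous_intros continuous_q t)
  have "locE p g (ball x s) <= (LBINT y. K1 * t * (norm (g y) powr p * sq t 2 y) +
     (SUM P:A. indicator (ball x s Int V P t) y * norm (g y) powr p))"
  proof (rule integral_mono)
   show "integrable lborel (%y. indicator (ball x s) y * norm (g y) powr p)" by (rule iG) simp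
   show "integrable lborel (%y. K1 * t * (norm (g y) powr p * sq t 2 y) +
     (SUM P:A. indicator (ball x s Int V P t) y * norm (g y) powr p))"
    using iW iG V by (intro Bochner_Integration.integrable_add Bochner_Integration.integrable_sum integrable_mult_right) auto
   fix y
   have W0: "0 <= K1 * t * (norm (g y) powr p * sq t 2 y)" using K1(1) t q_ge_1[of t 2 y] by simp
   have S0: "0 <= (SUM P:A. indicator (ball x s Int V P t) y * norm (g y) powr p)" by (intro sum_nonneg) simp
   show "indicator (ball x s) y * norm (g y) powr p <= K1 * t * (norm (g y) powr p * sq t 2 y) +
     (SUM P:A. indicator (ball x s Int V P t) y * norm (g y) powr p)"
   proof (cases "y : ball x s & g y ~= 0")
    case False
    then show ?thesis using W0 S0 by auto
   next
    case True
    have y: "y : Om"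
    proof -
     obtain K where "K <= Om" "!!x. x ~: K ==> g x = 0" using C1cE[OF vC] by metis
     with True show ?thesis by blast
    qed
    show ?thesis
    proof (cases "K1 * t * sq t 2 y <= 1")
     case q: True
     from K1(2)[OF t(1) y q] obtain I S e r where P: "(I, S, e, r) : A" "y : S" "cball y (0 * t) <= inner_zone m1 M K I t"
      by clarify (rule that, assumption, assumption, assumption)
     then have "y : V (I, S, e, r) t" by (simp add: V_def)
     then have "norm (g y) powr p = indicator (ball x s Int V (I, S, e, r) t) y * norm (g y) powr p" using True by simp
     also have "... <= (SUM P:A. indicator (ball x s Int V P t) y * norm (g y) powr p)" by (rule member_le_sum[OF P(1)]) (use z(3) in auto)
     finally show ?thesis using True W0 by simp
    next
     case False
     then have "norm (g y) powr p * 1 <= norm (g y) powr p * (K1 * t * sq t 2 y)" by (intro mult_left_mono) auto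
     also have "... = K1 * t * (norm (g y) powr p * sq t 2 y)" by simp
     finally show ?thesis using True add_increasing2[OF S0] by simp
    qed
   qed
  qed
  also have "... = K1 * t * Ewt t 2 g + (SUM P:A. locE p g (ball x s Int V P t))"
   using iW iG V by (subst Bochner_Integration.integral_add) (auto intro!: Bochner_Integration.integrable_sum Bochner_Integration.integral_sum)
  also have "... <= K1 * t * CW + (SUM P:A. CP P * ((s / t) ^ DIM('a) * kap + t))"
   using K1(1) t CW(2)[OF t v] CP(2)[OF _ t v s kap] by (intro add_mono mult_left_mono sum_mono) auto
  also have "... = K1 * CW * t + (SUM P:A. CP P) * ((s / t) ^ DIM('a) * kap + t)" by (simp add: sum_distrib_right)
  also have "... <= C * ((s / t) ^ DIM('a) * kap + t)"
  proof -
   have "0 <= kap" by (rule order_trans[OF Bochner_Integration.integral_nonneg kap]) simp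
   then have k: "0 <= (s / t) ^ DIM('a) * kap" using s t by simp
   have "(1 + K1 * CW) * t <= (1 + K1 * CW) * ((s / t) ^ DIM('a) * kap + t)" using k KC by (intro mult_left_mono) auto
   then show ?thesis unfolding C_def using t by (simp add: algebra_simps)
  qed
  finally show "locE p g (ball x s) <= C * ((s / t) ^ DIM('a) * kap + t)" .
 qed
qed

text \<open>The step is iterated from radius 3 t to radius \<open>sig\<close> t. As the dimension is
  at least 2, the volume ratio is at most \<open>sig\<close>^2, which beats the linear decay
  claimed; 3 C1 \<open>sig\<close> = 1/2 closes the induction. It works down to radius h, where the
  slack of order h is still of order t.\<close>

lemma morrey:
 assumes Lam: "0 <= Lam"
 obtains C where "0 <= C" "!!h v g s x. 0 < h ==> h <= 1 ==> near_min (Lam * h) v g ==> h <= s ==> locE p g (ball x s) <= C * s"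
proof -
 obtain C1 where C1: "1 <= C1" "!!t v g s x kap. 0 < t ==> t <= 1 ==> near_min (Lam * t) v g ==> 0 < s ==> s <= t ==> locE p g (ball x (3 * t)) <= kap ==>
   locE p g (ball x s) <= C1 * ((s / t) ^ DIM('a) * kap + t)" by (rule morrey_step[OF Lam]) (rule that; assumption)
 obtain E where E: "0 < E" "!!v g. near_min Lam v g ==> En g <= E" using energy_bound[of Lam] by blast
 define sig where "sig = 1 / (6 * C1)"
 have sig: "0 < sig" "sig <= 1" "3 * C1 * sig = 1 / 2" using C1(1) by (auto simp: sig_def field_simps)
 define C where "C = max (E / sig) (2 * C1 / sig)"
 have C: "0 <= C" "E / sig <= C" "C1 <= C * sig / 2" using C1(1) sig(1) by (auto simp: C_def max_def field_simps)
 show ?thesis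
 proof (rule that[OF C(1)])
  fix h v g s x assume h: "0 < h" "h <= (1::real)" and v: "near_min (Lam * h) v g" and s: "h <= s"
  have vt: "near_min (Lam * t) v g" if "h <= t" for t by (rule near_min_mono[OF v]) (use that Lam in "auto intro: mult_left_mono")
  have GI: "integrable lborel (%y. norm (g y) powr p)" by (rule integrable_grad[OF near_minD(1)[OF v]])
  have E': "locE p g (ball x s) <= E" for x s
  proof -
   have "locE p g (ball x s) <= En g" unfolding En_def by (rule integral_mono'[OF GI]) (auto simp: indicator_def)
   also have "... <= E" by (rule E(2)) (use vt[OF h(2)] in simp)
   finally show ?thesis .
  qed
  \<comment> \<open>n counts the steps needed to come down from radius 1 to s; at radius 1 or more
    the total energy suffices.\<close>
  have "ALL s x. h <= s --> (sig / 3) ^ n <= s --> locE p g (ball x s) <= C * s" for n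
  proof (induction n)
   case 0
   show ?case
   proof (intro allI impI)
    fix s x assume "(sig / 3) ^ 0 <= s"
    moreover have "E <= C" using C(2) sig(1,2) E(1) by (simp add: divide_le_eq mult_left_le order_trans[of E "E / sig"] field_simps)
    ultimately show "locE p g (ball x s) <= C * s" using E'[of x s] C(1) mult_left_mono[of 1 s C] by simp
   qed
  next
   case (Suc n)
   show ?case
   proof (intro allI impI)
    fix s x assume s: "h <= s" "(sig / 3) ^ Suc n <= s"
    show "locE p g (ball x s) <= C * s"
    proof (cases "sig <= s")
     case True
     have "E <= C * sig" using C(2) sig(1) by (simp add: divide_le_eq)
     also have "... <= C * s" using True C(1) by (rule mult_left_mono)
     finally show ?thesis using E'[of x s] by simp
    next
     case False
     define t where "t = s / sig"
     have st: "s = sig * t" using sig(1) by (simp add: t_def)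
     have t: "0 < t" "t <= 1" "s <= t" "(sig / 3) ^ n <= 3 * t" using False sig h s by (auto simp: t_def field_simps mult_left_le)
     have "locE p g (ball x (3 * t)) <= C * (3 * t)" using Suc.IH t s by auto
     from C1(2)[OF t(1,2) vt _ t(3) this] h s t
     have "locE p g (ball x s) <= C1 * ((s / t) ^ DIM('a) * (C * (3 * t)) + t)" by auto
     also have "(s / t) ^ DIM('a) <= sig^2" using power_decreasing[OF dim, of sig] sig t(1) by (simp add: st)
     then have "C1 * ((s / t) ^ DIM('a) * (C * (3 * t)) + t) <= C1 * (sig^2 * (C * (3 * t)) + t)"
      using C1(1) C(1) t by (intro mult_left_mono add_right_mono mult_right_mono) auto
     also have "... = (3 * C1 * sig) * (C * (sig * t)) + C1 * t" by (simp add: power2_eq_square algebra_simps)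
     also have "... <= C * s / 2 + (C * sig / 2) * t" unfolding sig(3) st using C(3) t(1) by (intro add_mono mult_right_mono) auto
     also have "... = C * s" by (simp add: st)
     finally show ?thesis .
    qed
   qed
  qed
  moreover obtain n where "(sig / 3) ^ n < h" using real_arch_pow_inv[OF h(1), of "sig / 3"] sig by auto
  ultimately show "locE p g (ball x s) <= C * s" using s by (meson less_imp_le order_trans)
 qed
qed
end

section \<open>Mollification\<close>

text \<open>s^(-m) exp (-1/s), extended by 0. The derivative of one such function is a combination
  of two others, so the family is closed under differentiation up to linear combinations.\<close>

definition flat_exp :: "nat => real => real" where "flat_exp m s = (if 0 < s then inverse s ^ m * exp (- inverse s) else 0)"

lemma flat_exp_tendsto: "(flat_exp m \<longlongrightarrow> 0) (at 0)"
proof -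
 have "((%s. inverse s ^ m / exp (inverse s)) \<longlongrightarrow> 0) (at_right (0::real))"
  by (rule filterlim_compose[OF tendsto_power_div_exp_0 filterlim_inverse_at_top_right])
 then have "(flat_exp m \<longlongrightarrow> 0) (at_right 0)"
  by (rule Lim_transform_eventually) (auto simp: flat_exp_def eventually_at_filter exp_minus field_simps)
 moreover have "(flat_exp m \<longlongrightarrow> 0) (at_left 0)"
  by (rule Lim_transform_eventually[OF tendsto_const]) (auto simp: flat_exp_def eventually_at_filter)
 ultimately show ?thesis by (simp add: filterlim_split_at)
qed

lemma flat_exp_deriv:
 "(flat_exp m has_field_derivative (flat_exp (m + 2) s - real m * flat_exp (m + 1) s)) (at s)"
proof -
 consider "s < 0" | "s = 0" | "0 < s" by linarith
 then show ?thesis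
 proof cases
  case 1
  have "(flat_exp m has_field_derivative 0) (at s)" by (rule has_field_derivative_transform_within_open[OF DERIV_const[of 0], of "{..<0}"])
     (use 1 in "auto simp: flat_exp_def")
  then show ?thesis using 1 by (simp add: flat_exp_def)
 next
  case 2
  have "((%h. (flat_exp m (0 + h) - flat_exp m 0) / h) \<longlongrightarrow> 0) (at 0)"
   by (rule Lim_transform_eventually[OF flat_exp_tendsto[of "m + 1"]]) (auto simp: eventually_at_filter flat_exp_def field_simps)
  then show ?thesis using 2 by (simp add: DERIV_def flat_exp_def)
 next
  case 3
  have "m = 0 \<or> m = 1 \<or> (EX k. m = Suc (Suc k))" by (metis One_nat_def not0_implies_Suc)
  then have "((%s. inverse s ^ m * exp (- inverse s)) has_field_derivative (flat_exp (m + 2) s - real m * flat_exp (m + 1) s)) (at s)"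
   using 3 by (auto intro!: derivative_eq_intros simp: flat_exp_def field_simps power2_eq_square)
  then show ?thesis by (rule has_field_derivative_transform_within_open[of _ _ _ "{0<..}"]) (use 3 in "auto simp: flat_exp_def")
 qed
qed

text \<open>Closed under partial derivatives, so that all its members are smooth; it contains a bump function.\<close>

inductive bump_alg :: "('a::euclidean_space => real) => bool" where
 const: "bump_alg (%x. c)"
| coord: "bump_alg (%x. x \<bullet> b)"
| bump: "bump_alg (%x. flat_exp m (1 - c * (x \<bullet> x)))"
| add: "bump_alg f ==> bump_alg g ==> bump_alg (%x. f x + g x)"
| mult: "bump_alg f ==> bump_alg g ==> bump_alg (%x. f x * g x)"

lemma bump_alg_derivative:
 "bump_alg f ==> EX f'. (ALL x. (f has_derivative (%h. f' h x)) (at x)) & (ALL h. bump_alg (f' h))"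
proof (induction rule: bump_alg.induct)
 case (const c)
 show ?case by (rule exI[of _ "%h x. 0"]) (auto intro: bump_alg.intros)
next
 case (coord b)
 show ?case by (rule exI[of _ "%h x. h \<bullet> b"]) (auto intro: bump_alg.intros intro!: derivative_eq_intros)
next
 case (bump m c)
 show ?case
 proof (rule exI[of _ "%h x. (flat_exp (m + 2) (1 - c * (x \<bullet> x)) + (- real m) * flat_exp (m + 1) (1 - c * (x \<bullet> x))) *
   ((- 2 * c) * (x \<bullet> h))"], intro conjI allI)
  fix x :: 'a
  have "((%x. 1 - c * (x \<bullet> x)) has_derivative (%h. (- 2 * c) * (x \<bullet> h))) (at x)"
   by (auto intro!: derivative_eq_intros simp: inner_commute)
  from has_derivative_compose[OF this flat_exp_deriv[unfolded has_field_derivative_def]]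
  show "((%x. flat_exp m (1 - c * (x \<bullet> x))) has_derivative (%h. (flat_exp (m + 2) (1 - c * (x \<bullet> x)) +
    (- real m) * flat_exp (m + 1) (1 - c * (x \<bullet> x))) * ((- 2 * c) * (x \<bullet> h)))) (at x)" by simp
 qed (intro bump_alg.intros)
next
 case (add f g)
 then obtain f' g' where "!!x. (f has_derivative (%h. f' h x)) (at x)" "!!x. (g has_derivative (%h. g' h x)) (at x)"
  "!!h. bump_alg (f' h)" "!!h. bump_alg (g' h)" by blast
 then show ?case by (intro exI[of _ "%h x. f' h x + g' h x"]) (auto intro: bump_alg.intros has_derivative_add)
next
 case (mult f g)
 then obtain f' g' where "!!x. (f has_derivative (%h. f' h x)) (at x)" "!!x. (g has_derivative (%h. g' h x)) (at x)"
  "!!h. bump_alg (f' h)" "!!h. bump_alg (g' h)" by blast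
 note d = this
 show ?case by (rule exI[of _ "%h x. f x * g' h x + f' h x * g x"])
    (use d mult.hyps in "auto intro!: has_derivative_mult bump_alg.add[OF bump_alg.mult bump_alg.mult]")
qed

lemma bump_alg_C_k: "bump_alg f ==> C_k k f"
proof (induction k arbitrary: f)
 case 0
 then obtain f' where "!!x. (f has_derivative (%h. f' h x)) (at x)" using bump_alg_derivative by blast
 then show ?case by (auto intro!: continuous_at_imp_continuous_on intro: has_derivative_continuous)
next
 case (Suc k)
 obtain f' where f': "!!x. (f has_derivative (%h. f' h x)) (at x)" "!!h. bump_alg (f' h)" using bump_alg_derivative[OF Suc.prems] by blast
 have "frechet_derivative f (at x) = (%h. f' h x)" for x by (rule frechet_derivative_at[OF f'(1), symmetric])
 then show ?case using Suc.IH[OF f'(2)] f'(1) by (auto simp: differentiable_on_def intro: differentiableI)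
qed

definition kernel :: "real => ('a::euclidean_space => real) => bool" where
 "kernel delta psi \<longleftrightarrow> 0 < delta & (ALL k. C_k k psi) & (ALL x. 0 <= psi x) & (ALL x. delta <= norm x --> psi x = 0) & (LBINT x. psi x) = 1"

lemma kernelD:
 assumes "kernel delta psi"
 shows "0 < delta" "!!k. C_k k psi" "!!x. 0 <= psi x" "!!x. delta <= norm x ==> psi x = 0" "(LBINT x. psi x) = 1" "continuous_on UNIV psi"
 using assms unfolding kernel_def by (auto dest: spec[of _ 0])

lemma kernel_exists:
 obtains c where "0 < c" "!!delta. 0 < delta ==> EX psi::'a::euclidean_space => real. kernel delta psi & (ALL x. psi x <= c / delta ^ DIM('a))"
proof -
 \<comment> \<open>The bump is at least exp (-4/3) on the ball of radius delta/2, which bounds its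
   integral from below and hence the normalised kernel from above.\<close>
 define c where "c = 2 ^ DIM('a) / (exp (- 4 / 3) * unit_ball_vol DIM('a))"
 show ?thesis
 proof (rule that[of c])
  show "0 < c" by (simp add: c_def)
  fix delta :: real assume delta: "0 < delta"
  define phi where "phi x = flat_exp 0 (1 - inverse (delta^2) * (x \<bullet> x))" for x :: 'a
  have phiC: "bump_alg phi" unfolding phi_def[abs_def] by (rule bump_alg.bump)
  have c: "continuous_on UNIV phi" using bump_alg_C_k[OF phiC, of 0] by simp
  have off: "phi x = 0" if "delta <= norm x" for x
  proof -
   have "delta^2 <= x \<bullet> x" using power_mono[OF that, of 2] delta by (simp add: power2_norm_eq_inner)
   then show ?thesis using delta by (simp add: phi_def flat_exp_def field_simps)
  qed
  have i: "integrable lborel phi" by (rule integrable_compact_support[OF c compact_cball[of 0 delta]]) (use off in auto)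
  have p: "0 <= phi x" "phi x <= 1" for x by (auto simp: phi_def flat_exp_def)
  define N where "N = (LBINT x. phi x)"
  have N: "exp (- 4 / 3) * (unit_ball_vol DIM('a) * (delta / 2) ^ DIM('a)) <= N"
  proof -
   have "exp (- 4 / 3) * (unit_ball_vol DIM('a) * (delta / 2) ^ DIM('a)) = (LBINT x. exp (- 4 / 3) * indicator (cball (0::'a) (delta / 2)) x)"
    using delta by (simp add: content_cball)
   also have "... <= N" unfolding N_def
   proof (rule integral_mono'[OF i])
    fix x :: 'a
    show "exp (- 4 / 3) * indicator (cball 0 (delta / 2)) x <= phi x"
    proof (cases "norm x <= delta / 2")
     case True
     have "x \<bullet> x <= delta^2 / 4" using power_mono[OF True, of 2] by (simp add: power2_norm_eq_inner power_divide)
     then have s: "3 / 4 <= 1 - inverse (delta^2) * (x \<bullet> x)" using delta by (simp add: field_simps)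
     then have "inverse (1 - inverse (delta^2) * (x \<bullet> x)) <= inverse (3 / 4)" by (intro le_imp_inverse_le) auto
     then show ?thesis using True s by (simp add: phi_def flat_exp_def)
    qed (use p in auto)
   qed (rule p)
   finally show ?thesis .
  qed
  have N0: "0 < N" by (rule less_le_trans[OF _ N]) (use delta in simp)
  define psi where "psi x = inverse N * phi x" for x
  have "bump_alg psi" unfolding psi_def[abs_def] by (intro bump_alg.intros phiC)
  moreover have "integral\<^sup>L lborel psi = 1" using N0 unfolding psi_def[abs_def] by (simp add: N_def[symmetric])
  ultimately have "kernel delta psi" unfolding kernel_def using delta bump_alg_C_k[of psi] p off N0 by (simp add: psi_def)
  moreover have "psi x <= c / delta ^ DIM('a)" for x
  proof -
   have "psi x <= inverse N * 1" unfolding psi_def using p N0 by (intro mult_left_mono) auto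
   also have "... <= inverse (exp (- 4 / 3) * (unit_ball_vol DIM('a) * (delta / 2) ^ DIM('a)))" using le_imp_inverse_le[OF N] delta by simp
   also have "... = c / delta ^ DIM('a)" by (simp add: c_def power_divide field_simps)
   finally show ?thesis .
  qed
  ultimately show "EX psi::'a => real. kernel delta psi & (ALL x. psi x <= c / delta ^ DIM('a))" by blast
 qed
qed

section \<open>Convolution with a scalar kernel\<close>

definition cv :: "('a::euclidean_space => 'b::euclidean_space) => ('a => real) => 'a => 'b" where "cv F k x = (LBINT y. k y *R F (x - y))"

lemma integrable_compact_support_vec:
 fixes F :: "'a::euclidean_space => 'b::euclidean_space"
 assumes "continuous_on UNIV F" "compact K" "!!x. x ~: K ==> F x = 0"
 shows "integrable lborel F"
proof -
 have "integrable lborel (%x. indicator K x *R F x)" by (rule borel_integrable_compact[OF assms(2) continuous_on_subset[OF assms(1)]]) simp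
 moreover have "(%x. indicator K x *R F x) = F" using assms(3) by (auto simp: indicator_def)
 ultimately show ?thesis by simp
qed

lemma cv_integrable:
 fixes F :: "'a::euclidean_space => 'b::euclidean_space"
 assumes "continuous_on UNIV F" "continuous_on UNIV k" "compact K" "!!x. x ~: K ==> k x = 0"
 shows "integrable lborel (%y. k y *R F (x - y))" by (rule integrable_compact_support_vec[OF _ assms(3)])
   (use assms(4) in "auto intro!: continuous_intros assms(2) continuous_on_compose2[OF assms(1)]")

lemma cv_commute:
 fixes v k :: "'a::euclidean_space => real"
 assumes "continuous_on UNIV v" "continuous_on UNIV k"
 shows "cv v k x = cv k v x"
proof -
 have "cv k v x = (LINT y|distr lborel borel ((-) x). v y * k (x - y))" using lborel_affine[of "-1" x] by (simp add: density_1 one_ereal_def cv_def)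
 also have "... = (LBINT y. v (x - y) * k (x - (x - y)))" by (rule integral_distr)
    (auto intro!: borel_measurable_continuous_onI continuous_intros assms(1) continuous_on_compose2[OF assms(2)])
 finally show ?thesis by (simp add: cv_def mult.commute)
qed

lemma weighted_norm_bound:
 fixes D :: "'a::euclidean_space => 'b::euclidean_space"
 assumes k: "integrable lborel (%y. abs (k y))" and D: "integrable lborel (%y. k y *R D y)" "!!y. norm (D y) <= B"
 shows "norm (LBINT y. k y *R D y) <= (LBINT y. abs (k y)) * B"
proof -
 have "norm (LBINT y. k y *R D y) <= (LBINT y. norm (k y *R D y))" by (rule integral_norm_bound)
 also have "... <= (LBINT y. abs (k y) * B)"
 proof (rule integral_mono)
  show "integrable lborel (%y. norm (k y *R D y))" using D(1) by (rule integrable_norm)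
  show "norm (k y *R D y) <= abs (k y) * B" for y unfolding norm_scaleR by (intro mult_left_mono D) simp
 qed (use k in simp)
 finally show ?thesis by simp
qed

text \<open>The derivative falls on f, whose gradient is uniformly continuous; of k only continuity
  and compact support are asked.\<close>

lemma cv_C1:
 assumes f: "C1c S f gf" and k: "continuous_on UNIV k" "compact K" "!!x. x ~: K ==> k x = 0"
 shows "C1 (cv f k) (cv gf k)"
proof -
 obtain Kf where Kf: "compact Kf" "!!x. x ~: Kf ==> gf x = 0" using C1cE[OF f] by metis
 note fC = C1c_C1[OF f]
 have uc: "EX d>0. ALL x x'. norm (x' - x) < d --> norm (gf x' - gf x) < e" if e: "0 < e" for e
 proof -
  let ?K = "{x + y |x y. x : Kf & y : cball 0 1}"
  have "uniformly_continuous_on ?K gf"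
   by (intro compact_uniformly_continuous compact_sums Kf compact_cball continuous_on_subset[OF C1_grad_cont[OF fC]]) auto
  then obtain d where d: "0 < d" "!!x x'. x : ?K ==> x' : ?K ==> norm (x' - x) < d ==> norm (gf x' - gf x) < e"
   using e unfolding uniformly_continuous_on_def dist_norm by meson
  have K: "z : ?K" if "z' : Kf" "norm (z - z') <= 1" for z z' using that by (intro CollectI exI[of _ z'] exI[of _ "z - z'"]) auto
  have "norm (gf x' - gf x) < e" if n: "norm (x' - x) < min d 1" for x x'
  proof (cases "x : Kf \<or> x' : Kf")
   case True
   then have "x : ?K" "x' : ?K" using K[of x x] K[of x' x'] K[of x x'] K[of x' x] n by (auto simp: norm_minus_commute)
   then show ?thesis using d(2) n by simp
  qed (use Kf(2) e in simp)
  then show ?thesis using d(1) by (intro exI[of _ "min d 1"]) auto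
 qed
 note i = cv_integrable[OF C1_cont[OF fC] k] cv_integrable[OF C1_grad_cont[OF fC] k]
 have ik: "integrable lborel (%y. abs (k y))" by (rule integrable_compact_support[OF _ k(2)]) (use k in "auto intro!: continuous_intros")
 define M where "M = (LBINT y. abs (k y))"
 have M: "0 <= M" unfolding M_def by (rule Bochner_Integration.integral_nonneg) simp
 have small: "EX d>0. ALL h. norm h < d --> norm (cv gf k (x + h) - cv gf k x) <= e &
   abs (cv f k (x + h) - cv f k x - cv gf k x \<bullet> h) <= e * norm h" if e: "0 < e" for e x
 proof -
  have e': "0 < e / (M + 1)" using e M by simp
  obtain d where d: "0 < d" "!!x x'. norm (x' - x) < d ==> norm (gf x' - gf x) < e / (M + 1)" using uc[OF e'] by blast
  have bM: "M * (e / (M + 1) * c) <= e * c" if "0 <= c" for c using mult_left_le_one_le[of "e * c" "M / (M + 1)"] M e that by simp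
  show ?thesis
  proof (intro exI[of _ d] conjI d(1) allI impI)
   fix h :: 'a assume h: "norm h < d"
   have "cv gf k (x + h) - cv gf k x = (LBINT y. k y *R (gf (x + h - y) - gf (x - y)))"
    unfolding cv_def using i(2)[of x] i(2)[of "x + h"] by (simp add: scaleR_diff_right)
   also have "norm ... <= M * (e / (M + 1) * 1)" unfolding M_def by (rule weighted_norm_bound[OF ik])
      (use i(2)[of x] i(2)[of "x + h"] d(2) h in "auto simp: scaleR_diff_right M_def[symmetric] intro: less_imp_le")
   finally show "norm (cv gf k (x + h) - cv gf k x) <= e" using bM[of 1] by simp
   have "cv f k (x + h) - cv f k x - cv gf k x \<bullet> h = (LBINT y. k y *R (f (x + h - y) - f (x - y) - gf (x - y) \<bullet> h))"
   proof -
    have "integrable lborel (%y. k y * (gf (x - y) \<bullet> h))" "cv gf k x \<bullet> h = (LBINT y. k y * (gf (x - y) \<bullet> h))"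
     using integrable_inner_left[OF i(2)[of x], of h] integral_inner_left[OF i(2)[of x], of h] by (auto simp: cv_def)
    then show ?thesis using i(1)[of x] i(1)[of "x + h"] by (simp add: cv_def right_diff_distrib)
   qed
   also have "norm ... <= M * (e / (M + 1) * norm h)" unfolding M_def
   proof (rule weighted_norm_bound[OF ik], unfold M_def[symmetric])
    show "integrable lborel (%y. k y *R (f (x + h - y) - f (x - y) - gf (x - y) \<bullet> h))"
     using i(1)[of x] i(1)[of "x + h"] integrable_inner_left[OF i(2)[of x], of h] by (simp add: algebra_simps)
    fix y :: 'a
    have C: "C1 (%z. f z - gf (x - y) \<bullet> z) (%z. gf z - gf (x - y))" using C1D[OF fC] C1_grad_cont[OF fC] unfolding C1_def
     by (auto intro!: derivative_eq_intros continuous_intros simp: inner_diff_left)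
    have "abs ((f (x + h - y) - gf (x - y) \<bullet> (x + h - y)) - (f (x - y) - gf (x - y) \<bullet> (x - y))) <= e / (M + 1) * norm (x + h - y - (x - y))"
    proof (rule C1_lipschitz_segment[OF C])
     fix z assume "z : closed_segment (x + h - y) (x - y)"
     from segment_bound(2)[OF this] h have "norm (z - (x - y)) < d" by (simp add: norm_minus_commute)
     from less_imp_le[OF d(2)[OF this]] show "norm (gf z - gf (x - y)) <= e / (M + 1)" .
    qed
    then show "norm (f (x + h - y) - f (x - y) - gf (x - y) \<bullet> h) <= e / (M + 1) * norm h"
     by (simp add: inner_diff_right inner_add_right algebra_simps)
   qed
   finally show "abs (cv f k (x + h) - cv f k x - cv gf k x \<bullet> h) <= e * norm h" using bM[of "norm h"] by simp
  qed
 qed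
 show ?thesis unfolding C1_def
 proof (intro conjI allI)
  show "(cv f k has_derivative (%h. cv gf k x \<bullet> h)) (at x)" for x unfolding has_derivative_at_alt
  proof (intro conjI allI impI bounded_linear_inner_right)
   fix e :: real assume "0 < e"
   from small[OF this, of x] obtain d where "0 < d" "!!h. norm h < d ==> \<bar>cv f k (x + h) - cv f k x - cv gf k x \<bullet> h\<bar> <= e * norm h"
    by blast
   then show "EX d>0. ALL y. norm (y - x) < d --> norm (cv f k y - cv f k x - cv gf k x \<bullet> (y - x)) <= e * norm (y - x)"
    by (metis add_diff_cancel_left' diff_add_cancel real_norm_def add.commute)
  qed
  show "continuous_on UNIV (cv gf k)" unfolding continuous_on_iff
  proof (intro ballI allI impI)
   fix x :: 'a and e :: real assume "0 < e"
   then have "0 < e / 2" by simp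
   from small[OF this, of x] obtain d where d: "0 < d" "!!h. norm h < d ==> norm (cv gf k (x + h) - cv gf k x) <= e / 2" by blast
   have "dist (cv gf k y) (cv gf k x) < e" if "dist y x < d" for y using d(2)[of "y - x"] that \<open>0 < e\<close> by (simp add: dist_norm)
   then show "EX d>0. ALL x':UNIV. dist x' x < d --> dist (cv gf k x') (cv gf k x) < e" using d(1) by blast
  qed
 qed
qed

lemma smooth_gradient:
 assumes "!!k. C_k k theta" "compact K" "!!x. x ~: K ==> theta x = 0"
 defines "dp \<equiv> %b x. frechet_derivative theta (at x) b"
 shows "C1c K theta (%x. SUM b:Basis. dp b x *R b)" "!!k b. b : Basis ==> C_k k (dp b)"
  "!!b x. b : Basis ==> x ~: K ==> dp b x = 0" "!!b. b : Basis ==> continuous_on UNIV (dp b)"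
proof -
 have d: "theta differentiable (at x)" for x using assms(1)[of 1] by (simp add: differentiable_on_def)
 show C: "C_k k (dp b)" if "b : Basis" for k b using assms(1)[of "Suc k"] that by (simp add: dp_def)
 show cont: "continuous_on UNIV (dp b)" if "b : Basis" for b using C[OF that, of 0] by simp
 have "(%h. (SUM b:Basis. dp b x *R b) \<bullet> h) = frechet_derivative theta (at x)" for x
 proof
  fix h
  interpret linear "frechet_derivative theta (at x)" by (rule linear_frechet_derivative[OF d])
  have "frechet_derivative theta (at x) h = frechet_derivative theta (at x) (SUM b:Basis. (h \<bullet> b) *R b)" by (simp add: euclidean_representation)
  also have "... = (SUM b:Basis. (h \<bullet> b) * dp b x)" by (simp add: sum scale dp_def)
  finally show "(SUM b:Basis. dp b x *R b) \<bullet> h = frechet_derivative theta (at x) h"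
   by (simp add: inner_sum_left inner_sum_right inner_commute[of _ h] mult.commute)
 qed
 then have C1: "C1 theta (%x. SUM b:Basis. dp b x *R b)"
  unfolding C1_def using d frechet_derivative_works cont by (auto intro!: continuous_intros)
 then show "C1c K theta (%x. SUM b:Basis. dp b x *R b)" by (rule C1cI) (use assms in auto)
 fix b :: 'a and x assume b: "b : Basis" "x ~: K"
 have "(SUM b:Basis. dp b x *R b) = 0" by (rule gradient_zero_off[OF C1 compact_imp_closed[OF assms(2)]]) (use assms b in auto)
 then have "(SUM b:Basis. dp b x *R b) \<bullet> b = 0" by simp
 then show "dp b x = 0" using b by (simp add: inner_sum_left inner_Basis if_distrib cong: if_cong)
qed

text \<open>Here theta is the smooth factor and takes all derivatives, so the induction runs over
  its partial derivatives with v fixed.\<close>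

lemma cv_smooth:
 assumes "continuous_on UNIV v" "compact K" "!!x. x ~: K ==> v x = 0"
 shows "(!!k. C_k k theta) ==> compact K' ==> (!!x. x ~: K' ==> theta x = 0) ==> C_k k (cv theta v)"
proof (induction k arbitrary: theta)
 case 0
 show ?case using C1_cont[OF cv_C1[OF smooth_gradient(1)[OF 0] assms]] by simp
next
 case (Suc k)
 define dp where "dp b x = frechet_derivative theta (at x) b" for b x
 note sg = smooth_gradient[OF Suc.prems, folded dp_def]
 note C = cv_C1[OF sg(1) assms]
 have d: "(cv theta v has_derivative (%h. cv (%x. SUM b:Basis. dp b x *R b) v x \<bullet> h)) (at x)" for x by (rule C1D[OF C])
 have i: "integrable lborel (%y. v y *R (SUM b:Basis. dp b (x - y) *R b))" for x
  by (rule cv_integrable[OF C1_grad_cont[OF C1c_C1[OF sg(1)]] assms])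
 have "frechet_derivative (cv theta v) (at x) b = cv (dp b) v x" if "b : Basis" for b x
 proof -
  have "frechet_derivative (cv theta v) (at x) b = cv (%x. SUM b:Basis. dp b x *R b) v x \<bullet> b"
   using frechet_derivative_at[OF d[of x]] by metis
  also have "... = (LBINT y. (v y *R (SUM b:Basis. dp b (x - y) *R b)) \<bullet> b)"
   unfolding cv_def using i by (intro integral_inner_left[symmetric])
  also have "... = cv (dp b) v x" unfolding cv_def
   using that by (intro Bochner_Integration.integral_cong refl) (simp add: inner_sum_left inner_Basis if_distrib cong: if_cong)
  finally show ?thesis .
 qed
 then show ?case using d Suc.IH[OF sg(2) Suc.prems(2) sg(3)] by (auto simp: differentiable_on_def intro: differentiableI)
qed

lemma kernel_integrable:
 fixes F :: "'a::euclidean_space => 'b::euclidean_space"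
 assumes "kernel delta psi" "continuous_on UNIV F"
 shows "integrable lborel (%y. psi y *R F y)" by (rule integrable_compact_support_vec[of _ "cball 0 delta"])
   (use kernelD(4,6)[OF assms(1)] assms(2) in "auto intro!: continuous_intros")

lemma kernel_jensen:
 fixes F :: "'a::euclidean_space => 'b::euclidean_space"
 assumes k: "kernel delta psi" and F: "continuous_on UNIV F" and p: "1 < p"
 shows "norm (LBINT y. psi y *R F y) powr p <= (LBINT y. psi y * norm (F y) powr p)"
proof -
 note kd = kernelD[OF k]
 define c where "c = (LBINT y. psi y * norm (F y))"
 have i: "integrable lborel (%y. psi y * norm (F y))" "integrable lborel (%y. psi y * norm (F y) powr p)" "integrable lborel psi"
  using kernel_integrable[OF k, of "%y. norm (F y)"] kernel_integrable[OF k, of "%y. norm (F y) powr p"]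
   kernel_integrable[OF k, of "%y. 1::real"] F continuous_norm_powr[OF F, of p] p by (auto intro!: continuous_intros)
 have c: "0 <= c" unfolding c_def using kd(3) by (intro Bochner_Integration.integral_nonneg) simp
 have "norm (LBINT y. psi y *R F y) <= c" unfolding c_def by (rule order_trans[OF integral_norm_bound]) (use kd(3) in simp)
 then have "norm (LBINT y. psi y *R F y) powr p <= c powr p" using p by (intro powr_mono2) auto
 moreover have "p * c powr p <= (LBINT y. psi y * norm (F y) powr p) + (p - 1) * c powr p"
 proof -
  have "p * c powr p = p * c powr (p - 1) * c" unfolding mult.assoc by (simp add: powr_mult_self[OF c p] mult.commute[of _ c])
  also have "... = (LBINT y. p * c powr (p - 1) * (psi y * norm (F y)))" by (simp add: c_def)
  also have "... <= (LBINT y. psi y * norm (F y) powr p + (p - 1) * c powr p * psi y)"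
  proof (rule integral_mono)
   fix y
   show "p * c powr (p - 1) * (psi y * norm (F y)) <= psi y * norm (F y) powr p + (p - 1) * c powr p * psi y"
    using mult_left_mono[OF powr_tangent[OF p norm_ge_zero[of "F y"] c] kd(3)[of y]] by (simp add: algebra_simps)
  qed (use i in auto)
  also have "... = (LBINT y. psi y * norm (F y) powr p) + (p - 1) * c powr p" using i kd(5) by simp
  finally show ?thesis .
 qed
 ultimately show ?thesis by (simp add: algebra_simps)
qed

text \<open>Jensen's inequality for the kernel and Tonelli's theorem: a bound for F (., y) that is
  uniform in |y| <= delta passes to the average. It serves both for the translated gradient and for
  the differences v (x - y) - v x.\<close>

lemma kernel_powr_integral_le:
 fixes F :: "'a::euclidean_space => 'a => 'b::euclidean_space"
 assumes k: "kernel delta psi" and F: "continuous_on UNIV (%(x, y). F x y)" and p: "1 < p"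
  and u: "!!x. u x = (LBINT y. psi y *R F x y)" "integrable lborel (%x. norm (u x) powr p)"
  and D: "!!y. norm y <= delta ==> integrable lborel (%x. norm (F x y) powr p)" "!!y. norm y <= delta ==> (LBINT x. norm (F x y) powr p) <= D"
 shows "Epow p u <= D"
proof -
 note kd = kernelD[OF k]
 have Fx: "continuous_on UNIV (F x)" for x
 proof -
  have "continuous_on UNIV (%y. (x, y))" by (intro continuous_intros)
  from continuous_on_compose2[OF F this] show ?thesis by simp
 qed
 have D0: "0 <= D" using D(2)[of 0] kd(1) by (intro order_trans[OF Bochner_Integration.integral_nonneg D(2)[of 0]]) auto
 define G where "G z = psi (snd z) * norm (F (fst z) (snd z)) powr p" for z
 have Gc: "continuous_on UNIV G" unfolding G_def
  using F p by (intro continuous_intros continuous_on_powr' continuous_on_compose2[OF kd(6)]) (auto simp: split_beta)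
 then have "G : borel_measurable borel" by (rule borel_measurable_continuous_onI)
 then have [measurable]: "G : borel_measurable (lborel \<Otimes>\<^sub>M lborel)" by (simp add: lborel_prod)
 have "ennreal (Epow p u) = (\<integral>\<^sup>+x. ennreal (norm (u x) powr p) \<partial>lborel)"
  using u(2) by (intro nn_integral_eq_integral[symmetric]) auto
 also have "... <= (\<integral>\<^sup>+x. (\<integral>\<^sup>+y. ennreal (G (x, y)) \<partial>lborel) \<partial>lborel)"
 proof (rule nn_integral_mono)
  fix x
  have "integrable lborel (%y. G (x, y))" using kernel_integrable[OF k continuous_norm_powr[OF Fx[of x]], of p] p by (simp add: G_def)
  then have "(\<integral>\<^sup>+y. ennreal (G (x, y)) \<partial>lborel) = ennreal (LBINT y. G (x, y))"
   by (intro nn_integral_eq_integral) (auto simp: G_def kd(3))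
  then show "ennreal (norm (u x) powr p) <= (\<integral>\<^sup>+y. ennreal (G (x, y)) \<partial>lborel)"
   using kernel_jensen[OF k Fx p, of x] unfolding u(1) by (simp add: G_def ennreal_leI)
 qed
 also have "... = (\<integral>\<^sup>+y. (\<integral>\<^sup>+x. ennreal (G (x, y)) \<partial>lborel) \<partial>lborel)"
  by (rule lborel_pair.Fubini'[symmetric]) measurable
 also have "... <= (\<integral>\<^sup>+y. ennreal D * ennreal (psi y) \<partial>lborel)"
 proof (rule nn_integral_mono)
  fix y
  show "(\<integral>\<^sup>+x. ennreal (G (x, y)) \<partial>lborel) <= ennreal D * ennreal (psi y)"
  proof (cases "norm y <= delta")
   case True
   have "(\<integral>\<^sup>+x. ennreal (G (x, y)) \<partial>lborel) = ennreal (LBINT x. G (x, y))"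
    using D(1)[OF True] by (intro nn_integral_eq_integral) (auto simp: G_def kd(3))
   also have "... <= ennreal (psi y * D)" using D[OF True] kd(3)[of y] by (intro ennreal_leI) (auto simp: G_def intro: mult_left_mono)
   finally show ?thesis using D0 kd(3)[of y] by (simp add: ennreal_mult' mult.commute)
  qed (use kd(4)[of y] in "simp add: G_def")
 qed
 also have "... = ennreal D * ennreal (LBINT y. psi y)" using kernel_integrable[OF k, of "%y. 1::real"] kd(3)
   nn_integral_eq_integral[of lborel psi] borel_measurable_continuous_onI[OF kd(6)] by (simp add: nn_integral_cmult)
 finally show ?thesis using kd(5) D0 by simp
qed

lemma cv_minus:
 assumes k: "kernel delta psi" and v: "continuous_on UNIV v"
 shows "cv v psi x - v x = (LBINT y. psi y *R (v (x - y) - v x))"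
proof -
 have "integrable lborel (%y. psi y *R v (x - y))" by (rule kernel_integrable[OF k]) (auto intro!: continuous_on_compose2[OF v] continuous_intros)
 moreover have "integrable lborel psi" using kernel_integrable[OF k, of "%y. 1::real"] by simp
 ultimately show ?thesis using kernelD(5)[OF k] by (simp add: cv_def scaleR_diff_right)
qed

text \<open>The last part turns local energy into a pointwise bound: by Jensen's inequality the p-th
  power of the mollified gradient is at most the mollification of |g|^p, and the kernel is at most
  c.\<close>

lemma mollify:
 fixes v :: "'a::euclidean_space => real"
 assumes v: "C1c Om v g" and k: "kernel delta psi" and p: "1 < p"
  and K: "compact K" "!!x. x ~: K ==> v x = 0" "!!x. x : K ==> cball x delta <= Om"
 shows "C1c Om (cv v psi) (cv g psi)" "cv v psi : test_functions Om" "Epow p (cv g psi) <= Epow p g"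
  "(LBINT x. abs (cv v psi x - v x) powr p) <= 2 * delta powr p * Epow p g"
  "!!c x. (!!y. psi y <= c) ==> norm (cv g psi x) powr p <= c * locE p g (ball x delta)"
proof -
 note kd = kernelD[OF k] and vC = C1c_C1[OF v]
 have off: "psi x = 0" if "x ~: cball 0 delta" for x using kd(4)[of x] that by simp
 let ?K = "{x + y |x y. x : K & y : cball 0 delta}"
 have Kc: "compact ?K" by (rule compact_sums[OF K(1) compact_cball])
 have KOm: "?K <= Om" using K(3) by (fastforce simp: dist_norm subset_iff)
 have zero: "cv v psi x = 0" if x: "x ~: ?K" for x
 proof -
  have "psi y *R v (x - y) = 0" for y
  proof (cases "psi y = 0")
   case False
   then have "x - y ~: K" using x off[of y] by (auto intro: exI[of _ "x - y"])
   then show ?thesis using K(2) by simp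
  qed simp
  then show ?thesis unfolding cv_def by (simp only: Bochner_Integration.integral_zero)
 qed
 show wC: "C1c Om (cv v psi) (cv g psi)" by (rule C1cI[OF cv_C1[OF v kd(6) compact_cball off] Kc KOm zero])
 have "cv v psi = cv psi v" using cv_commute[OF C1_cont[OF vC] kd(6)] by blast
 moreover have "C_k n (cv psi v)" for n by (rule cv_smooth[OF C1_cont[OF vC] K(1,2) kd(2) compact_cball off])
 ultimately have "C_k n (cv v psi)" for n by simp
 then show "cv v psi : test_functions Om" unfolding test_functions_def using Kc KOm zero by blast
 note gc = C1_grad_cont[OF vC]
 have ig: "integrable lborel (%x. norm (g x) powr p)" using C1c_powr(1)[OF v, of p] p by simp
 have gm: "(%x. norm (g x) powr p) : borel_measurable borel" by (rule borel_measurable_continuous_onI[OF continuous_norm_powr[OF gc]]) (use p in simp)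
 show "Epow p (cv g psi) <= Epow p g"
 proof (rule kernel_powr_integral_le[OF k _ p])
  show "continuous_on UNIV (%(x, y). g (x - y))" unfolding split_beta by (intro continuous_on_compose2[OF gc] continuous_intros) auto
  show "cv g psi x = (LBINT y. psi y *R g (x - y))" for x by (simp add: cv_def)
  show "integrable lborel (%x. norm (cv g psi x) powr p)" using C1c_powr(1)[OF wC, of p] p by simp
  show "integrable lborel (%x. norm (g (x - y)) powr p)" for y using integrable_translate[OF gm ig, of "- y"] by simp
  show "(LBINT x. norm (g (x - y)) powr p) <= Epow p g" for y using integral_translate[OF gm, of "- y"] by simp
 qed
 show "(LBINT x. abs (cv v psi x - v x) powr p) <= 2 * delta powr p * Epow p g" unfolding real_norm_def[symmetric]
 proof (rule kernel_powr_integral_le[OF k _ p])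
  note vc = C1_cont[OF vC]
  show "continuous_on UNIV (%(x, y). v (x - y) - v x)" unfolding split_beta by (intro continuous_intros continuous_on_compose2[OF vc]) auto
  show "cv v psi x - v x = (LBINT y. psi y *R (v (x - y) - v x))" for x by (rule cv_minus[OF k vc])
  have "C1c Om (%x. cv v psi x - v x) (%x. cv g psi x - g x)"
  proof -
   obtain K0 where "compact K0" "K0 <= Om" "!!x. x ~: K0 ==> v x = 0" using C1cE[OF v] by metis
   then show ?thesis by (intro C1cI[OF C1_diff[OF C1c_C1[OF wC] vC], of "?K Un K0"] compact_Un Kc) (use KOm zero in auto)
  qed
  from C1c_powr(2)[OF this, of p] show "integrable lborel (%x. norm (cv v psi x - v x) powr p)" using p by simp
  fix y :: 'a assume y: "norm y <= delta"
  have X: "small_field (%x. 1 *R (- y)) (%x h. 1 *R proj {} h + (0 \<bullet> h) *R (- y))"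
   using deformation.small[OF translation_deformation[of "%x. 1" "%x. 0" "- y"]] by simp
  note dp = displacement_powr_le[OF v p X, of "%x. 1" "%x. 1" "delta powr p" "%x. v (x - y) - v x"]
  have D: "continuous_on UNIV (%x. v (x - y) - v x)" by (intro continuous_intros continuous_on_compose2[OF vc]) auto
  have y': "norm y powr p <= delta powr p" using y p by (intro powr_mono2) auto
  have s: "EX s. 0 <= s & s <= 1 & abs (v (x - y) - v x) <= abs (v (x + s *R 1 *R - y) - v x)" for x by (rule exI[of _ 1]) simp
  show "integrable lborel (%x. norm (v (x - y) - v x) powr p)" using dp(1) D y' s by simp
  show "(LBINT x. norm (v (x - y) - v x) powr p) <= 2 * delta powr p * Epow p g" using dp(2) D y' s by simp
 qed
 fix c x assume c: "!!y. psi y <= c"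
 have "norm (cv g psi x) powr p <= (LBINT y. psi y * norm (g (x - y)) powr p)"
  unfolding cv_def by (rule kernel_jensen[OF k _ p]) (auto intro!: continuous_on_compose2[OF gc] continuous_intros)
 also have "... = cv (%z. norm (g z) powr p) psi x" by (simp add: cv_def)
 also have "... = cv psi (%z. norm (g z) powr p) x" by (rule cv_commute[OF continuous_norm_powr[OF gc] kd(6)]) (use p in simp)
 also have "... <= (LBINT y. c * (indicator (ball x delta) y * norm (g y) powr p))" unfolding cv_def
 proof (rule integral_mono')
  show "integrable lborel (%y. c * (indicator (ball x delta) y * norm (g y) powr p))"
   using integrable_real_mult_indicator[OF _ ig, of "ball x delta"] by (simp add: mult.commute[of "indicator _ _"])
  show "norm (g y) powr p *R psi (x - y) <= c * (indicator (ball x delta) y * norm (g y) powr p)" for y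
  proof (cases "y : ball x delta")
   case True
   then show ?thesis using mult_left_mono[OF c[of "x - y"], of "norm (g y) powr p"] by (simp add: mult.commute)
  next
   case False
   then show ?thesis using kd(4)[of "x - y"] by (simp add: dist_norm)
  qed
  show "0 <= c * (indicator (ball x delta) y * norm (g y) powr p)" for y using order_trans[OF kd(3)[of 0] c[of 0]] by simp
 qed
 finally show "norm (cv g psi x) powr p <= c * locE p g (ball x delta)" by simp
qed

context polyhedral
begin

text \<open>After the push a ball of radius c h around every support point lies in Om, which leaves
  room for a kernel of radius c h / 2. Its height is of order h^(-d), and the energy on a ball of
  radius h contributes h.\<close>

lemma regular_competitor:
 assumes ex: "!!c. 0 < c ==> EX v g. near_min c v g"
 obtains C where "0 < C" "!!h. 0 < h ==> h <= 1 ==> EX w g. w : test_functions Om & near_min (C * h) w g &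
  (ALL x. norm (g x) powr p <= C * h powr (1 - real DIM('a)))"
proof -
 obtain C c where S: "0 <= C" "0 < c" "c <= 1" "!!t v g. 0 < t ==> t <= 1 ==> near_min (1 * t) v g ==>
  EX w gw. near_min (C * t) w gw & (ALL x. w x ~= 0 --> ball x (c * t) <= Om)" by (rule support_push[OF zero_le_one]) (rule that; assumption)
 obtain M where M: "0 <= M" "!!h v g s x. 0 < h ==> h <= 1 ==> near_min (C * h) v g ==> h <= s ==> locE p g (ball x s) <= M * s"
  by (rule morrey[OF S(1)]) (rule that; assumption)
 obtain E where E: "0 < E" "!!v g. near_min C v g ==> En g <= E" using energy_bound[of C] by blast
 obtain c0 where c0: "0 < c0" "!!delta. 0 < delta ==> EX psi::'a => real. kernel delta psi & (ALL x. psi x <= c0 / delta ^ DIM('a))"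
  by (rule kernel_exists) (rule that; assumption)
 define A where "A = max (C + (F0 + 2 * E)) (c0 / (c / 2) ^ DIM('a) * M) + 1"
 have A: "C + (F0 + 2 * E) <= A" "c0 / (c / 2) ^ DIM('a) * M <= A" "0 < A" using S(1) F0 E(1) by (auto simp: A_def max_def)
 show ?thesis
 proof (rule that[OF A(3)])
  fix h :: real assume h: "0 < h" "h <= 1"
  obtain v0 g0 where "near_min (1 * h) v0 g0" using ex[of h] h(1) unfolding mult_1 by blast
  from S(4)[OF h this] obtain v g where v: "near_min (C * h) v g" "!!x. v x ~= 0 ==> ball x (c * h) <= Om" by blast
  note vC = near_minD(1)[OF v(1)]
  define delta where "delta = c / 2 * h"
  have delta: "0 < delta" "delta <= h" "2 * delta = c * h" using S h by (auto simp: delta_def field_simps intro: order_trans)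
  obtain psi :: "'a => real" where psi: "kernel delta psi" "!!x. psi x <= c0 / delta ^ DIM('a)" using c0(2)[OF delta(1)] by blast
  \<comment> \<open>The room is known only where v is nonzero; a point of the closure is within
    delta of such a point, and delta is half of c h.\<close>
  define K where "K = closure {x. v x ~= 0}"
  obtain K0 where "compact K0" "!!x. x ~: K0 ==> v x = 0" using C1cE[OF vC] by metis
  then have "{x. v x ~= 0} <= K0" "compact K0" by blast+
  then have K: "compact K" unfolding K_def by (meson bounded_subset compact_closure compact_imp_bounded)
  have Kz: "v x = 0" if "x ~: K" for x using that closure_subset[of "{x. v x ~= 0}"] by (auto simp: K_def)
  have KOm: "cball x delta <= Om" if "x : K" for x
  proof -
   have "x : closure {x. v x ~= 0}" using that by (simp add: K_def)
   from this[unfolded closure_approachable] obtain y where y: "v y ~= 0" "dist y x < delta" using delta(1) by blast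
   have "cball x delta <= ball y (c * h)"
   proof
    fix z assume "z : cball x delta"
    then show "z : ball y (c * h)" using y(2) dist_triangle[of y z x] delta(3) by simp
   qed
   then show ?thesis using v(2)[OF y(1)] by blast
  qed
  have mo: "C1c Om (cv v psi) (cv g psi)" "cv v psi : test_functions Om" "En (cv g psi) <= En g"
   "(LBINT x. abs (cv v psi x - v x) powr p) <= 2 * delta powr p * En g"
   "norm (cv g psi x) powr p <= c0 / delta ^ DIM('a) * locE p g (ball x delta)" for x
   unfolding En_def by (rule mollify[OF vC psi(1) p(1) K] Kz KOm psi(2); assumption?)+
  have Eg: "En g <= E" by (rule E(2)[OF near_min_mono[OF v(1)]]) (use S(1) h in "simp add: mult_left_le")
  have "(LBINT x. abs (cv v psi x - v x) powr p) <= (2 * E) * h powr p"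
  proof -
   have "2 * delta powr p * En g <= 2 * h powr p * E" using delta p Eg En_nonneg[of g] by (intro mult_mono mult_left_mono powr_mono2) auto
   then show ?thesis using mo(4) by (simp add: mult_ac)
  qed
  from near_min_change(1)[OF v(1) mo(1) h(1) this]
  have "En (cv g psi) / p - L (cv v psi) <= m + C * h + (En (cv g psi) - En g) / p + h * (F0 + 2 * E)" .
  moreover have "(En (cv g psi) - En g) / p <= 0" using mo(3) p by (simp add: divide_le_0_iff)
  moreover have "(C + (F0 + 2 * E)) * h <= A * h" using h by (intro mult_right_mono A) auto
  ultimately have "near_min (A * h) (cv v psi) (cv g psi)" using mo(1) by (simp add: near_min_def algebra_simps)
  moreover have "norm (cv g psi x) powr p <= A * h powr (1 - real DIM('a))" for x
  proof -
   have ig: "integrable lborel (%y. indicator (ball x h) y * norm (g y) powr p)"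
    using integrable_real_mult_indicator[OF _ integrable_grad[OF vC], of "ball x h"] by (simp add: mult.commute[of "indicator _ _"])
   have "norm (cv g psi x) powr p <= c0 / delta ^ DIM('a) * locE p g (ball x delta)" by (rule mo(5))
   also have "... <= c0 / delta ^ DIM('a) * (M * h)"
   proof (rule mult_left_mono)
    have "locE p g (ball x delta) <= locE p g (ball x h)" by (rule integral_mono'[OF ig]) (use delta(2) in "auto simp: indicator_def")
    also have "... <= M * h" by (rule M(2)[OF h v(1) order_refl])
    finally show "locE p g (ball x delta) <= M * h" .
   qed (use c0 delta in simp)
   also have "... = c0 / (c / 2) ^ DIM('a) * M * h powr (1 - real DIM('a))"
    using h unfolding delta_def power_mult_distrib by (simp add: powr_diff powr_realpow)
   also have "... <= A * h powr (1 - real DIM('a))" by (intro mult_right_mono A) auto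
   finally show ?thesis .
  qed
  ultimately show "EX w g. w : test_functions Om & near_min (A * h) w g &
   (ALL x. norm (g x) powr p <= A * h powr (1 - real DIM('a)))" using mo(2) by blast
 qed
qed
end

section \<open>Inner angles\<close>

text \<open>The slit ball is starlike about a point opposite to the slit, hence connected and its
  own only component. After division of the complex coordinate by u it consists of the points with
  argument in (0, 2 pi), which is the dihedron of opening 2 pi.\<close>

lemma slit_inner_angle:
 fixes Om :: "'a::euclidean_space set"
 assumes b: "orthonormal_pair b1 b2" and rho: "0 < rho" and u: "norm u = 1"
  and eq: "Om Int ball q rho = {x : ball q rho. coord b1 b2 (x - q) ~: {r *R u |r. 0 <= r}}"
 shows "inner_angle_at Om q (2 * pi)"
proof -
 interpret orthonormal_pair b1 b2 by (rule b)
 let ?e = "em u" and ?e' = "em (\<i> * u)"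
 have inn: "em z \<bullet> em w = Re (z * cnj w)" for z w using b bb by (simp add: emb_def inner_add_left inner_add_right)
 have dot: "x \<bullet> em w = Re (zc x * cnj w)" for x w by (simp add: emb_def coord_def inner_add_right)
 have uu: "u * cnj u = 1" using u by (simp add: complex_norm_square[symmetric])
 define w where "w x = zc (x - q) * cnj u" for x
 have wz: "zc (x - q) = w x * u" for x using uu by (simp add: w_def mult.assoc mult.commute[of "cnj u"])
 have ray: "zc (x - q) : {r *R u |r. 0 <= r} \<longleftrightarrow> (EX r>=0. w x = of_real r)" for x
 proof
  assume "zc (x - q) : {r *R u |r. 0 <= r}"
  then show "EX r>=0. w x = of_real r" using uu by (auto simp: w_def scaleR_conv_of_real mult.assoc)
 next
  assume "EX r>=0. w x = of_real r"
  then show "zc (x - q) : {r *R u |r. 0 <= r}" unfolding wz by (auto simp: scaleR_conv_of_real)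
 qed
 have dih: "x : dihedron q ?e ?e' (2 * pi) \<longleftrightarrow> \<not> (EX r>=0. w x = of_real r)" for x
 proof -
  have "(x - q) \<bullet> ?e = Re (w x)" "(x - q) \<bullet> ?e' = Im (w x)" by (simp_all add: dot w_def algebra_simps)
  then have "x : dihedron q ?e ?e' (2 * pi) \<longleftrightarrow> (EX rho phi. 0 < rho & 0 < phi & phi < 2 * pi & w x = rcis rho phi)"
   by (simp add: dihedron_def complex_eq_iff)
  also have "... \<longleftrightarrow> \<not> (EX r>=0. w x = of_real r)"
  proof
   assume "EX rho phi. 0 < rho & 0 < phi & phi < 2 * pi & w x = rcis rho phi"
   then obtain rho phi where a: "0 < rho" "0 < phi" "phi < 2 * pi" "w x = rcis rho phi" by blast
   show "\<not> (EX r>=0. w x = of_real r)"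
   proof
    assume "EX r>=0. w x = of_real r"
    then obtain r where r: "0 <= r" "rho * cos phi = r" "rho * sin phi = 0" using a(4) by (auto simp: complex_eq_iff)
    then have "sin phi = 0" "0 <= cos phi" using a(1) by (auto simp: zero_le_mult_iff)
    then have "cos phi = 1" using sin_cos_squared_add[of phi] by (auto simp: power2_eq_1_iff)
    then obtain n :: int where n: "phi = n * 2 * pi" using cos_one_2pi_int[of phi] by (auto simp: mult_ac)
    then have "0 < n" "n < 1" using a(2,3) by (auto simp: zero_less_mult_iff)
    then show False by simp
   qed
  next
   assume n: "\<not> (EX r>=0. w x = of_real r)"
   have w: "w x = rcis (cmod (w x)) (Arg2pi (w x))" using Arg2pi_eq[of "w x"] by (simp add: rcis_def cis_conv_exp)
   have "Arg2pi (w x) ~= 0"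
   proof
    assume "Arg2pi (w x) = 0"
    then have "w x = of_real (cmod (w x))" using w by (simp add: rcis_def)
    then show False using n norm_ge_zero by blast
   qed
   moreover have "w x ~= 0" using n by force
   ultimately have "0 < cmod (w x)" "0 < Arg2pi (w x)" "Arg2pi (w x) < 2 * pi" using Arg2pi_ge_0[of "w x"] Arg2pi_lt_2pi[of "w x"] by auto
   then show "EX rho phi. 0 < rho & 0 < phi & phi < 2 * pi & w x = rcis rho phi" using w by blast
  qed
  finally show ?thesis .
 qed
 let ?S = "Om Int ball q rho" and ?a = "q - (rho / 2) *R em u"
 have memS: "x : ?S \<longleftrightarrow> x : ball q rho & \<not> (EX r>=0. w x = of_real r)" for x unfolding eq using ray by blast
 have wa: "w ?a = - of_real (rho / 2)"
 proof -
  have "?a - q = em ((- rho / 2) *R u)" by (simp only: em_scaleR) simp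
  then show ?thesis using uu by (simp add: w_def scaleR_conv_of_real mult.assoc)
 qed
 have aS: "?a : ?S"
 proof -
  have "dist q ?a < rho" using rho u by (simp add: dist_norm norm_em)
  moreover have "Re (w ?a) < 0" using rho unfolding wa by simp
  ultimately show ?thesis unfolding memS by auto
 qed
 have "starlike ?S" unfolding starlike_def
 proof (intro bexI[OF _ aS] ballI subsetI)
  fix x z assume x: "x : ?S" and z: "z : closed_segment ?a x"
  have "z : ball q rho" using closed_segment_subset[OF _ _ convex_ball, of ?a q rho x] z x aS by blast
  moreover have "\<not> (EX r>=0. w z = of_real r)"
  proof
   assume "EX r>=0. w z = of_real r"
   then obtain r where r: "0 <= r" "w z = of_real r" by blast
   obtain s where s: "0 <= s" "s <= 1" "z = (1 - s) *R ?a + s *R x" using z by (auto simp: in_segment)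
   have "z - q = (1 - s) *R (?a - q) + s *R (x - q)" unfolding s(3) by (simp add: algebra_simps)
   then have wz': "w z = of_real (1 - s) * w ?a + of_real s * w x"
    by (simp only: w_def zc_add zc_scaleR) (simp add: scaleR_conv_of_real algebra_simps)
   then have e: "Re (w z) = - ((1 - s) * (rho / 2)) + s * Re (w x)" "Im (w z) = s * Im (w x)" unfolding wa by auto
   have "s ~= 0" using e(1) r rho by auto
   have "Re (w z) = r" "Im (w z) = 0" using r(2) by simp_all
   then have "Im (w x) = 0" "s * Re (w x) = r + (1 - s) * (rho / 2)" using e \<open>s ~= 0\<close> by auto
   moreover from this have "0 <= s * Re (w x)" using r(1) s rho by simp
   ultimately have "Im (w x) = 0" "0 <= s * Re (w x)" by auto
   then have "w x = of_real (Re (w x))" "0 <= Re (w x)" using \<open>s ~= 0\<close> s(1) by (auto simp: complex_eq_iff zero_le_mult_iff)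
   then show False using x unfolding memS by metis
  qed
  ultimately show "z : ?S" unfolding memS by blast
 qed
 then have "connected ?S" by (rule starlike_imp_connected)
 then have "?S : components ?S" using aS in_components_self[of ?S] by blast
 moreover have "dihedron q ?e ?e' (2 * pi) Int ball q rho = ?S" using dih memS by blast
 ultimately have "dihedron q ?e ?e' (2 * pi) Int ball q rho : components (Om Int ball q rho)" by simp
 moreover have "norm ?e = 1" "norm ?e' = 1" "?e \<bullet> ?e' = 0" using u by (auto simp: norm_em norm_mult inn)
 ultimately show ?thesis unfolding inner_angle_at_def using rho by auto
qed

text \<open>The frontier near q would lie in an affine subspace of codimension two. But q belongs to
  a polytope P of the frontier, and the part of P in the ball spans a hyperplane; it would coincide
  with both the hyperplane through q normal to \<open>b1\<close> and that normal to
  \<open>b2\<close>.\<close>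

lemma polyhedral_no_puncture:
 fixes Om :: "'a::euclidean_space set"
 assumes poly: "polyhedral_domain Om" and b: "orthonormal_pair b1 b2" and rho: "0 < rho"
 shows "Om Int ball q rho ~= {x : ball q rho. coord b1 b2 (x - q) ~= 0}"
proof
 assume eq: "Om Int ball q rho = {x : ball q rho. coord b1 b2 (x - q) ~= 0}"
 interpret orthonormal_pair b1 b2 by (rule b)
 obtain F where F: "open Om" "!!P. P : F ==> polytope P" "!!P. P : F ==> aff_dim P = int DIM('a) - 1" "frontier Om = \<Union>F"
  using poly unfolding polyhedral_domain_def by blast
 have fr: "coord b1 b2 (x - q) = 0" if "x : frontier Om" "x : ball q rho" for x using that eq F(1) by (auto simp: frontier_def interior_open)
 have "q : closure Om" unfolding closure_approachable
 proof (intro allI impI)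
  fix e :: real assume e: "0 < e"
  define s where "s = min e rho / 2"
  have s: "0 < s" "s < e" "s < rho" using e rho by (auto simp: s_def)
  have "q + s *R b1 : Om Int ball q rho" unfolding eq using s b bb by (simp add: dist_norm coord_def complex_eq_iff)
  then show "EX y:Om. dist y q < e" using s b by (intro bexI[of _ "q + s *R b1"]) (auto simp: dist_norm)
 qed
 moreover have "q ~: Om"
 proof
  assume "q : Om"
  then have "q : Om Int ball q rho" using rho by simp
  then show False unfolding eq by (simp add: coord_def complex_eq_iff)
 qed
 ultimately have "q : frontier Om" using F(1) by (simp add: frontier_def interior_open)
 then obtain P where P: "P : F" "q : P" using F(4) by blast
 let ?T = "P Int ball q rho"
 have conv: "convex ?T" using F(2)[OF P(1)] by (simp add: convex_Int polytope_imp_convex)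
 have "affine hull ?T = affine hull P" by (rule affine_hull_convex_Int_open) (use F(2)[OF P(1)] P(2) rho in "auto simp: polytope_imp_convex")
 then have dT: "aff_dim ?T = int DIM('a) - 1" using F(3)[OF P(1)] by (metis aff_dim_affine_hull)
 have hyp: "affine hull ?T = {x. b1' \<bullet> x = b1' \<bullet> q}" if b1': "b1' = b1 \<or> b1' = b2" for b1'
 proof (rule affine_dim_equal[OF affine_affine_hull affine_hyperplane])
  show "affine hull ?T ~= {}" using P(2) rho by auto
  have "?T <= {x. b1' \<bullet> x = b1' \<bullet> q}"
  proof
   fix x assume "x : ?T"
   then have "coord b1 b2 (x - q) = 0" using fr F(4) P(1) by blast
   then show "x : {x. b1' \<bullet> x = b1' \<bullet> q}" using b1' by (auto simp: coord_def complex_eq_iff inner_diff_left inner_commute[of _ x] inner_commute[of _ q])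
  qed
  then show "affine hull ?T <= {x. b1' \<bullet> x = b1' \<bullet> q}" by (simp add: hull_minimal affine_hyperplane)
  have "b1' ~= 0" using b1' b by auto
  then show "aff_dim (affine hull ?T) = aff_dim {x. b1' \<bullet> x = b1' \<bullet> q}" using dT by simp
 qed
 have "q + b2 : affine hull ?T" using hyp[of b1] b by (simp add: inner_add_right)
 then show False using hyp[of b2] bb by (simp add: inner_add_right)
qed

section \<open>The fundamental lemma and weak gradients\<close>

text \<open>Mollification at radius e/3 of a piecewise linear function of the distance to K that is
  1 up to distance e/3 and 0 from 2 e/3 on.\<close>

lemma smooth_cutoff:
 fixes K :: "'a::euclidean_space set"
 assumes K: "compact K" and e: "0 < e"
 obtains phi where "!!k. C_k k phi" "!!x. 0 <= phi x" "!!x. phi x <= 1" "!!x. x : K ==> phi x = 1" "!!x. e <= infdist x K ==> phi x = 0"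
proof (cases "K = {}")
 case True
 have "bump_alg (%x::'a. 0)" by (rule bump_alg.const)
 then show ?thesis by (intro that[of "%x. 0"]) (use True bump_alg_C_k in auto)
next
 case False
 define delta where "delta = e / 3"
 have delta: "0 < delta" using e by (simp add: delta_def)
 obtain psi :: "'a => real" where psi: "kernel delta psi" using kernel_exists delta by metis
 note kd = kernelD[OF psi]
 define zeta where "zeta y = min 1 (max 0 (2 - infdist y K / delta))" for y
 have cc: "continuous_on UNIV zeta" unfolding zeta_def by (intro continuous_intros) (use delta in auto)
 have off: "zeta y = 0" if "y ~: {y. infdist y K <= 2 * delta}" for y using that delta by (auto simp: zeta_def field_simps)
 have ib: "0 <= zeta y" "zeta y <= 1" for y by (auto simp: zeta_def)
 define phi where "phi = cv psi zeta"
 have phi: "phi x = (LBINT y. psi y * zeta (x - y))" for x unfolding phi_def cv_commute[OF kd(6) cc] by (simp add: cv_def)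
 have i: "integrable lborel (%y. psi y * zeta (x - y))" for x
  using kernel_integrable[OF psi, of "%y. zeta (x - y)"] by (simp add: continuous_on_compose2[OF cc] continuous_intros)
 have ipsi: "integrable lborel psi" using kernel_integrable[OF psi, of "%y. 1::real"] by simp
 have near: "infdist (x - y) K <= infdist x K + norm y" "infdist x K <= infdist (x - y) K + norm y" for x y
  using infdist_triangle[of "x - y" K x] infdist_triangle[of x K "x - y"] by (auto simp: dist_norm norm_minus_commute)
 show ?thesis
 proof (rule that[of phi])
  show "C_k k phi" for k unfolding phi_def
   by (rule cv_smooth[OF cc compact_infdist_le[OF False K, of "2 * delta"] off kd(2) compact_cball[of 0 delta]]) (use delta kd(4) in auto)
  show "0 <= phi x" for x unfolding phi by (intro Bochner_Integration.integral_nonneg mult_nonneg_nonneg kd(3) ib)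
  have "phi x <= (LBINT y. psi y)" for x unfolding phi by (intro integral_mono i ipsi) (use ib kd(3) in "auto intro: mult_left_le")
  then show "phi x <= 1" for x using kd(5) by simp
  fix x
  show "phi x = 1" if x: "x : K"
  proof -
   have "psi y * zeta (x - y) = psi y" for y
   proof (cases "delta <= norm y")
    case False
    then have "infdist (x - y) K <= delta" using near(1)[of x y] x by simp
    then show ?thesis using delta by (simp add: zeta_def field_simps)
   qed (use kd(4) in simp)
   then have "(%y. psi y * zeta (x - y)) = psi" by (rule ext)
   then show ?thesis unfolding phi using kd(5) by simp
  qed
  show "phi x = 0" if x: "e <= infdist x K"
  proof -
   have "psi y * zeta (x - y) = 0" for y
   proof (cases "delta <= norm y")
    case False
    then have "2 * delta < infdist (x - y) K" using near(2)[of x y] x by (simp add: delta_def)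
    then show ?thesis using off[of "x - y"] by simp
   qed (use kd(4) in simp)
   then show ?thesis unfolding phi by (simp only: Bochner_Integration.integral_zero)
  qed
 qed
qed

lemma compact_fattening:
 fixes K :: "'a::euclidean_space set"
 assumes "compact K" "open Om" "K <= Om" "K ~= {}"
 obtains e where "0 < e" "compact {x. infdist x K <= e}" "{x. infdist x K <= e} <= Om"
proof -
 obtain e where e: "0 < e" "(\<Union>x\<in>K. cball x e) <= Om" using compact_subset_open_imp_cball_epsilon_subset[OF assms(1-3)] by blast
 have "{x. infdist x K <= e} <= Om"
 proof
  fix x assume "x : {x. infdist x K <= e}"
  moreover obtain y where "y : K" "infdist x K = dist x y" using infdist_attains_inf[OF compact_imp_closed[OF assms(1)] assms(4), of x] by blast
  ultimately have "x : cball y e" by (simp add: dist_commute)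
  then show "x : Om" using e(2) \<open>y : K\<close> by blast
 qed
 then show ?thesis using e(1) compact_infdist_le[OF assms(4,1) e(1)] that by blast
qed

text \<open>If h were at least some e > 0 on a set of positive measure, inner regularity would give
  a compact subset of positive measure, over which the integral of h is positive.\<close>

lemma AE_nonpos_of_compact_integrals:
 fixes h :: "'a::euclidean_space => real"
 assumes K: "compact K" and h: "integrable (lebesgue_on K) h"
  and z: "!!T. compact T ==> T <= K ==> (LINT x|lebesgue_on T. h x) = 0"
 shows "AE x in lebesgue_on K. h x <= 0"
proof -
 have Ks: "K : sets lebesgue" using K by (simp add: lmeasurable_compact fmeasurableD)
 have "AE x in lebesgue_on K. h x < inverse (real (Suc n))" for n
 proof -
  define e where "e = inverse (real (Suc n))"
  have e: "0 < e" by (simp add: e_def)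
  define A where "A = {x : K. e <= h x}"
  have "A = h -` {e..} Int space (lebesgue_on K)" by (auto simp: A_def)
  then have "A : sets (lebesgue_on K)" using measurable_sets[OF borel_measurable_integrable[OF h], of "{e..}"] by simp
  then have As: "A : sets lebesgue" using Ks by (simp add: sets_restrict_space_iff)
  have "A : lmeasurable" by (rule bounded_set_imp_lmeasurable[OF bounded_subset[OF compact_imp_bounded[OF K]] As]) (auto simp: A_def)
  have "measure lebesgue A = 0"
  proof (rule ccontr)
   assume "measure lebesgue A ~= 0"
   then have mA: "0 < measure lebesgue A" by (simp add: zero_less_measure_iff)
   obtain T where T: "closed T" "T <= A" "A - T : lmeasurable" "emeasure lebesgue (A - T) < ennreal (measure lebesgue A)"
    using sets_lebesgue_inner_closed[OF As mA] by blast
   have "bounded T" using T(2) bounded_subset[OF compact_imp_bounded[OF K], of T] by (auto simp: A_def)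
   then have Tc: "compact T" using T(1) compact_eq_bounded_closed by blast
   then have Tl: "T : lmeasurable" by (rule lmeasurable_compact)
   have TK: "T <= K" using T(2) by (auto simp: A_def)
   have "measure lebesgue (A - T) < measure lebesgue A" using T(3,4) mA by (simp add: emeasure_eq_measure2 ennreal_less_iff)
   moreover have "measure lebesgue (A - T) = measure lebesgue A - measure lebesgue T"
    using \<open>A : lmeasurable\<close> Tl T(2) by (simp add: measurable_measure_Diff)
   ultimately have mT: "0 < measure lebesgue T" by simp
   have hT: "integrable (lebesgue_on T) h"
   proof -
    have "set_integrable lebesgue K h" using h Ks by (simp add: integrable_restrict_space set_integrable_def)
    then have "set_integrable lebesgue T h" by (rule set_integrable_subset) (use Tl TK in auto)
    then show ?thesis using Tl by (simp add: integrable_restrict_space set_integrable_def)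
   qed
   have "(LINT x|lebesgue_on T. e) <= (LINT x|lebesgue_on T. h x)"
    by (rule integral_mono[OF _ hT]) (use Tl T(2) in "auto simp: A_def integrable_restrict_space lmeasurable_iff_integrable[symmetric]")
   then have "e * measure lebesgue T <= 0" using z[OF Tc TK] Tl by (simp add: measure_restrict_space mult.commute)
   then show False using e mT by (simp add: mult_le_0_iff)
  qed
  then have "A : null_sets lebesgue" using \<open>A : lmeasurable\<close> by (simp add: null_setsI emeasure_eq_measure2 fmeasurableD)
  then have "AE x in lebesgue. x ~: A" by (rule AE_not_in)
  then show ?thesis unfolding AE_restrict_space_iff[of K lebesgue, simplified, OF Ks] by eventually_elim (auto simp: A_def e_def)
 qed
 then have "AE x in lebesgue_on K. ALL n. h x < inverse (real (Suc n))" by (simp add: AE_all_countable)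
 then show ?thesis
 proof eventually_elim
  case (elim x)
  show "h x <= 0"
  proof (rule ccontr)
   assume "\<not> h x <= 0"
   then obtain n where "inverse (real (Suc n)) < h x" using reals_Archimedean[of "h x"] by auto
   then show False using elim[rule_format, of n] by simp
  qed
 qed
qed

lemma locally_integrable_times_test:
 fixes h :: "'a::euclidean_space => real"
 assumes Om: "open Om" and h: "locally_integrable_on Om h"
  and phi: "continuous_on UNIV phi" "compact K" "K <= Om" "!!x. x ~: K ==> phi x = 0"
 shows "integrable (lebesgue_on Om) (%x. h x * phi x)"
proof -
 have s: "K : sets lebesgue" "Om : sets lebesgue" using phi(2) Om by (auto simp: lmeasurable_compact fmeasurableD)
 have "integrable (lebesgue_on K) h" using h phi by (simp add: locally_integrable_on_def)
 then have hK: "integrable lebesgue (%x. indicator K x *R h x)" using s by (simp add: integrable_restrict_space)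
 obtain B where B: "!!x. x : K ==> norm (phi x) <= B"
  using compact_imp_bounded[OF compact_continuous_image[OF continuous_on_subset[OF phi(1)] phi(2)]] by (auto simp: bounded_iff)
 have m: "phi : borel_measurable lebesgue" using borel_measurable_continuous_onI[OF phi(1)] by (simp add: measurable_completion)
 have "integrable lebesgue (%x. (indicator K x *R h x) * phi x)"
 proof (rule Bochner_Integration.integrable_bound[OF integrable_mult_right[OF integrable_norm[OF hK], of B]])
  show "(%x. (indicator K x *R h x) * phi x) : borel_measurable lebesgue" using borel_measurable_integrable[OF hK] m by (rule borel_measurable_times)
  show "AE x in lebesgue. norm ((indicator K x *R h x) * phi x) <= norm (B * norm (indicator K x *R h x))"
  proof (rule AE_I2)
   fix x
   show "norm ((indicator K x *R h x) * phi x) <= norm (B * norm (indicator K x *R h x))"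
   proof (cases "x : K")
    case True
    then have "abs (phi x) <= abs B" using B[OF True] by simp
    then show ?thesis using True by (simp add: abs_mult mult.commute[of "abs B"] mult_left_mono)
   qed simp
  qed
 qed
 moreover have "(%x. (indicator K x *R h x) * phi x) = (%x. indicator Om x *R (h x * phi x))" using phi(3,4) by (auto simp: fun_eq_iff indicator_def)
 ultimately show ?thesis using s by (simp add: integrable_restrict_space)
qed

text \<open>An open set is a countable union of closed boxes, each of them compact.\<close>

lemma open_AE_cover:
 fixes Om :: "'a::euclidean_space set"
 assumes Om: "open Om" and K: "!!K. compact K ==> K <= Om ==> AE x in lebesgue_on K. P x"
 shows "AE x in lebesgue_on Om. P x"
proof -
 obtain D where D: "countable D" "D <= Pow Om" "!!X. X : D ==> EX a b. X = cbox a b" "\<Union>D = Om"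
  using open_countable_Union_open_cbox[OF Om] by blast
 have "AE x in lebesgue. x : X --> P x" if "X : D" for X
 proof -
  have "compact X" "X <= Om" using D(2) D(3)[OF that] that by auto
  then show ?thesis using K[of X] by (simp add: AE_restrict_space_iff lmeasurable_compact fmeasurableD)
 qed
 then have "AE x in lebesgue. ALL X:D. x : X --> P x" unfolding AE_ball_countable[OF D(1)] by blast
 then have "AE x in lebesgue. x : Om --> P x" by eventually_elim (use D(4) in auto)
 then show ?thesis using Om by (simp add: AE_restrict_space_iff)
qed

text \<open>Smooth cut-offs that are 1 on a compact T and supported in shrinking neighbourhoods
  converge to the indicator of T. By dominated convergence h has integral zero over every compact T
  in Om.\<close>

lemma fundamental_lemma:
 fixes h :: "'a::euclidean_space => real"
 assumes Om: "open Om" and h: "locally_integrable_on Om h"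
  and z: "!!phi. phi : test_functions Om ==> (LINT x|lebesgue_on Om. h x * phi x) = 0"
 shows "AE x in lebesgue_on Om. h x = 0"
proof (rule open_AE_cover[OF Om])
 fix K assume K: "compact K" "K <= Om"
 have zero: "(LINT x|lebesgue_on T. h x) = 0" if T: "compact T" "T <= Om" for T
 proof (cases "T = {}")
  case False
  obtain e where e: "0 < e" "compact {x. infdist x T <= e}" "{x. infdist x T <= e} <= Om" using compact_fattening[OF T(1) Om T(2) False] by blast
  let ?K = "{x. infdist x T <= e}"
  have s: "?K : sets lebesgue" "T : sets lebesgue" "Om : sets lebesgue" using e(2) T(1) Om by (auto simp: lmeasurable_compact fmeasurableD)
  have hK: "integrable lebesgue (%x. indicator ?K x *R h x)"
  proof -
   have "integrable (lebesgue_on ?K) h" using h e unfolding locally_integrable_on_def by blast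
   then show ?thesis using s(1) by (simp add: integrable_restrict_space)
  qed
  define delta where "delta n = e * inverse (real (Suc n))" for n
  have delta: "0 < delta n" "delta n <= e" for n using e(1) by (auto simp: delta_def field_simps)
  have "ALL n. EX phi. (ALL k. C_k k phi) & (ALL x. 0 <= phi x & phi x <= 1) & (ALL x:T. phi x = 1) & (ALL x. delta n <= infdist x T --> phi x = 0)"
  proof
   fix n
   obtain phi where "!!k. C_k k phi" "!!x. 0 <= phi x" "!!x. phi x <= 1" "!!x. x : T ==> phi x = 1"
    "!!x. delta n <= infdist x T ==> phi x = 0" by (rule smooth_cutoff[OF T(1) delta(1)[of n]]) (rule that; assumption)
   then show "EX phi. (ALL k. C_k k phi) & (ALL x. 0 <= phi x & phi x <= 1) & (ALL x:T. phi x = 1) & (ALL x. delta n <= infdist x T --> phi x = 0)"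
    by blast
  qed
  from choice[OF this] obtain phi where phi: "!!n k. C_k k (phi n)" "!!n x. 0 <= phi n x" "!!n x. phi n x <= 1"
   "!!n x. x : T ==> phi n x = 1" "!!n x. delta n <= infdist x T ==> phi n x = 0" by blast
  have off: "phi n x = 0" if "x ~: ?K" for n x using that phi(5)[of n x] delta(2)[of n] by auto
  have "phi n : test_functions Om" for n unfolding test_functions_def using phi(1) off e by blast
  then have 0: "(LINT x|lebesgue. indicator Om x *R (h x * phi n x)) = 0" for n using z s(3) by (simp add: integral_restrict_space)
  have eq: "indicator Om x *R (h x * phi n x) = (indicator ?K x *R h x) * phi n x" for n x using off[of x n] e(3) by (auto simp: indicator_def)
  note 0 = 0[unfolded eq]
  have "(%n. LINT x|lebesgue. (indicator ?K x *R h x) * phi n x) \<longlonglongrightarrow> (LINT x|lebesgue. indicator T x *R h x)"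
  proof (rule integral_dominated_convergence[OF _ _ integrable_norm[OF hK]])
   show m: "(%x. indicator T x *R h x) : borel_measurable lebesgue"
   proof -
    have "(%x. indicator T x *R (indicator ?K x *R h x)) : borel_measurable lebesgue"
     by (rule borel_measurable_scaleR[OF borel_measurable_indicator[OF s(2)] borel_measurable_integrable[OF hK]])
    moreover have "(%x. indicator T x *R (indicator ?K x *R h x)) = (%x. indicator T x *R h x)" using e(1) by (auto simp: fun_eq_iff indicator_def)
    ultimately show ?thesis by simp
   qed
   have "phi n : borel_measurable borel" for n using phi(1)[of 0 n] by (simp add: borel_measurable_continuous_onI)
   then show "(%x. (indicator ?K x *R h x) * phi n x) : borel_measurable lebesgue" for n
    by (intro borel_measurable_times borel_measurable_integrable[OF hK] measurable_completion) simp
   show "AE x in lebesgue. norm ((indicator ?K x *R h x) * phi n x) <= norm (indicator ?K x *R h x)" for n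
    by (intro AE_I2) (use phi(2,3) in "simp add: abs_mult mult_left_le")
   show "AE x in lebesgue. (%n. (indicator ?K x *R h x) * phi n x) \<longlonglongrightarrow> indicator T x *R h x"
   proof (rule AE_I2)
    fix x
    show "(%n. (indicator ?K x *R h x) * phi n x) \<longlonglongrightarrow> indicator T x *R h x"
    proof (cases "x : T")
     case True
     then show ?thesis using phi(4)[OF True] e(1) by simp
    next
     case F: False
     then have "0 < infdist x T" using infdist_pos_not_in_closed[OF compact_imp_closed[OF T(1)] False] by blast
     moreover have "delta \<longlonglongrightarrow> e * 0" unfolding delta_def by (intro tendsto_intros LIMSEQ_inverse_real_of_nat)
     ultimately have "\<forall>\<^sub>F n in sequentially. delta n < infdist x T" by (simp add: order_tendstoD(2))
     then have "\<forall>\<^sub>F n in sequentially. (indicator ?K x *R h x) * phi n x = indicator T x *R h x"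
      by eventually_elim (use phi(5) F in auto)
     then show ?thesis by (rule tendsto_eventually)
    qed
   qed
  qed
  then have "(LINT x|lebesgue. indicator T x *R h x) = 0" unfolding 0 using LIMSEQ_unique tendsto_const by blast
  then show ?thesis using s(2) by (simp add: integral_restrict_space)
 qed (simp add: integral_restrict_space)
 have i: "integrable (lebesgue_on K) h" using h K by (simp add: locally_integrable_on_def)
 have "AE x in lebesgue_on K. h x <= 0" by (rule AE_nonpos_of_compact_integrals[OF K(1) i]) (use zero K(2) in auto)
 moreover have "AE x in lebesgue_on K. - h x <= 0" by (rule AE_nonpos_of_compact_integrals[OF K(1)]) (use i zero K(2) in auto)
 ultimately show "AE x in lebesgue_on K. h x = 0" by eventually_elim auto
qed

section \<open>Weak gradients: agreement with classical gradients, uniqueness, measurability\<close>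

lemma test_functionE:
 fixes phi :: "'a::euclidean_space => real"
 assumes "phi : test_functions Om"
 obtains g where "C1c Om phi g" "!!x b. frechet_derivative phi (at x) b = g x \<bullet> b"
proof -
 obtain K where K: "compact K" "K <= Om" "!!x. x ~: K ==> phi x = 0" and C: "!!k. C_k k phi" using assms unfolding test_functions_def by blast
 let ?g = "%x. SUM b:Basis. frechet_derivative phi (at x) b *R b"
 have "C1c K phi ?g" by (rule smooth_gradient(1)[OF C K(1,3)])
 note 1 = C1c_mono[OF this K(2)]
 show ?thesis by (rule that[OF 1]) (use frechet_derivative_at[OF C1D[OF C1c_C1[OF 1]]] in metis)
qed

lemma LINT_lebesgue_on:
 fixes F :: "'a::euclidean_space => real"
 assumes "open Om" "F : borel_measurable borel" "!!x. x ~: Om ==> F x = 0"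
 shows "(LINT x|lebesgue_on Om. F x) = (LBINT x. F x)" "integrable (lebesgue_on Om) F \<longleftrightarrow> integrable lborel F"
proof -
 have "(%x. indicator Om x *R F x) = F" using assms(3) by (auto simp: fun_eq_iff indicator_def)
 then show "(LINT x|lebesgue_on Om. F x) = (LBINT x. F x)" "integrable (lebesgue_on Om) F \<longleftrightarrow> integrable lborel F"
  using assms by (simp_all add: integral_restrict_space integrable_restrict_space integral_completion integrable_completion)
qed

lemma locally_integrable_continuous:
 fixes F :: "'a::euclidean_space => 'b::euclidean_space"
 assumes "continuous_on UNIV F"
 shows "locally_integrable_on Om F" unfolding locally_integrable_on_def
proof (intro allI impI)
 fix K :: "'a set" assume K: "compact K"
 have b: "integrable lborel (%x. indicator K x *R F x)" by (rule borel_integrable_compact[OF K continuous_on_subset[OF assms]]) simp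
 then have "integrable lebesgue (%x. indicator K x *R F x)" by (subst integrable_completion) auto
 then show "integrable (lebesgue_on K) F" using K by (simp add: integrable_restrict_space lmeasurable_compact fmeasurableD)
qed

lemma locally_integrable_diff:
 "locally_integrable_on Om F ==> locally_integrable_on Om G ==> locally_integrable_on Om (%x. F x - G x)" by (simp add: locally_integrable_on_def)

lemma is_weak_gradient_C1c:
 assumes Om: "open Om" and v: "C1c Om v g"
 shows "is_weak_gradient Om v g" unfolding is_weak_gradient_def
proof (intro conjI ballI)
 note vc = C1_cont[OF C1c_C1[OF v]] and gc = C1_grad_cont[OF C1c_C1[OF v]]
 show "locally_integrable_on Om v" "locally_integrable_on Om g" by (intro locally_integrable_continuous vc gc)+
 fix phi and b :: 'a assume phi: "phi : test_functions Om"
 obtain h where h: "C1c Om phi h" "!!x b. frechet_derivative phi (at x) b = h x \<bullet> b" using test_functionE[OF phi] by blast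
 note pc = C1_cont[OF C1c_C1[OF h(1)]] and hc = C1_grad_cont[OF C1c_C1[OF h(1)]]
 obtain K where K: "compact K" "K <= Om" "!!x. x ~: K ==> v x = 0" "!!x. x ~: K ==> g x = 0" using C1cE[OF v] by metis
 have "C1c Om (%x. v x * phi x) (%x. v x *R h x + phi x *R g x)" by (rule C1cI[OF C1_mult[OF C1c_C1[OF v] C1c_C1[OF h(1)]] K(1,2)]) (use K in auto)
 from integral_gradient_zero[OF this, of b]
 have "(LBINT x. v x * (h x \<bullet> b) + (g x \<bullet> b) * phi x) = 0" by (simp add: inner_add_left mult.commute)
 moreover have "integrable lborel (%x. v x * (h x \<bullet> b))" "integrable lborel (%x. (g x \<bullet> b) * phi x)"
  by (rule integrable_compact_support[OF _ K(1)]; use K in "auto intro!: continuous_intros vc gc pc hc")+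
 ultimately have "(LBINT x. v x * (h x \<bullet> b)) = - (LBINT x. (g x \<bullet> b) * phi x)" by simp
 moreover have z: "v x = 0" "g x = 0" if "x ~: Om" for x using that K by blast+
 have "(LINT x|lebesgue_on Om. v x * (h x \<bullet> b)) = (LBINT x. v x * (h x \<bullet> b))"
  "(LINT x|lebesgue_on Om. (g x \<bullet> b) * phi x) = (LBINT x. (g x \<bullet> b) * phi x)" by (rule LINT_lebesgue_on(1)[OF Om];
    use z in "auto intro!: borel_measurable_continuous_onI continuous_intros vc gc pc hc")+
 ultimately show "(LINT x|lebesgue_on Om. v x * frechet_derivative phi (at x) b) = - (LINT x|lebesgue_on Om. (g x \<bullet> b) * phi x)"
  by (simp add: h(2))
qed

lemma locally_integrable_inner:
 "locally_integrable_on Om G ==> locally_integrable_on Om (%x. G x \<bullet> b)" by (simp add: locally_integrable_on_def)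

lemma test_function_product_integrable:
 fixes h :: "'a::euclidean_space => real"
 assumes "open Om" "locally_integrable_on Om h" "phi : test_functions Om"
 shows "integrable (lebesgue_on Om) (%x. h x * phi x)" "integrable (lebesgue_on Om) (%x. h x * frechet_derivative phi (at x) b)"
proof -
 obtain g where g: "C1c Om phi g" "!!x b. frechet_derivative phi (at x) b = g x \<bullet> b" using test_functionE[OF assms(3)] by blast
 obtain K where K: "compact K" "K <= Om" "!!x. x ~: K ==> phi x = 0" "!!x. x ~: K ==> g x = 0" using C1cE[OF g(1)] by metis
 show "integrable (lebesgue_on Om) (%x. h x * phi x)" by (rule locally_integrable_times_test[OF assms(1,2) C1_cont[OF C1c_C1[OF g(1)]] K(1-3)])
 show "integrable (lebesgue_on Om) (%x. h x * frechet_derivative phi (at x) b)"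
  unfolding g(2) by (rule locally_integrable_times_test[OF assms(1,2) _ K(1,2)])
   (use K in "auto intro!: continuous_intros C1_grad_cont[OF C1c_C1[OF g(1)]]")
qed

lemma is_weak_gradient_diff:
 assumes Om: "open Om" and u: "is_weak_gradient Om u G" and v: "is_weak_gradient Om v H"
 shows "is_weak_gradient Om (%x. u x - v x) (%x. G x - H x)"
proof -
 have l: "locally_integrable_on Om u" "locally_integrable_on Om G" "locally_integrable_on Om v" "locally_integrable_on Om H"
  using u v by (simp_all add: is_weak_gradient_def)
 show ?thesis unfolding is_weak_gradient_def
 proof (intro conjI ballI locally_integrable_diff l)
  fix phi and b :: 'a assume phi: "phi : test_functions Om" and b: "b : Basis"
  note i = test_function_product_integrable[OF Om _ phi]
  show "(LINT x|lebesgue_on Om. (u x - v x) * frechet_derivative phi (at x) b) =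
    - (LINT x|lebesgue_on Om. ((G x - H x) \<bullet> b) * phi x)"
   using u v phi b i(2)[OF l(1), of b] i(2)[OF l(3), of b] i(1)[OF locally_integrable_inner[OF l(2), of b]]
    i(1)[OF locally_integrable_inner[OF l(4), of b]] by (simp add: is_weak_gradient_def left_diff_distrib inner_diff_left)
 qed
qed

lemma weak_gradient_unique:
 assumes Om: "open Om" and G: "is_weak_gradient Om u G" and H: "is_weak_gradient Om u H"
 shows "AE x in lebesgue_on Om. G x = H x"
proof -
 have "is_weak_gradient Om (%x. u x - u x) (%x. G x - H x)" by (rule is_weak_gradient_diff[OF Om G H])
 then have w: "locally_integrable_on Om (%x. G x - H x)"
  "!!phi b. phi : test_functions Om ==> b : Basis ==> (LINT x|lebesgue_on Om. ((G x - H x) \<bullet> b) * phi x) = 0"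
  by (simp_all add: is_weak_gradient_def)
 have "AE x in lebesgue_on Om. ALL b:Basis. (G x - H x) \<bullet> b = 0"
  by (intro AE_finite_allI finite_Basis fundamental_lemma[OF Om locally_integrable_inner[OF w(1)]] w(2))
 then show ?thesis by eventually_elim (metis euclidean_eq_iff inner_zero_left right_minus_eq)
qed

lemma weak_gradient_works: "is_weak_gradient Om u G ==> is_weak_gradient Om u (weak_gradient Om u)"
 unfolding weak_gradient_def by (rule someI[of "is_weak_gradient Om u"])

lemma weak_gradient_AE:
 "open Om ==> is_weak_gradient Om u G ==> AE x in lebesgue_on Om. weak_gradient Om u x = G x" by (rule weak_gradient_unique[OF _ weak_gradient_works])

lemma locally_integrable_measurable:
 fixes G :: "'a::euclidean_space => 'b::euclidean_space"
 assumes Om: "open Om" and G: "locally_integrable_on Om G"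
 shows "G : borel_measurable (lebesgue_on Om)"
proof (rule measurableI)
 obtain D where D: "countable D" "D <= Pow Om" "!!X. X : D ==> EX a b. X = cbox a b" "\<Union>D = Om"
  using open_countable_Union_open_cbox[OF Om] by blast
 fix A :: "'b set" assume A: "A : sets borel"
 have "G -` A Int X : sets lebesgue" if "X : D" for X
 proof -
  have X: "compact X" "X <= Om" using D(3)[OF that] D(2) that by auto
  then have s: "X : sets lebesgue" by (simp add: lmeasurable_compact fmeasurableD)
  have "G : borel_measurable (lebesgue_on X)" using G X unfolding locally_integrable_on_def by (intro borel_measurable_integrable) blast
  from measurable_sets[OF this A] have "G -` A Int X : sets (lebesgue_on X)" by (simp add: space_restrict_space)
  then show ?thesis using sets_restrict_space_iff[of X lebesgue "G -` A Int X"] s by simp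
 qed
 then have "(\<Union>X\<in>D. G -` A Int X) : sets lebesgue" by (rule sets.countable_UN''[OF D(1)])
 moreover have "(\<Union>X\<in>D. G -` A Int X) = G -` A Int Om" using D(4) by blast
 ultimately have "G -` A Int Om : sets lebesgue" by simp
 then show "G -` A Int space (lebesgue_on Om) : sets (lebesgue_on Om)"
  using sets_restrict_space_iff[of Om lebesgue "G -` A Int Om"] Om by (simp add: space_restrict_space)
qed simp

lemma weak_gradient_measurable:
 assumes "open Om" "is_weak_gradient Om u G"
 shows "weak_gradient Om u : borel_measurable (lebesgue_on Om)" "G : borel_measurable (lebesgue_on Om)"
 using weak_gradient_works[OF assms(2)] assms(2) by (auto intro: locally_integrable_measurable[OF assms(1)] simp: is_weak_gradient_def)

section \<open>Energies of smooth functions\<close>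

lemma conjugate_gt_1:
 fixes p p' :: real
 assumes "1 < p" "1 / p + 1 / p' = 1"
 shows "1 < p'"
proof -
 have "0 < 1 / p" "1 / p < 1" using assms(1) by auto
 then have "0 < 1 / p'" "1 / p' < 1" using assms(2) by linarith+
 then show ?thesis by (auto simp: divide_less_eq split: if_splits)
qed

text \<open>Young's inequality for f and z / t, with the factors 1/p and 1/p' estimated by 1. The
  free parameter t becomes the size of a displacement.\<close>

lemma pairing_bound:
 fixes f z :: "'a::euclidean_space => real"
 assumes p: "1 < p" "1 / p + 1 / p' = 1" and f: "f : Lp_space p' Om" and z: "z : Lp_space p Om"
 shows "integrable (lebesgue_on Om) (%x. f x * z x)"
  and "0 < t ==> \<bar>LINT x|lebesgue_on Om. f x * z x\<bar> <=
   t * ((LINT x|lebesgue_on Om. abs (f x) powr p') + (LINT x|lebesgue_on Om. abs (z x) powr p) / t powr p)"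
proof -
 note p' = conjugate_gt_1[OF p]
 have young: "norm (f x * z x) <= t * (abs (f x) powr p' + abs (z x) powr p / t powr p)" if t: "0 < t" for x t
 proof -
  have "abs (f x) * (abs (z x) / t) <= abs (f x) powr p' / p' + (abs (z x) / t) powr p / p"
   by (rule Youngs_inequality) (use p p' t in "auto simp: add.commute")
  also have "... <= abs (f x) powr p' + (abs (z x) / t) powr p"
   using p p' by (intro add_mono) (auto simp: divide_le_eq mult_le_cancel_left1)
  also have "(abs (z x) / t) powr p = abs (z x) powr p / t powr p" using t by (simp add: powr_divide)
  finally show ?thesis using t by (simp add: abs_mult field_simps)
 qed
 have i: "integrable (lebesgue_on Om) (%x. abs (f x) powr p')" "integrable (lebesgue_on Om) (%x. abs (z x) powr p)"
  and m: "f : borel_measurable (lebesgue_on Om)" "z : borel_measurable (lebesgue_on Om)" using f z by (simp_all add: Lp_space_def)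
 show fz: "integrable (lebesgue_on Om) (%x. f x * z x)"
  by (rule Bochner_Integration.integrable_bound[of _ "%x. 1 * (abs (f x) powr p' + abs (z x) powr p / 1 powr p)"])
    (use i m young[of 1] in "auto intro!: AE_I2 order_trans[OF _ abs_ge_self]")
 assume t: "0 < t"
 have "abs (LINT x|lebesgue_on Om. f x * z x) <= (LINT x|lebesgue_on Om. norm (f x * z x))"
  using integral_norm_bound[of "lebesgue_on Om" "%x. f x * z x"] by simp
 also have "... <= (LINT x|lebesgue_on Om. t * (abs (f x) powr p' + abs (z x) powr p / t powr p))"
  by (rule integral_mono[OF integrable_norm[OF fz]]) (use i young[OF t] in auto)
 also have "... = t * ((LINT x|lebesgue_on Om. abs (f x) powr p') + (LINT x|lebesgue_on Om. abs (z x) powr p) / t powr p)" using i by simp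
 finally show "abs (LINT x|lebesgue_on Om. f x * z x) <=
   t * ((LINT x|lebesgue_on Om. abs (f x) powr p') + (LINT x|lebesgue_on Om. abs (z x) powr p) / t powr p)" .
qed

lemma C1c_diff:
 assumes "C1c Om v g" "C1c Om w h"
 shows "C1c Om (%x. v x - w x) (%x. g x - h x)"
proof -
 obtain K where K: "compact K" "K <= Om" "!!x. x ~: K ==> v x = 0" using C1cE[OF assms(1)] by metis
 obtain K' where K': "compact K'" "K' <= Om" "!!x. x ~: K' ==> w x = 0" using C1cE[OF assms(2)] by metis
 show ?thesis by (rule C1cI[OF C1_diff[OF C1c_C1[OF assms(1)] C1c_C1[OF assms(2)]], of "K Un K'"]) (use K K' in auto)
qed

lemma C1c_Lp:
 fixes v :: "'a::euclidean_space => real"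
 assumes Om: "open Om" and v: "C1c Om v g" and p: "0 < (p::real)"
 shows "v : Lp_space p Om" "weak_gradient Om v : Lp_space p Om" "(LINT x|lebesgue_on Om. abs (v x) powr p) = (LBINT x. abs (v x) powr p)"
  "(LINT x|lebesgue_on Om. norm (weak_gradient Om v x) powr p) = Epow p g"
proof -
 note w = is_weak_gradient_C1c[OF Om v]
 note ae = weak_gradient_AE[OF Om w] and m = weak_gradient_measurable[OF Om w]
 note vc = C1_cont[OF C1c_C1[OF v]] and gc = C1_grad_cont[OF C1c_C1[OF v]]
 obtain K where "K <= Om" "!!x. x ~: K ==> v x = 0" "!!x. x ~: K ==> g x = 0" using C1cE[OF v] by metis
 then have z: "v x = 0" "g x = 0" if "x ~: Om" for x using that by blast+
 note cp = C1c_powr[OF v p]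
 have vL: "(LINT x|lebesgue_on Om. abs (v x) powr p) = (LBINT x. abs (v x) powr p)"
  "integrable (lebesgue_on Om) (%x. abs (v x) powr p) \<longleftrightarrow> integrable lborel (%x. abs (v x) powr p)"
  by (rule LINT_lebesgue_on[OF Om]; use cp(2) z in simp)+
 have gL: "(LINT x|lebesgue_on Om. norm (g x) powr p) = Epow p g"
  "integrable (lebesgue_on Om) (%x. norm (g x) powr p) \<longleftrightarrow> integrable lborel (%x. norm (g x) powr p)"
  by (rule LINT_lebesgue_on[OF Om]; use cp(1) z in simp)+
 show "(LINT x|lebesgue_on Om. abs (v x) powr p) = (LBINT x. abs (v x) powr p)" by (rule vL)
 have mp: "(%x. norm (weak_gradient Om v x) powr p) : borel_measurable (lebesgue_on Om)"
  "(%x. norm (g x) powr p) : borel_measurable (lebesgue_on Om)" using m by measurable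
 have eq: "AE x in lebesgue_on Om. norm (weak_gradient Om v x) powr p = norm (g x) powr p" using ae by eventually_elim simp
 show "(LINT x|lebesgue_on Om. norm (weak_gradient Om v x) powr p) = Epow p g" using integral_cong_AE[OF mp eq] gL(1) by simp
 show "weak_gradient Om v : Lp_space p Om" using integrable_cong_AE[OF mp eq] gL(2) cp(1) m(1) by (simp add: Lp_space_def)
 show "v : Lp_space p Om" using vL(2) cp(2) locally_integrable_measurable[OF Om locally_integrable_continuous[OF vc]] by (simp add: Lp_space_def)
qed

lemma test_function_W1p_0:
 fixes phi :: "'a::euclidean_space => real"
 assumes Om: "open Om" and phi: "phi : test_functions Om" and p: "0 < p"
 shows "phi : W1p_0 p Om"
proof -
 obtain g where g: "C1c Om phi g" using test_functionE[OF phi] by blast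
 have "W1p_norm p Om (%x. phi x - phi x) = 0" using C1c_Lp(4)[OF Om C1c_zero p] by (simp add: W1p_norm_def)
 then have "EX xi. (ALL n. xi n : test_functions Om) & (%n::nat. W1p_norm p Om (%x. phi x - xi n x)) \<longlonglongrightarrow> 0"
  using phi by (intro exI[of _ "%n. phi"]) simp
 then show ?thesis using C1c_Lp(1,2)[OF Om g p] is_weak_gradient_C1c[OF Om g] unfolding W1p_0_def W1p_def by blast
qed

text \<open>For t <= ep the outer quadratic branch is not met. On the inner one, em^(p - 2) <= t^(p
  - 2) because p < 2, so the quadratic term is at most t^p / p and only the constant exceeds
  it.\<close>

lemma kappa_le:
 assumes "1 < p" "p < 2" "0 < em" "0 <= t" "t <= ep"
 shows "kappa p em ep t <= t powr p / p + (1 / p - 1 / 2) * em powr p"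
proof (cases "t <= em")
 case True
 have "1 / 2 * (em powr (p - 2) * t^2) <= 1 / p * t powr p"
 \<comment> \<open>At 0 the comparison of powers fails, because \<open>0 powr (p - 2)\<close> is 0,
   but both sides of the claim vanish.\<close>
 proof (cases "t = 0")
  case False
  then have t: "0 < t" using assms by simp
  have "em powr (p - 2) <= t powr (p - 2)" using True t assms by (intro powr_mono2') auto
  then have "em powr (p - 2) * t^2 <= t powr (p - 2) * t^2" by (intro mult_right_mono) auto
  also have "... = t powr p" using t by (simp add: powr_diff)
  finally show ?thesis using assms by (intro mult_mono) (auto simp: field_simps)
 qed simp
 then show ?thesis using True by (simp add: kappa_def mult.assoc)
next
 case False
 have "0 <= (1 / p - 1 / 2) * em powr p" using assms by (intro mult_nonneg_nonneg) (auto simp: field_simps)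
 then show ?thesis using False assms by (simp add: kappa_def)
qed

lemma relaxed_energy_le:
 fixes w :: "'a::euclidean_space => real"
 assumes Om: "open Om" "bounded Om" and w: "C1c Om w g" and p: "1 < p" "p < 2"
  and e: "0 < em" "!!x. norm (g x) <= ep"
 shows "relaxed_energy p Om f em ep w <=
  ereal (Epow p g / p + (1 / p - 1 / 2) * em powr p * measure lebesgue Om - pairing Om f w)"
proof -
 have p0: "0 < p" using p by simp
 note wg = is_weak_gradient_C1c[OF Om(1) w]
 let ?W = "%x. norm (weak_gradient Om w x) powr p" and ?c = "(1 / p - 1 / 2) * em powr p"
 have c: "0 <= ?c" using p by (intro mult_nonneg_nonneg) (auto simp: field_simps)
 have Oml: "Om : lmeasurable" using Om by (rule lmeasurable_open[rotated])
 interpret finite_measure "lebesgue_on Om" by (rule finite_measure_lebesgue_on[OF Oml])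
 have i: "integrable (lebesgue_on Om) ?W" using C1c_Lp(2)[OF Om(1) w p0] by (simp add: Lp_space_def)
 have "(\<integral>\<^sup>+ x. ennreal (kappa p em ep (norm (weak_gradient Om w x))) \<partial>lebesgue_on Om)
   <= (\<integral>\<^sup>+ x. ennreal (?W x / p + ?c) \<partial>lebesgue_on Om)"
 proof (rule nn_integral_mono_AE)
  show "AE x in lebesgue_on Om. ennreal (kappa p em ep (norm (weak_gradient Om w x))) <= ennreal (?W x / p + ?c)"
   using weak_gradient_AE[OF Om(1) wg] by eventually_elim (intro ennreal_leI kappa_le, use p e in auto)
 qed
 also have "... = ennreal (LINT x|lebesgue_on Om. ?W x / p + ?c)" by (rule nn_integral_eq_integral) (use i c p0 in auto)
 also have "(LINT x|lebesgue_on Om. ?W x / p + ?c) = Epow p g / p + ?c * measure lebesgue Om"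
  using i C1c_Lp(4)[OF Om(1) w p0] Oml by (simp add: measure_restrict_space fmeasurableD)
 finally have "enn2ereal (\<integral>\<^sup>+ x. ennreal (kappa p em ep (norm (weak_gradient Om w x))) \<partial>lebesgue_on Om)
   <= enn2ereal (ennreal (Epow p g / p + ?c * measure lebesgue Om))" by (simp add: less_eq_ennreal.rep_eq)
 also have "... = ereal (Epow p g / p + ?c * measure lebesgue Om)" by (rule enn2ereal_ennreal) (use c p0 in simp)
 finally have "relaxed_energy p Om f em ep w <=
   ereal (Epow p g / p + ?c * measure lebesgue Om) - ereal (pairing Om f w)" unfolding relaxed_energy_def by (intro ereal_minus_mono) auto
 then show ?thesis by simp
qed

text \<open>The space is the closure of the test functions by definition, and the energy passes to
  the limit along an approximating sequence: the gradient part by \<open>powr_add_split\<close> with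
  small theta, the pairing by Young's inequality with small t.\<close>

lemma near_minimizers:
 fixes f u :: "'a::euclidean_space => real"
 assumes Om: "open Om" and p: "1 < p" "1 / p + 1 / p' = 1" and f: "f : Lp_space p' Om"
  and u: "u : W1p_0 p Om" and c: "0 < c"
 shows "EX v g. C1c Om v g & Epow p g / p - pairing Om f v <= energy p Om f u + c"
proof -
 have p0: "0 < p" using p by simp
 obtain phi where phi: "!!n. phi n : test_functions Om" "(%n::nat. W1p_norm p Om (%x. u x - phi n x)) \<longlonglongrightarrow> 0"
  using u unfolding W1p_0_def by blast
 obtain Gu where Gu: "is_weak_gradient Om u Gu" and uL: "u : Lp_space p Om" "weak_gradient Om u : Lp_space p Om"
  using u unfolding W1p_0_def W1p_def by blast
 let ?G = "weak_gradient Om u"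
 note G = weak_gradient_works[OF Gu]
 have "EX g. C1c Om (phi n) g" for n using test_functionE[OF phi(1)[of n]] by blast
 then obtain g where g: "!!n. C1c Om (phi n) (g n)" by metis
 define d where "d n x = u x - phi n x" for n x
 define A where "A n = (LINT x|lebesgue_on Om. abs (d n x) powr p)" for n
 define B where "B n = (LINT x|lebesgue_on Om. norm (weak_gradient Om (d n) x) powr p)" for n
 have AB0: "0 <= A n" "0 <= B n" for n by (auto simp: A_def B_def)
 have "(%n. ((A n + B n) powr (1 / p)) powr p) \<longlonglongrightarrow> 0 powr p"
  using phi(2) p0 by (intro tendsto_powr') (auto simp: W1p_norm_def A_def B_def d_def[abs_def])
 then have AB: "(%n. A n + B n) \<longlonglongrightarrow> 0" using p0 AB0 by (simp add: powr_powr)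
 have A: "A \<longlonglongrightarrow> 0" and B: "B \<longlonglongrightarrow> 0" by (rule tendsto_sandwich[OF _ _ tendsto_const AB]; use AB0 in simp)+
 have dw: "is_weak_gradient Om (d n) (%x. ?G x - g n x)" for n
  unfolding d_def[abs_def] by (rule is_weak_gradient_diff[OF Om G is_weak_gradient_C1c[OF Om g]])
 note dm = weak_gradient_measurable[OF Om dw]
 let ?E = "LINT x|lebesgue_on Om. norm (?G x) powr p"
 have iG: "integrable (lebesgue_on Om) (%x. norm (?G x) powr p)" using uL(2) by (simp add: Lp_space_def)
 have ig: "integrable (lebesgue_on Om) (%x. norm (weak_gradient Om (phi n) x) powr p)" for n using C1c_Lp(2)[OF Om g p0] by (simp add: Lp_space_def)
 have aeg: "AE x in lebesgue_on Om. weak_gradient Om (d n) x = ?G x - weak_gradient Om (phi n) x" for n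
  using weak_gradient_AE[OF Om dw[of n]] weak_gradient_AE[OF Om is_weak_gradient_C1c[OF Om g[of n]]] by eventually_elim simp
 \<comment> \<open>Integrability has to be proved: the integral of a non-integrable function is 0 by
   convention, so small norms alone would say nothing about the differences.\<close>
 have id: "integrable (lebesgue_on Om) (%x. norm (weak_gradient Om (d n) x) powr p)" for n
 proof (rule Bochner_Integration.integrable_bound[OF integrable_mult_right[OF Bochner_Integration.integrable_add[OF iG ig[of n]], of "2 powr p"]])
  show "(%x. norm (weak_gradient Om (d n) x) powr p) : borel_measurable (lebesgue_on Om)" using dm(1)[of n] by measurable
  show "AE x in lebesgue_on Om. norm (norm (weak_gradient Om (d n) x) powr p)
    <= norm (2 powr p * (norm (?G x) powr p + norm (weak_gradient Om (phi n) x) powr p))" using aeg[of n]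
  proof eventually_elim
   case (elim x)
   have "norm (weak_gradient Om (d n) x) powr p <= (norm (?G x) + norm (weak_gradient Om (phi n) x)) powr p"
    unfolding elim using p0 by (intro powr_mono2 norm_triangle_ineq4) auto
   also have "... <= 2 powr p * (norm (?G x) powr p + norm (weak_gradient Om (phi n) x) powr p)" by (rule powr_add_le) (use p in auto)
   finally show ?case by simp
  qed
 qed
 have split: "(LBINT x. norm (g n x) powr p) <= (1 - theta) powr (1 - p) * ?E + theta powr (1 - p) * B n"
  if theta: "0 < theta" "theta < 1" for theta n
 proof -
  have "(LBINT x. norm (g n x) powr p) = (LINT x|lebesgue_on Om. norm (weak_gradient Om (phi n) x) powr p)" using C1c_Lp(4)[OF Om g p0] by simp
  also have "... <= (LINT x|lebesgue_on Om. (1 - theta) powr (1 - p) * norm (?G x) powr p + theta powr (1 - p) * norm (weak_gradient Om (d n) x) powr p)"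
  proof (rule integral_mono_AE[OF ig])
   show "AE x in lebesgue_on Om. norm (weak_gradient Om (phi n) x) powr p <=
     (1 - theta) powr (1 - p) * norm (?G x) powr p + theta powr (1 - p) * norm (weak_gradient Om (d n) x) powr p" using aeg[of n]
   proof eventually_elim
    case (elim x)
    have "weak_gradient Om (phi n) x = ?G x - weak_gradient Om (d n) x" by (simp add: elim)
    then have "norm (weak_gradient Om (phi n) x) <= norm (?G x) + norm (weak_gradient Om (d n) x)" by (metis norm_triangle_ineq4)
    then have "norm (weak_gradient Om (phi n) x) powr p <= (norm (?G x) + norm (weak_gradient Om (d n) x)) powr p" using p0 by (intro powr_mono2) auto
    also have "... <= (1 - theta) powr (1 - p) * norm (?G x) powr p + theta powr (1 - p) * norm (weak_gradient Om (d n) x) powr p"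
     by (rule powr_add_split) (use p theta in auto)
    finally show ?case .
   qed
  qed (use iG id in auto)
  also have "... = (1 - theta) powr (1 - p) * ?E + theta powr (1 - p) * B n" using iG id by (simp add: B_def)
  finally show ?thesis .
 qed
 have "((%theta::real. (1 - theta) powr (1 - p) * ?E) \<longlongrightarrow> (1 - 0) powr (1 - p) * ?E) (at_right 0)" by (intro tendsto_intros) auto
 then have "\<forall>\<^sub>F theta::real in at_right 0. (1 - theta) powr (1 - p) * ?E < ?E + c / 4" using c by (intro order_tendstoD) auto
 moreover have "\<forall>\<^sub>F theta::real in at_right 0. 0 < theta & theta < 1"
  using eventually_at_right_real[of 0 "1::real"] by (rule eventually_mono) auto
 ultimately obtain theta :: real where theta: "(1 - theta) powr (1 - p) * ?E < ?E + c / 4" "0 < theta" "theta < 1"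
  using eventually_happens[OF eventually_conj] trivial_limit_at_right_real by blast
 define F0 where "F0 = (LINT x|lebesgue_on Om. abs (f x) powr p')"
 have F0: "0 <= F0" by (simp add: F0_def)
 define t where "t = c / (4 * (F0 + 1))"
 have t: "0 < t" "t * F0 <= c / 4" using c F0 by (auto simp: t_def field_simps)
 have "(%n. theta powr (1 - p) * B n) \<longlonglongrightarrow> theta powr (1 - p) * 0" by (intro tendsto_intros B)
 then have "\<forall>\<^sub>F n in sequentially. theta powr (1 - p) * B n < c / 4" using c by (intro order_tendstoD) auto
 moreover have "(%n. t * (A n / t powr p)) \<longlonglongrightarrow> t * (0 / t powr p)" by (intro tendsto_intros A) (use t in simp)
 then have "\<forall>\<^sub>F n in sequentially. t * (A n / t powr p) < c / 4" using c by (intro order_tendstoD) auto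
 ultimately obtain n where n: "theta powr (1 - p) * B n < c / 4" "t * (A n / t powr p) < c / 4"
  using eventually_happens[OF eventually_conj] sequentially_bot by blast
 have iA: "integrable (lebesgue_on Om) (%x. abs (d n x) powr p)"
 proof (rule Bochner_Integration.integrable_bound)
  show "integrable (lebesgue_on Om) (%x. 2 powr p * (abs (u x) powr p + abs (phi n x) powr p))"
   using uL(1) C1c_Lp(1)[OF Om g p0] by (auto simp: Lp_space_def)
  have "u : borel_measurable (lebesgue_on Om)" "phi n : borel_measurable (lebesgue_on Om)"
   using uL(1) C1c_Lp(1)[OF Om g p0] by (auto simp: Lp_space_def)
  then show "(%x. abs (d n x) powr p) : borel_measurable (lebesgue_on Om)" unfolding d_def by measurable
  have "abs (d n x) powr p <= 2 powr p * (abs (u x) powr p + abs (phi n x) powr p)" for x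
  proof -
   have "abs (d n x) powr p <= (abs (u x) + abs (phi n x)) powr p" unfolding d_def using p0 by (intro powr_mono2 abs_triangle_ineq4) auto
   also have "... <= 2 powr p * (abs (u x) powr p + abs (phi n x) powr p)" by (rule powr_add_le) (use p in auto)
   finally show ?thesis .
  qed
  then show "AE x in lebesgue_on Om. norm (abs (d n x) powr p) <= norm (2 powr p * (abs (u x) powr p + abs (phi n x) powr p))" by simp
 qed
 have dL: "d n : Lp_space p Om" using iA uL(1) C1c_Lp(1)[OF Om g[of n] p0] by (auto simp: Lp_space_def d_def[abs_def])
 have "pairing Om f u - pairing Om f (phi n) = (LINT x|lebesgue_on Om. f x * d n x)"
  using pairing_bound(1)[OF p f uL(1)] pairing_bound(1)[OF p f C1c_Lp(1)[OF Om g p0]] by (simp add: pairing_def d_def right_diff_distrib)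
 then have "pairing Om f u - pairing Om f (phi n) <= t * (F0 + A n / t powr p)" using pairing_bound(2)[OF p f dL t(1)] by (simp add: F0_def A_def)
 also have "... <= c / 2" using t(2) n(2) unfolding distrib_left by linarith
 finally have 1: "pairing Om f u - pairing Om f (phi n) <= c / 2" .
 have "(LBINT x. norm (g n x) powr p) <= ?E + c / 2" using split[OF theta(2,3), of n] theta(1) n(1) by simp
 then have "(LBINT x. norm (g n x) powr p) / p <= (?E + c / 2) / p" using p0 by (intro divide_right_mono) auto
 also have "... <= ?E / p + c / 2" using divide_left_mono[of 1 p "c / 2"] p c unfolding add_divide_distrib by simp
 finally have "(LBINT x. norm (g n x) powr p) / p - pairing Om f (phi n) <= energy p Om f u + c" using 1 by (simp add: energy_def)
 then show ?thesis using g by blast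
qed

text \<open>Minimality gives the bound for test functions, while deformed competitors are only C1.
  Mollification inside Om does not increase the gradient energy and changes the pairing by at most a
  constant times delta.\<close>

lemma mollified_lower_bound:
 fixes f v :: "'a::euclidean_space => real"
 assumes Om: "open Om" and p: "1 < p" "1 / p + 1 / p' = 1" and f: "f : Lp_space p' Om"
  and m: "!!w. w : test_functions Om ==> m <= energy p Om f w" and v: "C1c Om v g"
 shows "m <= Epow p g / p - pairing Om f v"
proof (rule field_le_epsilon)
 fix e :: real assume e: "0 < e"
 have p0: "0 < p" using p by simp
 obtain K where K: "compact K" "K <= Om" "!!x. x ~: K ==> v x = 0" using C1cE[OF v] by metis
 obtain r where r: "0 < r" "(\<Union>x\<in>K. cball x r) <= Om" using compact_subset_open_imp_cball_epsilon_subset[OF K(1) Om K(2)] by blast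
 define F0 where "F0 = (LINT x|lebesgue_on Om. abs (f x) powr p')"
 define E where "E = Epow p g"
 have FE: "0 <= F0" "0 <= E" by (simp_all add: F0_def E_def)
 define delta where "delta = min r (e / (F0 + 2 * E + 1))"
 have delta: "0 < delta" "delta <= r" "delta * (F0 + 2 * E) <= e"
 proof -
  show "0 < delta" "delta <= r" using r e FE by (auto simp: delta_def add_nonneg_pos)
  have "delta * (F0 + 2 * E) <= e / (F0 + 2 * E + 1) * (F0 + 2 * E)" using FE by (intro mult_right_mono) (auto simp: delta_def)
  also have "... <= e" using FE e by (simp add: field_simps)
  finally show "delta * (F0 + 2 * E) <= e" .
 qed
 obtain psi :: "'a => real" where psi: "kernel delta psi" using kernel_exists delta(1) by metis
 have ball: "cball x delta <= Om" if "x : K" for x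
 proof -
  have "cball x delta <= cball x r" using delta(2) by (rule subset_cball)
  then show ?thesis using r(2) that by blast
 qed
 define w where "w = cv v psi"
 define gw where "gw = cv g psi"
 have mo: "C1c Om w gw" "w : test_functions Om" "Epow p gw <= E" "(LBINT x. abs (w x - v x) powr p) <= 2 * delta powr p * E"
  unfolding w_def gw_def E_def by (rule mollify[OF v psi p(1) K(1)] K(3) ball; assumption?)+
 have dC: "C1c Om (%x. w x - v x) (%x. gw x - g x)" by (rule C1c_diff[OF mo(1) v])
 note dL = C1c_Lp(1,3)[OF Om dC p0]
 have "pairing Om f w - pairing Om f v = (LINT x|lebesgue_on Om. f x * (w x - v x))"
  using pairing_bound(1)[OF p f C1c_Lp(1)[OF Om v p0]] pairing_bound(1)[OF p f C1c_Lp(1)[OF Om mo(1) p0]]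
  by (simp add: pairing_def right_diff_distrib)
 then have "abs (pairing Om f w - pairing Om f v) <= delta * (F0 + (LBINT x. abs (w x - v x) powr p) / delta powr p)"
  using pairing_bound(2)[OF p f dL(1) delta(1)] dL(2) by (simp add: F0_def)
 also have "... <= delta * (F0 + 2 * E)" using mo(4) delta(1) by (intro mult_left_mono add_left_mono) (auto simp: divide_le_eq mult_ac)
 finally have "abs (pairing Om f w - pairing Om f v) <= e" using delta(3) by simp
 moreover have "m <= Epow p gw / p - pairing Om f w" using m[OF mo(2)] C1c_Lp(4)[OF Om mo(1) p0] by (simp add: energy_def)
 moreover have "Epow p gw / p <= E / p" using mo(3) p0 by (intro divide_right_mono) auto
 ultimately show "m <= Epow p g / p - pairing Om f v + e" by (simp add: E_def)
qed

lemma relaxed_competitor: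
 fixes Om :: "'a::euclidean_space set" and p p' :: real and f u :: "'a => real"
 assumes dim: "2 <= DIM('a)" and p: "1 < p" "p < 2" and p': "1 / p + 1 / p' = 1"
  and poly: "polyhedral_domain Om" and angle: "!!x theta. inner_angle_at Om x theta ==> theta < 2 * pi"
  and f: "f : Lp_space p' Om" and u: "is_minimizer_on (W1p_0 p Om) (energy p Om f) u"
 obtains C where "0 < C" "!!em ep. 0 < em ==> em <= ep ==> EX w:W1p_0 p Om. relaxed_energy p Om f em ep w <=
  ereal (energy p Om f u + C * (em powr p + ep powr (- (p / (real DIM('a) - 1)))))"
proof -
 have p0: "0 < p" using p by simp
 have Om: "open Om" "bounded Om" using poly by (auto simp: polyhedral_domain_def)
 obtain HH where HH: "finite HH" "!!x y. same_signs HH x y ==> x : Om ==> y : Om" using polyhedral_domain_signs[OF poly] by blast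
 define F0 where "F0 = (LINT x|lebesgue_on Om. abs (f x) powr p')"
 define m where "m = energy p Om f u"
 have um: "m <= energy p Om f w" if "w : test_functions Om" for w
  using u test_function_W1p_0[OF Om(1) that p0] by (simp add: is_minimizer_on_def m_def)
 interpret polyhedral HH Om p "pairing Om f" F0 m
 proof
  fix v gv w gw and t :: real
  assume v: "C1c Om v gv" and w: "C1c Om w gw" and t: "0 < t"
  note d = C1c_Lp[OF Om(1) C1c_diff[OF v w] p0]
  have "pairing Om f v - pairing Om f w = (LINT x|lebesgue_on Om. f x * (v x - w x))"
   using pairing_bound(1)[OF p(1) p' f C1c_Lp(1)[OF Om(1) v p0]] pairing_bound(1)[OF p(1) p' f C1c_Lp(1)[OF Om(1) w p0]]
   by (simp add: pairing_def right_diff_distrib)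
  then show "abs (pairing Om f v - pairing Om f w) <= t * (F0 + (LBINT x. abs (v x - w x) powr p) / t powr p)"
   using pairing_bound(2)[OF p(1) p' f d(1) t] d(3) by (simp add: F0_def)
 next
  show "m <= Epow p g / p - pairing Om f v" if "C1c Om v g" for v g by (rule mollified_lower_bound[OF Om(1) p(1) p' f um that])
 next
  fix b1 b2 q :: 'a and rho :: real and a :: complex assume b: "orthonormal_pair b1 b2" "0 < rho"
  show "Om Int ball q rho ~= {x : ball q rho. coord b1 b2 (x - q) ~= 0}" by (rule polyhedral_no_puncture[OF poly b])
  assume "cmod a = 1"
  then show "Om Int ball q rho ~= {x : ball q rho. coord b1 b2 (x - q) ~: {r *R a |r. 0 <= r}}" using slit_inner_angle[OF b] angle by blast
 qed (use HH Om p dim in "auto simp: F0_def")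
 have ex: "EX v g. near_min c v g" if "0 < c" for c
  using near_minimizers[OF Om(1) p(1) p' f _ that, of u] u unfolding near_min_def is_minimizer_on_def En_def unfolding m_def by blast
 obtain C where C: "0 < C" "!!h. 0 < h ==> h <= 1 ==> EX w g. w : test_functions Om & near_min (C * h) w g &
  (ALL x. norm (g x) powr p <= C * h powr (1 - real DIM('a)))" by (rule regular_competitor, erule ex) (rule that; assumption)
 define s where "s = real DIM('a) - 1"
 have s: "1 <= s" using dim by (simp add: s_def)
 let ?V = "(1 / p - 1 / 2) * measure lebesgue Om"
 have V: "0 <= ?V" using p by (intro mult_nonneg_nonneg) (auto simp: field_simps)
 define D where "D = (C + abs m) * C powr (1 / s) + ?V"
 have D: "0 < D" "(C + abs m) * C powr (1 / s) <= D" "?V <= D" using C(1) V by (auto simp: D_def add_pos_nonneg)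
 show ?thesis
 proof (rule that[OF D(1)])
  fix em ep :: real assume e: "0 < em" "em <= ep"
  \<comment> \<open>The solution of C h^(1 - d) = ep^p, so that the gradient of the competitor stays
    below ep.\<close>
  define h where "h = (C * ep powr (- p)) powr (1 / s)"
  have ep: "0 < ep" using e by simp
  have h: "0 < h" using C(1) ep by (simp add: h_def)
  have h_eq: "h = C powr (1 / s) * ep powr (- (p / s))" using C(1) ep by (simp add: h_def powr_mult powr_powr)
  have fin: "(C + abs m) * h + ?V * em powr p <= D * (em powr p + ep powr (- (p / s)))"
   using mult_right_mono[OF D(2), of "ep powr (- (p / s))"] mult_right_mono[OF D(3), of "em powr p"] by (simp add: h_eq distrib_left mult.assoc)
  have "EX w g. w : test_functions Om & C1c Om w g & (ALL x. norm (g x) <= ep) &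
    En g / p - pairing Om f w <= m + (C + abs m) * h"
  proof (cases "h <= 1")
   case True
   from C(2)[OF h True] obtain w g where w: "w : test_functions Om" "near_min (C * h) w g"
    "!!x. norm (g x) powr p <= C * h powr (1 - real DIM('a))" by blast
   have "(1 - real DIM('a)) / s = - 1" using s by (simp add: s_def divide_eq_eq)
   then have "h powr (1 - real DIM('a)) = (C * ep powr (- p)) powr - 1" by (simp add: h_def powr_powr)
   then have "C * h powr (1 - real DIM('a)) = ep powr p" using C(1) ep by (simp add: powr_minus powr_mult field_simps)
   then have "norm (g x) <= ep" for x using w(3)[of x] powr_less_mono2[OF p0, of ep "norm (g x)"] ep by fastforce
   moreover have "C * h <= (C + abs m) * h" using h by (intro mult_right_mono) auto
   then have "En g / p - pairing Om f w <= m + (C + abs m) * h" using near_minD(2)[OF w(2)] by linarith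
   ultimately show ?thesis using w near_minD(1) by blast
  next
   case False
   \<comment> \<open>For h > 1 the zero function is the competitor: its energy 0 is at most m + |m|
     h, which is why |m| is added to C.\<close>
   have "abs m * 1 <= (C + abs m) * h" using False C(1) by (intro mult_mono) auto
   then have "En (%x. 0) / p - pairing Om f (%x. 0) <= m + (C + abs m) * h" by (simp add: En_def pairing_def)
   moreover have "(%x. 0) : test_functions Om" using bump_alg_C_k[OF bump_alg.const] by (auto simp: test_functions_def)
   ultimately show ?thesis using ep by (intro exI[of _ "%x. 0"]) simp
  qed
  then obtain w g where w: "w : test_functions Om" "C1c Om w g" "!!x. norm (g x) <= ep"
   "En g / p - pairing Om f w <= m + (C + abs m) * h" by blast
  have "relaxed_energy p Om f em ep w <= ereal (En g / p + (1 / p - 1 / 2) * em powr p * measure lebesgue Om - pairing Om f w)"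
   unfolding En_def by (rule relaxed_energy_le[OF Om w(2) p e(1) w(3)])
  also have "... <= ereal (m + D * (em powr p + ep powr (- (p / s))))" using w(4) fin by (simp add: mult_ac)
  finally show "EX w:W1p_0 p Om. relaxed_energy p Om f em ep w <=
    ereal (energy p Om f u + D * (em powr p + ep powr (- (p / (real DIM('a) - 1)))))"
   using test_function_W1p_0[OF Om(1) w(1) p0] by (auto simp: m_def s_def)
 qed
qed


theorem corollary16:
  fixes \<Omega> :: "'a::euclidean_space set" and p p' :: real and f u :: "'a \<Rightarrow> real"
  assumes dim: "2 \<le> DIM('a)"
    and p: "1 < p" "p < 2"
    and p': "1 / p + 1 / p' = 1"
    and poly: "polyhedral_domain \<Omega>"
    and angle: "\<And>x \<theta>. inner_angle_at \<Omega> x \<theta> \<Longrightarrow> \<theta> < 2 * pi"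
    and f: "f \<in> Lp_space p' \<Omega>"
    and u: "is_minimizer_on (W1p_0 p \<Omega>) (energy p \<Omega> f) u"
  shows "\<exists>C>0. \<forall>em ep u\<^sub>\<epsilon>. 0 < em \<longrightarrow> em \<le> ep \<longrightarrow>
           is_minimizer_on (W1p_0 p \<Omega>) (relaxed_energy p \<Omega> f em ep) u\<^sub>\<epsilon> \<longrightarrow>
           relaxed_energy p \<Omega> f em ep u\<^sub>\<epsilon> - ereal (energy p \<Omega> f u)
             \<le> ereal (C * (em powr p + ep powr (- (p / (real DIM('a) - 1)))))"
proof -
  obtain C where C: "0 < C" "\<And>em ep. 0 < em \<Longrightarrow> em \<le> ep \<Longrightarrow> \<exists>w\<in>W1p_0 p \<Omega>. relaxed_energy p \<Omega> f em ep w \<le>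
      ereal (energy p \<Omega> f u + C * (em powr p + ep powr (- (p / (real DIM('a) - 1)))))"
    by (rule relaxed_competitor[OF dim p p' poly _ f u], erule angle) (rule that; assumption)
  show ?thesis
  proof (intro exI[of _ C] conjI C(1) allI impI)
    fix em ep u\<^sub>\<epsilon> assume e: "0 < em" "em \<le> ep" and ue: "is_minimizer_on (W1p_0 p \<Omega>) (relaxed_energy p \<Omega> f em ep) u\<^sub>\<epsilon>"
    let ?B = "C * (em powr p + ep powr (- (p / (real DIM('a) - 1))))"
    have "relaxed_energy p \<Omega> f em ep u\<^sub>\<epsilon> \<le> ereal (energy p \<Omega> f u + ?B)"
      using C(2)[OF e] ue unfolding is_minimizer_on_def by (meson order_trans)
    then have "relaxed_energy p \<Omega> f em ep u\<^sub>\<epsilon> - ereal (energy p \<Omega> f u) \<le> ereal (energy p \<Omega> f u + ?B) - ereal (energy p \<Omega> f u)"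
      by (intro ereal_minus_mono) auto
    then show "relaxed_energy p \<Omega> f em ep u\<^sub>\<epsilon> - ereal (energy p \<Omega> f u) \<le> ereal ?B" by simp
  qed
qed

end
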